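(* Let $q\in\mathbb{C}^{*}$ with $q^n\neq 1$ for all integers $n\ge 1$, and let $L=(\mathbb{C}(t),\sigma,\theta^{*})$, $k=\mathbb{C}$ be the $q$-skew iterative $\sigma$-differential field extension described in the context. With the notation of the context, the quantum formal group $\widehat{\mathfrak{H}}_{q\,L^{\natural}}$ operates on the functor $\mathcal{NCF}_{L/k}$ in such a way that there is a functorial isomorphism $$\mathcal{NCF}_{L/k}\simeq \widehat{\mathfrak{H}}_{q\,L^{\natural}}$$ of functors $(NCAlg/L^{\natural})\to(Set)$, and the restriction of $\mathcal{NCF}_{L/k}$ to the category $(CAlg/L^{\natural})$ of commutative $L^\natural$-algebras is functorially isomorphic to $\widehat{\mathbb{G}}_{m\,L^{\natural}}$, where $\widehat{\mathbb{G}}_{m\,L^\natural}(A)=\{c\in A\mid c-1 \text{ is nilpotent}\}$. Moreover: (1) By this isomorphism, the co-product of the quantum formal group $\widehat{\mathfrak{H}}_{q\,L^{\natural}}$ arising from multiplication of triangular matrices is identified with the composition of coordinate transformations of the initial condition. That is, a deformation $\varphi\in\mathcal{NCF}_{L/k}(A)$ with $\varphi(\iota_0(t))=(e(t+W)+f)Q+X$ corresponds to the matrix $\begin{bmatrix} e&f\\0&1\end{bmatrix}$ and to the coordinate transformation $W\mapsto (e-1)t+f+eW$; and for two elements with matrices $\begin{bmatrix} e&f\\0&1\end{bmatrix}$, $\begin{bmatrix} g&h\\0&1\end{bmatrix}$ such that $\{e,f\}$ and $\{g,h\}$ are mutually commutative, the product of matrices corresponds to the composite of the coordinate transformations. (In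 this sense the quantum infinitesimal Galois group of $(\mathbb{C}(t),\sigma,\theta^* )/\mathbb{C}$ is $\widehat{\mathfrak{H}}_{q\,L^\natural}$.) (2) The commutative Galois group functor $\mathrm{CInf\text{-}gal}(L/k)$ on the category $(CAlg/L^{\natural})$ is isomorphic to the formal group $\widehat{\mathbb{G}}_{m}$.
   Context: Notation. $[n]_q=1+q+\dots+q^{n-1}$, $[n]_q!=\prod_{i=1}^n[i]_q$, $[0]_q!=1$, and $\binom{m}{n}_q=\frac{[m]_q!}{[n]_q![m-n]_q!}$. All algebras are associative and unital. The field. $\sigma$ is the $\mathbb{C}$-automorphism of $\mathbb{C}(t)$ with $\sigma(t)=qt$; $\theta^{(0)}=\mathrm{Id}$, $\theta^{(1)}(a)=\frac{\sigma(a)-a}{(q-1)t}$, $\theta^{(n)}=\frac{1}{[n]_q!}(\theta^{(1)})^n$. $L^{\natural}$ is the abstract field $\mathbb{C}(t)$, and $L^{\sharp}$ is $L^\natural$ with the derivation $\partial/\partial t$. Twisted power series. For a $\mathbb{C}$-algebra $B$, $F(\mathbb{Z},B)$ is the ring of functions $\mathbb{Z}\to B$ with shift $(\Sigma f)(n)=f(n+1)$. $F(\mathbb{Z},B)[[X]]$ is the set of formal series $\sum_{i\ge0}X^ia_i$, $a_i\in F(\mathbb{Z},B)$, with multiplication determined by $aX=X\Sigma(a)$. It carries the operators $\hat\Sigma(\sum X^ia_i)=\sum X^iq^i\Sigma(a_i)$ and $\hat\Theta^{(l)}(\sum X^ia_i)=\sum X^i\binom{i+l}{l}_qa_{i+l}$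 ($l\ge 0$). Derivations of $B$ act on coefficients. Galois hull. The universal Hopf morphism is $\iota_0:L\to F(\mathbb{Z},L^\natural)[[X]]$, $a\mapsto\sum_i X^iu[\theta^{(i)}(a)]$, $u[b](n)=\sigma^n(b)$. Elements of $L^\sharp$ are identified with constant functions (series of degree $0$ in $X$). Let $Q\in F(\mathbb{Z},\mathbb{C})$, $Q(n)=q^n$; then $\iota_0(t)=tQ+X$. The Galois hull $\mathcal{L}$ is the smallest subalgebra of $F(\mathbb{Z},L^\sharp)[[X]]$ containing $\iota_0(L)$ and $L^\sharp$ and invariant under $\hat\Sigma$, all $\hat\Theta^{(l)}$ and $\partial/\partial t$; and $\mathcal{K}=L^\sharp$. Deformations. $(NCAlg/L^\natural)$ is the category of not necessarily commutative $L^\natural$-algebras $A$ such that the image of $L^\natural$ is central; $(CAlg/L^\natural)$ is that of commutative ones. The Taylor morphism $L^\sharp\to L^\natural[[W]]$, $a\mapsto\sum_n\frac{1}{n!}\frac{\partial^na}{\partial t^n}W^n$, followed by $L^\natural\to A$, induces the canonical morphism $\iota:\mathcal{L}\to F(\mathbb{Z},A[[W]])[[X]]$. Under this, $t\in L^\sharp$ becomes $t+W$. $\mathcal{NCF}_{L/k}(A)$ is the set of algebra morphisms $\varphi:\mathcal{L}\to F(\mathbb{Z},A[[W]])[[X]]$ compatible with $\hat\Sigma$, all $\hat\Theta^{(l)}$ and the derivations ($\partial/\partial t$ on $\mathcal{L}$, $\partial/\partial W$ on the target), equal to $\iota$ on $\mathcal{K}$, and congruent to $\iota$ modulo nilpotent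 elements (for every $x\in\mathcal{L}$, all the coefficients in $A$ of $\varphi(x)-\iota(x)$ are nilpotent). Initial condition: the initial condition of $f(W,X)=\sum X^ia_i(W)\in F(\mathbb Z,A[[W]])[[X]]$ is the value of $a_0(W)$ at $n=0$. That of $\iota(\iota_0(t))=(t+W)Q+X$ is $t+W$. Quantum group. $\mathfrak{H}_q=\mathbb{C}\langle u,u^{-1},v\rangle/(uv-qvu)$ with $\Delta(u^{\pm1})=u^{\pm1}\otimes u^{\pm1}$, $\Delta(v)=u\otimes v+v\otimes1$, $\epsilon(u^{\pm 1})=1$, $\epsilon(v)=0$, $S(u)=u^{-1}$, $S(v)=-u^{-1}v$. Its formal completion over $L^\natural$ is $\widehat{\mathfrak{H}}_{q\,L^\natural}(A)=\{\psi:\mathfrak{H}_q\otimes_{\mathbb{C}}L^\natural\to A \mid \psi$ an $L^\natural$-algebra morphism with $\psi(u)-1$ and $\psi(v)$ nilpotent$\}$; $\psi$ is identified with the matrix $\begin{bmatrix}\psi(u)&\psi(v)\\0&1\end{bmatrix}$. Two subsets of $A$ are mutually commutative if each element of one commutes with each element of the other. Products are only defined under mutual commutativity: if $\varphi(\iota_0(t))=(e(t+W)+f)Q+X$ and $\{\psi(u),\psi(v)\}$, $\{e,f\}$ are mutually commutative, the operation $\psi\cdot\varphi$ is the deformation $\varpi$ with $\varpi(\iota_0(t))=\bigl(\psi(u)e(t+W)+\psi(u)f+\psi(v)\bigr)Q+X$. Commutative Galois group. For commutative $A$, $\mathrm{CInf\text{-}gal}(L/k)(A)$ is the group of $\mathcal{K}\hat\otimes_{L^\sharp}A[[W]]$-algebra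 automorphisms of $\mathcal{L}\hat\otimes_{L^\sharp}A[[W]]$ (completion for the $W$-adic topology, $L^\sharp\to A[[W]]$ the Taylor morphism) that are compatible with $\hat\Sigma,\hat\Theta^{(l)}$ and the derivation, continuous for the $W$-adic topology, and congruent to the identity modulo nilpotent elements (modulo the closed ideal generated by the nilpotent elements of $A$). *)

theory Defs
  imports
    "HOL-Computational_Algebra.Computational_Algebra"
    "HOL-Library.Poly_Mapping"
    "HOL-Library.FuncSet"
    "HOL-Algebra.QuotRing"
    "HOL-Algebra.Generated_Rings"
    "Jordan_Normal_Form.Matrix"
begin

section \<open>The field of rational functions with its operators\<close>

definition qint :: "complex \<Rightarrow> nat \<Rightarrow> complex" where
  "qint q n = (\<Sum>i<n. q ^ i)"

definition qfact :: "complex \<Rightarrow> nat \<Rightarrow> complex" where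
  "qfact q n = (\<Prod>i=1..n. qint q i)"

definition qbinom :: "complex \<Rightarrow> nat \<Rightarrow> nat \<Rightarrow> complex" where
  "qbinom q m n = qfact q m / (qfact q n * qfact q (m - n))"

type_synonym ratfun = "complex poly fract"

definition rconst :: "complex \<Rightarrow> ratfun" where
  "rconst c = Fract [:c:] 1"

definition rt :: ratfun where
  "rt = Fract [:0, 1:] 1"

definition rsigma :: "complex \<Rightarrow> ratfun \<Rightarrow> ratfun" where
  "rsigma q x = (THE y. \<exists>a b. b \<noteq> 0 \<and> x = Fract a b \<and>
     y = Fract (a \<circ>\<^sub>p [:0, q:]) (b \<circ>\<^sub>p [:0, q:]))"

definition rderiv :: "ratfun \<Rightarrow> ratfun" where
  "rderiv x = (THE y. \<exists>a b. b \<noteq> 0 \<and> x = Fract a b \<and>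
     y = Fract (pderiv a * b - a * pderiv b) (b * b))"

definition rsigma_int :: "complex \<Rightarrow> int \<Rightarrow> ratfun \<Rightarrow> ratfun" where
  "rsigma_int q n = (if 0 \<le> n then rsigma q ^^ nat n else inv_into UNIV (rsigma q) ^^ nat (- n))"

definition rtheta1 :: "complex \<Rightarrow> ratfun \<Rightarrow> ratfun" where
  "rtheta1 q a = (rsigma q a - a) / (rconst (q - 1) * rt)"

definition rtheta :: "complex \<Rightarrow> nat \<Rightarrow> ratfun \<Rightarrow> ratfun" where
  "rtheta q n a = (rtheta1 q ^^ n) a / rconst (qfact q n)"

lemma rsigma_Fract:
  assumes q: "q \<noteq> 0" and b: "b \<noteq> 0"
  shows "rsigma q (Fract a b) = Fract (a \<circ>\<^sub>p [:0, q:]) (b \<circ>\<^sub>p [:0, q:])"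
  unfolding rsigma_def
proof (rule the_equality)
  show "\<exists>a' b'. b' \<noteq> 0 \<and> Fract a b = Fract a' b' \<and>
      Fract (a \<circ>\<^sub>p [:0, q:]) (b \<circ>\<^sub>p [:0, q:]) = Fract (a' \<circ>\<^sub>p [:0, q:]) (b' \<circ>\<^sub>p [:0, q:])"
    using b by blast
next
  fix y assume "\<exists>c d. d \<noteq> 0 \<and> Fract a b = Fract c d \<and> y = Fract (c \<circ>\<^sub>p [:0, q:]) (d \<circ>\<^sub>p [:0, q:])"
  then obtain c d where d: "d \<noteq> 0" "Fract a b = Fract c d"
    and y: "y = Fract (c \<circ>\<^sub>p [:0, q:]) (d \<circ>\<^sub>p [:0, q:])" by blast
  then have eq: "a * d = c * b" using b by (simp add: eq_fract)
  have nz: "p \<circ>\<^sub>p [:0, q:] \<noteq> 0" if "p \<noteq> 0" for p :: "complex poly"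
    using that q pcompose_eq_0[of p "[:0, q:]"] by auto
  have "(a \<circ>\<^sub>p [:0, q:]) * (d \<circ>\<^sub>p [:0, q:]) = (c \<circ>\<^sub>p [:0, q:]) * (b \<circ>\<^sub>p [:0, q:])"
    using eq by (metis pcompose_mult)
  then show "y = Fract (a \<circ>\<^sub>p [:0, q:]) (b \<circ>\<^sub>p [:0, q:])"
    using nz[OF d(1)] nz[OF b] y by (simp add: eq_fract)
qed

lemma rderiv_Fract:
  assumes b: "b \<noteq> 0"
  shows "rderiv (Fract a b) = Fract (pderiv a * b - a * pderiv b) (b * b)"
  unfolding rderiv_def
proof (rule the_equality)
  show "\<exists>a' b'. b' \<noteq> 0 \<and> Fract a b = Fract a' b' \<and>
      Fract (pderiv a * b - a * pderiv b) (b * b) = Fract (pderiv a' * b' - a' * pderiv b') (b' * b')"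
    using b by blast
next
  fix y assume "\<exists>c d. d \<noteq> 0 \<and> Fract a b = Fract c d \<and> y = Fract (pderiv c * d - c * pderiv d) (d * d)"
  then obtain c d where d: "d \<noteq> 0" "Fract a b = Fract c d"
    and y: "y = Fract (pderiv c * d - c * pderiv d) (d * d)" by blast
  then have eq: "c * b = a * d" using b by (simp add: eq_fract)
  have eq': "pderiv c * b + c * pderiv b = pderiv a * d + a * pderiv d"
    using arg_cong[OF eq, of pderiv] by (simp add: pderiv_mult algebra_simps)
  have "(pderiv c * d - c * pderiv d) * (b * b) = (pderiv a * b - a * pderiv b) * (d * d)"
  proof -
    have "(pderiv c * d - c * pderiv d) * (b * b) = b * d * (pderiv c * b) - c * b * (b * pderiv d)"
      by (simp add: algebra_simps)
    also have "\<dots> = b * d * (pderiv c * b - a * pderiv d)"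
      unfolding eq by (simp add: algebra_simps)
    also have "pderiv c * b - a * pderiv d = pderiv a * d - c * pderiv b"
      using eq' by (simp add: algebra_simps)
    also have "b * d * \<dots> = b * d * (pderiv a * d) - c * b * (d * pderiv b)"
      by (simp add: algebra_simps)
    also have "\<dots> = (pderiv a * b - a * pderiv b) * (d * d)"
      unfolding eq by (simp add: algebra_simps)
    finally show ?thesis .
  qed
  then show "y = Fract (pderiv a * b - a * pderiv b) (b * b)"
    using d b y by (simp add: eq_fract)
qed

section \<open>Twisted power series\<close>

text \<open>
  An element of \<open>F(\<int>, B)[[X]]\<close> is the family of its coefficients \<open>a\<^sub>i : \<int> \<rightarrow> B\<close>, written to the
  right of the powers of \<open>X\<close>. From \<open>a X = X \<Sigma>(a)\<close> one gets
  \<open>X\<^sup>i a \<cdot> X\<^sup>j b = X\<^sup>i\<^sup>+\<^sup>j \<Sigma>\<^sup>j(a) b\<close>, hence the formula for the product.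
\<close>

typedef 'b tser = "UNIV :: (nat \<Rightarrow> int \<Rightarrow> 'b) set"
  morphisms tcoeff Tser ..

setup_lifting type_definition_tser

lemma tcoeff_Tser [simp]: "tcoeff (Tser F) = F"
  by (simp add: Tser_inverse)

lemma tser_eqI: "(\<And>i n. tcoeff f i n = tcoeff g i n) \<Longrightarrow> f = g"
  by (metis ext tcoeff_inject)

instantiation tser :: (zero) zero
begin
definition "0 = Tser (\<lambda>i n. 0)"
instance ..
end

instantiation tser :: ("{zero,one}") one
begin
definition "1 = Tser (\<lambda>i n. if i = 0 then 1 else 0)"
instance ..
end

instantiation tser :: (plus) plus
begin
definition "f + g = Tser (\<lambda>i n. tcoeff f i n + tcoeff g i n)"
instance ..
end

instantiation tser :: (minus) minus
begin
definition "f - g = Tser (\<lambda>i n. tcoeff f i n - tcoeff g i n)"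
instance ..
end

instantiation tser :: (uminus) uminus
begin
definition "- f = Tser (\<lambda>i n. - tcoeff f i n)"
instance ..
end

instantiation tser :: ("{comm_monoid_add,times}") times
begin
definition "f * g =
  Tser (\<lambda>k n. \<Sum>i=0..k. tcoeff f i (n + int (k - i)) * tcoeff g (k - i) n)"
instance ..
end

instance tser :: (ab_group_add) ab_group_add
  by standard
    (auto intro!: tser_eqI simp: zero_tser_def plus_tser_def minus_tser_def uminus_tser_def
      algebra_simps)

instance tser :: (ring) ring
proof
  fix f g h :: "'a tser"
  show "f * g * h = f * (g * h)"
  proof (rule tser_eqI)
    fix k n
    define T where "T = (\<lambda>a b c. tcoeff f a (n + int b + int c) * tcoeff g b (n + int c) * tcoeff h c n)"
    have "tcoeff (f * g * h) k n = (\<Sum>i=0..k. \<Sum>j=0..i. T j (i - j) (k - i))"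
      by (auto simp: times_tser_def sum_distrib_right T_def add.assoc add.commute add.left_commute intro!: sum.cong)
    also have "\<dots> = (\<Sum>j=0..k. \<Sum>i=0..k - j. T j i (k - j - i))"
      by (rule fps_mult_assoc_lemma)
    also have "\<dots> = tcoeff (f * (g * h)) k n"
      by (auto simp: times_tser_def sum_distrib_left T_def mult.assoc of_nat_diff algebra_simps intro!: sum.cong)
    finally show "tcoeff (f * g * h) k n = tcoeff (f * (g * h)) k n" .
  qed
  show "(f + g) * h = f * h + g * h"
    by (rule tser_eqI) (simp add: times_tser_def plus_tser_def distrib_right sum.distrib)
  show "f * (g + h) = f * g + f * h"
    by (rule tser_eqI) (simp add: times_tser_def plus_tser_def distrib_left sum.distrib)
qed

definition tconst :: "'b::zero \<Rightarrow> 'b tser" where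
  "tconst b = Tser (\<lambda>i n. if i = 0 then b else 0)"

definition tX :: "'b::{zero,one} tser" where
  "tX = Tser (\<lambda>i n. if i = 1 then 1 else 0)"

text \<open>In the next three definitions \<open>\<kappa> : \<complex> \<rightarrow> B\<close> is the structure map of the \<open>\<complex>\<close>-algebra \<open>B\<close>.\<close>

definition tQ :: "(complex \<Rightarrow> 'b::zero) \<Rightarrow> complex \<Rightarrow> 'b tser" where
  "tQ \<kappa> q = Tser (\<lambda>i n. if i = 0 then \<kappa> (q powi n) else 0)"

definition tsigma :: "(complex \<Rightarrow> 'b::times) \<Rightarrow> complex \<Rightarrow> 'b tser \<Rightarrow> 'b tser" where
  "tsigma \<kappa> q f = Tser (\<lambda>i n. \<kappa> (q ^ i) * tcoeff f i (n + 1))"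

definition ttheta :: "(complex \<Rightarrow> 'b::times) \<Rightarrow> complex \<Rightarrow> nat \<Rightarrow> 'b tser \<Rightarrow> 'b tser" where
  "ttheta \<kappa> q l f = Tser (\<lambda>i n. \<kappa> (qbinom q (i + l) l) * tcoeff f (i + l) n)"

definition tmap :: "('b \<Rightarrow> 'c) \<Rightarrow> 'b tser \<Rightarrow> 'c tser" where
  "tmap d f = Tser (\<lambda>i n. d (tcoeff f i n))"

definition initial_condition :: "'b tser \<Rightarrow> 'b" where
  "initial_condition f = tcoeff f 0 0"

section \<open>The universal Hopf morphism and the Galois hull\<close>

definition iota0 :: "complex \<Rightarrow> ratfun \<Rightarrow> ratfun tser" where
  "iota0 q a = Tser (\<lambda>i n. rsigma_int q n (rtheta q i a))"

text \<open>
  Closure under multiplication by complex scalars is a special case of closure under products,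
  since the constants of \<open>L\<^sup>\<sharp>\<close> are in the hull.
\<close>

inductive_set galois_hull :: "complex \<Rightarrow> ratfun tser set" for q where
  hull_iota0: "iota0 q a \<in> galois_hull q"
| hull_const: "tconst a \<in> galois_hull q"
| hull_add: "x \<in> galois_hull q \<Longrightarrow> y \<in> galois_hull q \<Longrightarrow> x + y \<in> galois_hull q"
| hull_mult: "x \<in> galois_hull q \<Longrightarrow> y \<in> galois_hull q \<Longrightarrow> x * y \<in> galois_hull q"
| hull_sigma: "x \<in> galois_hull q \<Longrightarrow> tsigma rconst q x \<in> galois_hull q"
| hull_theta: "x \<in> galois_hull q \<Longrightarrow> ttheta rconst q l x \<in> galois_hull q"
| hull_deriv: "x \<in> galois_hull q \<Longrightarrow> tmap rderiv x \<in> galois_hull q"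

section \<open>Algebras and infinitesimal deformations\<close>

text \<open>
  The sort \<open>{ring, monoid_mult}\<close> is that of unital associative rings, the zero ring included
  (\<open>ring_1\<close> would exclude it). An object of \<open>(NCAlg/L\<^sup>\<natural>)\<close> is such a ring with a structure map \<open>s\<close>.
\<close>

definition L_algebra :: "(ratfun \<Rightarrow> 'a::{ring,monoid_mult}) \<Rightarrow> bool" where
  "L_algebra s \<longleftrightarrow>
     s 1 = 1 \<and> (\<forall>a b. s (a + b) = s a + s b) \<and> (\<forall>a b. s (a * b) = s a * s b) \<and>
     (\<forall>a x. s a * x = x * s a)"

definition L_algebra_hom ::
    "(ratfun \<Rightarrow> 'a::{ring,monoid_mult}) \<Rightarrow> (ratfun \<Rightarrow> 'b::{ring,monoid_mult}) \<Rightarrow> ('a \<Rightarrow> 'b) \<Rightarrow> bool" where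
  "L_algebra_hom s s' h \<longleftrightarrow>
     h 1 = 1 \<and> (\<forall>x y. h (x + y) = h x + h y) \<and> (\<forall>x y. h (x * y) = h x * h y) \<and>
     (\<forall>a. h (s a) = s' a)"

definition nilpotent :: "'a::{ring,monoid_mult} \<Rightarrow> bool" where
  "nilpotent a \<longleftrightarrow> (\<exists>m. a ^ m = 0)"

definition mutually_commutative :: "'a::times set \<Rightarrow> 'a set \<Rightarrow> bool" where
  "mutually_commutative S T \<longleftrightarrow> (\<forall>x\<in>S. \<forall>y\<in>T. x * y = y * x)"

text \<open>
  \<open>A[[W]]\<close> is \<open>'a fps\<close>; \<open>W\<close> is central. The library derivation \<open>fps_deriv\<close> is not available for
  the sort used here, so \<open>\<partial>/\<partial>W\<close> is written with the structure map.
\<close>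

definition wderiv :: "(ratfun \<Rightarrow> 'a::{ring,monoid_mult}) \<Rightarrow> 'a fps \<Rightarrow> 'a fps" where
  "wderiv s f = Abs_fps (\<lambda>n. s (of_nat (Suc n)) * fps_nth f (Suc n))"

definition wmap :: "('a \<Rightarrow> 'b) \<Rightarrow> 'a fps \<Rightarrow> 'b fps" where
  "wmap h f = Abs_fps (\<lambda>n. h (fps_nth f n))"

definition wconst :: "(ratfun \<Rightarrow> 'a::{ring,monoid_mult}) \<Rightarrow> complex \<Rightarrow> 'a fps" where
  "wconst s c = fps_const (s (rconst c))"

definition taylor :: "(ratfun \<Rightarrow> 'a::{ring,monoid_mult}) \<Rightarrow> ratfun \<Rightarrow> 'a fps" where
  "taylor s a = Abs_fps (\<lambda>n. s ((rderiv ^^ n) a / of_nat (fact n)))"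

definition can_iota :: "(ratfun \<Rightarrow> 'a::{ring,monoid_mult}) \<Rightarrow> ratfun tser \<Rightarrow> 'a fps tser" where
  "can_iota s = tmap (taylor s)"

text \<open>
  \<open>\<complex>\<close>-linearity (indeed \<open>\<K>\<close>-linearity) of \<open>\<phi>\<close> follows from multiplicativity and the prescribed
  values on \<open>\<K>\<close>. Morphisms are functions that are \<open>undefined\<close> outside the hull, so that they are
  determined by their values on it.
\<close>

definition NCF :: "complex \<Rightarrow> (ratfun \<Rightarrow> 'a::{ring,monoid_mult}) \<Rightarrow> (ratfun tser \<Rightarrow> 'a fps tser) set" where
  "NCF q s = {\<phi> \<in> extensional (galois_hull q).
     \<phi> 1 = 1 \<and>
     (\<forall>x\<in>galois_hull q. \<forall>y\<in>galois_hull q. \<phi> (x + y) = \<phi> x + \<phi> y \<and> \<phi> (x * y) = \<phi> x * \<phi> y) \<and>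
     (\<forall>x\<in>galois_hull q. \<phi> (tsigma rconst q x) = tsigma (wconst s) q (\<phi> x)) \<and>
     (\<forall>x\<in>galois_hull q. \<forall>l. \<phi> (ttheta rconst q l x) = ttheta (wconst s) q l (\<phi> x)) \<and>
     (\<forall>x\<in>galois_hull q. \<phi> (tmap rderiv x) = tmap (wderiv s) (\<phi> x)) \<and>
     (\<forall>a. \<phi> (tconst a) = can_iota s (tconst a)) \<and>
     (\<forall>x\<in>galois_hull q. \<forall>i n m. nilpotent (fps_nth (tcoeff (\<phi> x - can_iota s x) i n) m))}"

definition NCF_map ::
    "complex \<Rightarrow> ('a \<Rightarrow> 'b) \<Rightarrow> (ratfun tser \<Rightarrow> 'a fps tser) \<Rightarrow> (ratfun tser \<Rightarrow> 'b fps tser)" where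
  "NCF_map q h \<phi> = restrict (\<lambda>x. tmap (wmap h) (\<phi> x)) (galois_hull q)"

text \<open>The series \<open>(e(t+W)+f)Q+X\<close>.\<close>

definition deformed :: "complex \<Rightarrow> (ratfun \<Rightarrow> 'a::{ring,monoid_mult}) \<Rightarrow> 'a \<Rightarrow> 'a \<Rightarrow> 'a fps tser" where
  "deformed q s e f =
     tconst (fps_const e * (fps_const (s rt) + fps_X) + fps_const f) * tQ (wconst s) q + tX"

text \<open>
  Coordinate transformation \<open>W \<mapsto> p(W)\<close> as a substitution operator \<open>w \<mapsto> p(w)\<close> on \<open>A[[W]]\<close>, with
  coefficients on the left, for \<open>p\<close> a polynomial in \<open>W\<close> (the sum ranges over the support of \<open>p\<close>).
  The transformation of a deformation sends \<open>t + W\<close> to the initial condition of \<open>\<phi>(\<iota>\<^sub>0(t))\<close>.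
\<close>

definition wsubst :: "'a::{ring,monoid_mult} fps \<Rightarrow> 'a fps \<Rightarrow> 'a fps" where
  "wsubst p w = (\<Sum>n | fps_nth p n \<noteq> 0. fps_const (fps_nth p n) * ((\<lambda>z. w * z) ^^ n) 1)"

definition coord_trans ::
    "complex \<Rightarrow> (ratfun \<Rightarrow> 'a::{ring,monoid_mult}) \<Rightarrow> (ratfun tser \<Rightarrow> 'a fps tser) \<Rightarrow> 'a fps \<Rightarrow> 'a fps" where
  "coord_trans q s \<phi> = wsubst (initial_condition (\<phi> (iota0 q rt)) - fps_const (s rt))"

section \<open>Tensor products of algebras\<close>

abbreviation type_ring :: "'a::{times,plus,one,zero} ring" where
  "type_ring \<equiv> \<lparr>carrier = UNIV, monoid.mult = (*), one = 1, zero = 0, add = (+)\<rparr>"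

definition integral_monoid_ring :: "('m, 'z) monoid_scheme \<Rightarrow> ('m \<Rightarrow>\<^sub>0 int) ring" where
  "integral_monoid_ring M =
     \<lparr>carrier = {p. Poly_Mapping.keys p \<subseteq> carrier M},
      monoid.mult = (\<lambda>p p'. frag_extend (\<lambda>a. frag_extend (\<lambda>b. frag_of (a \<otimes>\<^bsub>M\<^esub> b)) p') p),
      one = frag_of \<one>\<^bsub>M\<^esub>, zero = 0, add = (+)\<rparr>"

text \<open>
  \<open>R \<otimes>\<^sub>k S\<close> for \<open>k\<close>-algebras \<open>R\<close>, \<open>S\<close> with structure maps \<open>\<kappa>\<close>, \<open>\<kappa>'\<close>: the free abelian group on
  \<open>R \<times> S\<close>, with the product extending \<open>(x,y)(x',y') = (xx',yy')\<close>, modulo the bilinearity relations.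
\<close>

definition tensor_ideal ::
    "('r, 'y) ring_scheme \<Rightarrow> ('k \<Rightarrow> 'r) \<Rightarrow> ('s, 'z) ring_scheme \<Rightarrow> ('k \<Rightarrow> 's) \<Rightarrow> ('r \<times> 's \<Rightarrow>\<^sub>0 int) set" where
  "tensor_ideal R \<kappa> S \<kappa>' = Idl\<^bsub>integral_monoid_ring (R \<times>\<times> S)\<^esub>
     ({frag_of (x \<oplus>\<^bsub>R\<^esub> x', y) - frag_of (x, y) - frag_of (x', y) | x x' y.
         x \<in> carrier R \<and> x' \<in> carrier R \<and> y \<in> carrier S} \<union>
      {frag_of (x, y \<oplus>\<^bsub>S\<^esub> y') - frag_of (x, y) - frag_of (x, y') | x y y'.
         x \<in> carrier R \<and> y \<in> carrier S \<and> y' \<in> carrier S} \<union>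
      {frag_of (\<kappa> c \<otimes>\<^bsub>R\<^esub> x, y) - frag_of (x, \<kappa>' c \<otimes>\<^bsub>S\<^esub> y) | c x y.
         x \<in> carrier R \<and> y \<in> carrier S})"

definition tensor_ring ::
    "('r, 'y) ring_scheme \<Rightarrow> ('k \<Rightarrow> 'r) \<Rightarrow> ('s, 'z) ring_scheme \<Rightarrow> ('k \<Rightarrow> 's) \<Rightarrow> ('r \<times> 's \<Rightarrow>\<^sub>0 int) set ring" where
  "tensor_ring R \<kappa> S \<kappa>' = integral_monoid_ring (R \<times>\<times> S) Quot tensor_ideal R \<kappa> S \<kappa>'"

definition tensor_elem ::
    "('r, 'y) ring_scheme \<Rightarrow> ('k \<Rightarrow> 'r) \<Rightarrow> ('s, 'z) ring_scheme \<Rightarrow> ('k \<Rightarrow> 's) \<Rightarrow> 'r \<Rightarrow> 's \<Rightarrow> ('r \<times> 's \<Rightarrow>\<^sub>0 int) set" where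
  "tensor_elem R \<kappa> S \<kappa>' x y =
     tensor_ideal R \<kappa> S \<kappa>' +>\<^bsub>integral_monoid_ring (R \<times>\<times> S)\<^esub> frag_of (x, y)"

section \<open>The quantum group\<close>

datatype 'g word = Word "'g list"

instantiation word :: (type) monoid_add
begin
definition "0 = Word []"
fun plus_word :: "'a word \<Rightarrow> 'a word \<Rightarrow> 'a word" where
  "Word xs + Word ys = Word (xs @ ys)"
instance
proof
  fix a b c :: "'a word"
  show "a + b + c = a + (b + c)" by (cases a; cases b; cases c) simp
  show "0 + a = a" by (cases a) (simp add: zero_word_def)
  show "a + 0 = a" by (cases a) (simp add: zero_word_def)
qed
end

datatype hgen = GenU | GenUinv | GenV

text \<open>
  With words added by concatenation, the convolution ring of finitely supported functions is the
  free algebra \<open>\<complex>\<langle>u, u\<^sup>-\<^sup>1, v\<rangle>\<close>.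
\<close>

type_synonym hfree = "hgen word \<Rightarrow>\<^sub>0 complex"

abbreviation hgenerator :: "hgen \<Rightarrow> hfree" where
  "hgenerator g \<equiv> Poly_Mapping.single (Word [g]) 1"

definition H_ideal :: "complex \<Rightarrow> hfree set" where
  "H_ideal q = Idl\<^bsub>type_ring\<^esub>
     {hgenerator GenU * hgenerator GenUinv - 1,
      hgenerator GenUinv * hgenerator GenU - 1,
      hgenerator GenU * hgenerator GenV
        - Poly_Mapping.single 0 q * (hgenerator GenV * hgenerator GenU)}"

definition H_ring :: "complex \<Rightarrow> hfree set ring" where
  "H_ring q = type_ring Quot H_ideal q"

definition H_class :: "complex \<Rightarrow> hfree \<Rightarrow> hfree set" where
  "H_class q p = H_ideal q +>\<^bsub>type_ring\<^esub> p"

definition H_const :: "complex \<Rightarrow> complex \<Rightarrow> hfree set" where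
  "H_const q c = H_class q (Poly_Mapping.single 0 c)"

definition H_gen :: "complex \<Rightarrow> hgen \<Rightarrow> hfree set" where
  "H_gen q g = H_class q (hgenerator g)"

abbreviation HH_ring :: "complex \<Rightarrow> (hfree set \<times> hfree set \<Rightarrow>\<^sub>0 int) set ring" where
  "HH_ring q \<equiv> tensor_ring (H_ring q) (H_const q) (H_ring q) (H_const q)"

abbreviation HH_elem :: "complex \<Rightarrow> hfree set \<Rightarrow> hfree set \<Rightarrow> (hfree set \<times> hfree set \<Rightarrow>\<^sub>0 int) set" where
  "HH_elem q \<equiv> tensor_elem (H_ring q) (H_const q) (H_ring q) (H_const q)"

definition H_coproduct :: "complex \<Rightarrow> hfree set \<Rightarrow> (hfree set \<times> hfree set \<Rightarrow>\<^sub>0 int) set" where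
  "H_coproduct q = (THE D. D \<in> extensional (carrier (H_ring q)) \<and> D \<in> Ring.ring_hom (H_ring q) (HH_ring q) \<and>
     (\<forall>c. D (H_const q c) = HH_elem q (H_const q c) (H_const q 1)) \<and>
     D (H_gen q GenU) = HH_elem q (H_gen q GenU) (H_gen q GenU) \<and>
     D (H_gen q GenUinv) = HH_elem q (H_gen q GenUinv) (H_gen q GenUinv) \<and>
     D (H_gen q GenV) = HH_elem q (H_gen q GenU) (H_gen q GenV)
       \<oplus>\<^bsub>HH_ring q\<^esub> HH_elem q (H_gen q GenV) (H_const q 1))"

definition H_counit :: "complex \<Rightarrow> hfree set \<Rightarrow> complex" where
  "H_counit q = (THE E. E \<in> extensional (carrier (H_ring q)) \<and> E \<in> Ring.ring_hom (H_ring q) type_ring \<and>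
     (\<forall>c. E (H_const q c) = c) \<and>
     E (H_gen q GenU) = 1 \<and> E (H_gen q GenUinv) = 1 \<and> E (H_gen q GenV) = 0)"

type_synonym hL = "(hfree set \<times> ratfun \<Rightarrow>\<^sub>0 int) set"

definition HL_ring :: "complex \<Rightarrow> hL ring" where
  "HL_ring q = tensor_ring (H_ring q) (H_const q) type_ring rconst"

definition HL_elem :: "complex \<Rightarrow> hfree set \<Rightarrow> ratfun \<Rightarrow> hL" where
  "HL_elem q = tensor_elem (H_ring q) (H_const q) type_ring rconst"

abbreviation u_val :: "complex \<Rightarrow> (hL \<Rightarrow> 'a) \<Rightarrow> 'a" where
  "u_val q \<psi> \<equiv> \<psi> (HL_elem q (H_gen q GenU) 1)"

abbreviation v_val :: "complex \<Rightarrow> (hL \<Rightarrow> 'a) \<Rightarrow> 'a" where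
  "v_val q \<psi> \<equiv> \<psi> (HL_elem q (H_gen q GenV) 1)"

text \<open>
  Points of the formal completion. The structure map of \<open>\<H>\<^sub>q \<otimes> L\<close> over \<open>L\<close> is \<open>a \<mapsto> 1 \<otimes> a\<close>, and
  \<open>u_val\<close>, \<open>v_val\<close> are the values at \<open>u \<otimes> 1\<close>, \<open>v \<otimes> 1\<close>.
\<close>

definition QFG :: "complex \<Rightarrow> (ratfun \<Rightarrow> 'a::{ring,monoid_mult}) \<Rightarrow> (hL \<Rightarrow> 'a) set" where
  "QFG q s = {\<psi> \<in> extensional (carrier (HL_ring q)).
     \<psi> \<in> Ring.ring_hom (HL_ring q) type_ring \<and>
     (\<forall>a. \<psi> (HL_elem q (H_const q 1) a) = s a) \<and>
     nilpotent (u_val q \<psi> - 1) \<and> nilpotent (v_val q \<psi>)}"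

definition QFG_map :: "complex \<Rightarrow> ('a \<Rightarrow> 'b) \<Rightarrow> (hL \<Rightarrow> 'a) \<Rightarrow> (hL \<Rightarrow> 'b)" where
  "QFG_map q h \<psi> = restrict (\<lambda>z. h (\<psi> z)) (carrier (HL_ring q))"

definition upper_mat :: "'a::{ring,monoid_mult} \<Rightarrow> 'a \<Rightarrow> 'a mat" where
  "upper_mat e f = mat_of_rows_list 2 [[e, f], [0, 1]]"

definition QFG_mat :: "complex \<Rightarrow> (hL \<Rightarrow> 'a::{ring,monoid_mult}) \<Rightarrow> 'a mat" where
  "QFG_mat q \<psi> = upper_mat (u_val q \<psi>) (v_val q \<psi>)"

text \<open>
  The product of two points with mutually commutative images, through the co-product:
  \<open>H_pairing\<close> is the morphism \<open>\<H>\<^sub>q \<otimes> \<H>\<^sub>q \<rightarrow> A\<close>, \<open>x \<otimes> y \<mapsto> \<psi>(x) \<psi>'(y)\<close>, and the product is the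
  \<open>L\<close>-linear extension of its composite with the co-product.
\<close>

definition H_pairing ::
    "complex \<Rightarrow> (hL \<Rightarrow> 'a::{ring,monoid_mult}) \<Rightarrow> (hL \<Rightarrow> 'a) \<Rightarrow> (hfree set \<times> hfree set \<Rightarrow>\<^sub>0 int) set \<Rightarrow> 'a" where
  "H_pairing q \<psi> \<psi>' = (THE m. m \<in> extensional (carrier (HH_ring q)) \<and> m \<in> Ring.ring_hom (HH_ring q) type_ring \<and>
     (\<forall>x\<in>carrier (H_ring q). \<forall>y\<in>carrier (H_ring q).
        m (HH_elem q x y) = \<psi> (HL_elem q x 1) * \<psi>' (HL_elem q y 1)))"

definition QFG_prod ::
    "complex \<Rightarrow> (ratfun \<Rightarrow> 'a::{ring,monoid_mult}) \<Rightarrow> (hL \<Rightarrow> 'a) \<Rightarrow> (hL \<Rightarrow> 'a) \<Rightarrow> (hL \<Rightarrow> 'a)" where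
  "QFG_prod q s \<psi> \<psi>' = (THE \<omega>. \<omega> \<in> QFG q s \<and>
     (\<forall>x\<in>carrier (H_ring q). \<omega> (HL_elem q x 1) = H_pairing q \<psi> \<psi>' (H_coproduct q x)))"

definition QFG_unit :: "complex \<Rightarrow> (ratfun \<Rightarrow> 'a::{ring,monoid_mult}) \<Rightarrow> (hL \<Rightarrow> 'a)" where
  "QFG_unit q s = (THE \<omega>. \<omega> \<in> QFG q s \<and>
     (\<forall>x\<in>carrier (H_ring q). \<omega> (HL_elem q x 1) = s (rconst (H_counit q x))))"

text \<open>
  \<open>QFG_act q s \<psi> \<phi>\<close> is \<open>\<psi> \<cdot> \<phi>\<close>; it is meaningful when the entries of \<open>\<psi>\<close> commute with those of
  \<open>\<phi>\<close>. \<open>NCF_iso q s \<phi>\<close> is the point \<open>\<psi>\<close> whose matrix has the entries \<open>e\<close>, \<open>f\<close> for which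
  \<open>\<phi>(\<iota>\<^sub>0(t)) = (e(t+W)+f)Q+X\<close>.
\<close>

definition QFG_act ::
    "complex \<Rightarrow> (ratfun \<Rightarrow> 'a::{ring,monoid_mult}) \<Rightarrow> (hL \<Rightarrow> 'a) \<Rightarrow>
     (ratfun tser \<Rightarrow> 'a fps tser) \<Rightarrow> (ratfun tser \<Rightarrow> 'a fps tser)" where
  "QFG_act q s \<psi> \<phi> = (THE \<omega>. \<omega> \<in> NCF q s \<and>
     (\<exists>e f. \<phi> (iota0 q rt) = deformed q s e f \<and>
        \<omega> (iota0 q rt) = deformed q s (u_val q \<psi> * e) (u_val q \<psi> * f + v_val q \<psi>)))"

definition NCF_iso ::
    "complex \<Rightarrow> (ratfun \<Rightarrow> 'a::{ring,monoid_mult}) \<Rightarrow> (ratfun tser \<Rightarrow> 'a fps tser) \<Rightarrow> (hL \<Rightarrow> 'a)" where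
  "NCF_iso q s \<phi> = (THE \<psi>. \<psi> \<in> QFG q s \<and>
     \<phi> (iota0 q rt) = deformed q s (u_val q \<psi>) (v_val q \<psi>))"

definition Gm :: "'c::{comm_ring,comm_monoid_mult} monoid" where
  "Gm = \<lparr>carrier = {c. nilpotent (c - 1)}, monoid.mult = (*), one = 1\<rparr>"

section \<open>The commutative Galois group\<close>

text \<open>Completion of a ring for a decreasing sequence of ideals, as an inverse limit.\<close>

definition completion_ring :: "('r, 'z) ring_scheme \<Rightarrow> (nat \<Rightarrow> 'r set) \<Rightarrow> (nat \<Rightarrow> 'r set) ring" where
  "completion_ring R I =
     \<lparr>carrier = {x. \<forall>n. x n \<in> carrier (R Quot I n) \<and> x (Suc n) \<subseteq> x n},
      monoid.mult = (\<lambda>x y n. x n \<otimes>\<^bsub>R Quot I n\<^esub> y n),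
      one = (\<lambda>n. \<one>\<^bsub>R Quot I n\<^esub>),
      zero = (\<lambda>n. \<zero>\<^bsub>R Quot I n\<^esub>),
      add = (\<lambda>x y n. x n \<oplus>\<^bsub>R Quot I n\<^esub> y n)\<rparr>"

definition completion_map :: "('r, 'z) ring_scheme \<Rightarrow> (nat \<Rightarrow> 'r set) \<Rightarrow> 'r \<Rightarrow> nat \<Rightarrow> 'r set" where
  "completion_map R I x = (\<lambda>n. I n +>\<^bsub>R\<^esub> x)"

text \<open>
  Extension to the completions of an additive map \<open>O\<close> with \<open>O(I (n+1)) \<subseteq> I' n\<close>: the shift by one is
  needed for the derivation, which lowers \<open>W\<close>-adic order by one.
\<close>

definition completion_extend ::
    "('r, 'z) ring_scheme \<Rightarrow> (nat \<Rightarrow> 'r set) \<Rightarrow> ('p \<Rightarrow> 'r) \<Rightarrow> (nat \<Rightarrow> 'p set) \<Rightarrow> nat \<Rightarrow> 'r set" where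
  "completion_extend R I' F x = (\<lambda>n. \<Union>y\<in>x (Suc n). I' n +>\<^bsub>R\<^esub> F y)"

type_synonym 'a hullW = "(ratfun tser \<times> 'a fps \<Rightarrow>\<^sub>0 int) set"

definition hull_ring :: "complex \<Rightarrow> ratfun tser ring" where
  "hull_ring q = \<lparr>carrier = galois_hull q, monoid.mult = (*), one = 1, zero = 0, add = (+)\<rparr>"

definition T_ring :: "complex \<Rightarrow> (ratfun \<Rightarrow> 'a::{ring,monoid_mult}) \<Rightarrow> 'a hullW ring" where
  "T_ring q s = tensor_ring (hull_ring q) tconst type_ring (taylor s)"

definition T_elem :: "complex \<Rightarrow> (ratfun \<Rightarrow> 'a::{ring,monoid_mult}) \<Rightarrow> ratfun tser \<Rightarrow> 'a fps \<Rightarrow> 'a hullW" where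
  "T_elem q s = tensor_elem (hull_ring q) tconst type_ring (taylor s)"

definition T_filtration :: "complex \<Rightarrow> (ratfun \<Rightarrow> 'a::{ring,monoid_mult}) \<Rightarrow> nat \<Rightarrow> 'a hullW set" where
  "T_filtration q s n = Idl\<^bsub>T_ring q s\<^esub> {T_elem q s 1 fps_X [^]\<^bsub>T_ring q s\<^esub> n}"

text \<open>
  The additive map from the tensor product to \<open>T_ring q s\<close> induced by a biadditive map \<open>G\<close> with
  values in formal sums of pairs.
\<close>

definition T_extend ::
    "complex \<Rightarrow> (ratfun \<Rightarrow> 'a::{ring,monoid_mult}) \<Rightarrow>
     ('p \<Rightarrow> (ratfun tser \<times> 'a fps \<Rightarrow>\<^sub>0 int)) \<Rightarrow> ('p \<Rightarrow>\<^sub>0 int) set \<Rightarrow> 'a hullW" where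
  "T_extend q s G z =
     (\<Union>p\<in>z. tensor_ideal (hull_ring q) tconst type_ring (taylor s)
        +>\<^bsub>integral_monoid_ring (hull_ring q \<times>\<times> (type_ring :: 'a fps ring))\<^esub> frag_extend G p)"

text \<open>\<open>CT_ring q s\<close> is the completed tensor product of the Galois hull with \<open>A[[W]]\<close>.\<close>

definition CT_ring :: "complex \<Rightarrow> (ratfun \<Rightarrow> 'a::{ring,monoid_mult}) \<Rightarrow> (nat \<Rightarrow> 'a hullW set) ring" where
  "CT_ring q s = completion_ring (T_ring q s) (T_filtration q s)"

definition CT_elem ::
    "complex \<Rightarrow> (ratfun \<Rightarrow> 'a::{ring,monoid_mult}) \<Rightarrow> ratfun tser \<Rightarrow> 'a fps \<Rightarrow> (nat \<Rightarrow> 'a hullW set)" where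
  "CT_elem q s x b = completion_map (T_ring q s) (T_filtration q s) (T_elem q s x b)"

definition CT_extend ::
    "complex \<Rightarrow> (ratfun \<Rightarrow> 'a::{ring,monoid_mult}) \<Rightarrow> ('p \<Rightarrow> (ratfun tser \<times> 'a fps \<Rightarrow>\<^sub>0 int)) \<Rightarrow>
     (nat \<Rightarrow> ('p \<Rightarrow>\<^sub>0 int) set set) \<Rightarrow> (nat \<Rightarrow> 'a hullW set)" where
  "CT_extend q s G = completion_extend (T_ring q s) (T_filtration q s) (T_extend q s G)"

definition CT_sigma ::
    "complex \<Rightarrow> (ratfun \<Rightarrow> 'a::{ring,monoid_mult}) \<Rightarrow> (nat \<Rightarrow> 'a hullW set) \<Rightarrow> (nat \<Rightarrow> 'a hullW set)" where
  "CT_sigma q s = CT_extend q s (\<lambda>(x, b). frag_of (tsigma rconst q x, b))"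

definition CT_theta ::
    "complex \<Rightarrow> (ratfun \<Rightarrow> 'a::{ring,monoid_mult}) \<Rightarrow> nat \<Rightarrow> (nat \<Rightarrow> 'a hullW set) \<Rightarrow> (nat \<Rightarrow> 'a hullW set)" where
  "CT_theta q s l = CT_extend q s (\<lambda>(x, b). frag_of (ttheta rconst q l x, b))"

definition CT_deriv ::
    "complex \<Rightarrow> (ratfun \<Rightarrow> 'a::{ring,monoid_mult}) \<Rightarrow> (nat \<Rightarrow> 'a hullW set) \<Rightarrow> (nat \<Rightarrow> 'a hullW set)" where
  "CT_deriv q s = CT_extend q s (\<lambda>(x, b). frag_of (tmap rderiv x, b) + frag_of (x, wderiv s b))"

definition CT_map ::
    "complex \<Rightarrow> (ratfun \<Rightarrow> 'b::{ring,monoid_mult}) \<Rightarrow> ('a \<Rightarrow> 'b) \<Rightarrow>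
     (nat \<Rightarrow> 'a hullW set) \<Rightarrow> (nat \<Rightarrow> 'b hullW set)" where
  "CT_map q s' h = CT_extend q s' (\<lambda>(x, b). frag_of (x, wmap h b))"

definition CT_nbhd :: "complex \<Rightarrow> (ratfun \<Rightarrow> 'a::{ring,monoid_mult}) \<Rightarrow> nat \<Rightarrow> (nat \<Rightarrow> 'a hullW set) set" where
  "CT_nbhd q s n = Idl\<^bsub>CT_ring q s\<^esub> {CT_elem q s 1 fps_X [^]\<^bsub>CT_ring q s\<^esub> n}"

text \<open>The image of the completed tensor product of \<open>\<K>\<close> with \<open>A[[W]]\<close>.\<close>

definition CT_base :: "complex \<Rightarrow> (ratfun \<Rightarrow> 'a::{ring,monoid_mult}) \<Rightarrow> (nat \<Rightarrow> 'a hullW set) set" where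
  "CT_base q s = {x \<in> carrier (CT_ring q s). \<forall>n.
     \<exists>z \<in> generate_ring (T_ring q s) {T_elem q s (tconst a) b | a b. True}.
       x n = T_filtration q s n +>\<^bsub>T_ring q s\<^esub> z}"

definition CT_nil :: "complex \<Rightarrow> (ratfun \<Rightarrow> 'a::{ring,monoid_mult}) \<Rightarrow> (nat \<Rightarrow> 'a hullW set) set" where
  "CT_nil q s = {x \<in> carrier (CT_ring q s). \<forall>n.
     \<exists>y \<in> Idl\<^bsub>CT_ring q s\<^esub> {CT_elem q s 1 (fps_const a) | a. nilpotent a}.
       x \<ominus>\<^bsub>CT_ring q s\<^esub> y \<in> CT_nbhd q s n}"

definition CInf_gal ::
    "complex \<Rightarrow> (ratfun \<Rightarrow> 'a::{comm_ring,comm_monoid_mult}) \<Rightarrow>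
     ((nat \<Rightarrow> 'a hullW set) \<Rightarrow> (nat \<Rightarrow> 'a hullW set)) monoid" where
  "CInf_gal q s =
     \<lparr>carrier = {\<alpha> \<in> extensional (carrier (CT_ring q s)).
        \<alpha> \<in> ring_iso (CT_ring q s) (CT_ring q s) \<and>
        (\<forall>x\<in>CT_base q s. \<alpha> x = x) \<and>
        (\<forall>x\<in>carrier (CT_ring q s). \<alpha> (CT_sigma q s x) = CT_sigma q s (\<alpha> x)) \<and>
        (\<forall>x\<in>carrier (CT_ring q s). \<forall>l. \<alpha> (CT_theta q s l x) = CT_theta q s l (\<alpha> x)) \<and>
        (\<forall>x\<in>carrier (CT_ring q s). \<alpha> (CT_deriv q s x) = CT_deriv q s (\<alpha> x)) \<and>
        (\<forall>x\<in>carrier (CT_ring q s). \<forall>n. \<exists>m. \<forall>y\<in>carrier (CT_ring q s).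
           y \<ominus>\<^bsub>CT_ring q s\<^esub> x \<in> CT_nbhd q s m \<longrightarrow> \<alpha> y \<ominus>\<^bsub>CT_ring q s\<^esub> \<alpha> x \<in> CT_nbhd q s n) \<and>
        (\<forall>x\<in>carrier (CT_ring q s). \<alpha> x \<ominus>\<^bsub>CT_ring q s\<^esub> x \<in> CT_nil q s)},
      monoid.mult = compose (carrier (CT_ring q s)),
      one = restrict (\<lambda>x. x) (carrier (CT_ring q s))\<rparr>"

text \<open>
  The induced map of groups sends an automorphism \<open>\<alpha>\<close> to its base change, the automorphism \<open>\<beta>\<close>
  over \<open>B[[W]]\<close> that extends it.
\<close>

definition CInf_gal_map ::
    "complex \<Rightarrow> (ratfun \<Rightarrow> 'a::{comm_ring,comm_monoid_mult}) \<Rightarrow>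
     (ratfun \<Rightarrow> 'b::{comm_ring,comm_monoid_mult}) \<Rightarrow> ('a \<Rightarrow> 'b) \<Rightarrow>
     ((nat \<Rightarrow> 'a hullW set) \<Rightarrow> (nat \<Rightarrow> 'a hullW set)) \<Rightarrow>
     ((nat \<Rightarrow> 'b hullW set) \<Rightarrow> (nat \<Rightarrow> 'b hullW set))" where
  "CInf_gal_map q s s' h \<alpha> = (THE \<beta>. \<beta> \<in> carrier (CInf_gal q s') \<and>
     (\<forall>x\<in>carrier (CT_ring q s). \<beta> (CT_map q s' h x) = CT_map q s' h (\<alpha> x)))"

text \<open>The \<open>c\<close> such that \<open>\<alpha>\<close> sends \<open>\<iota>\<^sub>0(t)\<close> to \<open>c(t+W)Q + X\<close>.\<close>

definition CInf_gal_iso ::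
    "complex \<Rightarrow> (ratfun \<Rightarrow> 'a::{comm_ring,comm_monoid_mult}) \<Rightarrow>
     ((nat \<Rightarrow> 'a hullW set) \<Rightarrow> (nat \<Rightarrow> 'a hullW set)) \<Rightarrow> 'a" where
  "CInf_gal_iso q s \<alpha> = (THE c. \<alpha> (CT_elem q s (iota0 q rt) 1) =
     CT_elem q s (tQ rconst q) (fps_const c * (fps_const (s rt) + fps_X))
       \<oplus>\<^bsub>CT_ring q s\<^esub> CT_elem q s tX 1)"

end

theory Submission
  imports Defs "HOL-Algebra.Free_Abelian_Groups"
begin

text \<open>
  Why the theorem holds. A deformation \<open>\<phi>\<close> is compatible with all operators of the hull, and the hull
  is generated, under these operators and the inversion of \<open>\<iota>\<^sub>0(b)\<close>, by the constants and \<open>\<iota>\<^sub>0(t)\<close>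
  (\<open>hull_hom_unique\<close>). So \<open>\<phi>\<close> is determined by \<open>F = \<phi>(\<iota>\<^sub>0(t))\<close>. The equations
  \<open>\<Sigma>(F) = q F\<close>, \<open>\<Theta>\<^sup>(\<^sup>1\<^sup>)(F) = 1\<close> and \<open>\<partial>\<^sup>2 F = 0\<close>, inherited from \<open>\<iota>\<^sub>0(t) = tQ + X\<close>, force
  \<open>F = (e(t+W)+f)Q + X\<close> (\<open>deformed_form\<close>). The commutation relation between \<open>Q = \<partial>(\<iota>\<^sub>0(t))\<close> and
  \<open>\<iota>\<^sub>0(t)\<close> becomes \<open>ef = q fe\<close>, and \<open>e - 1\<close> is nilpotent (\<open>deformation_form\<close>).

  The decisive remark is that these two properties imply \<open>f = 0\<close>. From \<open>(e-1)f = f(qe-1)\<close> a power of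
  \<open>qe-1\<close> annihilates \<open>f\<close>; but \<open>qe - 1 = (q-1) + q(e-1)\<close> is the sum of a non-zero scalar and a nilpotent
  element, hence invertible (\<open>q_commuting_unipotent\<close>). The same computation shows that a point \<open>\<psi>\<close> of
  the formal completion of the quantum group has \<open>\<psi>(v) = 0\<close>. Both functors are therefore described by
  a single unipotent element \<open>e\<close>, also when the algebra is not commutative. What
  remains to be shown is that every unipotent \<open>e\<close> occurs.

  For the points of the quantum group this is the universal property of generators and relations. For
  deformations, \<open>e = 1 + \<epsilon>\<close> has to come from the substitution \<open>Q \<mapsto> (1+\<epsilon>)Q\<close>, which is
  given by the Taylor expansion \<open>x \<mapsto> \<Sum>\<^sub>k D\<^sub>k(x) \<epsilon>\<^sup>k\<close> with the divided powers
  \<open>D\<^sub>k = Q\<^sup>k/k! (d/dQ)\<^sup>k\<close>, the binomial coefficients of the derivation \<open>D\<^sub>1 = Q d/dQ\<close>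
  (\<open>deform\<close>). That \<open>Q d/dQ\<close> is well defined on the hull uses that \<open>q\<close> is not a root of
  unity: a polynomial over \<open>\<complex>(t)\<close> that vanishes at all powers \<open>q\<^sup>n\<close> has infinitely many zeros, so it is
  zero and its derivative is (\<open>Qeuler_seq_0\<close>). It preserves the hull
  because on \<open>\<iota>\<^sub>0(L)\<close> it coincides with \<open>t \<partial>/\<partial>t\<close>.

  The product of points multiplies the values at the group-like element \<open>u\<close>, the composition of
  \<open>W \<mapsto> (e-1)t + f + eW\<close> multiplies the factors \<open>e\<close>, and the operation on deformations does the same;
  with \<open>f = 0\<close> all compatibilities follow from the associativity of the product in the algebra and the
  assumed commutations.

  For the commutative Galois group the completed tensor product has to be understood. It is mapped to
  \<open>F(\<int>, A[[W]])[[X]]\<close> by \<open>x \<otimes> b \<mapsto> \<iota>(x) b\<close>. This map is injective modulo every power of \<open>W\<close>: the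
  hull consists of functions with values in the field \<open>L\<close>, so Gaussian elimination reduces the number
  of terms of a formal sum (\<open>tsum_faithful\<close>). Hence the completion is a ring of twisted power
  series, its operators are the usual ones there, and an automorphism restricts to a map from the hull
  to which \<open>deformation_form\<close> applies. So automorphisms correspond to unipotent elements \<open>c\<close>, and each
  \<open>c = 1 + \<epsilon>\<close> is realized by the extension of \<open>x \<otimes> b \<mapsto> \<Sum>\<^sub>k D\<^sub>k(x) \<otimes> \<epsilon>\<^sup>k b\<close> to the completion
  (\<open>CTsubst_endo\<close>).
\<close>

section \<open>Rational functions and their operators\<close>

lemma pcompose_linear_nz: "q \<noteq> 0 \<Longrightarrow> p \<noteq> 0 \<Longrightarrow> p \<circ>\<^sub>p [:0, q:] \<noteq> (0::complex poly)"
  using pcompose_eq_0[of p "[:0, q:]"] by auto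

lemma rsigma_add: "q \<noteq> 0 \<Longrightarrow> rsigma q (x + y) = rsigma q x + rsigma q y"
  by (cases x rule: Fract_cases; cases y rule: Fract_cases)
    (simp add: rsigma_Fract pcompose_linear_nz pcompose_add pcompose_mult)

lemma rsigma_mult: "q \<noteq> 0 \<Longrightarrow> rsigma q (x * y) = rsigma q x * rsigma q y"
  by (cases x rule: Fract_cases; cases y rule: Fract_cases)
    (simp add: rsigma_Fract pcompose_linear_nz pcompose_mult)

lemma rsigma_rconst [simp]: "q \<noteq> 0 \<Longrightarrow> rsigma q (rconst c) = rconst c"
  by (simp add: rconst_def rsigma_Fract pcompose_1)

lemma rsigma_0 [simp]: "q \<noteq> 0 \<Longrightarrow> rsigma q 0 = 0"
  by (simp add: Zero_fract_def rsigma_Fract pcompose_1)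

lemma rsigma_1 [simp]: "q \<noteq> 0 \<Longrightarrow> rsigma q 1 = 1"
  by (simp add: One_fract_def rsigma_Fract pcompose_1)

lemma rsigma_minus: "q \<noteq> 0 \<Longrightarrow> rsigma q (x - y) = rsigma q x - rsigma q y"
  using rsigma_add[of q "x - y" y] by simp

lemma rconst_0 [simp]: "rconst 0 = 0" by (simp add: rconst_def Zero_fract_def)
lemma rconst_1 [simp]: "rconst 1 = 1" by (simp add: rconst_def One_fract_def one_pCons)
lemma rconst_add: "rconst (a + b) = rconst a + rconst b" by (simp add: rconst_def)
lemma rconst_diff: "rconst (a - b) = rconst a - rconst b" by (simp add: rconst_def)
lemma rconst_mult: "rconst (a * b) = rconst a * rconst b" by (simp add: rconst_def mult.commute)
lemma rconst_eq_iff [simp]: "rconst a = rconst b \<longleftrightarrow> a = b"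
  by (simp add: rconst_def eq_fract)
lemma rconst_eq_0_iff [simp]: "rconst a = 0 \<longleftrightarrow> a = 0"
  using rconst_eq_iff[of a 0] by simp
lemma rconst_of_nat: "rconst (of_nat n) = of_nat n"
  by (induction n) (simp_all add: rconst_add)
lemma rconst_inverse: "rconst (inverse a) = inverse (rconst a)"
proof (cases "a = 0")
  case False
  then have "rconst a * rconst (inverse a) = 1" by (simp flip: rconst_mult)
  then show ?thesis by (metis inverse_unique)
qed simp
lemma rconst_divide: "rconst (a / b) = rconst a / rconst b"
  by (simp add: divide_inverse rconst_mult rconst_inverse)

lemma rt_nonzero [simp]: "rt \<noteq> 0"
  by (simp add: rt_def Zero_fract_def eq_fract)

lemma rsigma_rt: "q \<noteq> 0 \<Longrightarrow> rsigma q rt = rconst q * rt"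
  by (simp add: rt_def rconst_def rsigma_Fract pcompose_1 pcompose_pCons)

lemma rsigma_rsigma:
  assumes "p \<noteq> 0" "q \<noteq> 0"
  shows "rsigma p (rsigma q x) = rsigma (p * q) x"
proof (cases x rule: Fract_cases)
  case (Fract a b)
  have *: "r \<circ>\<^sub>p [:0, q:] \<circ>\<^sub>p [:0, p:] = r \<circ>\<^sub>p [:0, p * q:]" for r
    by (simp flip: pcompose_assoc add: pcompose_pCons mult.commute)
  show ?thesis using assms Fract(2)
    by (simp add: Fract(1) rsigma_Fract pcompose_linear_nz *)
qed

lemma rsigma_id [simp]: "rsigma 1 x = x"
  by (cases x rule: Fract_cases) (simp add: rsigma_Fract)

lemma rsigma_pow: "q \<noteq> 0 \<Longrightarrow> (rsigma q ^^ n) x = rsigma (q ^ n) x"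
  by (induction n) (simp_all add: rsigma_rsigma)

lemma rsigma_int_eq:
  assumes q: "q \<noteq> 0"
  shows "rsigma_int q n = rsigma (q powi n)"
proof (rule ext)
  fix x
  have inv: "inv_into UNIV (rsigma q) = rsigma (inverse q)"
    by (rule inv_equality) (use q in \<open>simp_all add: rsigma_rsigma\<close>)
  show "rsigma_int q n x = rsigma (q powi n) x"
    using q by (simp add: rsigma_int_def inv rsigma_pow power_int_def)
qed

lemma rderiv_add: "rderiv (x + y) = rderiv x + rderiv y"
proof (cases x rule: Fract_cases; cases y rule: Fract_cases)
  fix a b c d assume "x = Fract a b" "b \<noteq> 0" "y = Fract c d" "d \<noteq> 0"
  then show ?thesis
    by (simp add: rderiv_Fract eq_fract pderiv_add pderiv_mult) (simp add: algebra_simps)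
qed

lemma rderiv_mult: "rderiv (x * y) = rderiv x * y + x * rderiv y"
proof (cases x rule: Fract_cases; cases y rule: Fract_cases)
  fix a b c d assume "x = Fract a b" "b \<noteq> 0" "y = Fract c d" "d \<noteq> 0"
  then show ?thesis
    by (simp add: rderiv_Fract eq_fract pderiv_add pderiv_mult) (simp add: algebra_simps)
qed

lemma rderiv_rconst [simp]: "rderiv (rconst c) = 0"
  by (simp add: rconst_def rderiv_Fract Zero_fract_def pderiv_pCons)
lemma rderiv_0 [simp]: "rderiv 0 = 0" using rderiv_rconst[of 0] by simp
lemma rderiv_1 [simp]: "rderiv 1 = 0" using rderiv_rconst[of 1] by simp
lemma rderiv_rt [simp]: "rderiv rt = 1"
  by (simp add: rt_def rderiv_Fract One_fract_def pderiv_pCons eq_fract)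
lemma rderiv_minus: "rderiv (x - y) = rderiv x - rderiv y"
  using rderiv_add[of "x - y" y] by simp
lemma rderiv_rsigma:
  assumes "q \<noteq> 0"
  shows "rderiv (rsigma q x) = rconst q * rsigma q (rderiv x)"
proof (cases x rule: Fract_cases)
  case (Fract a b)
  show ?thesis using assms Fract(2)
    by (simp add: Fract(1) rsigma_Fract rderiv_Fract pcompose_linear_nz pderiv_pcompose
        pderiv_pCons pcompose_mult pcompose_diff rconst_def eq_fract)
      (simp add: algebra_simps smult_diff_right smult_add_right)
qed

lemma ratfun_of_nat_Suc_nonzero: "(of_nat (Suc n) :: ratfun) \<noteq> 0"
  unfolding rconst_of_nat[symmetric] rconst_eq_0_iff by (rule of_nat_neq_0)

lemma rderiv_of_nat [simp]: "rderiv (of_nat n) = 0"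
  by (simp flip: rconst_of_nat)

lemma rderiv_pow_add: "(rderiv ^^ n) (a + b) = (rderiv ^^ n) a + (rderiv ^^ n) b"
  by (induction n) (simp_all add: rderiv_add)

text \<open>The Euler derivation \<open>t d/dt\<close> commutes with \<open>\<sigma>\<close>, while \<open>d/dt\<close> does so only up to a factor.\<close>

definition euler :: "ratfun \<Rightarrow> ratfun" where "euler x = rt * rderiv x"

lemma euler_add: "euler (x + y) = euler x + euler y"
  by (simp add: euler_def rderiv_add algebra_simps)
lemma euler_mult: "euler (x * y) = euler x * y + x * euler y"
  by (simp add: euler_def rderiv_mult algebra_simps)
lemma euler_rconst [simp]: "euler (rconst c) = 0" by (simp add: euler_def)
lemma euler_0 [simp]: "euler 0 = 0" by (simp add: euler_def)
lemma euler_1 [simp]: "euler 1 = 0" by (simp add: euler_def)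
lemma euler_rsigma: "q \<noteq> 0 \<Longrightarrow> euler (rsigma q x) = rsigma q (euler x)"
  by (simp add: euler_def rderiv_rsigma rsigma_mult rsigma_rt)

section \<open>The iterative \<open>q\<close>-difference operators\<close>

lemma q_not_1: "\<forall>n\<ge>1. q ^ n \<noteq> 1 \<Longrightarrow> q \<noteq> (1::complex)"
  by (metis order_refl power_one_right)

lemma qint_nonzero:
  assumes "\<forall>n\<ge>1. q ^ n \<noteq> 1" shows "qint q (Suc n) \<noteq> 0"
proof -
  have "qint q (Suc n) = (q ^ Suc n - 1) / (q - 1)"
    unfolding qint_def using geometric_sum[OF q_not_1[OF assms], of "Suc n"] .
  moreover have "q ^ Suc n \<noteq> 1" using assms by (metis le_add1 plus_1_eq_Suc)
  ultimately show ?thesis using q_not_1[OF assms] by simp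
qed

lemma qint_0 [simp]: "qint q 0 = 0" by (simp add: qint_def)
lemma qint_1 [simp]: "qint q (Suc 0) = 1" by (simp add: qint_def)
lemma qint_Suc: "qint q (Suc n) = qint q n + q ^ n" by (simp add: qint_def)
lemma qint_add: "qint q (m + n) = qint q m + q ^ m * qint q n"
  by (induction n) (simp_all add: qint_Suc power_add algebra_simps)

lemma qfact_0 [simp]: "qfact q 0 = 1" by (simp add: qfact_def)
lemma qfact_Suc: "qfact q (Suc n) = qfact q n * qint q (Suc n)"
  by (simp add: qfact_def mult.commute)
lemma qfact_nonzero: "\<forall>n\<ge>1. q ^ n \<noteq> 1 \<Longrightarrow> qfact q n \<noteq> 0"
  by (induction n) (simp_all add: qfact_Suc qint_nonzero)

lemma qbinom_1: "\<forall>n\<ge>1. q ^ n \<noteq> 1 \<Longrightarrow> qbinom q (Suc i) (Suc 0) = qint q (Suc i)"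
  using qfact_nonzero[of q i] by (simp add: qbinom_def qfact_Suc)

lemma rtheta1_add: "q \<noteq> 0 \<Longrightarrow> rtheta1 q (x + y) = rtheta1 q x + rtheta1 q y"
  by (simp add: rtheta1_def rsigma_add add_divide_distrib[symmetric])

lemma rtheta1_mult: "q \<noteq> 0 \<Longrightarrow> rtheta1 q (x * y) = rtheta1 q x * y + rsigma q x * rtheta1 q y"
  by (simp add: rtheta1_def rsigma_mult add_divide_distrib[symmetric] algebra_simps)

lemma rtheta1_rconst [simp]: "q \<noteq> 0 \<Longrightarrow> rtheta1 q (rconst c) = 0" by (simp add: rtheta1_def)
lemma rtheta1_scale: "q \<noteq> 0 \<Longrightarrow> rtheta1 q (rconst c * x) = rconst c * rtheta1 q x"
  by (simp add: rtheta1_mult)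
lemma rtheta1_0 [simp]: "q \<noteq> 0 \<Longrightarrow> rtheta1 q 0 = 0" by (simp add: rtheta1_def)
lemma rtheta1_1 [simp]: "q \<noteq> 0 \<Longrightarrow> rtheta1 q 1 = 0" by (simp add: rtheta1_def)
lemma rtheta1_rt: "q \<noteq> 0 \<Longrightarrow> q \<noteq> 1 \<Longrightarrow> rtheta1 q rt = 1"
  by (simp add: rtheta1_def rsigma_rt rconst_diff algebra_simps)
    (metis diff_self eq_iff_diff_eq_0 left_diff_distrib mult.commute mult_eq_0_iff rconst_1 rconst_eq_iff right_inverse_eq rt_nonzero)

lemma rtheta1_rsigma: "q \<noteq> 0 \<Longrightarrow> rtheta1 q (rsigma q x) = rconst q * rsigma q (rtheta1 q x)"
proof -
  assume q: "q \<noteq> 0"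
  have d: "rsigma q (y / z) = rsigma q y / rsigma q z" for y z
  proof (cases "z = 0")
    case False
    have "rsigma q z \<noteq> 0"
    proof
      assume "rsigma q z = 0"
      then have "rsigma (inverse q) (rsigma q z) = 0" using q by simp
      then show False using q False by (simp add: rsigma_rsigma)
    qed
    moreover have "rsigma q (y / z) * rsigma q z = rsigma q y"
      using False q by (simp flip: rsigma_mult)
    ultimately show ?thesis by (simp add: eq_divide_eq)
  qed (use q in simp)
  show ?thesis using q
    by (simp add: rtheta1_def d rsigma_minus rsigma_mult rsigma_rt)
qed

lemma rtheta1_rsigma_pow:
  "q \<noteq> 0 \<Longrightarrow> rtheta1 q (rsigma (q ^ m) x) = rconst (q ^ m) * rsigma (q ^ m) (rtheta1 q x)"
proof (induction m)
  case (Suc m)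
  have "rtheta1 q (rsigma (q ^ Suc m) x) = rtheta1 q (rsigma q (rsigma (q ^ m) x))"
    using Suc by (simp add: rsigma_rsigma)
  also have "\<dots> = rconst q * rsigma q (rtheta1 q (rsigma (q ^ m) x))"
    by (rule rtheta1_rsigma[OF Suc.prems])
  also have "\<dots> = rconst (q ^ Suc m) * rsigma (q ^ Suc m) (rtheta1 q x)"
    unfolding Suc.IH[OF Suc.prems] using Suc.prems
    by (simp add: rsigma_mult rsigma_rsigma rconst_mult mult.assoc)
  finally show ?case .
qed simp

lemma rtheta_0 [simp]: "rtheta q 0 x = x" by (simp add: rtheta_def)

lemma rtheta_Suc:
  assumes "q \<noteq> 0" "\<forall>n\<ge>1. q ^ n \<noteq> 1"
  shows "rtheta1 q (rtheta q n x) = rconst (qint q (Suc n)) * rtheta q (Suc n) x"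
proof -
  have "rtheta1 q (rtheta q n x) = rtheta1 q (rconst (inverse (qfact q n)) * (rtheta1 q ^^ n) x)"
    by (simp add: rtheta_def rconst_inverse divide_inverse mult.commute)
  also have "\<dots> = rconst (inverse (qfact q n)) * (rtheta1 q ^^ Suc n) x"
    using assms by (simp add: rtheta1_scale)
  also have "\<dots> = rconst (qint q (Suc n)) * rtheta q (Suc n) x"
    using qfact_nonzero[OF assms(2), of n] qint_nonzero[OF assms(2), of n]
    by (simp add: rtheta_def rconst_divide qfact_Suc rconst_mult field_simps del: funpow.simps)
  finally show ?thesis .
qed

lemma rtheta_add: "q \<noteq> 0 \<Longrightarrow> rtheta q n (x + y) = rtheta q n x + rtheta q n y"
proof -
  assume q: "q \<noteq> 0"
  have "(rtheta1 q ^^ n) (x + y) = (rtheta1 q ^^ n) x + (rtheta1 q ^^ n) y"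
    by (induction n) (simp_all add: rtheta1_add q)
  then show ?thesis by (simp add: rtheta_def add_divide_distrib)
qed

lemma rtheta1_sum: "q \<noteq> 0 \<Longrightarrow> rtheta1 q (sum f A) = (\<Sum>i\<in>A. rtheta1 q (f i))"
  by (induction A rule: infinite_finite_induct) (simp_all add: rtheta1_add)

text \<open>
  The \<open>q\<close>-Leibniz rule. Applying \<open>\<theta>\<^sup>(\<^sup>1\<^sup>)\<close> to the rule for \<open>k\<close>, the term with index \<open>i\<close> occurs with the
  coefficients \<open>q\<^sup>k\<^sup>+\<^sup>1\<^sup>-\<^sup>i [i]\<close> and \<open>[k+1-i]\<close>, whose sum is \<open>[k+1]\<close>.
\<close>

lemma rtheta_mult:
  assumes q: "q \<noteq> 0" "\<forall>n\<ge>1. q ^ n \<noteq> 1"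
  shows "rtheta q k (a * b) = (\<Sum>i=0..k. rsigma (q ^ (k - i)) (rtheta q i a) * rtheta q (k - i) b)"
proof (induction k)
  case (Suc k)
  define T where "T i = rsigma (q ^ (Suc k - i)) (rtheta q i a) * rtheta q (Suc k - i) b" for i
  have "rconst (qint q (Suc k)) * rtheta q (Suc k) (a * b) = rtheta1 q (rtheta q k (a * b))"
    by (simp add: rtheta_Suc q)
  also have "\<dots> = (\<Sum>i=0..k. rtheta1 q (rsigma (q ^ (k - i)) (rtheta q i a) * rtheta q (k - i) b))"
    by (simp add: Suc rtheta1_sum q)
  also have "\<dots> = (\<Sum>i=0..k. rconst (q ^ (k - i) * qint q (Suc i)) * T (Suc i)
                      + rconst (qint q (Suc (k - i))) * T i)"
  proof (rule sum.cong)
    fix i assume "i \<in> {0..k}"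
    then have i: "Suc k - i = Suc (k - i)" by auto
    show "rtheta1 q (rsigma (q ^ (k - i)) (rtheta q i a) * rtheta q (k - i) b) =
        rconst (q ^ (k - i) * qint q (Suc i)) * T (Suc i) + rconst (qint q (Suc (k - i))) * T i"
      unfolding T_def i
      unfolding rtheta1_mult[OF q(1)] rtheta1_rsigma_pow[OF q(1)] rtheta_Suc[OF q]
      by (simp add: q rsigma_mult rsigma_rsigma rconst_mult algebra_simps)
  qed simp
  also have "\<dots> = (\<Sum>i=0..k. rconst (q ^ (k - i) * qint q (Suc i)) * T (Suc i))
                    + (\<Sum>i=0..k. rconst (qint q (Suc k - i)) * T i)"
    by (simp add: sum.distrib Suc_diff_le)
  also have "(\<Sum>i=0..k. rconst (q ^ (k - i) * qint q (Suc i)) * T (Suc i))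
      = (\<Sum>i=0..Suc k. rconst (q ^ (Suc k - i) * qint q i) * T i)"
    by (subst sum.atLeast0_atMost_Suc_shift) simp
  also have "(\<Sum>i=0..k. rconst (qint q (Suc k - i)) * T i) = (\<Sum>i=0..Suc k. rconst (qint q (Suc k - i)) * T i)"
    by simp
  also have "(\<Sum>i=0..Suc k. rconst (q ^ (Suc k - i) * qint q i) * T i) + \<dots>
      = (\<Sum>i=0..Suc k. rconst (qint q (Suc k)) * T i)"
  proof -
    have "rconst (q ^ (Suc k - i) * qint q i) * T i + rconst (qint q (Suc k - i)) * T i
        = rconst (qint q (Suc k)) * T i" if "i \<le> Suc k" for i
    proof -
      have "qint q (Suc k) = q ^ (Suc k - i) * qint q i + qint q (Suc k - i)"
        using qint_add[of q "Suc k - i" i] that by simp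
      then show ?thesis by (simp add: rconst_add algebra_simps)
    qed
    then show ?thesis by (simp add: sum.distrib[symmetric] del: sum.atLeast0_atMost_Suc)
  qed
  finally show ?case
    using qint_nonzero[OF q(2), of k] by (simp add: T_def sum_distrib_left[symmetric] del: sum.atLeast0_atMost_Suc)
qed simp

lemma rtheta_rconst: "q \<noteq> 0 \<Longrightarrow> rtheta q n (rconst c) = (if n = 0 then rconst c else 0)"
proof -
  assume q: "q \<noteq> 0"
  have "(rtheta1 q ^^ Suc m) (rconst c) = 0" for m
    by (induction m) (simp_all add: q)
  then show ?thesis by (cases n) (auto simp: rtheta_def simp del: funpow.simps)
qed

lemma rtheta_rt: "q \<noteq> 0 \<Longrightarrow> q \<noteq> 1 \<Longrightarrow> rtheta q n rt = (if n = 0 then rt else if n = 1 then 1 else 0)"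
proof -
  assume q: "q \<noteq> 0" "q \<noteq> 1"
  have "(rtheta1 q ^^ Suc (Suc m)) rt = 0" for m
    by (induction m) (simp_all add: q rtheta1_rt)
  moreover have "n = 0 \<or> n = 1 \<or> (\<exists>m. n = Suc (Suc m))" by presburger
  ultimately show ?thesis using q by (auto simp: rtheta_def rtheta1_rt qfact_Suc simp del: funpow.simps(2)) (simp add: rtheta1_rt)
qed

section \<open>Twisted power series\<close>

instance fps :: ("{semiring_0,monoid_mult}") monoid_mult
proof
  fix a :: "'a fps"
  show "1 * a = a" "a * 1 = a" by (simp_all add: fps_one_mult)
qed

lemma tcoeff_0 [simp]: "tcoeff 0 i n = 0" by (simp add: zero_tser_def)
lemma tcoeff_1: "tcoeff 1 i n = (if i = 0 then 1 else 0)" by (simp add: one_tser_def)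
lemma tcoeff_add [simp]: "tcoeff (f + g) i n = tcoeff f i n + tcoeff g i n" by (simp add: plus_tser_def)
lemma tcoeff_diff [simp]: "tcoeff (f - g) i n = tcoeff f i n - tcoeff g i n" by (simp add: minus_tser_def)
lemma tcoeff_uminus [simp]: "tcoeff (- f) i n = - tcoeff f i n" by (simp add: uminus_tser_def)
lemma tcoeff_mult:
  "tcoeff (f * g) k n = (\<Sum>i=0..k. tcoeff f i (n + int (k - i)) * tcoeff g (k - i) n)"
  by (simp add: times_tser_def)
lemma tcoeff_sum: "tcoeff (sum f A) i n = (\<Sum>a\<in>A. tcoeff (f a) i n)"
  by (induction A rule: infinite_finite_induct) auto
lemma tcoeff_mult_0: "tcoeff (f * g) 0 n = tcoeff f 0 n * tcoeff g 0 n"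
  by (simp add: tcoeff_mult)

lemma tcoeff_degree_0_mult:
  fixes g :: "'b::ring tser"
  assumes "\<And>i n. tcoeff f (Suc i) n = 0"
  shows "tcoeff (f * g) i n = tcoeff f 0 (n + int i) * tcoeff g i n"
proof -
  have "tcoeff (f * g) i n = (\<Sum>j\<in>{0}. tcoeff f j (n + int (i - j)) * tcoeff g (i - j) n)"
    unfolding tcoeff_mult
  proof (rule sum.mono_neutral_right)
    show "\<forall>j\<in>{0..i} - {0}. tcoeff f j (n + int (i - j)) * tcoeff g (i - j) n = 0"
      by (metis DiffD2 assms insertI1 mult_zero_left not0_implies_Suc)
  qed auto
  then show ?thesis by simp
qed

lemma tcoeff_mult_degree_0:
  fixes f :: "'b::ring tser"
  assumes "\<And>i n. tcoeff g (Suc i) n = 0"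
  shows "tcoeff (f * g) i n = tcoeff f i n * tcoeff g 0 n"
proof -
  have "tcoeff (f * g) i n = (\<Sum>j\<in>{i}. tcoeff f j (n + int (i - j)) * tcoeff g (i - j) n)"
    unfolding tcoeff_mult
  proof (rule sum.mono_neutral_right)
    show "\<forall>j\<in>{0..i} - {i}. tcoeff f j (n + int (i - j)) * tcoeff g (i - j) n = 0"
    proof
      fix j assume "j \<in> {0..i} - {i}"
      then obtain k where "i - j = Suc k" by (metis Diff_iff atLeastAtMost_iff diff_is_0_eq insert_iff le_antisym not0_implies_Suc)
      then show "tcoeff f j (n + int (i - j)) * tcoeff g (i - j) n = 0" by (simp add: assms)
    qed
  qed auto
  then show ?thesis by simp
qed

lemma tcoeff_tconst: "tcoeff (tconst b) i n = (if i = 0 then b else 0)" by (simp add: tconst_def)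
lemma tcoeff_tQ: "tcoeff (tQ k q) i n = (if i = 0 then k (q powi n) else 0)" by (simp add: tQ_def)
lemma tcoeff_tX: "tcoeff tX i n = (if i = 1 then 1 else 0)" by (simp add: tX_def)

lemma tcoeff_tconst_mult [simp]: "tcoeff (tconst b * g) i n = b * tcoeff g i n" for g :: "'b::ring tser"
  by (subst tcoeff_degree_0_mult) (simp_all add: tcoeff_tconst)
lemma tcoeff_mult_tconst [simp]: "tcoeff (g * tconst b) i n = tcoeff g i n * b" for g :: "'b::ring tser"
  by (subst tcoeff_mult_degree_0) (simp_all add: tcoeff_tconst)
lemma tcoeff_tQ_mult: "tcoeff (tQ k q * g) i n = k (q powi (n + int i)) * tcoeff g i n" for g :: "'b::ring tser"
  by (subst tcoeff_degree_0_mult) (simp_all add: tcoeff_tQ)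
lemma tcoeff_mult_tQ: "tcoeff (g * tQ k q) i n = tcoeff g i n * k (q powi n)" for g :: "'b::ring tser"
  by (subst tcoeff_mult_degree_0) (simp_all add: tcoeff_tQ)

instance tser :: ("{ring,monoid_mult}") monoid_mult
proof
  fix a :: "'a tser"
  have 1: "(1 :: 'a tser) = tconst 1" by (rule tser_eqI) (simp add: tcoeff_1 tcoeff_tconst)
  show "1 * a = a" "a * 1 = a" unfolding 1 by (rule tser_eqI; simp)+
qed

lemma tconst_1 [simp]: "tconst 1 = 1" by (rule tser_eqI) (simp add: tcoeff_1 tcoeff_tconst)
lemma tconst_0 [simp]: "tconst 0 = 0" by (rule tser_eqI) (simp add: tcoeff_tconst)
lemma tconst_add: "tconst (a + b) = tconst a + tconst b" for a :: "'b::ring"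
  by (rule tser_eqI) (simp add: tcoeff_tconst)
lemma tconst_mult: "tconst (a * b) = tconst a * tconst b" for a :: "'b::ring"
  by (rule tser_eqI) (simp add: tcoeff_tconst)
lemma tconst_central:
  fixes f :: "'b::ring tser"
  assumes "\<And>i n. b * tcoeff f i n = tcoeff f i n * b"
  shows "tconst b * f = f * tconst b"
  by (rule tser_eqI) (simp add: assms)

lemma tcoeff_tmap [simp]: "tcoeff (tmap d f) i n = d (tcoeff f i n)" by (simp add: tmap_def)
lemma tcoeff_tsigma [simp]: "tcoeff (tsigma k q f) i n = k (q ^ i) * tcoeff f i (n + 1)" by (simp add: tsigma_def)
lemma tcoeff_ttheta [simp]: "tcoeff (ttheta k q l f) i n = k (qbinom q (i + l) l) * tcoeff f (i + l) n" by (simp add: ttheta_def)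

lemma tmap_add: "(\<And>x y. d (x + y) = d x + d y) \<Longrightarrow> tmap d (f + g) = tmap d f + tmap d g"
  by (rule tser_eqI) simp

lemma additive_sum:
  fixes d :: "'b::ab_group_add \<Rightarrow> 'c::ab_group_add"
  assumes "\<And>x y. d (x + y) = d x + d y"
  shows "d (sum f A) = (\<Sum>a\<in>A. d (f a))"
proof -
  have "d 0 = 0" using assms[of 0 0] by simp
  then show ?thesis by (induction A rule: infinite_finite_induct) (simp_all add: assms)
qed

lemma tmap_hom:
  fixes d :: "'b::ring \<Rightarrow> 'c::ring"
  assumes "\<And>x y. d (x + y) = d x + d y" "\<And>x y. d (x * y) = d x * d y"
  shows "tmap d (f * g) = tmap d f * tmap d g"
  by (rule tser_eqI) (simp add: tcoeff_mult additive_sum[of d, OF assms(1)] assms(2))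

lemma tmap_derivation:
  fixes d :: "'b::ring \<Rightarrow> 'b::ring"
  assumes "\<And>x y. d (x + y) = d x + d y" "\<And>x y. d (x * y) = d x * y + x * d y"
  shows "tmap d (f * g) = tmap d f * g + f * tmap d g"
  by (rule tser_eqI) (simp add: tcoeff_mult additive_sum[of d, OF assms(1)] assms(2) sum.distrib)

lemma rsigma_sum: "c \<noteq> 0 \<Longrightarrow> rsigma c (sum f A) = (\<Sum>i\<in>A. rsigma c (f i))"
  by (rule additive_sum) (rule rsigma_add)

lemma tconst_commute: "tconst (a :: ratfun) * f = f * tconst a"
  by (rule tconst_central) simp

section \<open>The derivation \<open>Q d/dQ\<close> on sequences\<close>

text \<open>
  Rational functions of \<open>Q\<close> over \<open>\<complex>(t)\<close> of the kind that occur in the hull: the sequences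
  \<open>n \<mapsto> \<Sum> a\<^sub>j \<sigma>\<^sup>n(b\<^sub>j)\<close>, that is \<open>\<Sum> a\<^sub>j(t) b\<^sub>j(tQ)\<close>. The relation pairs such a sequence with its image
  \<open>n \<mapsto> \<Sum> a\<^sub>j \<sigma>\<^sup>n(t b\<^sub>j')\<close> under \<open>Q d/dQ\<close>.
\<close>

inductive Qeuler_seq :: "complex \<Rightarrow> (int \<Rightarrow> ratfun) \<Rightarrow> (int \<Rightarrow> ratfun) \<Rightarrow> bool" for q where
  zero: "Qeuler_seq q (\<lambda>n. 0) (\<lambda>n. 0)"
| step: "Qeuler_seq q f f' \<Longrightarrow>
    Qeuler_seq q (\<lambda>n. a * rsigma (q powi n) b + f n) (\<lambda>n. a * rsigma (q powi n) (euler b) + f' n)"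

lemma Fract_pCons: "Fract (pCons a P) 1 = rconst a + rt * Fract P 1"
  by (simp add: rconst_def rt_def)

text \<open>
  The polynomial \<open>Z \<mapsto> P(tZ)\<close> over \<open>\<complex>(t)\<close>. It turns the values \<open>\<sigma>\<^sup>n(P) = P(q\<^sup>nt)\<close> into the values of one
  polynomial at the points \<open>q\<^sup>n\<close>.
\<close>

definition twist :: "complex poly \<Rightarrow> ratfun poly" where
  "twist P = map_poly rconst P \<circ>\<^sub>p [:0, rt:]"

lemma twist_pCons: "twist (pCons a P) = [:rconst a:] + [:0, rt:] * twist P"
  by (cases "a = 0 \<and> P = 0") (auto simp: twist_def map_poly_pCons pcompose_pCons)

lemma poly_twist: "c \<noteq> 0 \<Longrightarrow> poly (twist P) (rconst c) = rsigma c (Fract P 1)"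
proof (induction P)
  case 0
  then show ?case by (simp add: twist_def fract_collapse)
next
  case (pCons a P)
  then show ?case by (simp add: twist_pCons Fract_pCons rsigma_add rsigma_mult rsigma_rt)
qed

lemma poly_pderiv_twist:
  "c \<noteq> 0 \<Longrightarrow> rconst c * poly (pderiv (twist P)) (rconst c) = rsigma c (euler (Fract P 1))"
proof (induction P)
  case 0
  then show ?case by (simp add: twist_def fract_collapse)
next
  case (pCons a P)
  have "rconst c * poly (pderiv (twist (pCons a P))) (rconst c)
      = rconst c * rt * (poly (twist P) (rconst c) + rconst c * poly (pderiv (twist P)) (rconst c))"
    by (simp add: twist_pCons pderiv_add pderiv_mult pderiv_pCons pderiv_smult algebra_simps)
  also have "\<dots> = rsigma c (euler (Fract (pCons a P) 1))"
    using pCons by (simp add: poly_twist Fract_pCons rsigma_add rsigma_mult rsigma_rt euler_add euler_mult)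
      (simp add: euler_def rsigma_mult rsigma_rt algebra_simps)
  finally show ?case .
qed

lemma Qeuler_seq_list:
  assumes "Qeuler_seq q f f'"
  shows "\<exists>xs. f = (\<lambda>n. \<Sum>(a, b)\<leftarrow>xs. a * rsigma (q powi n) b) \<and>
              f' = (\<lambda>n. \<Sum>(a, b)\<leftarrow>xs. a * rsigma (q powi n) (euler b))"
  using assms
proof (induction rule: Qeuler_seq.induct)
  case zero
  show ?case by (rule exI[of _ "[]"]) simp
next
  case (step f f' a b)
  then obtain xs where "f = (\<lambda>n. \<Sum>(a, b)\<leftarrow>xs. a * rsigma (q powi n) b)"
    "f' = (\<lambda>n. \<Sum>(a, b)\<leftarrow>xs. a * rsigma (q powi n) (euler b))" by blast
  then show ?case by (intro exI[of _ "(a, b) # xs"]) simp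
qed

lemma common_denominator:
  "\<exists>w. \<forall>b\<in>set bs. \<exists>P. b = Fract P 1 * Fract 1 w \<and> w \<noteq> (0 :: complex poly)"
proof (induction bs)
  case (Cons b bs)
  then obtain w where w: "\<forall>b\<in>set bs. \<exists>P. b = Fract P 1 * Fract 1 w \<and> w \<noteq> 0" by blast
  obtain B v where b: "b = Fract B v" "v \<noteq> 0" by (cases b rule: Fract_cases)
  define w' where "w' = (if w = 0 then 1 else w)"
  have "\<exists>P. c = Fract P 1 * Fract 1 (v * w') \<and> v * w' \<noteq> 0" if "c \<in> set (b # bs)" for c
  proof (cases "c = b")
    case True
    then show ?thesis by (intro exI[of _ "B * w'"]) (simp add: w'_def b eq_fract)
  next
    case False
    then have "c \<in> set bs" using that by simp
    then obtain P where "c = Fract P 1 * Fract 1 w" "w \<noteq> 0" using w by blast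
    then show ?thesis by (intro exI[of _ "P * v"]) (simp add: w'_def b eq_fract)
  qed
  then show ?case by blast
qed simp

lemma infinite_powers:
  assumes "q \<noteq> 0" "\<forall>n\<ge>1. q ^ n \<noteq> (1::complex)"
  shows "infinite (range (\<lambda>n::int. rconst (q powi n)))"
proof -
  have inj: "inj (\<lambda>n::nat. rconst (q powi int n))"
  proof (rule injI)
    fix m n :: nat assume "rconst (q powi int m) = rconst (q powi int n)"
    then have e: "q ^ m = q ^ n" by (simp add: power_int_def)
    have "\<not> a < b" if "q ^ a = q ^ b" for a b :: nat
    proof
      assume "a < b"
      then have "q ^ b = q ^ a * q ^ (b - a)" by (simp flip: power_add)
      then have "q ^ (b - a) = 1" using that assms(1) by simp
      then show False using assms(2) \<open>a < b\<close> by simp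
    qed
    from this[OF e] this[OF e[symmetric]] show "m = n" by simp
  qed
  have "infinite (range (\<lambda>n::nat. rconst (q powi int n)))"
    using finite_imageD[OF _ inj] infinite_UNIV_nat by blast
  moreover have "range (\<lambda>n::nat. rconst (q powi int n)) \<subseteq> range (\<lambda>n::int. rconst (q powi n))" by blast
  ultimately show ?thesis using finite_subset by blast
qed

text \<open>
  After multiplication by a common denominator, the sum is the value at \<open>q\<^sup>n\<close> of a polynomial over
  \<open>\<complex>(t)\<close>. As \<open>q\<close> is not a root of unity, this polynomial has infinitely many zeros, so it vanishes
  and its derivative does.
\<close>

lemma Qeuler_seq_0:
  assumes q: "q \<noteq> 0" "\<forall>n\<ge>1. q ^ n \<noteq> 1" and rel: "Qeuler_seq q (\<lambda>n. 0) g"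
  shows "g = (\<lambda>n. 0)"
proof -
  obtain xs where xs: "(\<lambda>n. 0) = (\<lambda>n. \<Sum>(a, b)\<leftarrow>xs. a * rsigma (q powi n) b)"
    and g: "g = (\<lambda>n. \<Sum>(a, b)\<leftarrow>xs. a * rsigma (q powi n) (euler b))"
    using Qeuler_seq_list[OF rel] by blast
  show ?thesis
  proof (cases xs)
    case (Cons x xs')
    obtain w where "\<forall>b\<in>set (map snd xs). \<exists>P. b = Fract P 1 * Fract 1 w \<and> w \<noteq> 0"
      using common_denominator by blast
    then obtain P where P: "\<And>b. b \<in> snd ` set xs \<Longrightarrow> b = Fract (P b) 1 * Fract 1 w" and "w \<noteq> 0"
      using Cons by (metis list.set_intros(1) list.set_map list.simps(9))
    \<comment> \<open>a polynomial over \<open>\<complex>(t)\<close> whose value at \<open>q\<^sup>n\<close> is the sum times the common denominator\<close>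
    define PP where "PP = (\<Sum>(a, b)\<leftarrow>xs. Polynomial.smult a (twist (P b)))"
    have e: "poly PP (rconst c) = (\<Sum>(a, b)\<leftarrow>xs. a * rsigma c (Fract (P b) 1))"
            "rconst c * poly (pderiv PP) (rconst c) = (\<Sum>(a, b)\<leftarrow>xs. a * rsigma c (euler (Fract (P b) 1)))"
      if "c \<noteq> 0" for c
      unfolding PP_def
      by (induction xs) (auto simp: poly_twist that pderiv_add pderiv_smult poly_pderiv_twist[OF that, symmetric] algebra_simps)
    have "PP = 0"
    proof (rule ccontr)
      assume "PP \<noteq> 0"
      then have "finite {x. poly PP x = 0}" by (rule poly_roots_finite)
      moreover have "range (\<lambda>n::int. rconst (q powi n)) \<subseteq> {x. poly PP x = 0}"
      proof clarify
        fix n :: int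
        have qn: "q powi n \<noteq> 0" using q by simp
        have "0 = (\<Sum>(a, b)\<leftarrow>xs. a * rsigma (q powi n) b)" by (rule fun_cong[OF xs])
        also have "\<dots> = (\<Sum>(a, b)\<leftarrow>xs. a * rsigma (q powi n) (Fract (P b) 1 * Fract 1 w))"
          using P by (intro arg_cong[of _ _ sum_list] map_cong) force+
        also have "\<dots> = (\<Sum>(a, b)\<leftarrow>xs. a * rsigma (q powi n) (Fract (P b) 1)) * rsigma (q powi n) (Fract 1 w)"
          by (induction xs) (auto simp del: mult_fract simp: rsigma_mult[OF qn] algebra_simps)
        finally have "poly PP (rconst (q powi n)) * rsigma (q powi n) (Fract 1 w) = 0"
          by (simp add: e(1)[OF qn])
        moreover have "rsigma (q powi n) (Fract 1 w) \<noteq> 0"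
        proof
          assume "rsigma (q powi n) (Fract 1 w) = 0"
          moreover have "rsigma (q powi n) (Fract 1 w) * rsigma (q powi n) (Fract w 1) = 1"
          proof -
            have "Fract 1 w * Fract w 1 = 1" using \<open>w \<noteq> 0\<close> by (simp add: One_fract_def eq_fract)
            then show ?thesis using qn by (simp only: rsigma_mult[OF qn, symmetric] rsigma_1[OF qn])
          qed
          ultimately show False by simp
        qed
        ultimately show "poly PP (rconst (q powi n)) = 0" by simp
      qed
      ultimately show False using infinite_powers[OF q] finite_subset by blast
    qed
    show ?thesis
    proof (rule ext)
      fix n :: int
      have qn: "q powi n \<noteq> 0" using q by simp
      have "g n = (\<Sum>(a, b)\<leftarrow>xs. a * rsigma (q powi n) (euler (Fract (P b) 1 * Fract 1 w)))"
        unfolding g using P by (intro arg_cong[of _ _ sum_list] map_cong) force+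
      also have "\<dots> = (\<Sum>(a, b)\<leftarrow>xs. a * rsigma (q powi n) (euler (Fract (P b) 1))) * rsigma (q powi n) (Fract 1 w)
          + (\<Sum>(a, b)\<leftarrow>xs. a * rsigma (q powi n) (Fract (P b) 1)) * rsigma (q powi n) (euler (Fract 1 w))"
        by (induction xs) (auto simp del: mult_fract simp: euler_mult rsigma_add[OF qn] rsigma_mult[OF qn] algebra_simps)
      also have "\<dots> = 0" using e[OF qn] \<open>PP = 0\<close> by simp
      finally show "g n = 0" .
    qed
  qed (simp add: g)
qed

lemma Qeuler_seq_base: "Qeuler_seq q (\<lambda>n. a * rsigma (q powi n) b) (\<lambda>n. a * rsigma (q powi n) (euler b))"
  using step[OF zero, of q a b] by simp

lemma Qeuler_seq_add:
  assumes "Qeuler_seq q f f'" "Qeuler_seq q g g'"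
  shows "Qeuler_seq q (\<lambda>n. f n + g n) (\<lambda>n. f' n + g' n)"
  using assms(1)
proof (induction rule: Qeuler_seq.induct)
  case (step f f' a b)
  then show ?case using Qeuler_seq.step[OF step.IH, of a b] by (simp add: add.assoc)
qed (use assms(2) in simp)

lemma Qeuler_seq_sum:
  "(\<And>i. i \<in> A \<Longrightarrow> Qeuler_seq q (f i) (f' i)) \<Longrightarrow>
   Qeuler_seq q (\<lambda>n. \<Sum>i\<in>A. f i n) (\<lambda>n. \<Sum>i\<in>A. f' i n)"
  by (induction A rule: infinite_finite_induct) (auto intro: zero Qeuler_seq_add)

lemma Qeuler_seq_mult1:
  assumes "q \<noteq> 0" "Qeuler_seq q g g'"
  shows "Qeuler_seq q (\<lambda>n. a * rsigma (q powi n) b * g n)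
    (\<lambda>n. a * rsigma (q powi n) (euler b) * g n + a * rsigma (q powi n) b * g' n)"
  using assms(2)
proof (induction rule: Qeuler_seq.induct)
  case zero
  show ?case using Qeuler_seq.zero by simp
next
  case (step f f' c d)
  have qn: "q powi n \<noteq> 0" for n using assms(1) by simp
  show ?case
    using Qeuler_seq.step[OF step.IH, of "a * c" "b * d"]
    by (simp add: euler_mult rsigma_add[OF qn] rsigma_mult[OF qn] algebra_simps)
qed

lemma Qeuler_seq_mult:
  assumes "q \<noteq> 0" "Qeuler_seq q f f'" "Qeuler_seq q g g'"
  shows "Qeuler_seq q (\<lambda>n. f n * g n) (\<lambda>n. f' n * g n + f n * g' n)"
  using assms(2)
proof (induction rule: Qeuler_seq.induct)
  case zero
  show ?case using Qeuler_seq.zero by simp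
next
  case (step f f' c d)
  show ?case
    using Qeuler_seq_add[OF Qeuler_seq_mult1[OF assms(1,3), of c d] step.IH]
    by (simp add: algebra_simps)
qed

lemma Qeuler_seq_shift:
  assumes "q \<noteq> 0" "Qeuler_seq q f f'"
  shows "Qeuler_seq q (\<lambda>n. f (n + k)) (\<lambda>n. f' (n + k))"
  using assms(2)
proof (induction rule: Qeuler_seq.induct)
  case (step f f' c d)
  have qn: "q powi n \<noteq> 0" for n using assms(1) by simp
  have "rsigma (q powi (n + k)) x = rsigma (q powi n) (rsigma (q powi k) x)" for n x
    using assms(1) by (simp add: rsigma_rsigma power_int_add)
  then show ?case
    using Qeuler_seq.step[OF step.IH, of c "rsigma (q powi k) d"]
    by (simp add: euler_rsigma[OF qn])
qed (rule Qeuler_seq.zero)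

lemma Qeuler_seq_const: "q \<noteq> 0 \<Longrightarrow> Qeuler_seq q (\<lambda>n. a) (\<lambda>n. 0)"
  using Qeuler_seq_base[of q a 1] by simp

lemma Qeuler_seq_scale: "q \<noteq> 0 \<Longrightarrow> Qeuler_seq q f f' \<Longrightarrow> Qeuler_seq q (\<lambda>n. a * f n) (\<lambda>n. a * f' n)"
  using Qeuler_seq_mult[OF _ Qeuler_seq_const, of q f f' a] by simp

text \<open>
  On \<open>\<sigma>\<^sup>n(b)\<close> the derivation \<open>d/dt\<close> is \<open>t\<^sup>-\<^sup>1\<close> times the Euler derivation, which commutes with \<open>\<sigma>\<^sup>n\<close>. So
  the derivative of a term \<open>a \<sigma>\<^sup>n(b)\<close> is a sum of two terms of the same kind.
\<close>

lemma Qeuler_seq_rderiv: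
  assumes "q \<noteq> 0" "Qeuler_seq q f f'"
  shows "Qeuler_seq q (\<lambda>n. rderiv (f n)) (\<lambda>n. rderiv (f' n))"
  using assms(2)
proof (induction rule: Qeuler_seq.induct)
  case zero
  show ?case using Qeuler_seq.zero by simp
next
  case (step f f' a b)
  have qn: "q powi n \<noteq> 0" for n using assms(1) by simp
  have e: "rderiv (a * rsigma (q powi n) x) = rderiv a * rsigma (q powi n) x + a / rt * rsigma (q powi n) (euler x)" for n x
    unfolding euler_rsigma[OF qn, symmetric] euler_def[of "rsigma (q powi n) x"] by (simp add: rderiv_mult)
  show ?case
    using Qeuler_seq.step[OF Qeuler_seq.step[OF step.IH, of "rderiv a" b], of "a / rt" "euler b"]
    by (simp add: rderiv_add e algebra_simps)
qed

lemma Qeuler_seq_unique: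
  assumes q: "q \<noteq> 0" "\<forall>n\<ge>1. q ^ n \<noteq> 1" and "Qeuler_seq q f g" "Qeuler_seq q f h"
  shows "g = h"
proof -
  have "Qeuler_seq q (\<lambda>n. 0) (\<lambda>n. g n + (-1) * h n)"
    using Qeuler_seq_add[OF assms(3) Qeuler_seq_scale[OF q(1) assms(4), of "-1"]] by simp
  from Qeuler_seq_0[OF q this] show ?thesis by (simp add: fun_eq_iff)
qed

section \<open>The Galois hull and its divided powers\<close>

locale nonroot =
  fixes q :: complex
  assumes q_nz: "q \<noteq> 0" and q_root: "\<forall>n\<ge>1. q ^ n \<noteq> 1"
begin

lemma q_ne_1: "q \<noteq> 1" using q_not_1[OF q_root] .
declare q_nz [simp]
lemma powi_nz: "q powi n \<noteq> 0" by simp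

lemma tcoeff_iota0: "tcoeff (iota0 q a) i n = rsigma (q powi n) (rtheta q i a)"
  by (simp add: iota0_def rsigma_int_eq[OF q_nz])

lemma iota0_add: "iota0 q (a + b) = iota0 q a + iota0 q b"
  by (rule tser_eqI) (simp add: tcoeff_iota0 rtheta_add[OF q_nz] rsigma_add)

lemma iota0_mult: "iota0 q (a * b) = iota0 q a * iota0 q b"
proof (rule tser_eqI)
  fix k n
  show "tcoeff (iota0 q (a * b)) k n = tcoeff (iota0 q a * iota0 q b) k n"
    by (simp add: tcoeff_iota0 tcoeff_mult rtheta_mult[OF q_nz q_root] rsigma_sum rsigma_mult
        rsigma_rsigma power_int_add del: of_nat_diff)
qed

lemma iota0_rconst: "iota0 q (rconst c) = tconst (rconst c)"
  by (rule tser_eqI) (simp add: tcoeff_iota0 tcoeff_tconst rtheta_rconst q_nz)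

lemma iota0_1: "iota0 q 1 = 1"
  using iota0_rconst[of 1] by simp

lemma iota0_rt: "iota0 q rt = tconst rt * tQ rconst q + tX"
  by (rule tser_eqI) (simp add: tcoeff_iota0 rtheta_rt[OF q_nz q_ne_1] tcoeff_tQ tcoeff_tX rsigma_rt)

lemma tmap_rderiv_iota0_rt: "tmap rderiv (iota0 q rt) = tQ rconst q"
  by (rule tser_eqI) (simp add: iota0_rt tcoeff_tQ tcoeff_tX rderiv_mult)

lemma hull_1 [simp]: "1 \<in> galois_hull q" using galois_hull.hull_const[of 1 q] by simp
lemma hull_0 [simp]: "0 \<in> galois_hull q" using galois_hull.hull_const[of 0 q] by simp
lemma hull_uminus: "x \<in> galois_hull q \<Longrightarrow> - x \<in> galois_hull q"
  using galois_hull.hull_mult[OF galois_hull.hull_const[of "-1"], of x q]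
  by (metis (no_types, lifting) mult_minus1 tcoeff_tconst_mult tcoeff_uminus tser_eqI)
lemma hull_diff: "x \<in> galois_hull q \<Longrightarrow> y \<in> galois_hull q \<Longrightarrow> x - y \<in> galois_hull q"
  using galois_hull.hull_add[OF _ hull_uminus] by fastforce
lemma hull_Q [simp]: "tQ rconst q \<in> galois_hull q"
  using galois_hull.hull_deriv[OF galois_hull.hull_iota0] tmap_rderiv_iota0_rt by metis
lemma hull_X [simp]: "tX \<in> galois_hull q"
  using hull_diff[OF galois_hull.hull_iota0[of q rt] galois_hull.hull_mult[OF galois_hull.hull_const[of rt] hull_Q]] by (simp add: iota0_rt)

text \<open>
  A deformation maps \<open>Q\<close> to \<open>eQ\<close> and \<open>\<iota>\<^sub>0(t)\<close> to \<open>(e(t+W)+f)Q+X\<close>, which turns this relation into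
  \<open>ef = q fe\<close>.
\<close>

lemma hull_commutator:
  defines "Y \<equiv> iota0 q rt" and "Q \<equiv> tmap rderiv (iota0 q rt)"
  shows "Q * Y - tconst (rconst q) * (Y * Q) = tconst (rconst (1 - q) * rt) * (Q * Q)"
  unfolding Y_def Q_def tmap_rderiv_iota0_rt
  by (rule tser_eqI)
    (auto simp: iota0_rt algebra_simps tcoeff_tQ_mult tcoeff_mult_tQ tcoeff_tQ tcoeff_tX rconst_diff
      power_int_add rconst_mult tcoeff_tconst)

definition Qeuler_rel :: "ratfun tser \<Rightarrow> ratfun tser \<Rightarrow> bool" where
  "Qeuler_rel x x' \<longleftrightarrow> (\<forall>i. Qeuler_seq q (tcoeff x i) (tcoeff x' i))"

definition Qeuler :: "ratfun tser \<Rightarrow> ratfun tser" where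
  "Qeuler x = (THE x'. Qeuler_rel x x')"

lemma Qeuler_eq: "Qeuler_rel x x' \<Longrightarrow> Qeuler x = x'"
  unfolding Qeuler_def
proof (rule the_equality)
  fix y assume "Qeuler_rel x x'" "Qeuler_rel x y"
  then have "tcoeff y i = tcoeff x' i" for i
    using Qeuler_seq_unique[OF q_nz q_root] unfolding Qeuler_rel_def by blast
  then show "y = x'" by (intro tser_eqI) simp
qed

lemma Qeuler_rel_add: "Qeuler_rel x x' \<Longrightarrow> Qeuler_rel y y' \<Longrightarrow> Qeuler_rel (x + y) (x' + y')"
  using Qeuler_seq_add unfolding Qeuler_rel_def plus_tser_def by simp

lemma Qeuler_rel_mult:
  assumes "Qeuler_rel x x'" "Qeuler_rel y y'"
  shows "Qeuler_rel (x * y) (x' * y + x * y')"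
  unfolding Qeuler_rel_def
proof
  fix k
  have "tcoeff (x * y) k = (\<lambda>n. \<Sum>i=0..k. tcoeff x i (n + int (k - i)) * tcoeff y (k - i) n)"
    "tcoeff (x' * y + x * y') k = (\<lambda>n. \<Sum>i=0..k. tcoeff x' i (n + int (k - i)) * tcoeff y (k - i) n
       + tcoeff x i (n + int (k - i)) * tcoeff y' (k - i) n)"
    by (simp_all add: fun_eq_iff tcoeff_mult sum.distrib)
  moreover have "Qeuler_seq q (\<lambda>n. \<Sum>i=0..k. tcoeff x i (n + int (k - i)) * tcoeff y (k - i) n)
    (\<lambda>n. \<Sum>i=0..k. tcoeff x' i (n + int (k - i)) * tcoeff y (k - i) n
       + tcoeff x i (n + int (k - i)) * tcoeff y' (k - i) n)"
    using assms unfolding Qeuler_rel_def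
    by (intro Qeuler_seq_sum Qeuler_seq_mult[OF q_nz] Qeuler_seq_shift[OF q_nz]) auto
  ultimately show "Qeuler_seq q (tcoeff (x * y) k) (tcoeff (x' * y + x * y') k)" by simp
qed

lemma Qeuler_rel_tconst: "Qeuler_rel (tconst a) 0"
proof -
  have "Qeuler_seq q (tcoeff (tconst a) i) (tcoeff 0 i)" for i
    using Qeuler_seq_const[OF q_nz, of "if i = 0 then a else 0"]
    by (cases "i = 0") (simp_all add: tconst_def zero_tser_def)
  then show ?thesis by (simp add: Qeuler_rel_def)
qed

lemma Qeuler_rel_iota0: "Qeuler_rel (iota0 q a) (tconst rt * tmap rderiv (iota0 q a))"
proof -
  have 1: "tcoeff (tconst rt * tmap rderiv (iota0 q a)) i = (\<lambda>n. 1 * rsigma (q powi n) (euler (rtheta q i a)))" for i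
    unfolding fun_eq_iff tcoeff_tconst_mult tcoeff_tmap tcoeff_iota0
    using euler_rsigma[OF powi_nz] by (simp only: euler_def mult_1) simp
  have 2: "tcoeff (iota0 q a) i = (\<lambda>n. 1 * rsigma (q powi n) (rtheta q i a))" for i
    by (simp add: fun_eq_iff tcoeff_iota0)
  show ?thesis
    unfolding Qeuler_rel_def 1 2 using Qeuler_seq_base by blast
qed

lemma Qeuler_rel_sigma: "Qeuler_rel x x' \<Longrightarrow> Qeuler_rel (tsigma rconst q x) (tsigma rconst q x')"
  unfolding Qeuler_rel_def tsigma_def
  by (simp add: Qeuler_seq_scale[OF q_nz] Qeuler_seq_shift[OF q_nz])

lemma Qeuler_rel_theta: "Qeuler_rel x x' \<Longrightarrow> Qeuler_rel (ttheta rconst q l x) (ttheta rconst q l x')"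
  unfolding Qeuler_rel_def ttheta_def
  by (simp add: Qeuler_seq_scale[OF q_nz])

lemma Qeuler_rel_deriv: "Qeuler_rel x x' \<Longrightarrow> Qeuler_rel (tmap rderiv x) (tmap rderiv x')"
  unfolding Qeuler_rel_def tmap_def
  by (simp add: Qeuler_seq_rderiv[OF q_nz])

text \<open>
  The hull is stable under \<open>Q d/dQ\<close> because on \<open>\<iota>\<^sub>0(L)\<close>, whose elements depend on \<open>t\<close> and \<open>Q\<close> only
  through \<open>tQ\<close> and \<open>X\<close>, it coincides with \<open>t d/dt\<close>.
\<close>

lemma Qeuler_hull_ex: "x \<in> galois_hull q \<Longrightarrow> \<exists>x'\<in>galois_hull q. Qeuler_rel x x'"
proof (induction rule: galois_hull.induct)
  case (hull_iota0 a)
  show ?case by (rule bexI, rule Qeuler_rel_iota0) (intro galois_hull.intros)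
next
  case (hull_const a)
  show ?case using Qeuler_rel_tconst hull_0 by blast
next
  case (hull_add x y)
  then show ?case using Qeuler_rel_add galois_hull.hull_add by blast
next
  case (hull_mult x y)
  then obtain x' y' where "x' \<in> galois_hull q" "Qeuler_rel x x'" "y' \<in> galois_hull q" "Qeuler_rel y y'" by blast
  then show ?case using Qeuler_rel_mult hull_mult.hyps
    by (intro bexI[of _ "x' * y + x * y'"]) (auto intro!: galois_hull.hull_add galois_hull.hull_mult)
next
  case (hull_sigma x)
  then show ?case using Qeuler_rel_sigma galois_hull.hull_sigma by blast
next
  case (hull_theta x l)
  then show ?case using Qeuler_rel_theta galois_hull.hull_theta by blast
next
  case (hull_deriv x)
  then show ?case using Qeuler_rel_deriv galois_hull.hull_deriv by blast
qed

lemma Qeuler_rel: "x \<in> galois_hull q \<Longrightarrow> Qeuler_rel x (Qeuler x)"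
  using Qeuler_hull_ex Qeuler_eq by metis
lemma Qeuler_hull [simp]: "x \<in> galois_hull q \<Longrightarrow> Qeuler x \<in> galois_hull q"
  using Qeuler_hull_ex Qeuler_eq by metis
lemma Qeuler_add: "x \<in> galois_hull q \<Longrightarrow> y \<in> galois_hull q \<Longrightarrow> Qeuler (x + y) = Qeuler x + Qeuler y"
  by (intro Qeuler_eq Qeuler_rel_add Qeuler_rel)
lemma Qeuler_mult: "x \<in> galois_hull q \<Longrightarrow> y \<in> galois_hull q \<Longrightarrow> Qeuler (x * y) = Qeuler x * y + x * Qeuler y"
  by (intro Qeuler_eq Qeuler_rel_mult Qeuler_rel)
lemma Qeuler_tconst [simp]: "Qeuler (tconst a) = 0"
  by (intro Qeuler_eq Qeuler_rel_tconst)
lemma Qeuler_0 [simp]: "Qeuler 0 = 0" using Qeuler_tconst[of 0] by simp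
lemma Qeuler_iota0: "Qeuler (iota0 q a) = tconst rt * tmap rderiv (iota0 q a)"
  by (intro Qeuler_eq Qeuler_rel_iota0)
lemma Qeuler_sigma: "x \<in> galois_hull q \<Longrightarrow> Qeuler (tsigma rconst q x) = tsigma rconst q (Qeuler x)"
  by (intro Qeuler_eq Qeuler_rel_sigma Qeuler_rel)
lemma Qeuler_theta: "x \<in> galois_hull q \<Longrightarrow> Qeuler (ttheta rconst q l x) = ttheta rconst q l (Qeuler x)"
  by (intro Qeuler_eq Qeuler_rel_theta Qeuler_rel)
lemma Qeuler_deriv: "x \<in> galois_hull q \<Longrightarrow> Qeuler (tmap rderiv x) = tmap rderiv (Qeuler x)"
  by (intro Qeuler_eq Qeuler_rel_deriv Qeuler_rel)
lemma Qeuler_scale: "x \<in> galois_hull q \<Longrightarrow> Qeuler (tconst a * x) = tconst a * Qeuler x"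
  by (simp add: Qeuler_mult galois_hull.hull_const)
lemma Qeuler_sum:
  "(\<And>i. i \<in> A \<Longrightarrow> f i \<in> galois_hull q) \<Longrightarrow> sum f A \<in> galois_hull q \<and> Qeuler (sum f A) = (\<Sum>i\<in>A. Qeuler (f i))"
  by (induction A rule: infinite_finite_induct) (simp_all add: Qeuler_add galois_hull.hull_add)
lemma Qeuler_Q: "Qeuler (tQ rconst q) = tQ rconst q"
proof -
  have "Qeuler (tQ rconst q) = tmap rderiv (Qeuler (iota0 q rt))"
    by (simp add: Qeuler_deriv galois_hull.hull_iota0 flip: tmap_rderiv_iota0_rt)
  also have "\<dots> = tmap rderiv (tconst rt * tQ rconst q)"
    by (simp add: Qeuler_iota0 tmap_rderiv_iota0_rt)
  also have "\<dots> = tQ rconst q"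
    by (rule tser_eqI) (simp add: tcoeff_tQ rderiv_mult)
  finally show ?thesis .
qed

text \<open>The divided powers \<open>Q\<^sup>k/k! (d/dQ)\<^sup>k\<close>, which are the binomial coefficients of \<open>Q d/dQ\<close>.\<close>

primrec Qdiv :: "nat \<Rightarrow> ratfun tser \<Rightarrow> ratfun tser" where
  "Qdiv 0 x = x"
| "Qdiv (Suc k) x = tconst (1 / of_nat (Suc k)) * (Qeuler (Qdiv k x) - tconst (of_nat k) * Qdiv k x)"

lemma Qdiv_hull [simp]: "x \<in> galois_hull q \<Longrightarrow> Qdiv k x \<in> galois_hull q"
  by (induction k) (simp_all add: galois_hull.hull_mult hull_diff galois_hull.hull_const)

lemma Qdiv_step: "Qeuler (Qdiv k x) = tconst (of_nat (Suc k)) * Qdiv (Suc k) x + tconst (of_nat k) * Qdiv k x"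
proof -
  have "tconst (of_nat (Suc k)) * Qdiv (Suc k) x
      = tconst (of_nat (Suc k) * (1 / of_nat (Suc k))) * (Qeuler (Qdiv k x) - tconst (of_nat k) * Qdiv k x)"
    unfolding Qdiv.simps tconst_mult mult.assoc ..
  also have "of_nat (Suc k) * (1 / of_nat (Suc k)) = (1 :: ratfun)"
    using ratfun_of_nat_Suc_nonzero by (simp del: of_nat_Suc)
  finally show ?thesis by simp
qed

lemma Qdiv_add: "x \<in> galois_hull q \<Longrightarrow> y \<in> galois_hull q \<Longrightarrow> Qdiv k (x + y) = Qdiv k x + Qdiv k y"
  by (induction k) (simp_all add: Qeuler_add algebra_simps)

lemma Qdiv_tconst: "Qdiv (Suc k) (tconst a) = 0"
  by (induction k) simp_all

lemma Qdiv_scale: "x \<in> galois_hull q \<Longrightarrow> Qdiv k (tconst a * x) = tconst a * Qdiv k x"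
proof (induction k)
  case (Suc k)
  have "tconst b * (tconst a * z) = tconst a * (tconst b * z)" for b and z :: "ratfun tser"
    by (simp add: mult.assoc[symmetric] flip: tconst_mult) (simp add: mult.commute)
  with Suc show ?case by (simp add: Qeuler_scale right_diff_distrib)
qed simp

lemma Qdiv_sigma: "x \<in> galois_hull q \<Longrightarrow> Qdiv k (tsigma rconst q x) = tsigma rconst q (Qdiv k x)"
proof (induction k)
  case (Suc k)
  then show ?case by (simp add: Qeuler_sigma) (rule tser_eqI, simp add: algebra_simps)
qed simp

lemma Qdiv_theta: "x \<in> galois_hull q \<Longrightarrow> Qdiv k (ttheta rconst q l x) = ttheta rconst q l (Qdiv k x)"
proof (induction k)
  case (Suc k)
  then show ?case by (simp add: Qeuler_theta) (rule tser_eqI, simp add: algebra_simps)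
qed simp

lemma Qdiv_deriv: "x \<in> galois_hull q \<Longrightarrow> Qdiv k (tmap rderiv x) = tmap rderiv (Qdiv k x)"
proof (induction k)
  case (Suc k)
  have c: "rderiv (1 / of_nat (Suc k)) = 0"
    using rderiv_rconst[of "1 / of_nat (Suc k)"] by (simp only: rconst_divide rconst_of_nat rconst_1)
  have m: "tmap rderiv (tconst a * z) = tconst a * tmap rderiv z" if "rderiv a = 0" for a z
    by (rule tser_eqI) (simp add: rderiv_mult that)
  have d: "tmap rderiv (y - z) = tmap rderiv y - tmap rderiv z" for y z
    by (rule tser_eqI) (simp add: rderiv_minus)
  show ?case
    using Suc unfolding Qdiv.simps m[OF c] d m[OF rderiv_of_nat] by (simp add: Qeuler_deriv)
qed simp

text \<open>
  Applying \<open>Q d/dQ - k\<close> to the rule for \<open>k\<close>, the product with indices \<open>i\<close> and \<open>k+1-i\<close> occurs with the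
  coefficients \<open>i\<close> and \<open>k+1-i\<close>, whose sum \<open>k+1\<close> is the denominator in the next divided power.
\<close>

lemma Qdiv_mult:
  assumes x: "x \<in> galois_hull q" and y: "y \<in> galois_hull q"
  shows "Qdiv k (x * y) = (\<Sum>i=0..k. Qdiv i x * Qdiv (k - i) y)"
proof (induction k)
  case (Suc k)
  define T where "T i = Qdiv i x * Qdiv (Suc k - i) y" for i
  have comm: "f * (tconst a * g) = tconst a * (f * g)" for a and f g :: "ratfun tser"
    by (metis mult.assoc tconst_commute)
  have "Qeuler (Qdiv k (x * y)) - tconst (of_nat k) * Qdiv k (x * y)
      = (\<Sum>i=0..k. Qeuler (Qdiv i x * Qdiv (k - i) y) - tconst (of_nat k) * (Qdiv i x * Qdiv (k - i) y))"
    using Qeuler_sum[of "{0..k}" "\<lambda>i. Qdiv i x * Qdiv (k - i) y"] x y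
    by (simp add: Suc galois_hull.hull_mult sum_subtractf sum_distrib_left)
  also have "\<dots> = (\<Sum>i=0..k. tconst (of_nat (Suc i)) * T (Suc i) + tconst (of_nat (Suc k - i)) * T i)"
  proof (rule sum.cong)
    fix i assume "i \<in> {0..k}"
    then have i: "Suc k - i = Suc (k - i)" and k: "of_nat k = (of_nat i + of_nat (k - i) :: ratfun)" by auto
    show "Qeuler (Qdiv i x * Qdiv (k - i) y) - tconst (of_nat k) * (Qdiv i x * Qdiv (k - i) y)
        = tconst (of_nat (Suc i)) * T (Suc i) + tconst (of_nat (Suc k - i)) * T i"
      unfolding T_def i k Qeuler_mult[OF Qdiv_hull[OF x] Qdiv_hull[OF y]] Qdiv_step tconst_add diff_Suc_Suc
      by (simp only: distrib_left distrib_right comm mult.assoc) simp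
  qed simp
  also have "\<dots> = (\<Sum>i=0..k. tconst (of_nat (Suc i)) * T (Suc i)) + (\<Sum>i=0..k. tconst (of_nat (Suc k - i)) * T i)"
    by (rule sum.distrib)
  also have "(\<Sum>i=0..k. tconst (of_nat (Suc i)) * T (Suc i)) = (\<Sum>i=0..Suc k. tconst (of_nat i) * T i)"
    by (subst sum.atLeast0_atMost_Suc_shift) simp
  also have "(\<Sum>i=0..k. tconst (of_nat (Suc k - i)) * T i) = (\<Sum>i=0..Suc k. tconst (of_nat (Suc k - i)) * T i)"
    by simp
  also have "(\<Sum>i=0..Suc k. tconst (of_nat i) * T i) + \<dots> = (\<Sum>i=0..Suc k. tconst (of_nat (Suc k)) * T i)"
  proof -
    have "tconst (of_nat i) * T i + tconst (of_nat (Suc k - i)) * T i = tconst (of_nat (Suc k)) * T i"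
      if "i \<le> Suc k" for i
      using that by (simp flip: distrib_right tconst_add of_nat_add del: of_nat_Suc)
    then show ?thesis by (simp add: sum.distrib[symmetric] del: sum.atLeast0_atMost_Suc of_nat_Suc)
  qed
  finally have "Qdiv (Suc k) (x * y) = tconst (1 / of_nat (Suc k)) * (tconst (of_nat (Suc k)) * (\<Sum>i=0..Suc k. T i))"
    by (simp only: Qdiv.simps sum_distrib_left)
  also have "\<dots> = (\<Sum>i=0..Suc k. T i)"
    using ratfun_of_nat_Suc_nonzero
    by (simp add: mult.assoc[symmetric] del: sum.atLeast0_atMost_Suc of_nat_Suc flip: tconst_mult)
  finally show ?case by (simp only: T_def)
qed simp

text \<open>
  In \<open>tQ + X\<close> only the first term depends on \<open>Q\<close>, and it is linear in \<open>Q\<close>.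
\<close>

lemma Qdiv_iota0_rt:
  "Qdiv (Suc k) (iota0 q rt) = (if k = 0 then tconst rt * tQ rconst q else 0)"
proof (induction k)
  case 0
  show ?case by (simp add: Qeuler_iota0 tmap_rderiv_iota0_rt)
next
  case (Suc k)
  show ?case
    by (subst Qdiv.simps(2), subst (1 2) Suc) (simp add: Qeuler_scale Qeuler_Q)
qed

end

section \<open>Nilpotent and unipotent elements\<close>

lemma ring_type_ring: "ring (type_ring :: 'a::{ring,monoid_mult} ring)"
proof (rule ringI)
  show "abelian_group (type_ring :: 'a ring)"
    by (rule abelian_groupI) (auto simp: algebra_simps intro: exI[of _ "- _"])
  show "Group.monoid (type_ring :: 'a ring)"
    by (rule monoidI) (auto simp: mult.assoc)
qed (auto simp: algebra_simps)

lemma a_inv_type_ring [simp]: "a_inv (type_ring :: 'a::{ring,monoid_mult} ring) x = - x"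
proof -
  interpret ring "type_ring :: 'a ring" by (rule ring_type_ring)
  show ?thesis by (rule minus_equality) auto
qed

lemma nilpotent_0: "nilpotent 0"
  unfolding nilpotent_def by (rule exI[of _ 1]) simp

lemma commuting_power_mult:
  fixes a b :: "'a::monoid_mult"
  assumes "a * b = b * a" shows "(a * b) ^ n = a ^ n * b ^ n"
proof (induction n)
  case (Suc n)
  have "a ^ n * b = b * a ^ n" using power_commuting_commutes[OF assms] by simp
  then show ?case using Suc by (simp add: power_commutes mult.assoc) (metis mult.assoc power_commutes)
qed simp

lemma nilpotent_mult:
  assumes "nilpotent a" "a * b = b * a" shows "nilpotent (a * b)"
  using assms unfolding nilpotent_def by (metis commuting_power_mult mult_zero_left)

lemma nilpotent_minus: "nilpotent a \<Longrightarrow> nilpotent (- a)"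
  using nilpotent_mult[of a "- 1"] by simp

text \<open>
  The inverse is the geometric series in \<open>1 - e\<close>.
\<close>

lemma unipotent_inverse:
  fixes e :: "'a::{ring,monoid_mult}"
  assumes "nilpotent (e - 1)"
  obtains e' where "e * e' = 1" "e' * e = 1" "nilpotent (e' - 1)"
proof -
  define y where "y = 1 - e"
  have "nilpotent y" using nilpotent_minus[OF assms] by (simp add: y_def)
  then obtain M where M: "y ^ M = 0" by (auto simp: nilpotent_def)
  define e' where "e' = (\<Sum>i<M. y ^ i)"
  have "(1 - y) * (\<Sum>i<m. y ^ i) = 1 - y ^ m" for m
  proof (induction m)
    case (Suc m)
    have "(1 - y) * (\<Sum>i<Suc m. y ^ i) = (1 - y) * (\<Sum>i<m. y ^ i) + (1 - y) * y ^ m"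
      by (simp add: distrib_left)
    also have "\<dots> = 1 - y ^ Suc m"
      unfolding Suc by (simp add: left_diff_distrib)
    finally show ?case .
  qed simp
  then have 1: "e * e' = 1" using M by (metis e'_def diff_zero y_def add_diff_cancel_left' diff_add_cancel)
  have "(\<Sum>i<m. y ^ i) * (1 - y) = 1 - y ^ m" for m
  proof (induction m)
    case (Suc m)
    have "(\<Sum>i<Suc m. y ^ i) * (1 - y) = (\<Sum>i<m. y ^ i) * (1 - y) + y ^ m * (1 - y)"
      by (simp add: distrib_right)
    also have "\<dots> = 1 - y ^ Suc m"
      unfolding Suc by (simp add: right_diff_distrib power_commutes)
    finally show ?case .
  qed simp
  then have 2: "e' * e = 1" using M by (metis e'_def diff_zero y_def add_diff_cancel_left' diff_add_cancel)
  have "e' - 1 = - ((e - 1) * e')" using 1 by (simp add: algebra_simps)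
  moreover have "nilpotent ((e - 1) * e')"
    using assms 1 2 by (intro nilpotent_mult) (auto simp: algebra_simps)
  ultimately have "nilpotent (e' - 1)" using nilpotent_minus by metis
  then show thesis using that 1 2 by blast
qed

text \<open>
  Modulo the right multiples of \<open>x\<close> the powers of \<open>x + y\<close> are those of \<open>y\<close>, so some power of \<open>x + y\<close> is
  \<open>xc\<close>, with \<open>c\<close> commuting with \<open>x\<close>.
\<close>

lemma nilpotent_add:
  fixes x y :: "'a::{ring,monoid_mult}"
  assumes "nilpotent x" "nilpotent y" and xy: "x * y = y * x"
  shows "nilpotent (x + y)"
proof -
  obtain M where M: "x ^ M = 0" using assms(1) by (auto simp: nilpotent_def)
  obtain N where N: "y ^ N = 0" using assms(2) by (auto simp: nilpotent_def)
  define z where "z = x + y"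
  have xz: "x * z = z * x" by (simp add: z_def distrib_left distrib_right xy)
  have "\<exists>c. z ^ k = x * c + y ^ k \<and> c * x = x * c" for k
  proof (induction k)
    case 0
    show ?case by (rule exI[of _ 0]) simp
  next
    case (Suc k)
    then obtain c where c: "z ^ k = x * c + y ^ k" "c * x = x * c" by blast
    have "z ^ Suc k = x * z ^ k + y * z ^ k" by (simp add: z_def distrib_right)
    also have "y * z ^ k = x * (y * c) + y ^ Suc k"
      unfolding c(1) by (simp add: distrib_left mult.assoc[symmetric] xy)
    finally have 1: "z ^ Suc k = x * (z ^ k + y * c) + y ^ Suc k" by (simp add: algebra_simps)
    have "z ^ k * x = x * z ^ k" using power_commuting_commutes[of z x k] xz by simp
    moreover have "y * c * x = x * (y * c)" by (metis c(2) xy mult.assoc)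
    ultimately have "(z ^ k + y * c) * x = x * (z ^ k + y * c)" by (simp add: distrib_left distrib_right)
    with 1 show ?case by blast
  qed
  from this[of N] obtain c where c: "z ^ N = x * c" "c * x = x * c" using N by auto
  have "(z ^ N) ^ M = x ^ M * c ^ M" unfolding c(1) using c(2) by (intro commuting_power_mult) simp
  then have "z ^ (N * M) = 0" using M by (simp add: power_mult)
  then show ?thesis unfolding z_def nilpotent_def by blast
qed

text \<open>
  Write \<open>eg - 1 = (e-1)g + (g-1)\<close>, a sum of commuting nilpotent elements.
\<close>

lemma unipotent_mult:
  fixes e g :: "'a::{ring,monoid_mult}"
  assumes "nilpotent (e - 1)" "nilpotent (g - 1)" "e * g = g * e"
  shows "nilpotent (e * g - 1)"
proof -
  have "nilpotent ((e - 1) * g)"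
    using assms by (intro nilpotent_mult) (simp_all add: algebra_simps)
  moreover have "(e - 1) * g * (g - 1) = (g - 1) * ((e - 1) * g)"
    using assms(3) by (simp add: algebra_simps)
  ultimately have "nilpotent ((e - 1) * g + (g - 1))"
    using assms(2) by (blast intro: nilpotent_add)
  then show ?thesis by (simp add: algebra_simps)
qed

lemma nilpotent_bound: "nilpotent \<epsilon> \<Longrightarrow> \<exists>N\<ge>2. \<epsilon> ^ N = 0"
proof -
  assume "nilpotent \<epsilon>"
  then obtain M where "\<epsilon> ^ M = 0" by (auto simp: nilpotent_def)
  then have "\<epsilon> ^ (2 + M) = 0" by (simp add: power_add)
  then show ?thesis by (intro exI[of _ "2 + M"]) simp
qed

lemma fps_central_mult:
  fixes f x :: "'a::{ring,monoid_mult} fps"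
  assumes "\<And>i j. fps_nth x i * fps_nth f j = fps_nth f j * fps_nth x i"
  shows "x * f = f * x"
proof (rule fps_ext)
  fix n
  have "fps_nth (x * f) n = (\<Sum>i=0..n. fps_nth x i * fps_nth f (n - i))" by (simp add: fps_mult_nth)
  also have "\<dots> = (\<Sum>i=0..n. fps_nth x (n - i) * fps_nth f i)" by (rule fps_mult_commute_lemma)
  also have "\<dots> = fps_nth (f * x) n" by (simp add: fps_mult_nth assms)
  finally show "fps_nth (x * f) n = fps_nth (f * x) n" .
qed

lemma sum_square_antidiagonals:
  fixes F :: "nat \<Rightarrow> nat \<Rightarrow> 'b::comm_monoid_add"
  assumes "\<And>i j. N \<le> i + j \<Longrightarrow> F i j = 0"
  shows "(\<Sum>i<N. \<Sum>j<N. F i j) = (\<Sum>k<N. \<Sum>i=0..k. F i (k - i))"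
proof -
  have "(\<Sum>i<N. \<Sum>j<N. F i j) = (\<Sum>(i,j)\<in>{..<N}\<times>{..<N}. F i j)"
    by (rule sum.cartesian_product)
  also have "\<dots> = (\<Sum>(i,j)\<in>{(i,j). i + j < N}. F i j)"
    by (rule sum.mono_neutral_right) (use assms in \<open>force+\<close>)
  also have "\<dots> = (\<Sum>k<N. \<Sum>i\<le>k. F i (k - i))" by (rule sum.triangle_reindex)
  finally show ?thesis by (simp add: atMost_atLeast0)
qed

section \<open>Morphisms from the Galois hull\<close>

lemma (in nonroot) ring_hull_ring: "ring (hull_ring q)"
proof (rule ringI)
  show "abelian_group (hull_ring q)"
    by (rule abelian_groupI)
      (auto simp: hull_ring_def algebra_simps galois_hull.hull_add intro!: bexI[of _ "- _"] hull_uminus)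
  show "Group.monoid (hull_ring q)"
    by (rule monoidI) (auto simp: hull_ring_def mult.assoc galois_hull.hull_mult)
qed (auto simp: hull_ring_def algebra_simps)

text \<open>
  The hull is generated, under its operators, by the constants and \<open>\<iota>\<^sub>0(t)\<close>: an element \<open>\<iota>\<^sub>0(a/b)\<close> is
  determined by \<open>\<iota>\<^sub>0(a)\<close> and the inverse \<open>\<iota>\<^sub>0(1/b)\<close> of \<open>\<iota>\<^sub>0(b)\<close>.
\<close>

lemma (in nonroot) hull_hom_unique:
  assumes M: "ring M"
    and h: "h \<in> Ring.ring_hom (hull_ring q) M" and h': "h' \<in> Ring.ring_hom (hull_ring q) M"
    and const: "\<And>a. h (tconst a) = h' (tconst a)"
    and Y: "h (iota0 q rt) = h' (iota0 q rt)"
    and sg: "\<And>x. x \<in> galois_hull q \<Longrightarrow> h (tsigma rconst q x) = S (h x)"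
      "\<And>x. x \<in> galois_hull q \<Longrightarrow> h' (tsigma rconst q x) = S (h' x)"
    and th: "\<And>x l. x \<in> galois_hull q \<Longrightarrow> h (ttheta rconst q l x) = T l (h x)"
      "\<And>x l. x \<in> galois_hull q \<Longrightarrow> h' (ttheta rconst q l x) = T l (h' x)"
    and dr: "\<And>x. x \<in> galois_hull q \<Longrightarrow> h (tmap rderiv x) = D (h x)"
      "\<And>x. x \<in> galois_hull q \<Longrightarrow> h' (tmap rderiv x) = D (h' x)"
    and x: "x \<in> galois_hull q"
  shows "h x = h' x"
proof -
  interpret M: ring M by (rule M)
  have closed: "g x \<in> carrier M" if "g \<in> Ring.ring_hom (hull_ring q) M" "x \<in> galois_hull q" for g x
    using ring_hom_closed[OF that(1)] that(2) by (simp add: hull_ring_def)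
  have hom: "g (x * y) = g x \<otimes>\<^bsub>M\<^esub> g y" "g (x + y) = g x \<oplus>\<^bsub>M\<^esub> g y"
    if "g \<in> Ring.ring_hom (hull_ring q) M" "x \<in> galois_hull q" "y \<in> galois_hull q" for g x y
    using ring_hom_mult[OF that(1)] ring_hom_add[OF that(1)] that(2,3)
    by (simp_all add: hull_ring_def)
  have one: "h 1 = \<one>\<^bsub>M\<^esub>" "h' 1 = \<one>\<^bsub>M\<^esub>"
    using ring_hom_one[OF h] ring_hom_one[OF h'] by (simp_all add: hull_ring_def)
  note hI = galois_hull.intros
  have poly: "h (iota0 q (Fract p 1)) = h' (iota0 q (Fract p 1))" for p
  proof (induction p)
    case 0
    show ?case using const[of 0] iota0_rconst[of 0] by (simp add: fract_collapse)
  next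
    case (pCons a p)
    show ?case
      using pCons const[of "rconst a"] Y
      by (simp add: Fract_pCons iota0_add iota0_mult iota0_rconst hom[OF h] hom[OF h'] hI)
  qed
  show ?thesis using x
  proof (induction rule: galois_hull.induct)
    case (hull_iota0 a)
    obtain p r where a: "a = Fract p r" "r \<noteq> 0" by (cases a rule: Fract_cases)
    define y z where "y = iota0 q (Fract r 1)" and "z = iota0 q (Fract 1 r)"
    have yz: "y \<in> galois_hull q" "z \<in> galois_hull q" by (simp_all add: y_def z_def hI)
    have 1: "Fract r 1 * Fract 1 r = 1" "Fract 1 r * Fract r 1 = 1"
      using a(2) by (simp_all add: One_fract_def eq_fract)
    have "y * z = 1" "z * y = 1"
      unfolding y_def z_def iota0_mult[symmetric] 1 by (rule iota0_1)+
    then have "h z \<otimes>\<^bsub>M\<^esub> h y = \<one>\<^bsub>M\<^esub>" "h' y \<otimes>\<^bsub>M\<^esub> h' z = \<one>\<^bsub>M\<^esub>"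
      using yz one by (simp_all flip: hom(1)[OF h] hom(1)[OF h'])
    moreover have "h y = h' y" unfolding y_def by (rule poly)
    ultimately have "h z = h' z"
      using M.inv_unique[of "h z" "h y" "h' z"] yz closed[OF h] closed[OF h'] by metis
    moreover have "a = Fract p 1 * Fract 1 r" by (simp add: a)
    ultimately show ?case
      using poly[of p] by (simp del: mult_fract add: iota0_mult hom[OF h] hom[OF h'] hI yz flip: z_def)
  next
    case (hull_sigma x)
    then show ?case by (simp only: sg)
  next
    case (hull_theta x l)
    then show ?case by (simp only: th)
  next
    case (hull_deriv x)
    then show ?case by (simp only: dr)
  qed (simp_all only: const hom[OF h] hom[OF h'])
qed

section \<open>Infinitesimal deformations\<close>

locale L_alg = nonroot q for q +
  fixes s :: "ratfun \<Rightarrow> 'a::{ring,monoid_mult}"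
  assumes L_algebra: "L_algebra s"
begin

lemma s_1 [simp]: "s 1 = 1" and s_add: "s (a + b) = s a + s b" and s_mult: "s (a * b) = s a * s b"
  and s_comm: "s a * x = x * s a"
  using L_algebra unfolding L_algebra_def by blast+
lemma s_0 [simp]: "s 0 = 0" using s_add[of 0 0] by simp
lemma s_minus: "s (a - b) = s a - s b" using s_add[of "a - b" b] by (simp add: eq_diff_eq)
lemma s_left_comm: "x * (s a * y) = s a * (x * y)"
  by (metis mult.assoc s_comm)

lemma s_inverse: "a \<noteq> 0 \<Longrightarrow> s (1 / a) * s a = 1"
  by (simp flip: s_mult)

lemma s_cancel: "a \<noteq> 0 \<Longrightarrow> s a * x = s a * y \<Longrightarrow> x = y"
  by (metis mult.assoc mult_1 s_inverse)

lemma nth_wderiv: "fps_nth (wderiv s f) n = s (of_nat (Suc n)) * fps_nth f (Suc n)"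
  by (simp add: wderiv_def)

lemma wderiv_add: "wderiv s (f + g) = wderiv s f + wderiv s g"
  by (rule fps_ext) (simp add: nth_wderiv distrib_left del: of_nat_Suc)

lemma wderiv_mult: "wderiv s (f * g) = wderiv s f * g + f * wderiv s g"
proof (rule fps_ext)
  fix n
  define F where "F i = fps_nth f i * fps_nth g (Suc n - i)" for i
  have "fps_nth (wderiv s f * g) n = (\<Sum>i=0..n. s (of_nat (Suc i)) * F (Suc i))"
    by (simp add: fps_mult_nth nth_wderiv F_def mult.assoc del: of_nat_Suc)
  also have "\<dots> = (\<Sum>i=0..Suc n. s (of_nat i) * F i)"
    by (subst sum.atLeast0_atMost_Suc_shift) simp
  finally have 1: "fps_nth (wderiv s f * g) n = (\<Sum>i=0..Suc n. s (of_nat i) * F i)" .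
  have "fps_nth (f * wderiv s g) n = (\<Sum>i=0..n. s (of_nat (Suc n - i)) * F i)"
    by (auto simp add: fps_mult_nth nth_wderiv F_def s_left_comm Suc_diff_le simp del: of_nat_Suc intro!: sum.cong)
  also have "\<dots> = (\<Sum>i=0..Suc n. s (of_nat (Suc n - i)) * F i)" by simp
  finally have 2: "fps_nth (f * wderiv s g) n = (\<Sum>i=0..Suc n. s (of_nat (Suc n - i)) * F i)" .
  have "s (of_nat i) * F i + s (of_nat (Suc n - i)) * F i = s (of_nat (Suc n)) * F i" if "i \<le> Suc n" for i
    using that by (simp flip: distrib_right s_add of_nat_add del: of_nat_Suc)
  then have "(\<Sum>i=0..Suc n. s (of_nat (Suc n)) * F i)
      = (\<Sum>i=0..Suc n. s (of_nat i) * F i + s (of_nat (Suc n - i)) * F i)"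
    by (intro sum.cong) simp_all
  moreover have "fps_nth (wderiv s (f * g)) n = (\<Sum>i=0..Suc n. s (of_nat (Suc n)) * F i)"
    by (simp only: nth_wderiv fps_mult_nth F_def sum_distrib_left)
  ultimately show "fps_nth (wderiv s (f * g)) n = fps_nth (wderiv s f * g + f * wderiv s g) n"
    unfolding fps_add_nth 1 2 by (simp only: sum.distrib)
qed

lemma wderiv_const [simp]: "wderiv s (fps_const a) = 0"
  by (rule fps_ext) (simp add: nth_wderiv)

lemma nth_taylor: "fps_nth (taylor s a) n = s ((rderiv ^^ n) a / of_nat (fact n))"
  by (simp add: taylor_def)

lemma taylor_add: "taylor s (a + b) = taylor s a + taylor s b"
  by (rule fps_ext) (simp add: nth_taylor rderiv_pow_add add_divide_distrib s_add)

lemma taylor_0 [simp]: "taylor s 0 = 0" using taylor_add[of 0 0] by simp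

lemma wderiv_taylor: "wderiv s (taylor s a) = taylor s (rderiv a)"
proof (rule fps_ext)
  fix n
  have "of_nat (Suc n) * ((rderiv ^^ Suc n) a / of_nat (fact (Suc n))) = (rderiv ^^ Suc n) a / of_nat (fact n)"
  proof -
    have "of_nat (fact (Suc n)) = of_nat (Suc n) * (of_nat (fact n) :: ratfun)"
      by (simp only: fact_Suc of_nat_mult of_nat_id)
    then show ?thesis
      using ratfun_of_nat_Suc_nonzero[of n] by (simp del: of_nat_Suc funpow.simps fact_Suc)
  qed
  then show "fps_nth (wderiv s (taylor s a)) n = fps_nth (taylor s (rderiv a)) n"
    by (simp add: nth_wderiv nth_taylor funpow_swap1 del: of_nat_Suc fact_Suc flip: s_mult)
qed

text \<open>Both sides have the same constant term, and the derivatives agree by induction.\<close>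

lemma taylor_mult: "taylor s (a * b) = taylor s a * taylor s b"
proof (rule fps_ext)
  fix n
  show "fps_nth (taylor s (a * b)) n = fps_nth (taylor s a * taylor s b) n"
  proof (induction n arbitrary: a b)
    case 0
    show ?case by (simp add: nth_taylor fps_mult_nth s_mult)
  next
    case (Suc n)
    have "s (of_nat (Suc n)) * fps_nth (taylor s (a * b)) (Suc n)
        = fps_nth (taylor s (rderiv a * b)) n + fps_nth (taylor s (a * rderiv b)) n"
      by (simp only: nth_wderiv[symmetric] wderiv_taylor rderiv_mult taylor_add fps_add_nth)
    also have "\<dots> = fps_nth (wderiv s (taylor s a * taylor s b)) n"
      by (simp only: Suc wderiv_mult wderiv_taylor fps_add_nth)
    finally have "s (of_nat (Suc n)) * fps_nth (taylor s (a * b)) (Suc n)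
        = s (of_nat (Suc n)) * fps_nth (taylor s a * taylor s b) (Suc n)" by (simp only: nth_wderiv)
    then show ?case by (rule s_cancel[OF ratfun_of_nat_Suc_nonzero])
  qed
qed

lemma taylor_rconst: "taylor s (rconst c) = wconst s c"
proof (rule fps_ext)
  fix n
  have "(rderiv ^^ Suc m) (rconst c) = 0" for m by (induction m) simp_all
  then show "fps_nth (taylor s (rconst c)) n = fps_nth (wconst s c) n"
    by (cases n) (simp_all add: nth_taylor wconst_def del: funpow.simps(2))
qed

lemma taylor_1 [simp]: "taylor s 1 = 1"
  using taylor_rconst[of 1] by (simp add: wconst_def)

lemma taylor_rt: "taylor s rt = fps_const (s rt) + fps_X"
proof (rule fps_ext)
  fix n
  have "(rderiv ^^ Suc (Suc m)) rt = 0" for m by (induction m) simp_all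
  moreover have "n = 0 \<or> n = 1 \<or> (\<exists>m. n = Suc (Suc m))" by presburger
  ultimately show "fps_nth (taylor s rt) n = fps_nth (fps_const (s rt) + fps_X) n"
    by (auto simp: nth_taylor fps_X_def simp del: funpow.simps(2)) simp
qed

lemma taylor_central: "taylor s a * f = f * taylor s a"
  by (rule fps_central_mult) (simp add: nth_taylor s_comm)

lemma taylor_left_comm: "f * (taylor s a * g) = taylor s a * (f * g)"
  by (metis mult.assoc taylor_central)

lemma wconst_mult: "wconst s (a * b) = wconst s a * wconst s b"
  by (simp flip: taylor_rconst add: rconst_mult taylor_mult)
lemma wconst_central: "wconst s c * f = f * wconst s c"
  by (simp flip: taylor_rconst add: taylor_central)
lemma wconst_cancel: "c \<noteq> 0 \<Longrightarrow> wconst s c * f = wconst s c * g \<Longrightarrow> f = g"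
  by (rule fps_ext) (metis wconst_def fps_mult_left_const_nth s_cancel rconst_eq_0_iff)

lemma tcoeff_can_iota [simp]: "tcoeff (can_iota s x) i n = taylor s (tcoeff x i n)"
  by (simp add: can_iota_def)

lemma can_iota_add: "can_iota s (x + y) = can_iota s x + can_iota s y"
  by (rule tser_eqI) (simp add: taylor_add)
lemma can_iota_mult: "can_iota s (x * y) = can_iota s x * can_iota s y"
  unfolding can_iota_def by (rule tmap_hom) (simp_all add: taylor_add taylor_mult)
lemma can_iota_tconst: "can_iota s (tconst a) = tconst (taylor s a)"
  by (rule tser_eqI) (simp add: tcoeff_tconst)
lemma can_iota_1 [simp]: "can_iota s 1 = 1" using can_iota_tconst[of 1] by simp
lemma can_iota_0 [simp]: "can_iota s 0 = 0" using can_iota_tconst[of 0] by simp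
lemma can_iota_sum: "can_iota s (sum f A) = (\<Sum>i\<in>A. can_iota s (f i))"
  by (rule additive_sum) (rule can_iota_add)
lemma can_iota_Q: "can_iota s (tQ rconst q) = tQ (wconst s) q"
  by (rule tser_eqI) (simp add: tcoeff_tQ taylor_rconst)
lemma can_iota_X: "can_iota s tX = tX"
  by (rule tser_eqI) (simp add: tcoeff_tX)
lemma can_iota_sigma: "can_iota s (tsigma rconst q x) = tsigma (wconst s) q (can_iota s x)"
  by (rule tser_eqI) (simp add: taylor_mult taylor_rconst)
lemma can_iota_theta: "can_iota s (ttheta rconst q l x) = ttheta (wconst s) q l (can_iota s x)"
  by (rule tser_eqI) (simp add: taylor_mult taylor_rconst)
lemma can_iota_deriv: "can_iota s (tmap rderiv x) = tmap (wderiv s) (can_iota s x)"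
  by (rule tser_eqI) (simp add: wderiv_taylor)
lemma can_iota_commute_const: "can_iota s x * tconst (fps_const a) = tconst (fps_const a) * can_iota s x"
  by (rule tser_eqI) (simp add: taylor_central)

text \<open>
  The substitution \<open>Q \<mapsto> (1+\<epsilon>)Q\<close> for a nilpotent \<open>\<epsilon>\<close>, by Taylor expansion in \<open>\<epsilon>\<close>. The bound \<open>N\<close> is any
  number with \<open>\<epsilon>\<^sup>N = 0\<close>.
\<close>

definition deform :: "nat \<Rightarrow> 'a \<Rightarrow> ratfun tser \<Rightarrow> 'a fps tser" where
  "deform N \<epsilon> x = (\<Sum>k<N. can_iota s (Qdiv k x) * tconst (fps_const (\<epsilon> ^ k)))"

lemma tcoeff_deform:
  "tcoeff (deform N \<epsilon> x) i n = (\<Sum>k<N. taylor s (tcoeff (Qdiv k x) i n) * fps_const (\<epsilon> ^ k))"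
  by (simp add: deform_def tcoeff_sum)

lemma deform_add: "x \<in> galois_hull q \<Longrightarrow> y \<in> galois_hull q \<Longrightarrow> deform N \<epsilon> (x + y) = deform N \<epsilon> x + deform N \<epsilon> y"
  by (simp add: deform_def Qdiv_add can_iota_add distrib_right sum.distrib)

lemma deform_mult:
  assumes "\<epsilon> ^ N = 0" "x \<in> galois_hull q" "y \<in> galois_hull q"
  shows "deform N \<epsilon> (x * y) = deform N \<epsilon> x * deform N \<epsilon> y"
proof -
  have z: "\<epsilon> ^ k = 0" if "N \<le> k" for k
    using that assms(1) by (metis le_Suc_ex mult_zero_left power_add)
  define F where "F i j = can_iota s (Qdiv i x) * can_iota s (Qdiv j y) * tconst (fps_const (\<epsilon> ^ (i + j)))" for i j
  have F: "can_iota s (Qdiv i x) * tconst (fps_const (\<epsilon> ^ i)) * (can_iota s (Qdiv j y) * tconst (fps_const (\<epsilon> ^ j))) = F i j" for i j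
  proof -
    have "tconst (fps_const (\<epsilon> ^ i)) * (can_iota s (Qdiv j y) * tconst (fps_const (\<epsilon> ^ j)))
        = can_iota s (Qdiv j y) * (tconst (fps_const (\<epsilon> ^ i)) * tconst (fps_const (\<epsilon> ^ j)))"
      by (simp only: mult.assoc[symmetric] can_iota_commute_const[symmetric])
    then show ?thesis by (simp add: F_def mult.assoc power_add flip: tconst_mult)
  qed
  have "deform N \<epsilon> x * deform N \<epsilon> y = (\<Sum>i<N. \<Sum>j<N. F i j)"
    by (simp add: deform_def sum_product F)
  also have "\<dots> = (\<Sum>k<N. \<Sum>i=0..k. F i (k - i))"
    by (rule sum_square_antidiagonals) (simp add: F_def z)
  also have "\<dots> = deform N \<epsilon> (x * y)"
    unfolding deform_def
    by (intro sum.cong) (auto simp: Qdiv_mult assms can_iota_sum can_iota_mult sum_distrib_right F_def)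
  finally show ?thesis by simp
qed

lemma deform_tconst: "0 < N \<Longrightarrow> deform N \<epsilon> (tconst a) = can_iota s (tconst a)"
proof -
  assume "0 < N"
  then have "deform N \<epsilon> (tconst a) = (\<Sum>k\<in>{0}. can_iota s (Qdiv k (tconst a)) * tconst (fps_const (\<epsilon> ^ k)))"
    unfolding deform_def
  proof (intro sum.mono_neutral_right ballI)
    fix k assume "k \<in> {..<N} - {0}"
    then obtain j where "k = Suc j" by (auto simp: gr0_conv_Suc)
    then show "can_iota s (Qdiv k (tconst a)) * tconst (fps_const (\<epsilon> ^ k)) = 0"
      by (simp only: Qdiv_tconst) simp
  qed auto
  then show ?thesis by simp
qed

lemma wconst_tser_deform:
  "wconst s c * (\<Sum>k<N. taylor s (F k) * fps_const (\<epsilon> ^ k)) = (\<Sum>k<N. taylor s (rconst c * F k) * fps_const (\<epsilon> ^ k))"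
  by (simp add: sum_distrib_left taylor_mult taylor_rconst mult.assoc)

lemma deform_sigma: "x \<in> galois_hull q \<Longrightarrow> deform N \<epsilon> (tsigma rconst q x) = tsigma (wconst s) q (deform N \<epsilon> x)"
  by (rule tser_eqI) (simp add: tcoeff_deform Qdiv_sigma wconst_tser_deform)
lemma deform_theta: "x \<in> galois_hull q \<Longrightarrow> deform N \<epsilon> (ttheta rconst q l x) = ttheta (wconst s) q l (deform N \<epsilon> x)"
  by (rule tser_eqI) (simp add: tcoeff_deform Qdiv_theta wconst_tser_deform)
lemma deform_deriv: "x \<in> galois_hull q \<Longrightarrow> deform N \<epsilon> (tmap rderiv x) = tmap (wderiv s) (deform N \<epsilon> x)"
  by (rule tser_eqI)
    (simp add: tcoeff_deform Qdiv_deriv additive_sum[of "wderiv s", OF wderiv_add] wderiv_mult wderiv_taylor)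

lemma deform_iota0_rt: "2 \<le> N \<Longrightarrow> deform N \<epsilon> (iota0 q rt) = deformed q s (1 + \<epsilon>) 0"
proof -
  assume "2 \<le> N"
  then have "deform N \<epsilon> (iota0 q rt)
      = (\<Sum>k\<in>{0, Suc 0}. can_iota s (Qdiv k (iota0 q rt)) * tconst (fps_const (\<epsilon> ^ k)))"
    unfolding deform_def
  proof (intro sum.mono_neutral_right ballI)
    fix k assume "k \<in> {..<N} - {0, Suc 0}"
    then obtain j where "k = Suc (Suc j)" by (auto, metis One_nat_def Suc_pred neq0_conv nat_neq_iff)
    then show "can_iota s (Qdiv k (iota0 q rt)) * tconst (fps_const (\<epsilon> ^ k)) = 0"
      by (simp only: Qdiv_iota0_rt) simp
  qed auto
  also have "\<dots> = can_iota s (iota0 q rt) + can_iota s (tconst rt * tQ rconst q) * tconst (fps_const \<epsilon>)"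
    by (simp add: Qdiv_iota0_rt del: Qdiv.simps(2))
  also have "\<dots> = deformed q s (1 + \<epsilon>) 0"
    unfolding deformed_def iota0_rt can_iota_add can_iota_mult can_iota_tconst can_iota_Q can_iota_X
      taylor_rt[symmetric]
  proof (rule tser_eqI)
    fix i n
    have "taylor s rt * (wconst s c * fps_const \<epsilon>) = fps_const \<epsilon> * (taylor s rt * wconst s c)" for c
      by (simp only: wconst_central[of c "fps_const \<epsilon>"] taylor_left_comm)
    moreover have e: "fps_const (1 + \<epsilon>) = 1 + fps_const \<epsilon>" by (rule fps_ext) simp
    ultimately show "tcoeff (tconst (taylor s rt) * tQ (wconst s) q + tX +
        tconst (taylor s rt) * tQ (wconst s) q * tconst (fps_const \<epsilon>)) i n
      = tcoeff (tconst (fps_const (1 + \<epsilon>) * taylor s rt + fps_const 0) * tQ (wconst s) q + tX) i n"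
      unfolding e by (simp add: tcoeff_tQ mult.assoc distrib_right)
  qed
  finally show ?thesis .
qed

text \<open>
  The term with \<open>k = 0\<close> is the canonical morphism. The other terms are divisible by \<open>\<epsilon>\<close>, which commutes
  with the coefficients since these come from \<open>L\<close>.
\<close>

lemma nilpotent_coeff_deform:
  assumes "\<epsilon> ^ N = 0" "0 < N"
  shows "nilpotent (fps_nth (tcoeff (deform N \<epsilon> x - can_iota s x) i n) m)"
proof -
  obtain M where N: "N = Suc M" using assms(2) gr0_conv_Suc by blast
  define c where "c k = fps_nth (taylor s (tcoeff (Qdiv k x) i n)) m" for k
  have c: "c k * y = y * c k" for k y by (simp add: c_def nth_taylor s_comm)
  have "fps_nth (tcoeff (deform N \<epsilon> x - can_iota s x) i n) m = (\<Sum>k<N. c k * \<epsilon> ^ k) - c 0"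
    by (simp add: tcoeff_deform c_def fps_sum_nth)
  also have "\<dots> = (\<Sum>k<M. c (Suc k) * \<epsilon> ^ Suc k)"
    unfolding N sum.lessThan_Suc_shift by simp
  also have "\<dots> = \<epsilon> * (\<Sum>k<M. c (Suc k) * \<epsilon> ^ k)"
    by (simp add: sum_distrib_left) (metis c mult.assoc)
  finally have *: "fps_nth (tcoeff (deform N \<epsilon> x - can_iota s x) i n) m = \<epsilon> * (\<Sum>k<M. c (Suc k) * \<epsilon> ^ k)" .
  have "\<epsilon> * (c (Suc k) * \<epsilon> ^ k) = c (Suc k) * \<epsilon> ^ k * \<epsilon>" for k
    by (metis c mult.assoc power_commutes)
  then have "\<epsilon> * (\<Sum>k<M. c (Suc k) * \<epsilon> ^ k) = (\<Sum>k<M. c (Suc k) * \<epsilon> ^ k) * \<epsilon>"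
    by (simp only: sum_distrib_left sum_distrib_right)
  then show ?thesis unfolding * using assms(1) by (intro nilpotent_mult) (auto simp: nilpotent_def)
qed

lemma NCF_hom:
  assumes "\<phi> \<in> NCF q s" shows "\<phi> \<in> Ring.ring_hom (hull_ring q) type_ring"
  using assms by (intro ring_hom_memI) (auto simp: NCF_def hull_ring_def)

lemma NCF_D:
  assumes "\<phi> \<in> NCF q s"
  shows "\<phi> (tconst a) = can_iota s (tconst a)"
    and "x \<in> galois_hull q \<Longrightarrow> \<phi> (tsigma rconst q x) = tsigma (wconst s) q (\<phi> x)"
    and "x \<in> galois_hull q \<Longrightarrow> \<phi> (ttheta rconst q l x) = ttheta (wconst s) q l (\<phi> x)"
    and "x \<in> galois_hull q \<Longrightarrow> \<phi> (tmap rderiv x) = tmap (wderiv s) (\<phi> x)"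
    and "\<phi> \<in> extensional (galois_hull q)"
  using assms unfolding NCF_def by blast+

lemma NCF_unique:
  assumes "\<phi> \<in> NCF q s" "\<phi>' \<in> NCF q s" "\<phi> (iota0 q rt) = \<phi>' (iota0 q rt)"
  shows "\<phi> = \<phi>'"
proof (rule extensionalityI[of _ "galois_hull q"])
  fix x assume "x \<in> galois_hull q"
  show "\<phi> x = \<phi>' x"
  proof (rule hull_hom_unique[OF ring_type_ring NCF_hom[OF assms(1)] NCF_hom[OF assms(2)]])
    show "\<phi> (tconst a) = \<phi>' (tconst a)" for a
      by (simp only: NCF_D(1)[OF assms(1)] NCF_D(1)[OF assms(2)])
  qed (fact assms(3) NCF_D(2-4)[OF assms(1)] NCF_D(2-4)[OF assms(2)] \<open>x \<in> galois_hull q\<close>)+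
qed (fact NCF_D(5)[OF assms(1)] NCF_D(5)[OF assms(2)])+

lemma deform_NCF:
  assumes "\<epsilon> ^ N = 0" "0 < N"
  shows "restrict (deform N \<epsilon>) (galois_hull q) \<in> NCF q s"
  using assms deform_tconst[of N \<epsilon> 1]
  by (auto simp: NCF_def deform_add deform_mult deform_sigma deform_theta deform_deriv deform_tconst
      galois_hull.intros
      nilpotent_coeff_deform[unfolded tcoeff_diff fps_sub_nth tcoeff_can_iota])

lemma tcoeff_deformed:
  "tcoeff (deformed q s e f) i n =
    (if i = 0 then (fps_const e * taylor s rt + fps_const f) * wconst s (q powi n) else if i = 1 then 1 else 0)"
  by (simp add: deformed_def tcoeff_tX tcoeff_mult_tQ tcoeff_tconst flip: taylor_rt)

lemma deformed_inject: "deformed q s e f = deformed q s e' f' \<longleftrightarrow> e = e' \<and> f = f'"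
proof
  assume "deformed q s e f = deformed q s e' f'"
  from arg_cong[OF this, of "\<lambda>x. tcoeff x 0 0"]
  have *: "fps_const e * taylor s rt + fps_const f = fps_const e' * taylor s rt + fps_const f'"
    by (simp add: tcoeff_deformed wconst_def)
  from arg_cong[OF this, of "\<lambda>x. fps_nth x 1"] have "e = e'" by (simp add: taylor_rt fps_X_def)
  moreover with arg_cong[OF *, of "\<lambda>x. fps_nth x 0"] have "f = f'" by simp
  ultimately show "e = e' \<and> f = f'" ..
qed simp

text \<open>
  The three equations concern separate parts of the series: \<open>\<Theta>\<^sup>(\<^sup>1\<^sup>)\<close> determines the coefficients of positive
  powers of \<open>X\<close>, \<open>\<Sigma>\<close> the dependence of the coefficient of \<open>X\<^sup>0\<close> on \<open>n\<close>, and \<open>\<partial>\<close> its dependence on \<open>W\<close>, which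
  is affine.
\<close>

lemma deformed_form:
  assumes sg: "tsigma (wconst s) q F = tconst (wconst s q) * F"
    and th: "ttheta (wconst s) q 1 F = 1"
    and dr: "tmap (wderiv s) (tmap (wderiv s) F) = 0"
  obtains e f where "F = deformed q s e f"
proof -
  have t: "tcoeff F (Suc i) n = (if i = 0 then 1 else 0)" for i n
  proof -
    have *: "wconst s (qint q (Suc i)) * tcoeff F (Suc i) n = (if i = 0 then 1 else 0)"
      using arg_cong[OF th, of "\<lambda>x. tcoeff x i n"] qbinom_1[OF q_root, of i] by (simp add: tcoeff_1)
    show ?thesis
    proof (cases "i = 0")
      case True
      then show ?thesis using * by (simp add: wconst_def)
    next
      case False
      then show ?thesis using * wconst_cancel[OF qint_nonzero[OF q_root, of i], of _ 0] by simp
    qed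
  qed
  have step: "tcoeff F 0 (n + 1) = wconst s q * tcoeff F 0 n" for n
    using arg_cong[OF sg, of "\<lambda>x. tcoeff x 0 n"] by (simp add: wconst_def)
  have Q: "tcoeff F 0 n = wconst s (q powi n) * tcoeff F 0 0" for n
  proof (induction n rule: int_induct[where k=0])
    case base
    show ?case by (simp add: wconst_def)
  next
    case (step1 n)
    then show ?case using step[of n] by (simp add: power_int_add wconst_mult mult.assoc) (metis mult.assoc wconst_central)
  next
    case (step2 n)
    have "wconst s q * tcoeff F 0 (n - 1) = wconst s q * (wconst s (q powi (n - 1)) * tcoeff F 0 0)"
      using step[of "n - 1"] step2
      by (simp add: mult.assoc[symmetric] power_int_diff flip: wconst_mult)
    then show ?case by (rule wconst_cancel[OF q_nz])
  qed
  define w where "w = tcoeff F 0 0"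
  have "wderiv s (wderiv s w) = 0"
    using arg_cong[OF dr, of "\<lambda>x. tcoeff x 0 0"] by (simp add: w_def)
  then have w2: "fps_nth w (Suc (Suc n)) = 0" for n
  proof -
    from \<open>wderiv s (wderiv s w) = 0\<close>
    have "s (of_nat (Suc n)) * (s (of_nat (Suc (Suc n))) * fps_nth w (Suc (Suc n))) = s (of_nat (Suc n)) * 0"
      by (simp only: nth_wderiv[symmetric]) simp
    then have "s (of_nat (Suc (Suc n))) * fps_nth w (Suc (Suc n)) = s (of_nat (Suc (Suc n))) * 0"
      using s_cancel[OF ratfun_of_nat_Suc_nonzero] by fastforce
    then show ?thesis by (rule s_cancel[OF ratfun_of_nat_Suc_nonzero])
  qed
  \<comment> \<open>the affine polynomial \<open>w = w\<^sub>0 + eW\<close> is rewritten as \<open>e(t+W) + f\<close>\<close>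
  define e f where "e = fps_nth w 1" and "f = fps_nth w 0 - e * s rt"
  have "w = fps_const e * taylor s rt + fps_const f"
  proof (rule fps_ext)
    fix n
    have "n = 0 \<or> n = 1 \<or> (\<exists>m. n = Suc (Suc m))" by presburger
    then show "fps_nth w n = fps_nth (fps_const e * taylor s rt + fps_const f) n"
      by (auto simp: w2 taylor_rt fps_X_def e_def f_def)
  qed
  have "F = deformed q s e f"
  proof (rule tser_eqI)
    fix i n
    show "tcoeff F i n = tcoeff (deformed q s e f) i n"
    proof (cases i)
      case 0
      have "tcoeff F 0 n = w * wconst s (q powi n)"
        using Q[of n] wconst_central[of "q powi n" w] by (simp add: w_def)
      then show ?thesis
        unfolding 0 tcoeff_deformed using \<open>w = fps_const e * taylor s rt + fps_const f\<close> by simp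
    next
      case (Suc j)
      then show ?thesis by (simp add: tcoeff_deformed t)
    qed
  qed
  then show thesis by (rule that)
qed

text \<open>
  A point with \<open>uv = q vu\<close> and \<open>u - 1\<close> nilpotent has \<open>v = 0\<close>: from \<open>(u - 1) v = v (qu - 1)\<close> some power of
  \<open>qu - 1\<close> annihilates \<open>v\<close>, but \<open>qu - 1 = (q - 1) + q (u - 1)\<close> is invertible.
\<close>

lemma q_commuting_unipotent:
  assumes uv: "u * v = s (rconst q) * (v * u)" and "nilpotent (u - 1)"
  shows "v = 0"
proof -
  define c where "c = s (rconst q)"
  obtain M where M: "(u - 1) ^ M = 0" using assms(2) by (auto simp: nilpotent_def)
  have "(u - 1) * v = v * (c * u - 1)"
    using uv by (simp add: c_def algebra_simps s_left_comm)
  then have "(u - 1) ^ k * v = v * (c * u - 1) ^ k" for k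
    by (induction k) (simp_all add: mult.assoc, metis mult.assoc power_commutes)
  with M have z: "v * (c * u - 1) ^ M = 0" by (metis mult_zero_left)
  define r where "r = s (rconst (1 / (q - 1)))"
  have r: "s (rconst (q - 1)) * r = 1" using q_ne_1 by (simp add: r_def flip: s_mult rconst_mult)
  \<comment> \<open>\<open>qu - 1 = (q - 1) w\<close> with \<open>w\<close> unipotent\<close>
  define w where "w = 1 + r * c * (u - 1)"
  have cen: "x * (r * c) = r * c * x" for x by (simp add: r_def c_def flip: s_mult) (metis s_comm)
  have "nilpotent (w - 1)"
    using nilpotent_mult[OF assms(2), of "r * c"] cen by (simp add: w_def)
  then obtain w' where w': "w * w' = 1" "w' * w = 1" by (rule unipotent_inverse)
  have "c * u - 1 = s (rconst (q - 1)) + c * (u - 1)"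
    by (simp add: c_def rconst_diff s_minus algebra_simps)
  also have "\<dots> = s (rconst (q - 1)) * w"
    by (simp add: w_def distrib_left r mult.assoc[symmetric])
  finally have cu: "c * u - 1 = s (rconst (q - 1)) * w" .
  have r': "r * s (rconst (q - 1)) = 1" using r by (simp only: s_comm[of _ r])
  have "(c * u - 1) * (w' * r) = s (rconst (q - 1)) * (w * w') * r" by (simp only: cu mult.assoc)
  then have "(c * u - 1) * (w' * r) = 1" by (simp only: w' r mult_1_right)
  moreover have "w' * r * (c * u - 1) = w' * (r * s (rconst (q - 1))) * w" by (simp only: cu mult.assoc)
  then have "w' * r * (c * u - 1) = 1" by (simp only: w' r' mult_1_right)
  ultimately have "(c * u - 1) ^ M * (w' * r) ^ M = 1"
    using commuting_power_mult[of "c * u - 1" "w' * r" M] by simp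
  then show ?thesis using z by (metis mult.assoc mult_1_right mult_zero_left)
qed

text \<open>
  The constant coefficient of \<open>\<phi>(Q) = \<partial> \<phi>(\<iota>\<^sub>0(t))\<close> is \<open>e\<close>, and that of \<open>\<iota>(Q)\<close> is \<open>1\<close>, so \<open>e\<close> is
  unipotent as soon as the difference is nilpotent at this one place. The relation of
  \<open>hull_commutator\<close>, read at \<open>X = W = 0\<close> and \<open>n = 0\<close>, gives \<open>ef = q fe\<close>.
  
  The hypotheses do not mention deformations because the lemma is also applied to the restrictions of
  automorphisms of the completed hull.
\<close>

lemma deformation_form:
  assumes hom: "\<phi> \<in> Ring.ring_hom (hull_ring q) type_ring"
    and can: "\<And>a. \<phi> (tconst a) = can_iota s (tconst a)"
    and sg: "\<And>x. x \<in> galois_hull q \<Longrightarrow> \<phi> (tsigma rconst q x) = tsigma (wconst s) q (\<phi> x)"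
    and th: "\<And>x l. x \<in> galois_hull q \<Longrightarrow> \<phi> (ttheta rconst q l x) = ttheta (wconst s) q l (\<phi> x)"
    and dr: "\<And>x. x \<in> galois_hull q \<Longrightarrow> \<phi> (tmap rderiv x) = tmap (wderiv s) (\<phi> x)"
    and nilp: "nilpotent (fps_nth (tcoeff (\<phi> (tQ rconst q) - can_iota s (tQ rconst q)) 0 0) 0)"
  obtains e where "\<phi> (iota0 q rt) = deformed q s e 0" "nilpotent (e - 1)"
proof -
  define F where "F = \<phi> (iota0 q rt)"
  have hY: "iota0 q rt \<in> galois_hull q" by (rule galois_hull.intros)
  note hI = galois_hull.intros
  have add: "\<phi> (x + y) = \<phi> x + \<phi> y" and mult: "\<phi> (x * y) = \<phi> x * \<phi> y"
    if "x \<in> galois_hull q" "y \<in> galois_hull q" for x y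
    using ring_hom_add[OF hom] ring_hom_mult[OF hom] that by (simp_all add: hull_ring_def)
  have one: "\<phi> 1 = 1" using ring_hom_one[OF hom] by (simp add: hull_ring_def)
  have const: "\<phi> (tconst a) = tconst (taylor s a)" for a
    by (simp add: can can_iota_tconst)
  have "tsigma rconst q (iota0 q rt) = tconst (rconst q) * iota0 q rt"
    by (rule tser_eqI) (auto simp: iota0_rt tcoeff_tQ tcoeff_tX rconst_mult power_int_add)
  then have 1: "tsigma (wconst s) q F = tconst (wconst s q) * F"
    using sg[OF hY] mult[OF hI(2) hY, of "rconst q"] const[of "rconst q"]
    by (simp only: F_def taylor_rconst)
  have "ttheta rconst q 1 (iota0 q rt) = 1"
    by (rule tser_eqI) (auto simp: iota0_rt tcoeff_tQ tcoeff_tX tcoeff_1 qbinom_1[OF q_root] tcoeff_tconst)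
  then have 2: "ttheta (wconst s) q 1 F = 1"
    using th[OF hY, of 1] one by (simp add: F_def)
  have "tmap rderiv (tmap rderiv (iota0 q rt)) = tconst 0"
    unfolding tmap_rderiv_iota0_rt by (rule tser_eqI) (simp add: tcoeff_tQ)
  then have 3: "tmap (wderiv s) (tmap (wderiv s) F) = 0"
    using dr[OF hY] dr[OF hI(7)[OF hY]] const[of 0] by (simp add: F_def)
  obtain e f where F: "F = deformed q s e f" using deformed_form[OF 1 2 3] by blast
  define G where "G = tmap (wderiv s) F"
  have G: "\<phi> (tQ rconst q) = G" using dr[OF hY] by (simp add: tmap_rderiv_iota0_rt G_def F_def)
  have G0: "fps_nth (tcoeff G 0 0) 0 = e"
    by (simp add: G_def F tcoeff_deformed nth_wderiv wconst_def taylor_rt fps_X_def)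
  have F0: "fps_nth (tcoeff F 0 0) 0 = e * s rt + f"
    by (simp add: F tcoeff_deformed wconst_def taylor_rt fps_X_def)
  have "nilpotent (fps_nth (tcoeff (G - can_iota s (tQ rconst q)) 0 0) 0)"
    using nilp by (simp only: G)
  then have nil: "nilpotent (e - 1)" by (simp add: G0 can_iota_Q tcoeff_tQ wconst_def)
  have "tQ rconst q * iota0 q rt = tconst (rconst (1 - q) * rt) * (tQ rconst q * tQ rconst q)
      + tconst (rconst q) * (iota0 q rt * tQ rconst q)"
    using hull_commutator by (simp add: tmap_rderiv_iota0_rt algebra_simps)
  from arg_cong[OF this, of \<phi>]
  have "G * F = tconst (taylor s (rconst (1 - q) * rt)) * (G * G) + tconst (taylor s (rconst q)) * (F * G)"
    by (simp add: add mult const G hI flip: F_def)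
  from arg_cong[OF this, of "\<lambda>x. fps_nth (tcoeff x 0 0) 0"]
  have rel: "e * (e * s rt + f) = s (rconst (1 - q) * rt) * (e * e) + s (rconst q) * ((e * s rt + f) * e)"
    by (simp add: tcoeff_mult_0 F0 G0 nth_taylor tcoeff_tconst)
  have "e * f = s (rconst q) * (f * e)"
  proof -
    define c t where "c = s (rconst q)" and "t = s rt"
    have t: "x * t = t * x" "x * (t * y) = t * (x * y)" for x y
      by (simp_all only: t_def s_comm[of rt x] s_left_comm)
    have "s (rconst (1 - q) * rt) = (1 - c) * t"
      by (simp add: c_def t_def s_mult s_minus rconst_diff)
    with rel have "e * (e * t + f) = (1 - c) * t * (e * e) + c * ((e * t + f) * e)"
      by (simp only: c_def t_def)
    then show "e * f = s (rconst q) * (f * e)"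
      unfolding c_def[symmetric]
      by (simp add: distrib_left distrib_right left_diff_distrib right_diff_distrib mult.assoc t)
  qed
  then have "f = 0" using nil by (rule q_commuting_unipotent)
  then show thesis using that F nil by (simp add: F_def)
qed

lemma NCF_form:
  assumes \<phi>: "\<phi> \<in> NCF q s"
  obtains e where "\<phi> (iota0 q rt) = deformed q s e 0" "nilpotent (e - 1)"
proof (rule deformation_form[OF NCF_hom[OF \<phi>] NCF_D(1-4)[OF \<phi>]])
  show "nilpotent (fps_nth (tcoeff (\<phi> (tQ rconst q) - can_iota s (tQ rconst q)) 0 0) 0)"
    using \<phi> hull_Q unfolding NCF_def by blast
qed

text \<open>
  The exponent is increased by \<open>2\<close> so that the linear term of the expansion is present even for
  \<open>e = 1\<close>.
\<close>

lemma NCF_exists: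
  assumes "nilpotent (e - 1)"
  shows "\<exists>\<phi>\<in>NCF q s. \<phi> (iota0 q rt) = deformed q s e 0"
proof -
  obtain M where M: "(e - 1) ^ M = 0" using assms by (auto simp: nilpotent_def)
  then have *: "(e - 1) ^ (M + 2) = 0" by (simp add: power_add)
  show ?thesis
    by (rule bexI[OF _ deform_NCF[OF *]]) (simp_all add: galois_hull.hull_iota0 deform_iota0_rt)
qed

lemma can_iota_NCF: "restrict (can_iota s) (galois_hull q) \<in> NCF q s"
  by (auto simp: NCF_def can_iota_add can_iota_mult can_iota_sigma can_iota_theta can_iota_deriv
      galois_hull.intros nilpotent_0)

lemma can_iota_iota0_rt: "can_iota s (iota0 q rt) = deformed q s 1 0"
  unfolding deformed_def iota0_rt can_iota_add can_iota_mult can_iota_tconst can_iota_Q can_iota_X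
      taylor_rt[symmetric] by simp

end

section \<open>Tensor products of rings\<close>

lemma (in ideal) quot_carrier: "z \<in> carrier (R Quot I) \<longleftrightarrow> (\<exists>p\<in>carrier R. z = I +> p)"
  by (auto simp: FactRing_def A_RCOSETS_def')

lemma (in ideal) quot_in [simp]: "p \<in> carrier R \<Longrightarrow> I +> p \<in> carrier (R Quot I)"
  by (auto simp: quot_carrier)

lemma (in ideal) quot_add:
  "x \<in> carrier R \<Longrightarrow> y \<in> carrier R \<Longrightarrow> (I +> x) \<oplus>\<^bsub>R Quot I\<^esub> (I +> y) = I +> (x \<oplus> y)"
  by (simp add: FactRing_def a_rcos_sum)

lemma (in ideal) quot_mult:
  "x \<in> carrier R \<Longrightarrow> y \<in> carrier R \<Longrightarrow> (I +> x) \<otimes>\<^bsub>R Quot I\<^esub> (I +> y) = I +> (x \<otimes> y)"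
  by (simp add: FactRing_def rcoset_mult_add)

lemma (in ideal) quot_one: "\<one>\<^bsub>R Quot I\<^esub> = I +> \<one>" by (simp add: FactRing_def)

lemma (in ideal) quot_zero: "\<zero>\<^bsub>R Quot I\<^esub> = I +> \<zero>"
  using a_coset_add_zero a_subset by (simp add: FactRing_def)

lemma (in ideal) quot_eq:
  "x \<in> carrier R \<Longrightarrow> y \<in> carrier R \<Longrightarrow> I +> x = I +> y \<longleftrightarrow> x \<ominus> y \<in> I"
  using quotient_eq_iff_same_a_r_cos[OF is_ideal] by blast

lemma (in ideal) quot_mem: "p \<in> carrier R \<Longrightarrow> p' \<in> I +> p \<longleftrightarrow> p' \<in> carrier R \<and> I +> p' = I +> p"
  using a_repr_independence'[of p' p] a_rcos_self[of p'] a_r_coset_subset_G[OF a_subset, of p] by auto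

lemma (in ideal) quot_a_inv: "x \<in> carrier R \<Longrightarrow> \<ominus>\<^bsub>R Quot I\<^esub> (I +> x) = I +> (\<ominus> x)"
proof -
  assume x: "x \<in> carrier R"
  interpret Q: ring "R Quot I" by (rule quotient_is_ring)
  show ?thesis
    by (rule Q.minus_equality) (use x in \<open>simp_all add: quot_add quot_zero l_neg\<close>)
qed

lemma (in ideal) quot_lift:
  assumes "\<And>p p'. p \<in> carrier R \<Longrightarrow> p' \<in> carrier R \<Longrightarrow> p \<ominus> p' \<in> I \<Longrightarrow> f p = f p'"
  shows "\<exists>h. \<forall>p\<in>carrier R. h (I +> p) = f p"
proof (intro exI ballI)
  fix p assume p: "p \<in> carrier R"
  define p' where "p' = (SOME p'. p' \<in> carrier R \<and> I +> p = I +> p')"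
  have "p' \<in> carrier R \<and> I +> p = I +> p'"
    unfolding p'_def by (rule someI[of _ p]) (simp add: p)
  then show "f (SOME p'. p' \<in> carrier R \<and> I +> p = I +> p') = f p"
    unfolding p'_def[symmetric] using assms[OF p, of p'] quot_eq[OF p] by metis
qed

definition frag_times :: "('m, 'z) monoid_scheme \<Rightarrow> ('m \<Rightarrow>\<^sub>0 int) \<Rightarrow> ('m \<Rightarrow>\<^sub>0 int) \<Rightarrow> ('m \<Rightarrow>\<^sub>0 int)" where
  "frag_times M p p' = frag_extend (\<lambda>a. frag_extend (\<lambda>b. frag_of (a \<otimes>\<^bsub>M\<^esub> b)) p') p"

lemma frag_times_of: "frag_times M (frag_of a) (frag_of b) = frag_of (a \<otimes>\<^bsub>M\<^esub> b)" by (simp add: frag_times_def)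
lemma frag_times_diff_left: "frag_times M (p - p') r = frag_times M p r - frag_times M p' r" by (simp add: frag_times_def frag_extend_diff)
lemma frag_cmul_right_diff: "frag_cmul k (x - y) = frag_cmul k x - frag_cmul k y"
  by (rule poly_mapping_eqI) (simp add: lookup_minus right_diff_distrib)
lemma frag_extend_fun_diff: "frag_extend (\<lambda>a. f a - g a) p = frag_extend f p - frag_extend g p"
  by (simp add: frag_extend_def sum_subtractf frag_cmul_right_diff)
lemma frag_extend_fun_0: "frag_extend (\<lambda>a. 0) p = 0" by (simp add: frag_extend_def)
lemma frag_times_diff_right: "frag_times M r (p - p') = frag_times M r p - frag_times M r p'"
  by (simp add: frag_times_def frag_extend_diff frag_extend_fun_diff)
lemma frag_times_0 [simp]: "frag_times M 0 r = 0" "frag_times M r 0 = 0" by (simp_all add: frag_times_def frag_extend_fun_0)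
lemma frag_times_uminus_left: "frag_times M (- p) r = - frag_times M p r" using frag_times_diff_left[of M 0 p r] by simp
lemma frag_times_uminus_right: "frag_times M r (- p) = - frag_times M r p" using frag_times_diff_right[of M r 0 p] by simp
lemma frag_times_add_left: "frag_times M (p + p') r = frag_times M p r + frag_times M p' r"
  using frag_times_diff_left[of M p "- p'" r] by (simp add: frag_times_uminus_left)
lemma frag_times_add_right: "frag_times M r (p + p') = frag_times M r p + frag_times M r p'"
  using frag_times_diff_right[of M r p "- p'"] by (simp add: frag_times_uminus_right)

lemma (in Group.monoid) keys_frag_times:
  assumes "Poly_Mapping.keys p \<subseteq> carrier G" "Poly_Mapping.keys r \<subseteq> carrier G"
  shows "Poly_Mapping.keys (frag_times G p r) \<subseteq> carrier G"
proof -
  have 1: "Poly_Mapping.keys (frag_extend (\<lambda>b. frag_of (a \<otimes> b)) r) \<subseteq> carrier G" if "a \<in> carrier G" for a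
    using keys_frag_extend[of "\<lambda>b. frag_of (a \<otimes> b)" r] assms(2) that by force
  show ?thesis unfolding frag_times_def
    by (rule order_trans[OF keys_frag_extend]) (use 1 assms(1) in blast)
qed

lemma (in Group.monoid) frag_times_assoc:
  assumes p: "Poly_Mapping.keys p \<subseteq> carrier G" and r: "Poly_Mapping.keys r \<subseteq> carrier G"
    and w: "Poly_Mapping.keys w \<subseteq> carrier G"
  shows "frag_times G (frag_times G p r) w = frag_times G p (frag_times G r w)"
  using p
proof (induction rule: frag_induction)
  case (one a)
  show ?case using r
  proof (induction rule: frag_induction)
    case (one b)
    show ?case using w
      by (induction rule: frag_induction)
        (use one \<open>a \<in> carrier G\<close> in \<open>simp_all add: frag_times_of frag_times_diff_right frag_times_diff_left m_assoc\<close>)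
  qed (simp_all add: frag_times_diff_left frag_times_diff_right)
qed (simp_all add: frag_times_diff_left)

lemma (in Group.monoid) frag_times_one:
  assumes "Poly_Mapping.keys p \<subseteq> carrier G"
  shows "frag_times G (frag_of \<one>) p = p" "frag_times G p (frag_of \<one>) = p"
  using assms by (induction rule: frag_induction; simp add: frag_times_of frag_times_diff_left frag_times_diff_right)+

lemma (in Group.monoid) ring_integral_monoid_ring: "ring (integral_monoid_ring G)"
proof (rule ringI)
  show "abelian_group (integral_monoid_ring G)"
  proof (rule abelian_groupI)
    fix p assume "p \<in> carrier (integral_monoid_ring G)"
    then show "\<exists>y\<in>carrier (integral_monoid_ring G). y \<oplus>\<^bsub>integral_monoid_ring G\<^esub> p = \<zero>\<^bsub>integral_monoid_ring G\<^esub>"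
      by (intro bexI[of _ "- p"]) (auto simp: integral_monoid_ring_def)
  qed (auto simp: integral_monoid_ring_def algebra_simps dest: subsetD[OF keys_add])
  show "Group.monoid (integral_monoid_ring G)"
    by (rule monoidI)
      (use keys_frag_times frag_times_assoc frag_times_one in \<open>auto simp: integral_monoid_ring_def frag_times_def[symmetric] keys_frag_of\<close>)
qed (auto simp: integral_monoid_ring_def frag_times_def[symmetric] frag_times_add_left frag_times_add_right)

text \<open>
  \<open>MR\<close> is the ring of formal sums of pairs, \<open>TI\<close> the ideal of the relations and \<open>TR\<close> the quotient, the
  tensor product.
\<close>

locale tensor = R: ring R + S: ring S
  for R :: "('r, 'y) ring_scheme" and S :: "('s, 'z) ring_scheme" +
  fixes \<kappa> :: "'k \<Rightarrow> 'r" and \<kappa>' :: "'k \<Rightarrow> 's"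
  assumes \<kappa>_closed [simp]: "\<kappa> c \<in> carrier R" and \<kappa>'_closed [simp]: "\<kappa>' c \<in> carrier S"
    and \<kappa>_central: "x \<in> carrier R \<Longrightarrow> \<kappa> c \<otimes>\<^bsub>R\<^esub> x = x \<otimes>\<^bsub>R\<^esub> \<kappa> c"
    and \<kappa>'_central: "y \<in> carrier S \<Longrightarrow> \<kappa>' c \<otimes>\<^bsub>S\<^esub> y = y \<otimes>\<^bsub>S\<^esub> \<kappa>' c"
begin

abbreviation "MR \<equiv> integral_monoid_ring (R \<times>\<times> S)"
abbreviation "TI \<equiv> tensor_ideal R \<kappa> S \<kappa>'"
abbreviation "TR \<equiv> tensor_ring R \<kappa> S \<kappa>'"
abbreviation "pure \<equiv> tensor_elem R \<kappa> S \<kappa>'"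
abbreviation "tclass p \<equiv> TI +>\<^bsub>MR\<^esub> p"

sublocale RS: Group.monoid "R \<times>\<times> S"
  by (rule DirProd_monoid) unfold_locales

sublocale MR: ring MR by (rule RS.ring_integral_monoid_ring)

lemma MR_simps [simp]:
  "p \<in> carrier MR \<longleftrightarrow> Poly_Mapping.keys p \<subseteq> carrier R \<times> carrier S"
  "p \<oplus>\<^bsub>MR\<^esub> p' = p + p'" "\<zero>\<^bsub>MR\<^esub> = 0" "\<one>\<^bsub>MR\<^esub> = frag_of (\<one>\<^bsub>R\<^esub>, \<one>\<^bsub>S\<^esub>)" "p \<otimes>\<^bsub>MR\<^esub> p' = frag_times (R \<times>\<times> S) p p'"
  by (simp_all add: integral_monoid_ring_def frag_times_def)

lemma MR_a_inv [simp]: "p \<in> carrier MR \<Longrightarrow> \<ominus>\<^bsub>MR\<^esub> p = - p"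
  by (rule MR.minus_equality) auto
lemma MR_minus [simp]: "p \<in> carrier MR \<Longrightarrow> p' \<in> carrier MR \<Longrightarrow> p \<ominus>\<^bsub>MR\<^esub> p' = p - p'"
  unfolding a_minus_def by simp

definition "tensor_relations =
     {frag_of (x \<oplus>\<^bsub>R\<^esub> x', y) - frag_of (x, y) - frag_of (x', y) | x x' y.
         x \<in> carrier R \<and> x' \<in> carrier R \<and> y \<in> carrier S} \<union>
      {frag_of (x, y \<oplus>\<^bsub>S\<^esub> y') - frag_of (x, y) - frag_of (x, y') | x y y'.
         x \<in> carrier R \<and> y \<in> carrier S \<and> y' \<in> carrier S} \<union>
      {frag_of (\<kappa> c \<otimes>\<^bsub>R\<^esub> x, y) - frag_of (x, \<kappa>' c \<otimes>\<^bsub>S\<^esub> y) | c x y.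
         x \<in> carrier R \<and> y \<in> carrier S}"

lemma tensor_relations_I:
  "x \<in> carrier R \<Longrightarrow> x' \<in> carrier R \<Longrightarrow> y \<in> carrier S \<Longrightarrow>
    frag_of (x \<oplus>\<^bsub>R\<^esub> x', y) - frag_of (x, y) - frag_of (x', y) \<in> tensor_relations"
  "x \<in> carrier R \<Longrightarrow> y \<in> carrier S \<Longrightarrow> y' \<in> carrier S \<Longrightarrow>
    frag_of (x, y \<oplus>\<^bsub>S\<^esub> y') - frag_of (x, y) - frag_of (x, y') \<in> tensor_relations"
  "x \<in> carrier R \<Longrightarrow> y \<in> carrier S \<Longrightarrow>
    frag_of (\<kappa> c \<otimes>\<^bsub>R\<^esub> x, y) - frag_of (x, \<kappa>' c \<otimes>\<^bsub>S\<^esub> y) \<in> tensor_relations"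
  unfolding tensor_relations_def by blast+

lemma tensor_relations_E:
  assumes "r \<in> tensor_relations"
  obtains (1) x x' y where "x \<in> carrier R" "x' \<in> carrier R" "y \<in> carrier S"
      "r = frag_of (x \<oplus>\<^bsub>R\<^esub> x', y) - frag_of (x, y) - frag_of (x', y)"
  | (2) x y y' where "x \<in> carrier R" "y \<in> carrier S" "y' \<in> carrier S"
      "r = frag_of (x, y \<oplus>\<^bsub>S\<^esub> y') - frag_of (x, y) - frag_of (x, y')"
  | (3) c x y where "x \<in> carrier R" "y \<in> carrier S"
      "r = frag_of (\<kappa> c \<otimes>\<^bsub>R\<^esub> x, y) - frag_of (x, \<kappa>' c \<otimes>\<^bsub>S\<^esub> y)"
  using assms unfolding tensor_relations_def Un_iff mem_Collect_eq by (elim disjE exE conjE) (rule that; assumption)+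

inductive_set relation_span :: "('r \<times> 's \<Rightarrow>\<^sub>0 int) set" where
  zero: "0 \<in> relation_span"
| rel: "r \<in> tensor_relations \<Longrightarrow> r \<in> relation_span"
| diff: "p \<in> relation_span \<Longrightarrow> p' \<in> relation_span \<Longrightarrow> p - p' \<in> relation_span"

lemma tensor_relations_carrier: "r \<in> tensor_relations \<Longrightarrow> Poly_Mapping.keys r \<subseteq> carrier R \<times> carrier S"
proof -
  have 2: "Poly_Mapping.keys (frag_of a - frag_of b) \<subseteq> {a, b}" for a b :: "'r \<times> 's"
    using keys_diff[of "frag_of a" "frag_of b"] by (auto simp: keys_frag_of)
  have 3: "Poly_Mapping.keys (frag_of a - frag_of b - frag_of c) \<subseteq> {a, b, c}" for a b c :: "'r \<times> 's"
    using keys_diff[of "frag_of a - frag_of b" "frag_of c"] 2[of a b] by (auto simp: keys_frag_of)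
  assume "r \<in> tensor_relations"
  then show ?thesis
  proof (cases rule: tensor_relations_E)
    case (1 x x' y)
    show ?thesis unfolding 1(4) by (rule order_trans[OF 3]) (use 1 in simp)
  next
    case (2 x y y')
    show ?thesis unfolding 2(4) by (rule order_trans[OF 3]) (use 2 in simp)
  next
    case (3 c x y)
    show ?thesis unfolding 3(3) by (rule order_trans[OF 2]) (use 3 in simp)
  qed
qed

lemma relation_span_carrier: "p \<in> relation_span \<Longrightarrow> Poly_Mapping.keys p \<subseteq> carrier R \<times> carrier S"
  by (induction rule: relation_span.induct) (use tensor_relations_carrier keys_diff in \<open>auto dest: subsetD[OF keys_diff]\<close>)

lemma tensor_relations_mult:
  assumes "r \<in> tensor_relations" "a \<in> carrier R" "b \<in> carrier S"
  shows "frag_times (R \<times>\<times> S) (frag_of (a, b)) r \<in> tensor_relations" "frag_times (R \<times>\<times> S) r (frag_of (a, b)) \<in> tensor_relations"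
proof -
  have \<kappa>1: "a \<otimes>\<^bsub>R\<^esub> (\<kappa> c \<otimes>\<^bsub>R\<^esub> x) = \<kappa> c \<otimes>\<^bsub>R\<^esub> (a \<otimes>\<^bsub>R\<^esub> x)" if "x \<in> carrier R" for c x
    using that assms(2) by (metis R.m_assoc \<kappa>_central \<kappa>_closed)
  have \<kappa>2: "b \<otimes>\<^bsub>S\<^esub> (\<kappa>' c \<otimes>\<^bsub>S\<^esub> x) = \<kappa>' c \<otimes>\<^bsub>S\<^esub> (b \<otimes>\<^bsub>S\<^esub> x)" if "x \<in> carrier S" for c x
    using that assms(3) by (metis S.m_assoc \<kappa>'_central \<kappa>'_closed)
  note simps = frag_times_diff_left frag_times_diff_right frag_times_of mult_DirProd R.l_distr R.r_distr S.l_distr S.r_distr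
  show "frag_times (R \<times>\<times> S) (frag_of (a, b)) r \<in> tensor_relations"
    using assms(1)
  proof (cases rule: tensor_relations_E)
    case (1 x x' y)
    then show ?thesis using assms by (simp add: simps tensor_relations_I)
  next
    case (2 x y y')
    then show ?thesis using assms by (simp add: simps tensor_relations_I)
  next
    case (3 c x y)
    then show ?thesis using assms by (simp add: simps tensor_relations_I \<kappa>1 \<kappa>2)
  qed
  show "frag_times (R \<times>\<times> S) r (frag_of (a, b)) \<in> tensor_relations"
    using assms(1)
  proof (cases rule: tensor_relations_E)
    case (1 x x' y)
    then show ?thesis using assms by (simp add: simps tensor_relations_I)
  next
    case (2 x y y')
    then show ?thesis using assms by (simp add: simps tensor_relations_I)
  next
    case (3 c x y)
    then show ?thesis using assms by (simp add: simps R.m_assoc S.m_assoc tensor_relations_I)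
  qed
qed

lemma relation_span_mult:
  assumes "p \<in> relation_span" "Poly_Mapping.keys w \<subseteq> carrier R \<times> carrier S"
  shows "frag_times (R \<times>\<times> S) w p \<in> relation_span" "frag_times (R \<times>\<times> S) p w \<in> relation_span"
proof -
  have *: "frag_times (R \<times>\<times> S) (frag_of (a, b)) p \<in> relation_span \<and> frag_times (R \<times>\<times> S) p (frag_of (a, b)) \<in> relation_span"
    if "a \<in> carrier R" "b \<in> carrier S" for a b
    using assms(1)
    by (induction rule: relation_span.induct)
      (use that in \<open>auto simp: frag_times_diff_left frag_times_diff_right intro: relation_span.intros tensor_relations_mult\<close>)
  show "frag_times (R \<times>\<times> S) w p \<in> relation_span" using assms(2)
    by (induction rule: frag_induction) (use * in \<open>auto simp: frag_times_diff_left intro: relation_span.intros\<close>)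
  show "frag_times (R \<times>\<times> S) p w \<in> relation_span" using assms(2)
    by (induction rule: frag_induction) (use * in \<open>auto simp: frag_times_diff_right intro: relation_span.intros\<close>)
qed

lemma ideal_relation_span: "ideal relation_span MR"
proof (rule idealI)
  show "subgroup relation_span (add_monoid MR)"
  proof (rule MR.add.subgroupI)
    show "relation_span \<subseteq> carrier MR" using relation_span_carrier by auto
    show "relation_span \<noteq> {}" using relation_span.zero by blast
    show "\<ominus>\<^bsub>MR\<^esub> a \<in> relation_span" if "a \<in> relation_span" for a
      using relation_span.diff[OF relation_span.zero that] MR_a_inv[of a] relation_span_carrier[OF that] by simp
    show "a \<oplus>\<^bsub>MR\<^esub> b \<in> relation_span" if "a \<in> relation_span" "b \<in> relation_span" for a b
      using relation_span.diff[OF that(1) relation_span.diff[OF relation_span.zero that(2)]] by simp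
  qed
qed (use relation_span_mult MR.ring_axioms in auto)

text \<open>
  Since the scalars are central, the additive span of the bilinearity relations is already an ideal;
  this is why additive maps, and not only ring morphisms, can be defined on the quotient.
\<close>

lemma TI_eq: "TI = relation_span"
proof
  show "TI \<subseteq> relation_span"
    unfolding tensor_ideal_def tensor_relations_def[symmetric]
    by (rule MR.genideal_minimal[OF ideal_relation_span]) (auto intro: relation_span.rel)
  have sub: "tensor_relations \<subseteq> carrier MR" using tensor_relations_carrier by auto
  interpret I: ideal "Idl\<^bsub>MR\<^esub> tensor_relations" MR by (rule MR.genideal_ideal[OF sub])
  show "relation_span \<subseteq> TI"
  proof
    fix p assume "p \<in> relation_span"
    then show "p \<in> TI"
      unfolding tensor_ideal_def tensor_relations_def[symmetric]
    proof (induction rule: relation_span.induct)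
      case zero
      show ?case using I.zero_closed by simp
    next
      case (rel r)
      then show ?case using MR.genideal_self[OF sub] by blast
    next
      case (diff p p')
      have p': "p' \<in> carrier MR" by (rule I.a_Hcarr[OF diff.IH(2)])
      have "p \<oplus>\<^bsub>MR\<^esub> (\<ominus>\<^bsub>MR\<^esub> p') \<in> Idl\<^bsub>MR\<^esub> tensor_relations"
        by (intro I.a_closed I.a_inv_closed diff.IH)
      then show ?case unfolding MR_a_inv[OF p'] by simp
    qed
  qed
qed

sublocale I: ideal TI MR unfolding TI_eq by (rule ideal_relation_span)

sublocale T: ring TR unfolding tensor_ring_def by (rule I.quotient_is_ring)

lemma pure_tclass: "pure x y = tclass (frag_of (x, y))" by (simp add: tensor_elem_def)

lemma pure_closed [simp]: "x \<in> carrier R \<Longrightarrow> y \<in> carrier S \<Longrightarrow> pure x y \<in> carrier TR"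
  unfolding pure_tclass tensor_ring_def by (rule I.quot_in) (simp add: keys_frag_of)

lemma T_carrier: "z \<in> carrier TR \<longleftrightarrow> (\<exists>p\<in>carrier MR. z = tclass p)"
  by (simp only: tensor_ring_def I.quot_carrier)

lemma tclass_add: "p \<in> carrier MR \<Longrightarrow> p' \<in> carrier MR \<Longrightarrow> tclass p \<oplus>\<^bsub>TR\<^esub> tclass p' = tclass (p + p')"
  using I.quot_add[of p p'] by (simp add: tensor_ring_def)

lemma tclass_in: "p \<in> carrier MR \<Longrightarrow> tclass p \<in> carrier TR" by (auto simp only: T_carrier)

lemma tclass_diff: "p \<in> carrier MR \<Longrightarrow> p' \<in> carrier MR \<Longrightarrow> tclass p \<ominus>\<^bsub>TR\<^esub> tclass p' = tclass (p - p')"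
  using tclass_add[of p "- p'"] I.quot_a_inv[of p'] by (simp add: tensor_ring_def a_minus_def)

lemma tclass_0: "tclass 0 = \<zero>\<^bsub>TR\<^esub>"
  using I.quot_zero by (simp add: tensor_ring_def)

lemma tclass_eq: "p \<in> carrier MR \<Longrightarrow> p' \<in> carrier MR \<Longrightarrow> tclass p = tclass p' \<longleftrightarrow> p - p' \<in> relation_span"
  using I.quot_eq[of p p'] by (simp add: TI_eq)

lemma pure_mult:
  "x \<in> carrier R \<Longrightarrow> x' \<in> carrier R \<Longrightarrow> y \<in> carrier S \<Longrightarrow> y' \<in> carrier S \<Longrightarrow>
    pure x y \<otimes>\<^bsub>TR\<^esub> pure x' y' = pure (x \<otimes>\<^bsub>R\<^esub> x') (y \<otimes>\<^bsub>S\<^esub> y')"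
  using I.quot_mult[of "frag_of (x, y)" "frag_of (x', y')"]
  by (simp add: pure_tclass tensor_ring_def keys_frag_of frag_times_of mult_DirProd)

lemma pure_one: "\<one>\<^bsub>TR\<^esub> = pure \<one>\<^bsub>R\<^esub> \<one>\<^bsub>S\<^esub>"
  using I.quot_one by (simp add: pure_tclass tensor_ring_def)

lemma pure_add_left:
  assumes "x \<in> carrier R" "x' \<in> carrier R" "y \<in> carrier S"
  shows "pure (x \<oplus>\<^bsub>R\<^esub> x') y = pure x y \<oplus>\<^bsub>TR\<^esub> pure x' y"
proof -
  have "frag_of (x \<oplus>\<^bsub>R\<^esub> x', y) - (frag_of (x, y) + frag_of (x', y)) \<in> relation_span"
    using relation_span.rel[OF tensor_relations_I(1)[OF assms]] by (simp add: algebra_simps)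
  then have "tclass (frag_of (x \<oplus>\<^bsub>R\<^esub> x', y)) = tclass (frag_of (x, y) + frag_of (x', y))"
    by (subst tclass_eq) (use assms MR.a_closed[of "frag_of (x, y)" "frag_of (x', y)"] in \<open>auto simp: keys_frag_of\<close>)
  then show ?thesis using assms by (simp add: pure_tclass tclass_add keys_frag_of)
qed

lemma pure_add_right:
  assumes "x \<in> carrier R" "y \<in> carrier S" "y' \<in> carrier S"
  shows "pure x (y \<oplus>\<^bsub>S\<^esub> y') = pure x y \<oplus>\<^bsub>TR\<^esub> pure x y'"
proof -
  have "frag_of (x, y \<oplus>\<^bsub>S\<^esub> y') - (frag_of (x, y) + frag_of (x, y')) \<in> relation_span"
    using relation_span.rel[OF tensor_relations_I(2)[OF assms]] by (simp add: algebra_simps)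
  then have "tclass (frag_of (x, y \<oplus>\<^bsub>S\<^esub> y')) = tclass (frag_of (x, y) + frag_of (x, y'))"
    by (subst tclass_eq) (use assms MR.a_closed[of "frag_of (x, y)" "frag_of (x, y')"] in \<open>auto simp: keys_frag_of\<close>)
  then show ?thesis using assms by (simp add: pure_tclass tclass_add keys_frag_of)
qed

lemma pure_balanced:
  assumes "x \<in> carrier R" "y \<in> carrier S"
  shows "pure (\<kappa> c \<otimes>\<^bsub>R\<^esub> x) y = pure x (\<kappa>' c \<otimes>\<^bsub>S\<^esub> y)"
  unfolding pure_tclass using relation_span.rel[OF tensor_relations_I(3)[OF assms, of c]]
  by (subst tclass_eq) (use assms in \<open>auto simp: keys_frag_of\<close>)

lemma pure_zero_left: "y \<in> carrier S \<Longrightarrow> pure \<zero>\<^bsub>R\<^esub> y = \<zero>\<^bsub>TR\<^esub>"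
  using pure_add_left[of "\<zero>\<^bsub>R\<^esub>" "\<zero>\<^bsub>R\<^esub>" y] by (simp add: T.add.l_cancel_one')
lemma pure_zero_right: "x \<in> carrier R \<Longrightarrow> pure x \<zero>\<^bsub>S\<^esub> = \<zero>\<^bsub>TR\<^esub>"
  using pure_add_right[of x "\<zero>\<^bsub>S\<^esub>" "\<zero>\<^bsub>S\<^esub>"] by (simp add: T.add.l_cancel_one')

lemma pure_uminus: "x \<in> carrier R \<Longrightarrow> y \<in> carrier S \<Longrightarrow> \<ominus>\<^bsub>TR\<^esub> pure x y = pure (\<ominus>\<^bsub>R\<^esub> x) y"
  by (rule T.minus_equality) (simp_all flip: pure_add_left add: R.l_neg pure_zero_left)

lemma T_induct [consumes 1, case_names zero pure add]:
  assumes z: "z \<in> carrier TR" and 0: "P \<zero>\<^bsub>TR\<^esub>"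
    and pure: "\<And>x y. x \<in> carrier R \<Longrightarrow> y \<in> carrier S \<Longrightarrow> P (pure x y)"
    and add: "\<And>z w. z \<in> carrier TR \<Longrightarrow> w \<in> carrier TR \<Longrightarrow> P z \<Longrightarrow> P w \<Longrightarrow> P (z \<oplus>\<^bsub>TR\<^esub> w)"
  shows "P z"
proof -
  obtain p where p: "p \<in> carrier MR" "z = tclass p" using iffD1[OF T_carrier z] by (rule bexE)
  from p(1) have "Poly_Mapping.keys p \<subseteq> carrier R \<times> carrier S" by simp
  then have "tclass p \<in> carrier TR \<and> P (tclass p) \<and> P (\<ominus>\<^bsub>TR\<^esub> tclass p) \<and> p \<in> carrier MR"
  proof (induction rule: frag_induction)
    case zero
    show ?case by (simp add: tclass_0 0)
  next
    case (one a)
    then show ?case by (cases a) (auto simp: pure pure_uminus keys_frag_of simp flip: pure_tclass)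
  next
    case (diff a b)
    then have "tclass (a - b) = tclass a \<oplus>\<^bsub>TR\<^esub> \<ominus>\<^bsub>TR\<^esub> tclass b" "\<ominus>\<^bsub>TR\<^esub> tclass (a - b) = \<ominus>\<^bsub>TR\<^esub> tclass a \<oplus>\<^bsub>TR\<^esub> tclass b"
      by (simp_all add: a_minus_def T.minus_add T.minus_minus T.a_inv_closed tclass_in del: MR_simps flip: tclass_diff)
    moreover have "a - b \<in> carrier MR" using MR.minus_closed[of a b] diff by simp
    ultimately show ?case using diff by (auto intro: add simp del: MR_simps)
  qed
  then show ?thesis using p by blast
qed

lemma frag_extend_closed:
  assumes "Poly_Mapping.keys p \<subseteq> A" "\<And>a. a \<in> A \<Longrightarrow> Poly_Mapping.keys (G a) \<subseteq> B"
  shows "Poly_Mapping.keys (frag_extend G p) \<subseteq> B"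
  by (rule order_trans[OF keys_frag_extend]) (use assms in blast)

text \<open>
  An additive map from the free abelian group factors through the tensor product as soon as it
  vanishes on the three families of relations, since these span the ideal additively.
\<close>

lemma T_additive_map:
  assumes "abelian_group M"
    and closed: "\<And>x y. x \<in> carrier R \<Longrightarrow> y \<in> carrier S \<Longrightarrow> f x y \<in> carrier M"
    and left: "\<And>x x' y. x \<in> carrier R \<Longrightarrow> x' \<in> carrier R \<Longrightarrow> y \<in> carrier S \<Longrightarrow>
      f (x \<oplus>\<^bsub>R\<^esub> x') y = f x y \<oplus>\<^bsub>M\<^esub> f x' y"
    and right: "\<And>x y y'. x \<in> carrier R \<Longrightarrow> y \<in> carrier S \<Longrightarrow> y' \<in> carrier S \<Longrightarrow>
      f x (y \<oplus>\<^bsub>S\<^esub> y') = f x y \<oplus>\<^bsub>M\<^esub> f x y'"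
    and bal: "\<And>c x y. x \<in> carrier R \<Longrightarrow> y \<in> carrier S \<Longrightarrow> f (\<kappa> c \<otimes>\<^bsub>R\<^esub> x) y = f x (\<kappa>' c \<otimes>\<^bsub>S\<^esub> y)"
  shows "\<exists>h. (\<forall>z\<in>carrier TR. h z \<in> carrier M) \<and>
    (\<forall>z\<in>carrier TR. \<forall>w\<in>carrier TR. h (z \<oplus>\<^bsub>TR\<^esub> w) = h z \<oplus>\<^bsub>M\<^esub> h w) \<and>
    (\<forall>x\<in>carrier R. \<forall>y\<in>carrier S. h (pure x y) = f x y)"
proof -
  interpret M: abelian_group M by (rule assms(1))
  obtain g where g: "g \<in> hom (free_Abelian_group (carrier R \<times> carrier S)) (add_monoid M)"
    and g_of: "\<And>a. a \<in> carrier R \<times> carrier S \<Longrightarrow> g (frag_of a) = (\<lambda>(x, y). f x y) a"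
    by (rule M.add.free_Abelian_group_universal[of "\<lambda>(x, y). f x y" "carrier R \<times> carrier S"])
      (use closed in auto)
  have g_closed: "g p \<in> carrier M" if "p \<in> carrier MR" for p
    using hom_in_carrier[OF g, of p] that by (simp add: free_Abelian_group_def)
  have g_add: "g (p + p') = g p \<oplus>\<^bsub>M\<^esub> g p'" if "p \<in> carrier MR" "p' \<in> carrier MR" for p p'
    using hom_mult[OF g, of p p'] that by (simp add: free_Abelian_group_def)
  have g_0: "g 0 = \<zero>\<^bsub>M\<^esub>"
    using g_add[of 0 0] g_closed[of 0] by (simp add: M.add.l_cancel_one')
  have g_diff: "g (p - p') = g p \<ominus>\<^bsub>M\<^esub> g p'" if "p \<in> carrier MR" "p' \<in> carrier MR" for p p'
  proof -
    have d: "p - p' \<in> carrier MR" using MR.minus_closed[OF that] that by simp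
    have "g p = g (p - p') \<oplus>\<^bsub>M\<^esub> g p'" using g_add[OF d that(2)] by simp
    moreover have "x \<oplus>\<^bsub>M\<^esub> y \<ominus>\<^bsub>M\<^esub> y = x" if "x \<in> carrier M" "y \<in> carrier M" for x y
      using that by (simp add: a_minus_def M.a_assoc M.r_neg)
    ultimately show ?thesis using g_closed[OF d] g_closed[OF that(2)] by simp
  qed
  have minus: "x \<oplus>\<^bsub>M\<^esub> y \<ominus>\<^bsub>M\<^esub> x \<ominus>\<^bsub>M\<^esub> y = \<zero>\<^bsub>M\<^esub>" if "x \<in> carrier M" "y \<in> carrier M" for x y
  proof -
    have "x \<oplus>\<^bsub>M\<^esub> y \<ominus>\<^bsub>M\<^esub> x = y" using that by (simp add: a_minus_def M.a_comm[of x y] M.a_assoc M.r_neg)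
    then show ?thesis using that by (simp add: a_minus_def M.r_neg)
  qed
  have kill: "g p = \<zero>\<^bsub>M\<^esub> \<and> p \<in> carrier MR" if "p \<in> relation_span" for p
    using that
  proof (induction rule: relation_span.induct)
    case zero
    show ?case by (simp add: g_0)
  next
    case (rel r)
    have dd: "frag_of a - frag_of b \<in> carrier MR"
      if "a \<in> carrier R \<times> carrier S" "b \<in> carrier R \<times> carrier S" for a b
      using that MR.minus_closed[of "frag_of a" "frag_of b"] by (simp add: keys_frag_of)
    have f1: "frag_of a \<in> carrier MR" if "a \<in> carrier R \<times> carrier S" for a
      using that by (simp add: keys_frag_of)
    have g2: "g (frag_of a - frag_of b) = (\<lambda>(x, y). f x y) a \<ominus>\<^bsub>M\<^esub> (\<lambda>(x, y). f x y) b"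
      if "a \<in> carrier R \<times> carrier S" "b \<in> carrier R \<times> carrier S" for a b
      using g_diff[OF f1[OF that(1)] f1[OF that(2)]] g_of[OF that(1)] g_of[OF that(2)] by simp
    have g3: "g (frag_of a - frag_of b - frag_of c)
        = (\<lambda>(x, y). f x y) a \<ominus>\<^bsub>M\<^esub> (\<lambda>(x, y). f x y) b \<ominus>\<^bsub>M\<^esub> (\<lambda>(x, y). f x y) c"
      if "a \<in> carrier R \<times> carrier S" "b \<in> carrier R \<times> carrier S" "c \<in> carrier R \<times> carrier S" for a b c
      using g_diff[OF dd[OF that(1,2)] f1[OF that(3)]] g2[OF that(1,2)] g_of[OF that(3)] by simp
    from rel have "g r = \<zero>\<^bsub>M\<^esub>"
    proof (cases rule: tensor_relations_E)
      case (1 x x' y)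
      then have "g r = f (x \<oplus>\<^bsub>R\<^esub> x') y \<ominus>\<^bsub>M\<^esub> f x y \<ominus>\<^bsub>M\<^esub> f x' y"
        by (simp add: g3)
      then show ?thesis using 1 by (simp add: left minus closed)
    next
      case (2 x y y')
      then have "g r = f x (y \<oplus>\<^bsub>S\<^esub> y') \<ominus>\<^bsub>M\<^esub> f x y \<ominus>\<^bsub>M\<^esub> f x y'"
        by (simp add: g3)
      then show ?thesis using 2 by (simp add: right minus closed)
    next
      case (3 c x y)
      then have "g r = f (\<kappa> c \<otimes>\<^bsub>R\<^esub> x) y \<ominus>\<^bsub>M\<^esub> f x (\<kappa>' c \<otimes>\<^bsub>S\<^esub> y)"
        by (simp add: g2)
      then show ?thesis using 3 by (simp add: bal a_minus_def M.r_neg closed)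
    qed
    then show ?case using tensor_relations_carrier[OF rel] by simp
  next
    case (diff p p')
    then show ?case using g_diff[of p p'] MR.minus_closed[of p p'] by (simp add: a_minus_def)
  qed
  have "\<exists>h. \<forall>p\<in>carrier MR. h (tclass p) = g p"
  proof (rule I.quot_lift)
    fix p p' assume p: "p \<in> carrier MR" "p' \<in> carrier MR" "p \<ominus>\<^bsub>MR\<^esub> p' \<in> TI"
    then have "p - p' \<in> relation_span" by (simp add: TI_eq)
    with kill g_diff p have "g p \<ominus>\<^bsub>M\<^esub> g p' = \<zero>\<^bsub>M\<^esub>" by metis
    then show "g p = g p'" using M.minus_equality[of "g p" "\<ominus>\<^bsub>M\<^esub> g p'"] g_closed[OF p(1)] g_closed[OF p(2)] by (simp add: a_minus_def)
  qed
  then obtain h where h: "\<And>p. p \<in> carrier MR \<Longrightarrow> h (tclass p) = g p" by blast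
  show ?thesis
  proof (intro exI conjI ballI)
    show "h z \<in> carrier M" if "z \<in> carrier TR" for z
      using that h g_closed unfolding T_carrier by metis
    show "h (z \<oplus>\<^bsub>TR\<^esub> w) = h z \<oplus>\<^bsub>M\<^esub> h w" if zw: "z \<in> carrier TR" "w \<in> carrier TR" for z w
    proof -
      obtain p where pp1: "p \<in> carrier MR" "z = tclass p" using iffD1[OF T_carrier zw(1)] by (rule bexE)
      obtain p' where pp2: "p' \<in> carrier MR" "w = tclass p'" using iffD1[OF T_carrier zw(2)] by (rule bexE)
      note pp = pp1 pp2
      have "p + p' \<in> carrier MR" using MR.a_closed[OF pp(1,3)] by simp
      then show ?thesis using pp by (simp add: tclass_add h g_add del: MR_simps(1))
    qed
    show "h (pure x y) = f x y" if "x \<in> carrier R" "y \<in> carrier S" for x y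
      using that by (simp add: pure_tclass h g_of keys_frag_of)
  qed
qed

lemma T_additive_0:
  assumes "abelian_group M"
    and "\<And>z. z \<in> carrier TR \<Longrightarrow> h z \<in> carrier M"
    and "\<And>z w. z \<in> carrier TR \<Longrightarrow> w \<in> carrier TR \<Longrightarrow> h (z \<oplus>\<^bsub>TR\<^esub> w) = h z \<oplus>\<^bsub>M\<^esub> h w"
  shows "h \<zero>\<^bsub>TR\<^esub> = \<zero>\<^bsub>M\<^esub>"
proof -
  interpret M: abelian_group M by (rule assms(1))
  show ?thesis
    using assms(3)[of "\<zero>\<^bsub>TR\<^esub>" "\<zero>\<^bsub>TR\<^esub>"] assms(2)[of "\<zero>\<^bsub>TR\<^esub>"] by (simp add: M.add.l_cancel_one')
qed

lemma T_additive_unique: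
  assumes M: "abelian_group M"
    and h: "\<And>z. z \<in> carrier TR \<Longrightarrow> h z \<in> carrier M"
      "\<And>z w. z \<in> carrier TR \<Longrightarrow> w \<in> carrier TR \<Longrightarrow> h (z \<oplus>\<^bsub>TR\<^esub> w) = h z \<oplus>\<^bsub>M\<^esub> h w"
    and h': "\<And>z. z \<in> carrier TR \<Longrightarrow> h' z \<in> carrier M"
      "\<And>z w. z \<in> carrier TR \<Longrightarrow> w \<in> carrier TR \<Longrightarrow> h' (z \<oplus>\<^bsub>TR\<^esub> w) = h' z \<oplus>\<^bsub>M\<^esub> h' w"
    and eq: "\<And>x y. x \<in> carrier R \<Longrightarrow> y \<in> carrier S \<Longrightarrow> h (pure x y) = h' (pure x y)"
    and z: "z \<in> carrier TR"
  shows "h z = h' z"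
  using z
  by (induction rule: T_induct) (simp_all add: eq h h' T_additive_0[OF M h] T_additive_0[OF M h'])

text \<open>
  An additive map is multiplicative if it is so on the elements \<open>x \<otimes> y\<close>, which span the tensor product.
\<close>

lemma T_ring_map:
  assumes "ring M"
    and closed: "\<And>x y. x \<in> carrier R \<Longrightarrow> y \<in> carrier S \<Longrightarrow> f x y \<in> carrier M"
    and left: "\<And>x x' y. x \<in> carrier R \<Longrightarrow> x' \<in> carrier R \<Longrightarrow> y \<in> carrier S \<Longrightarrow>
      f (x \<oplus>\<^bsub>R\<^esub> x') y = f x y \<oplus>\<^bsub>M\<^esub> f x' y"
    and right: "\<And>x y y'. x \<in> carrier R \<Longrightarrow> y \<in> carrier S \<Longrightarrow> y' \<in> carrier S \<Longrightarrow>
      f x (y \<oplus>\<^bsub>S\<^esub> y') = f x y \<oplus>\<^bsub>M\<^esub> f x y'"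
    and bal: "\<And>c x y. x \<in> carrier R \<Longrightarrow> y \<in> carrier S \<Longrightarrow> f (\<kappa> c \<otimes>\<^bsub>R\<^esub> x) y = f x (\<kappa>' c \<otimes>\<^bsub>S\<^esub> y)"
    and mult: "\<And>x x' y y'. x \<in> carrier R \<Longrightarrow> x' \<in> carrier R \<Longrightarrow> y \<in> carrier S \<Longrightarrow> y' \<in> carrier S \<Longrightarrow>
      f (x \<otimes>\<^bsub>R\<^esub> x') (y \<otimes>\<^bsub>S\<^esub> y') = f x y \<otimes>\<^bsub>M\<^esub> f x' y'"
    and one: "f \<one>\<^bsub>R\<^esub> \<one>\<^bsub>S\<^esub> = \<one>\<^bsub>M\<^esub>"
  shows "\<exists>h \<in> Ring.ring_hom TR M. \<forall>x\<in>carrier R. \<forall>y\<in>carrier S. h (pure x y) = f x y"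
proof -
  interpret M: ring M by (rule assms(1))
  obtain h where h: "\<And>z. z \<in> carrier TR \<Longrightarrow> h z \<in> carrier M"
    "\<And>z w. z \<in> carrier TR \<Longrightarrow> w \<in> carrier TR \<Longrightarrow> h (z \<oplus>\<^bsub>TR\<^esub> w) = h z \<oplus>\<^bsub>M\<^esub> h w"
    and pure: "\<And>x y. x \<in> carrier R \<Longrightarrow> y \<in> carrier S \<Longrightarrow> h (pure x y) = f x y"
  proof -
    have "\<exists>h. (\<forall>z\<in>carrier TR. h z \<in> carrier M) \<and>
      (\<forall>z\<in>carrier TR. \<forall>w\<in>carrier TR. h (z \<oplus>\<^bsub>TR\<^esub> w) = h z \<oplus>\<^bsub>M\<^esub> h w) \<and>
      (\<forall>x\<in>carrier R. \<forall>y\<in>carrier S. h (pure x y) = f x y)"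
      by (rule T_additive_map[of M f]) (fact M.abelian_group_axioms closed left right bal)+
    then show ?thesis using that by blast
  qed
  note h0 = T_additive_0[OF M.abelian_group_axioms h]
  have "h (z \<otimes>\<^bsub>TR\<^esub> w) = h z \<otimes>\<^bsub>M\<^esub> h w" if "z \<in> carrier TR" "w \<in> carrier TR" for z w
    using that(1)
  proof (induction rule: T_induct)
    case (pure x y)
    show ?case using that(2)
      by (induction rule: T_induct)
        (simp_all add: pure h h0 pure_mult T.r_distr M.r_distr mult \<open>\<And>x y. x \<in> carrier R \<Longrightarrow> y \<in> carrier S \<Longrightarrow> h (pure x y) = f x y\<close> closed)
  qed (simp_all add: h h0 T.l_distr M.l_distr that)
  then have "h \<in> Ring.ring_hom TR M"
    by (intro ring_hom_memI) (simp_all add: h pure_one pure one)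
  then show ?thesis using pure by blast
qed

end

text \<open>
  A map from pairs to formal sums of pairs induces an additive map between tensor products, whose
  value on a coset is the coset of the images of its elements.
\<close>

locale two_tensors = A: tensor R S \<kappa> \<kappa>' + B: tensor R' S' \<mu> \<mu>'
  for R :: "('r, 'y) ring_scheme" and S :: "('s, 'z) ring_scheme" and \<kappa> :: "'k \<Rightarrow> 'r" and \<kappa>' :: "'k \<Rightarrow> 's"
  and R' :: "('r1, 'y1) ring_scheme" and S' :: "('s1, 'z1) ring_scheme" and \<mu> :: "'k1 \<Rightarrow> 'r1" and \<mu>' :: "'k1 \<Rightarrow> 's1"
begin

text \<open>
  By the universal property there is an additive map with the prescribed values. It agrees with the
  union of cosets because every element of a coset has the same image.
\<close>

lemma induced_map:
  assumes G: "\<And>x y. x \<in> carrier R \<Longrightarrow> y \<in> carrier S \<Longrightarrow> G (x, y) \<in> carrier B.MR"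
    and left: "\<And>x x' y. x \<in> carrier R \<Longrightarrow> x' \<in> carrier R \<Longrightarrow> y \<in> carrier S \<Longrightarrow>
      B.tclass (G (x \<oplus>\<^bsub>R\<^esub> x', y)) = B.tclass (G (x, y)) \<oplus>\<^bsub>B.TR\<^esub> B.tclass (G (x', y))"
    and right: "\<And>x y y'. x \<in> carrier R \<Longrightarrow> y \<in> carrier S \<Longrightarrow> y' \<in> carrier S \<Longrightarrow>
      B.tclass (G (x, y \<oplus>\<^bsub>S\<^esub> y')) = B.tclass (G (x, y)) \<oplus>\<^bsub>B.TR\<^esub> B.tclass (G (x, y'))"
    and bal: "\<And>c x y. x \<in> carrier R \<Longrightarrow> y \<in> carrier S \<Longrightarrow>
      B.tclass (G (\<kappa> c \<otimes>\<^bsub>R\<^esub> x, y)) = B.tclass (G (x, \<kappa>' c \<otimes>\<^bsub>S\<^esub> y))"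
  defines "F \<equiv> \<lambda>z. \<Union>p\<in>z. B.tclass (frag_extend G p)"
  shows "z \<in> carrier A.TR \<Longrightarrow> F z \<in> carrier B.TR"
    and "z \<in> carrier A.TR \<Longrightarrow> w \<in> carrier A.TR \<Longrightarrow> F (z \<oplus>\<^bsub>A.TR\<^esub> w) = F z \<oplus>\<^bsub>B.TR\<^esub> F w"
    and "x \<in> carrier R \<Longrightarrow> y \<in> carrier S \<Longrightarrow> F (A.pure x y) = B.tclass (G (x, y))"
proof -
  obtain h where h: "\<And>z. z \<in> carrier A.TR \<Longrightarrow> h z \<in> carrier B.TR"
    "\<And>z w. z \<in> carrier A.TR \<Longrightarrow> w \<in> carrier A.TR \<Longrightarrow> h (z \<oplus>\<^bsub>A.TR\<^esub> w) = h z \<oplus>\<^bsub>B.TR\<^esub> h w"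
    and pure: "\<And>x y. x \<in> carrier R \<Longrightarrow> y \<in> carrier S \<Longrightarrow> h (A.pure x y) = B.tclass (G (x, y))"
  proof -
    have "\<exists>h. (\<forall>z\<in>carrier A.TR. h z \<in> carrier B.TR) \<and>
      (\<forall>z\<in>carrier A.TR. \<forall>w\<in>carrier A.TR. h (z \<oplus>\<^bsub>A.TR\<^esub> w) = h z \<oplus>\<^bsub>B.TR\<^esub> h w) \<and>
      (\<forall>x\<in>carrier R. \<forall>y\<in>carrier S. h (A.pure x y) = B.tclass (G (x, y)))"
      by (rule A.T_additive_map[of B.TR "\<lambda>x y. B.tclass (G (x, y))"])
        (fact B.T.abelian_group_axioms B.tclass_in[OF G] left right bal)+
    then show ?thesis using that by blast
  qed
  have fc: "Poly_Mapping.keys (frag_extend G p) \<subseteq> carrier R' \<times> carrier S'"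
    if "Poly_Mapping.keys p \<subseteq> carrier R \<times> carrier S" for p
    by (rule A.frag_extend_closed[OF that]) (use G in auto)
  have hm: "h (z \<ominus>\<^bsub>A.TR\<^esub> w) = h z \<ominus>\<^bsub>B.TR\<^esub> h w" if "z \<in> carrier A.TR" "w \<in> carrier A.TR" for z w
  proof -
    have "h (\<ominus>\<^bsub>A.TR\<^esub> w) \<oplus>\<^bsub>B.TR\<^esub> h w = \<zero>\<^bsub>B.TR\<^esub>"
      using that h(2)[of "\<ominus>\<^bsub>A.TR\<^esub> w" w] A.T_additive_0[OF B.T.abelian_group_axioms h]
      by (simp add: A.T.l_neg)
    then have "h (\<ominus>\<^bsub>A.TR\<^esub> w) = \<ominus>\<^bsub>B.TR\<^esub> h w" using that h(1) B.T.minus_equality by simp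
    then show ?thesis using that h(2) by (simp add: a_minus_def)
  qed
  have hc: "h (A.tclass p) = B.tclass (frag_extend G p)" if "p \<in> carrier A.MR" for p
  proof -
    have "Poly_Mapping.keys p \<subseteq> carrier R \<times> carrier S" using that by simp
    then have "h (A.tclass p) = B.tclass (frag_extend G p) \<and> p \<in> carrier A.MR"
    proof (induction rule: frag_induction)
      case zero
      show ?case using A.T_additive_0[OF B.T.abelian_group_axioms h] by (simp add: A.tclass_0 B.tclass_0)
    next
      case (one a)
      then show ?case by (cases a) (auto simp: pure keys_frag_of simp flip: A.pure_tclass)
    next
      case (diff a b)
      then have "a - b \<in> carrier A.MR" using A.MR.minus_closed[of a b] by simp
      moreover have "h (A.tclass (a - b)) = h (A.tclass a) \<ominus>\<^bsub>B.TR\<^esub> h (A.tclass b)"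
        using diff by (simp add: hm A.tclass_in del: A.MR_simps(1) flip: A.tclass_diff)
      ultimately show ?case
        using diff fc[of a] fc[of b] B.tclass_diff[of "frag_extend G a" "frag_extend G b"]
        by (simp add: frag_extend_diff)
    qed
    then show ?thesis ..
  qed
  have F: "F z = h z" if zT: "z \<in> carrier A.TR" for z
  proof -
    obtain p where p: "p \<in> carrier A.MR" "z = A.tclass p" using iffD1[OF A.T_carrier zT] by (rule bexE)
    have "B.tclass (frag_extend G p') = h z" if "p' \<in> z" for p'
      using that A.I.quot_mem[OF p(1), of p'] hc[of p'] p(2) by simp
    moreover have "p \<in> z" using A.I.quot_mem[OF p(1), of p] p by simp
    ultimately show ?thesis unfolding F_def by auto
  qed
  show "z \<in> carrier A.TR \<Longrightarrow> F z \<in> carrier B.TR" by (simp add: F h)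
  show "z \<in> carrier A.TR \<Longrightarrow> w \<in> carrier A.TR \<Longrightarrow> F (z \<oplus>\<^bsub>A.TR\<^esub> w) = F z \<oplus>\<^bsub>B.TR\<^esub> F w"
    by (simp add: F h)
  show "x \<in> carrier R \<Longrightarrow> y \<in> carrier S \<Longrightarrow> F (A.pure x y) = B.tclass (G (x, y))" by (simp add: F pure)
qed

end

section \<open>The quantum group\<close>

lemma ring_hom_restrict:
  assumes "ring R" "h \<in> Ring.ring_hom R M" shows "restrict h (carrier R) \<in> Ring.ring_hom R M"
proof -
  interpret ring R by (rule assms(1))
  show ?thesis using assms(2)
    by (intro ring_hom_memI) (simp_all add: ring_hom_closed ring_hom_mult ring_hom_add ring_hom_one)
qed

lemma poly_mapping_single_induct [case_names zero single add]:
  fixes p :: "'k \<Rightarrow>\<^sub>0 'v::ab_group_add"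
  assumes "P 0" "\<And>k v. P (Poly_Mapping.single k v)" "\<And>p p'. P p \<Longrightarrow> P p' \<Longrightarrow> P (p + p')"
  shows "P p"
proof -
  have "P (\<Sum>k\<in>A. Poly_Mapping.single k (Poly_Mapping.lookup p k))" if "finite A" for A
    using that by (induction A rule: finite_induct) (simp_all add: assms)
  moreover have "p = (\<Sum>k\<in>Poly_Mapping.keys p. Poly_Mapping.single k (Poly_Mapping.lookup p k))"
  proof (rule poly_mapping_eqI)
    fix k
    have "Poly_Mapping.lookup (\<Sum>k\<in>Poly_Mapping.keys p. Poly_Mapping.single k (Poly_Mapping.lookup p k)) k
        = (\<Sum>l\<in>Poly_Mapping.keys p. if l = k then Poly_Mapping.lookup p l else 0)"
      by (simp add: lookup_sum lookup_single when_def)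
    then show "Poly_Mapping.lookup p k = Poly_Mapping.lookup (\<Sum>k\<in>Poly_Mapping.keys p. Poly_Mapping.single k (Poly_Mapping.lookup p k)) k"
      by (simp add: sum.delta in_keys_iff)
  qed
  ultimately show ?thesis by (metis finite_keys)
qed

text \<open>
  Evaluation of the free algebra at the elements \<open>g\<close>, with coefficients mapped by \<open>\<kappa>\<close>. It is
  multiplicative because the images of the coefficients are central.
\<close>

locale free_map = M: ring M for M :: "('m, 'z) ring_scheme" +
  fixes \<kappa> :: "complex \<Rightarrow> 'm" and g :: "hgen \<Rightarrow> 'm"
  assumes \<kappa>_hom: "\<kappa> \<in> Ring.ring_hom type_ring M"
    and \<kappa>_central: "x \<in> carrier M \<Longrightarrow> \<kappa> c \<otimes>\<^bsub>M\<^esub> x = x \<otimes>\<^bsub>M\<^esub> \<kappa> c"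
    and g_closed [simp]: "g a \<in> carrier M"
begin

lemma \<kappa>_simps [simp]: "\<kappa> c \<in> carrier M" "\<kappa> 1 = \<one>\<^bsub>M\<^esub>"
  and \<kappa>_mult: "\<kappa> (c * d) = \<kappa> c \<otimes>\<^bsub>M\<^esub> \<kappa> d" and \<kappa>_add: "\<kappa> (c + d) = \<kappa> c \<oplus>\<^bsub>M\<^esub> \<kappa> d"
  using ring_hom_closed[OF \<kappa>_hom, of c] ring_hom_mult[OF \<kappa>_hom, of c d] ring_hom_add[OF \<kappa>_hom, of c d]
    ring_hom_one[OF \<kappa>_hom] by simp_all

lemma \<kappa>_0 [simp]: "\<kappa> 0 = \<zero>\<^bsub>M\<^esub>"
  using \<kappa>_add[of 0 0] by (simp add: M.add.l_cancel_one')

definition wval :: "hgen word \<Rightarrow> 'm" where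
  "wval w = (case w of Word xs \<Rightarrow> foldr (\<lambda>a y. g a \<otimes>\<^bsub>M\<^esub> y) xs \<one>\<^bsub>M\<^esub>)"

lemma wval_list_closed: "foldr (\<lambda>a y. g a \<otimes>\<^bsub>M\<^esub> y) xs \<one>\<^bsub>M\<^esub> \<in> carrier M"
  by (induction xs) simp_all

lemma wval_closed [simp]: "wval w \<in> carrier M"
  by (cases w) (simp add: wval_def wval_list_closed)

lemma wval_add: "wval (w + w') = wval w \<otimes>\<^bsub>M\<^esub> wval w'"
proof (cases w; cases w')
  fix xs ys assume "w = Word xs" "w' = Word ys"
  moreover have "foldr (\<lambda>a y. g a \<otimes>\<^bsub>M\<^esub> y) (xs @ ys) \<one>\<^bsub>M\<^esub>
      = foldr (\<lambda>a y. g a \<otimes>\<^bsub>M\<^esub> y) xs \<one>\<^bsub>M\<^esub> \<otimes>\<^bsub>M\<^esub> foldr (\<lambda>a y. g a \<otimes>\<^bsub>M\<^esub> y) ys \<one>\<^bsub>M\<^esub>"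
    using wval_list_closed by (induction xs) (simp_all add: M.m_assoc)
  ultimately show ?thesis by (simp add: wval_def)
qed

lemma wval_0: "wval 0 = \<one>\<^bsub>M\<^esub>" by (simp add: wval_def zero_word_def)

definition fval :: "hfree \<Rightarrow> 'm" where
  "fval p = finsum M (\<lambda>w. \<kappa> (Poly_Mapping.lookup p w) \<otimes>\<^bsub>M\<^esub> wval w) (Poly_Mapping.keys p)"

lemma fval_superset:
  assumes "finite A" "Poly_Mapping.keys p \<subseteq> A"
  shows "fval p = finsum M (\<lambda>w. \<kappa> (Poly_Mapping.lookup p w) \<otimes>\<^bsub>M\<^esub> wval w) A"
  unfolding fval_def
  by (rule M.add.finprod_mono_neutral_cong_left) (use assms in \<open>auto simp: in_keys_iff\<close>)

lemma fval_closed [simp]: "fval p \<in> carrier M"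
  by (simp add: fval_def)

lemma fval_add: "fval (p + p') = fval p \<oplus>\<^bsub>M\<^esub> fval p'"
proof -
  define A where "A = Poly_Mapping.keys p \<union> Poly_Mapping.keys p'"
  have A: "finite A" "Poly_Mapping.keys p \<subseteq> A" "Poly_Mapping.keys p' \<subseteq> A" "Poly_Mapping.keys (p + p') \<subseteq> A"
    using keys_add[of p p'] by (auto simp: A_def)
  have "fval (p + p') = finsum M (\<lambda>w. \<kappa> (Poly_Mapping.lookup p w) \<otimes>\<^bsub>M\<^esub> wval w \<oplus>\<^bsub>M\<^esub> \<kappa> (Poly_Mapping.lookup p' w) \<otimes>\<^bsub>M\<^esub> wval w) A"
    unfolding fval_superset[OF A(1,4)] by (intro M.finsum_cong') (simp_all add: lookup_add \<kappa>_add M.l_distr)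
  also have "\<dots> = fval p \<oplus>\<^bsub>M\<^esub> fval p'"
    unfolding fval_superset[OF A(1,2)] fval_superset[OF A(1,3)] by (rule M.finsum_addf) auto
  finally show ?thesis .
qed

lemma fval_single: "fval (Poly_Mapping.single w c) = \<kappa> c \<otimes>\<^bsub>M\<^esub> wval w"
  using fval_superset[of "{w}" "Poly_Mapping.single w c"] by (simp add: lookup_single)

lemma fval_0: "fval 0 = \<zero>\<^bsub>M\<^esub>"
  by (simp add: fval_def)

lemma fval_mult: "fval (p * p') = fval p \<otimes>\<^bsub>M\<^esub> fval p'"
proof (induction p rule: poly_mapping_single_induct)
  case (single w c)
  show ?case
  proof (induction p' rule: poly_mapping_single_induct)
    case (single w' c')
    have "\<kappa> c \<otimes>\<^bsub>M\<^esub> \<kappa> c' \<otimes>\<^bsub>M\<^esub> (wval w \<otimes>\<^bsub>M\<^esub> wval w') = \<kappa> c \<otimes>\<^bsub>M\<^esub> (\<kappa> c' \<otimes>\<^bsub>M\<^esub> wval w) \<otimes>\<^bsub>M\<^esub> wval w'"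
      by (simp add: M.m_assoc)
    also have "\<dots> = \<kappa> c \<otimes>\<^bsub>M\<^esub> wval w \<otimes>\<^bsub>M\<^esub> (\<kappa> c' \<otimes>\<^bsub>M\<^esub> wval w')"
      unfolding \<kappa>_central[OF wval_closed[of w], of c'] by (simp add: M.m_assoc)
    finally show ?case by (simp add: mult_single fval_single \<kappa>_mult wval_add)
  qed (simp_all add: distrib_left fval_add M.r_distr fval_0)
qed (simp_all add: distrib_right fval_add M.l_distr fval_0)

lemma fval_minus: "fval (- p) = \<ominus>\<^bsub>M\<^esub> fval p"
  using fval_add[of "- p" p] by (intro M.minus_equality[symmetric]) (simp_all add: fval_0)

end

lemma ring_free: "ring (type_ring :: hfree ring)" by (rule ring_type_ring)

lemma H_ideal_ideal: "ideal (H_ideal q) (type_ring :: hfree ring)"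
  unfolding H_ideal_def by (rule ring.genideal_ideal[OF ring_free]) simp

locale hopf = fixes q :: complex
begin

sublocale HI: ideal "H_ideal q" "type_ring :: hfree ring" by (rule H_ideal_ideal)
sublocale H: ring "H_ring q" unfolding H_ring_def by (rule HI.quotient_is_ring)

lemma H_class_closed [simp]: "H_class q p \<in> carrier (H_ring q)"
  using HI.quot_in[of p] by (simp add: H_class_def H_ring_def)
lemma H_const_closed [simp]: "H_const q c \<in> carrier (H_ring q)" by (simp add: H_const_def)
lemma H_gen_closed [simp]: "H_gen q a \<in> carrier (H_ring q)" by (simp add: H_gen_def)
lemma H_class_add: "H_class q (p + p') = H_class q p \<oplus>\<^bsub>H_ring q\<^esub> H_class q p'"
  using HI.quot_add[of p p'] by (simp add: H_class_def H_ring_def)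
lemma H_class_mult: "H_class q (p * p') = H_class q p \<otimes>\<^bsub>H_ring q\<^esub> H_class q p'"
  using HI.quot_mult[of p p'] by (simp add: H_class_def H_ring_def)
lemma H_class_one: "\<one>\<^bsub>H_ring q\<^esub> = H_class q 1"
  using HI.quot_one by (simp add: H_class_def H_ring_def)
lemma H_carrier: "x \<in> carrier (H_ring q) \<longleftrightarrow> (\<exists>p. x = H_class q p)"
  using HI.quot_carrier[of x] by (simp add: H_class_def H_ring_def)
lemma H_const_1: "H_const q 1 = \<one>\<^bsub>H_ring q\<^esub>" by (simp add: H_const_def H_class_one)

lemma H_const_hom: "H_const q \<in> Ring.ring_hom type_ring (H_ring q)"
  by (rule ring_hom_memI)
    (simp_all add: H_const_1, simp_all add: H_const_def single_add H_class_add mult_single flip: H_class_mult)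

lemma single_0_central: "Poly_Mapping.single 0 c * p = p * Poly_Mapping.single 0 (c::complex)"
  for p :: hfree
  by (induction p rule: poly_mapping_single_induct) (simp_all add: mult_single algebra_simps)

lemma H_const_central: "x \<in> carrier (H_ring q) \<Longrightarrow> H_const q c \<otimes>\<^bsub>H_ring q\<^esub> x = x \<otimes>\<^bsub>H_ring q\<^esub> H_const q c"
  unfolding H_carrier H_const_def by (auto simp: single_0_central simp flip: H_class_mult)

lemma H_class_eq: "p - p' \<in> H_ideal q \<Longrightarrow> H_class q p = H_class q p'"
  using HI.quot_eq[of p p'] by (simp add: H_class_def a_minus_def)

lemma H_ideal_gen:
  "hgenerator GenU * hgenerator GenUinv - 1 \<in> H_ideal q"
  "hgenerator GenUinv * hgenerator GenU - 1 \<in> H_ideal q"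
  "hgenerator GenU * hgenerator GenV - Poly_Mapping.single 0 q * (hgenerator GenV * hgenerator GenU) \<in> H_ideal q"
  unfolding H_ideal_def
  using ring.genideal_self[OF ring_free, of "{hgenerator GenU * hgenerator GenUinv - 1,
      hgenerator GenUinv * hgenerator GenU - 1,
      hgenerator GenU * hgenerator GenV
        - Poly_Mapping.single 0 q * (hgenerator GenV * hgenerator GenU)}"] by auto

lemma H_relations:
  "H_gen q GenU \<otimes>\<^bsub>H_ring q\<^esub> H_gen q GenUinv = \<one>\<^bsub>H_ring q\<^esub>"
  "H_gen q GenUinv \<otimes>\<^bsub>H_ring q\<^esub> H_gen q GenU = \<one>\<^bsub>H_ring q\<^esub>"
  "H_gen q GenU \<otimes>\<^bsub>H_ring q\<^esub> H_gen q GenV = H_const q q \<otimes>\<^bsub>H_ring q\<^esub> (H_gen q GenV \<otimes>\<^bsub>H_ring q\<^esub> H_gen q GenU)"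
  using H_class_eq[OF H_ideal_gen(1)] H_class_eq[OF H_ideal_gen(2)] H_class_eq[OF H_ideal_gen(3)]
  by (simp_all only: H_gen_def H_const_def H_class_mult H_class_one)

lemma hfree_induct [case_names const gen add mult]:
  fixes p :: hfree
  assumes const: "\<And>c. P (Poly_Mapping.single 0 c)" and gen: "\<And>a. P (hgenerator a)"
    and add: "\<And>p p'. P p \<Longrightarrow> P p' \<Longrightarrow> P (p + p')" and mult: "\<And>p p'. P p \<Longrightarrow> P p' \<Longrightarrow> P (p * p')"
  shows "P p"
proof (induction p rule: poly_mapping_single_induct)
  case zero
  show ?case using const[of 0] by simp
next
  case (single w c)
  obtain xs where w: "w = Word xs" by (cases w)
  have "P (Poly_Mapping.single (Word xs) 1)"
  proof (induction xs)
    case Nil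
    show ?case using const[of 1] by (simp only: zero_word_def)
  next
    case (Cons a xs)
    have "Poly_Mapping.single (Word (a # xs)) 1 = hgenerator a * Poly_Mapping.single (Word xs) (1::complex)"
      by (simp add: mult_single)
    then show ?case using mult[OF gen Cons] by simp
  qed
  then have "P (Poly_Mapping.single 0 c * Poly_Mapping.single (Word xs) 1)" by (rule mult[OF const])
  then show ?case by (simp add: mult_single w)
qed (rule add)

lemma H_induct [consumes 1, case_names const gen add mult]:
  assumes x: "x \<in> carrier (H_ring q)"
    and const: "\<And>c. P (H_const q c)" and gen: "\<And>a. P (H_gen q a)"
    and add: "\<And>x y. x \<in> carrier (H_ring q) \<Longrightarrow> y \<in> carrier (H_ring q) \<Longrightarrow> P x \<Longrightarrow> P y \<Longrightarrow> P (x \<oplus>\<^bsub>H_ring q\<^esub> y)"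
    and mult: "\<And>x y. x \<in> carrier (H_ring q) \<Longrightarrow> y \<in> carrier (H_ring q) \<Longrightarrow> P x \<Longrightarrow> P y \<Longrightarrow> P (x \<otimes>\<^bsub>H_ring q\<^esub> y)"
  shows "P x"
proof -
  have "P (H_class q p)" for p
    by (induction p rule: hfree_induct)
      (use const gen in \<open>auto simp: H_class_add H_class_mult H_const_def H_gen_def intro: add mult\<close>)
  moreover obtain p where "x = H_class q p" using iffD1[OF H_carrier x] by (rule exE)
  ultimately show ?thesis by simp
qed

text \<open>
  The image of \<open>u\<^sup>-\<^sup>1\<close> is the inverse of the image of \<open>u\<close>.
\<close>

lemma H_hom_unique:
  assumes M: "ring M" and h: "h \<in> Ring.ring_hom (H_ring q) M" and h': "h' \<in> Ring.ring_hom (H_ring q) M"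
    and const: "\<And>c. h (H_const q c) = h' (H_const q c)"
    and U: "h (H_gen q GenU) = h' (H_gen q GenU)" and V: "h (H_gen q GenV) = h' (H_gen q GenV)"
    and x: "x \<in> carrier (H_ring q)"
  shows "h x = h' x"
proof -
  interpret M: ring M by (rule M)
  note simps = ring_hom_closed[OF h] ring_hom_mult[OF h] ring_hom_add[OF h] ring_hom_one[OF h]
    ring_hom_closed[OF h'] ring_hom_mult[OF h'] ring_hom_add[OF h'] ring_hom_one[OF h']
  have inv: "h (H_gen q GenUinv) = h' (H_gen q GenUinv)"
  proof (rule M.inv_unique)
    show "h (H_gen q GenUinv) \<otimes>\<^bsub>M\<^esub> h (H_gen q GenU) = \<one>\<^bsub>M\<^esub>"
      using arg_cong[OF H_relations(2), of h] by (simp add: simps)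
    show "h (H_gen q GenU) \<otimes>\<^bsub>M\<^esub> h' (H_gen q GenUinv) = \<one>\<^bsub>M\<^esub>"
      using arg_cong[OF H_relations(1), of h'] by (simp add: simps U)
  qed (simp_all add: simps)
  have gen: "h (H_gen q a) = h' (H_gen q a)" for a
    by (cases a) (simp_all add: U V inv)
  show ?thesis using x
    by (induction rule: H_induct) (simp_all add: simps const gen)
qed

lemma H_hom_exists:
  assumes M: "ring M" and \<kappa>: "\<kappa> \<in> Ring.ring_hom type_ring M"
    and cen: "\<And>c x. x \<in> carrier M \<Longrightarrow> \<kappa> c \<otimes>\<^bsub>M\<^esub> x = x \<otimes>\<^bsub>M\<^esub> \<kappa> c"
    and closed: "u \<in> carrier M" "u' \<in> carrier M" "v \<in> carrier M"
    and rel: "u \<otimes>\<^bsub>M\<^esub> u' = \<one>\<^bsub>M\<^esub>" "u' \<otimes>\<^bsub>M\<^esub> u = \<one>\<^bsub>M\<^esub>" "u \<otimes>\<^bsub>M\<^esub> v = \<kappa> q \<otimes>\<^bsub>M\<^esub> (v \<otimes>\<^bsub>M\<^esub> u)"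
  obtains h where "h \<in> Ring.ring_hom (H_ring q) M" "\<And>c. h (H_const q c) = \<kappa> c"
    "h (H_gen q GenU) = u" "h (H_gen q GenUinv) = u'" "h (H_gen q GenV) = v"
proof -
  interpret M: ring M by (rule M)
  define g where "g = (\<lambda>a. case a of GenU \<Rightarrow> u | GenUinv \<Rightarrow> u' | GenV \<Rightarrow> v)"
  interpret F: free_map M \<kappa> g
    by unfold_locales (use \<kappa> cen closed in \<open>auto simp: g_def split: hgen.splits\<close>)
  have g_vals: "g GenU = u" "g GenUinv = u'" "g GenV = v" by (simp_all add: g_def)
  have gen: "F.fval (hgenerator a) = g a" for a
    by (simp add: F.fval_single F.wval_def)
  have const: "F.fval (Poly_Mapping.single 0 c) = \<kappa> c" for c
    by (simp add: F.fval_single F.wval_0)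
  have diff: "F.fval (p - p') = F.fval p \<ominus>\<^bsub>M\<^esub> F.fval p'" for p p'
    using F.fval_add[of p "- p'"] F.fval_minus[of p'] by (simp add: a_minus_def)
  have one: "F.fval 1 = \<one>\<^bsub>M\<^esub>" using const[of 1] by simp
  define K where "K = {p :: hfree. F.fval p = \<zero>\<^bsub>M\<^esub>}"
  have "ideal K (type_ring :: hfree ring)"
  proof (rule idealI[OF ring_free])
    show "subgroup K (add_monoid (type_ring :: hfree ring))"
    proof (rule HI.add.subgroupI)
      show "K \<noteq> {}" using F.fval_0 by (auto simp: K_def)
    qed (auto simp: K_def F.fval_add F.fval_minus)
  qed (auto simp: K_def F.fval_mult)
  then have sub: "H_ideal q \<subseteq> K"
    unfolding H_ideal_def
    by (rule ring.genideal_minimal[OF ring_free])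
      (use rel closed in \<open>auto simp: K_def diff F.fval_mult gen const one g_vals a_minus_def M.r_neg\<close>)
  obtain h where h: "\<And>p. h (H_class q p) = F.fval p"
  proof -
    have "\<exists>h. \<forall>p\<in>carrier (type_ring :: hfree ring). h (H_ideal q +>\<^bsub>type_ring\<^esub> p) = F.fval p"
    proof (rule HI.quot_lift)
      fix p p' :: hfree assume "p \<ominus>\<^bsub>type_ring\<^esub> p' \<in> H_ideal q"
      then have "F.fval (p - p') = \<zero>\<^bsub>M\<^esub>" using sub by (auto simp: K_def a_minus_def)
      then have "F.fval p \<oplus>\<^bsub>M\<^esub> \<ominus>\<^bsub>M\<^esub> F.fval p' = \<zero>\<^bsub>M\<^esub>" unfolding diff a_minus_def .
      then have "\<ominus>\<^bsub>M\<^esub> (\<ominus>\<^bsub>M\<^esub> F.fval p') = F.fval p" by (intro M.minus_equality) simp_all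
      then show "F.fval p = F.fval p'" by simp
    qed
    then show ?thesis using that by (auto simp: H_class_def)
  qed
  have "h \<in> Ring.ring_hom (H_ring q) M"
  proof (rule ring_hom_memI)
    fix x y assume "x \<in> carrier (H_ring q)"
    then obtain p where x: "x = H_class q p" unfolding H_carrier by blast
    show "h x \<in> carrier M" unfolding x h by simp
    assume "y \<in> carrier (H_ring q)"
    then obtain r where y: "y = H_class q r" unfolding H_carrier by blast
    show "h (x \<otimes>\<^bsub>H_ring q\<^esub> y) = h x \<otimes>\<^bsub>M\<^esub> h y" "h (x \<oplus>\<^bsub>H_ring q\<^esub> y) = h x \<oplus>\<^bsub>M\<^esub> h y"
      unfolding x y by (simp_all add: h F.fval_mult F.fval_add flip: H_class_mult H_class_add)
  qed (simp add: H_class_one h one)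
  then show thesis
    by (rule that) (simp_all add: H_const_def H_gen_def h const gen g_vals)
qed

sublocale HH: tensor "H_ring q" "H_ring q" "H_const q" "H_const q"
  by unfold_locales (simp_all add: H_const_central)

sublocale HL: tensor "H_ring q" "type_ring :: ratfun ring" "H_const q" rconst
proof -
  interpret ring "type_ring :: ratfun ring" by (rule ring_type_ring)
  show "tensor (H_ring q) (type_ring :: ratfun ring) (H_const q) rconst"
    by unfold_locales (simp_all add: H_const_central)
qed

lemma HL_def: "HL_ring q = tensor_ring (H_ring q) (H_const q) type_ring rconst"
  "HL_elem q = tensor_elem (H_ring q) (H_const q) type_ring rconst"
  by (simp_all add: HL_ring_def HL_elem_def)

lemma HL_elem_closed [simp]: "x \<in> carrier (H_ring q) \<Longrightarrow> HL_elem q x a \<in> carrier (HL_ring q)"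
  unfolding HL_def by simp

lemma HL_elem_hom: "(\<lambda>x. HL_elem q x 1) \<in> Ring.ring_hom (H_ring q) (HL_ring q)"
  unfolding HL_def
  by (rule ring_hom_memI) (simp_all add: HL.pure_mult HL.pure_add_left HL.pure_one)

lemma HL_elem_split: "x \<in> carrier (H_ring q) \<Longrightarrow>
  HL_elem q x a = HL_elem q x 1 \<otimes>\<^bsub>HL_ring q\<^esub> HL_elem q (H_const q 1) a"
  unfolding HL_def by (simp add: HL.pure_mult H_const_1)

lemma ring_hom_compose_HL:
  "\<psi> \<in> Ring.ring_hom (HL_ring q) M \<Longrightarrow> (\<lambda>x. \<psi> (HL_elem q x 1)) \<in> Ring.ring_hom (H_ring q) M"
  using ring_hom_trans[OF HL_elem_hom, of \<psi> M] by (simp add: comp_def)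

lemma HL_elem_const: "HL_elem q (H_const q c) 1 = HL_elem q (H_const q 1) (rconst c)"
  using HL.pure_balanced[of "H_const q 1" 1 c] unfolding HL_def by (simp add: H_const_1)

definition HH_coproduct_spec where
  "HH_coproduct_spec D \<longleftrightarrow> D \<in> extensional (carrier (H_ring q)) \<and> D \<in> Ring.ring_hom (H_ring q) (HH_ring q) \<and>
     (\<forall>c. D (H_const q c) = HH_elem q (H_const q c) (H_const q 1)) \<and>
     D (H_gen q GenU) = HH_elem q (H_gen q GenU) (H_gen q GenU) \<and>
     D (H_gen q GenUinv) = HH_elem q (H_gen q GenUinv) (H_gen q GenUinv) \<and>
     D (H_gen q GenV) = HH_elem q (H_gen q GenU) (H_gen q GenV)
       \<oplus>\<^bsub>HH_ring q\<^esub> HH_elem q (H_gen q GenV) (H_const q 1)"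

text \<open>
  With \<open>\<Delta>(u) = u \<otimes> u\<close> and \<open>\<Delta>(v) = u \<otimes> v + v \<otimes> 1\<close> the relation \<open>uv = q vu\<close> holds in each of the two
  summands, so the universal property applies.
\<close>

lemma H_coproduct_spec: "HH_coproduct_spec (H_coproduct q)"
proof -
  let ?M = "HH_ring q"
  let ?e = "HH_elem q"
  let ?U = "H_gen q GenU" let ?I = "H_gen q GenUinv" let ?V = "H_gen q GenV"
  let ?one = "\<one>\<^bsub>H_ring q\<^esub>"
  let ?k = "\<lambda>c. ?e (H_const q c) (H_const q 1)"
  let ?v = "?e ?U ?V \<oplus>\<^bsub>?M\<^esub> ?e ?V (H_const q 1)"
  have k_hom: "?k \<in> Ring.ring_hom type_ring ?M"
    using ring_hom_mult[OF H_const_hom] ring_hom_add[OF H_const_hom]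
    by (intro ring_hom_memI) (simp_all add: HH.pure_mult HH.pure_add_left HH.pure_one H_const_1)
  have k_cen: "?k c \<otimes>\<^bsub>?M\<^esub> x = x \<otimes>\<^bsub>?M\<^esub> ?k c" if "x \<in> carrier ?M" for c x
    using that
    by (induction rule: HH.T_induct)
      (simp_all add: HH.pure_mult H_const_1 H_const_central HH.T.r_distr HH.T.l_distr)
  have r: "?e ?U ?U \<otimes>\<^bsub>?M\<^esub> ?v = ?k q \<otimes>\<^bsub>?M\<^esub> (?v \<otimes>\<^bsub>?M\<^esub> ?e ?U ?U)"
  proof -
    have b: "?e x (H_const q q \<otimes>\<^bsub>H_ring q\<^esub> y) = ?e (H_const q q \<otimes>\<^bsub>H_ring q\<^esub> x) y"
      if "x \<in> carrier (H_ring q)" "y \<in> carrier (H_ring q)" for x y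
      using HH.pure_balanced[OF that] by simp
    show ?thesis
      by (simp add: HH.pure_mult HH.T.r_distr HH.T.l_distr H_const_1 H_relations b)
  qed
  have ru: "?e ?U ?U \<otimes>\<^bsub>?M\<^esub> ?e ?I ?I = \<one>\<^bsub>?M\<^esub>" "?e ?I ?I \<otimes>\<^bsub>?M\<^esub> ?e ?U ?U = \<one>\<^bsub>?M\<^esub>"
    by (simp_all add: HH.pure_mult H_relations HH.pure_one)
  obtain h where h: "h \<in> Ring.ring_hom (H_ring q) ?M" "\<And>c. h (H_const q c) = ?k c"
    "h ?U = ?e ?U ?U" "h ?I = ?e ?I ?I" "h ?V = ?v"
    by (rule H_hom_exists[OF HH.T.ring_axioms k_hom k_cen _ _ _ ru r]) auto
  have ex: "HH_coproduct_spec (restrict h (carrier (H_ring q)))"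
    using h ring_hom_restrict[OF H.ring_axioms h(1)] by (simp add: HH_coproduct_spec_def)
  show ?thesis
    unfolding H_coproduct_def HH_coproduct_spec_def[symmetric]
  proof (rule theI[of HH_coproduct_spec, OF ex])
    fix D assume D: "HH_coproduct_spec D"
    show "D = restrict h (carrier (H_ring q))"
    proof (rule extensionalityI)
      fix x assume "x \<in> carrier (H_ring q)"
      note d = D[unfolded HH_coproduct_spec_def] and e = ex[unfolded HH_coproduct_spec_def]
      show "D x = restrict h (carrier (H_ring q)) x"
      proof (rule H_hom_unique[OF HH.T.ring_axioms])
        show "x \<in> carrier (H_ring q)" by fact
        show "D (H_const q c) = restrict h (carrier (H_ring q)) (H_const q c)" for c
          by (simp only: d e)
        show "D (H_gen q GenU) = restrict h (carrier (H_ring q)) (H_gen q GenU)"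
          by (simp only: d e)
        show "D (H_gen q GenV) = restrict h (carrier (H_ring q)) (H_gen q GenV)"
          by (simp only: d e)
      qed (use d e in blast)+
    qed (use D in \<open>auto simp: HH_coproduct_spec_def\<close>)
  qed
qed

lemma H_coproduct:
  "H_coproduct q \<in> Ring.ring_hom (H_ring q) (HH_ring q)"
  "H_coproduct q (H_const q c) = HH_elem q (H_const q c) (H_const q 1)"
  "H_coproduct q (H_gen q GenU) = HH_elem q (H_gen q GenU) (H_gen q GenU)"
  "H_coproduct q (H_gen q GenV) = HH_elem q (H_gen q GenU) (H_gen q GenV)
       \<oplus>\<^bsub>HH_ring q\<^esub> HH_elem q (H_gen q GenV) (H_const q 1)"
  using H_coproduct_spec unfolding HH_coproduct_spec_def by blast+

definition H_counit_spec where
  "H_counit_spec E \<longleftrightarrow> E \<in> extensional (carrier (H_ring q)) \<and> E \<in> Ring.ring_hom (H_ring q) type_ring \<and>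
     (\<forall>c. E (H_const q c) = c) \<and>
     E (H_gen q GenU) = 1 \<and> E (H_gen q GenUinv) = 1 \<and> E (H_gen q GenV) = (0::complex)"

lemma H_counit_spec: "H_counit_spec (H_counit q)"
proof -
  have id: "(\<lambda>c. c) \<in> Ring.ring_hom (type_ring :: complex ring) type_ring"
    by (rule ring_hom_memI) simp_all
  obtain h where h: "h \<in> Ring.ring_hom (H_ring q) (type_ring :: complex ring)" "\<And>c. h (H_const q c) = c"
    "h (H_gen q GenU) = 1" "h (H_gen q GenUinv) = 1" "h (H_gen q GenV) = 0"
    by (rule H_hom_exists[OF ring_type_ring id, of 1 1 0]) auto
  have ex: "H_counit_spec (restrict h (carrier (H_ring q)))"
    using h ring_hom_restrict[OF H.ring_axioms h(1)] by (simp add: H_counit_spec_def)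
  show ?thesis
    unfolding H_counit_def H_counit_spec_def[symmetric]
  proof (rule theI[of H_counit_spec, OF ex])
    fix D assume D: "H_counit_spec D"
    show "D = restrict h (carrier (H_ring q))"
    proof (rule extensionalityI)
      fix x assume "x \<in> carrier (H_ring q)"
      note d = D[unfolded H_counit_spec_def] and e = ex[unfolded H_counit_spec_def]
      show "D x = restrict h (carrier (H_ring q)) x"
      proof (rule H_hom_unique[OF ring_type_ring])
        show "x \<in> carrier (H_ring q)" by fact
        show "D (H_const q c) = restrict h (carrier (H_ring q)) (H_const q c)" for c
          by (simp only: d e)
        show "D (H_gen q GenU) = restrict h (carrier (H_ring q)) (H_gen q GenU)"
          by (simp only: d e)
        show "D (H_gen q GenV) = restrict h (carrier (H_ring q)) (H_gen q GenV)"
          by (simp only: d e)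
      qed (use d e in blast)+
    qed (use D in \<open>auto simp: H_counit_spec_def\<close>)
  qed
qed

lemma H_counit:
  "H_counit q \<in> Ring.ring_hom (H_ring q) type_ring" "H_counit q (H_const q c) = c"
  "H_counit q (H_gen q GenU) = 1" "H_counit q (H_gen q GenV) = 0"
  using H_counit_spec unfolding H_counit_spec_def by blast+

end

section \<open>Points of the quantum formal group\<close>

sublocale L_alg \<subseteq> hopf q .

context L_alg
begin

lemma s_rconst_hom: "(\<lambda>c. s (rconst c)) \<in> Ring.ring_hom type_ring type_ring"
  by (rule ring_hom_memI) (simp_all add: rconst_add rconst_mult s_add s_mult)

lemma QFG_D:
  assumes "\<psi> \<in> QFG q s"
  shows "\<psi> \<in> Ring.ring_hom (HL_ring q) type_ring" "\<psi> \<in> extensional (carrier (HL_ring q))"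
    "\<psi> (HL_elem q (H_const q 1) a) = s a" "nilpotent (u_val q \<psi> - 1)"
  using assms unfolding QFG_def by blast+

lemma QFG_H_hom: "\<psi> \<in> QFG q s \<Longrightarrow> (\<lambda>x. \<psi> (HL_elem q x 1)) \<in> Ring.ring_hom (H_ring q) type_ring"
  by (rule ring_hom_compose_HL) (rule QFG_D)

lemma QFG_const: "\<psi> \<in> QFG q s \<Longrightarrow> \<psi> (HL_elem q (H_const q c) 1) = s (rconst c)"
  by (simp only: HL_elem_const QFG_D(3))

text \<open>
  The completion sees only the line \<open>v = 0\<close> of the quantum group.
\<close>

lemma QFG_v_0:
  assumes "\<psi> \<in> QFG q s" shows "v_val q \<psi> = 0"
proof (rule q_commuting_unipotent)
  note h = QFG_H_hom[OF assms]
  show "u_val q \<psi> * v_val q \<psi> = s (rconst q) * (v_val q \<psi> * u_val q \<psi>)"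
    using arg_cong[OF H_relations(3), of "\<lambda>x. \<psi> (HL_elem q x 1)"] ring_hom_mult[OF h]
    by (simp add: QFG_const[OF assms])
qed (rule QFG_D[OF assms])

lemma QFG_eqI:
  assumes "\<psi> \<in> QFG q s" "\<psi>' \<in> QFG q s" "u_val q \<psi> = u_val q \<psi>'"
  shows "\<psi> = \<psi>'"
proof (rule extensionalityI[of _ "carrier (HL_ring q)"])
  interpret A: ring "type_ring :: 'a ring" by (rule ring_type_ring)
  have H: "\<psi> (HL_elem q x 1) = \<psi>' (HL_elem q x 1)" if "x \<in> carrier (H_ring q)" for x
    by (rule H_hom_unique[OF ring_type_ring QFG_H_hom[OF assms(1)] QFG_H_hom[OF assms(2)] _ _ _ that])
      (simp_all add: QFG_const[OF assms(1)] QFG_const[OF assms(2)] assms(3) QFG_v_0[OF assms(1)] QFG_v_0[OF assms(2)])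
  note h = QFG_D(1)[OF assms(1)] and h' = QFG_D(1)[OF assms(2)]
  fix z assume z: "z \<in> carrier (HL_ring q)"
  show "\<psi> z = \<psi>' z"
  proof (rule HL.T_additive_unique[OF A.abelian_group_axioms])
    fix x and y :: ratfun assume x: "x \<in> carrier (H_ring q)"
    have "HL_elem q x 1 \<in> carrier (HL_ring q)" "HL_elem q (H_const q 1) y \<in> carrier (HL_ring q)"
      using x by simp_all
    then have "\<psi> (HL_elem q x y) = \<psi>' (HL_elem q x y)"
      using H[OF x] unfolding HL_elem_split[OF x, of y]
      by (simp add: ring_hom_mult[OF h] ring_hom_mult[OF h'] QFG_D(3)[OF assms(1)] QFG_D(3)[OF assms(2)])
    then show "\<psi> (HL.pure x y) = \<psi>' (HL.pure x y)" by (simp only: HL_def)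
  next
    show "z \<in> carrier HL.TR" using z by (simp only: HL_def)
  qed (simp_all add: ring_hom_add[OF h, unfolded HL_def] ring_hom_add[OF h', unfolded HL_def])
qed (rule QFG_D[OF assms(1)] QFG_D[OF assms(2)])+

lemma QFG_exists:
  assumes "nilpotent (e - 1)"
  shows "\<exists>\<psi>\<in>QFG q s. u_val q \<psi> = e \<and> v_val q \<psi> = 0"
proof -
  obtain e' where e': "e * e' = 1" "e' * e = 1" using unipotent_inverse[OF assms] by blast
  obtain h where h: "h \<in> Ring.ring_hom (H_ring q) (type_ring :: 'a ring)" "\<And>c. h (H_const q c) = s (rconst c)"
    "h (H_gen q GenU) = e" "h (H_gen q GenUinv) = e'" "h (H_gen q GenV) = 0"
    by (rule H_hom_exists[OF ring_type_ring s_rconst_hom, of e e' 0]) (use e' in \<open>auto intro: s_comm\<close>)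
  note hs = ring_hom_mult[OF h(1)] ring_hom_add[OF h(1)] ring_hom_one[OF h(1)]
  have "\<exists>g \<in> Ring.ring_hom HL.TR (type_ring :: 'a ring).
      \<forall>x\<in>carrier (H_ring q). \<forall>y\<in>carrier (type_ring :: ratfun ring). g (HL.pure x y) = h x * s y"
  proof (rule HL.T_ring_map[OF ring_type_ring])
    fix x x' :: "hfree set" and y y' :: ratfun
    assume "x \<in> carrier (H_ring q)" "x' \<in> carrier (H_ring q)"
    then show "h (x \<otimes>\<^bsub>H_ring q\<^esub> x') * s (y \<otimes>\<^bsub>type_ring\<^esub> y') = h x * s y \<otimes>\<^bsub>type_ring\<^esub> (h x' * s y')"
      by (simp add: hs s_mult mult.assoc) (metis mult.assoc s_comm)
  qed (simp_all add: hs h s_add s_mult distrib_left distrib_right mult.assoc[symmetric], simp_all only: s_comm)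
  then obtain g where g: "g \<in> Ring.ring_hom (HL_ring q) (type_ring :: 'a ring)"
    and gv: "\<And>x y. x \<in> carrier (H_ring q) \<Longrightarrow> g (HL_elem q x y) = h x * s y"
    unfolding HL_def by auto
  have "restrict g (carrier (HL_ring q)) \<in> QFG q s \<and> u_val q (restrict g (carrier (HL_ring q))) = e
      \<and> v_val q (restrict g (carrier (HL_ring q))) = 0"
    using ring_hom_restrict[OF _ g] HL.T.ring_axioms assms
    by (simp add: QFG_def gv h(2-5) HL_def(1)[symmetric] nilpotent_0)
  then show ?thesis by blast
qed

lemma u_val_bij: "bij_betw (u_val q) (QFG q s) {e. nilpotent (e - 1)}"
proof (rule bij_betwI')
  fix \<psi> \<psi>' assume "\<psi> \<in> QFG q s" "\<psi>' \<in> QFG q s"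
  then show "(u_val q \<psi> = u_val q \<psi>') = (\<psi> = \<psi>')" using QFG_eqI by blast
next
  fix \<psi> assume "\<psi> \<in> QFG q s"
  then show "u_val q \<psi> \<in> {e. nilpotent (e - 1)}" using QFG_D(4) by blast
next
  fix e :: 'a assume "e \<in> {e. nilpotent (e - 1)}"
  then show "\<exists>\<psi>\<in>QFG q s. e = u_val q \<psi>" using QFG_exists by blast
qed

lemma NCF_iso_eqI:
  assumes "\<phi> \<in> NCF q s" "\<psi> \<in> QFG q s" "\<phi> (iota0 q rt) = deformed q s (u_val q \<psi>) 0"
  shows "NCF_iso q s \<phi> = \<psi>"
  unfolding NCF_iso_def
proof (rule the_equality)
  show "\<psi> \<in> QFG q s \<and> \<phi> (iota0 q rt) = deformed q s (u_val q \<psi>) (v_val q \<psi>)"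
    using assms QFG_v_0[OF assms(2)] by simp
  fix \<psi>' assume "\<psi>' \<in> QFG q s \<and> \<phi> (iota0 q rt) = deformed q s (u_val q \<psi>') (v_val q \<psi>')"
  then show "\<psi>' = \<psi>" using assms deformed_inject by (intro QFG_eqI) auto
qed

lemma NCF_iso:
  assumes "\<phi> \<in> NCF q s"
  shows "NCF_iso q s \<phi> \<in> QFG q s" "\<phi> (iota0 q rt) = deformed q s (u_val q (NCF_iso q s \<phi>)) 0"
proof -
  obtain e where e: "\<phi> (iota0 q rt) = deformed q s e 0" "nilpotent (e - 1)"
    using NCF_form[OF assms] by blast
  obtain \<psi> where \<psi>: "\<psi> \<in> QFG q s" "u_val q \<psi> = e" using QFG_exists[OF e(2)] by blast
  have "NCF_iso q s \<phi> = \<psi>" by (rule NCF_iso_eqI[OF assms \<psi>(1)]) (simp add: \<psi> e)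
  then show "NCF_iso q s \<phi> \<in> QFG q s" "\<phi> (iota0 q rt) = deformed q s (u_val q (NCF_iso q s \<phi>)) 0"
    using \<psi> e by simp_all
qed

lemma NCF_of_QFG:
  assumes "\<psi> \<in> QFG q s"
  obtains \<phi> where "\<phi> \<in> NCF q s" "\<phi> (iota0 q rt) = deformed q s (u_val q \<psi>) 0" "NCF_iso q s \<phi> = \<psi>"
  using NCF_exists[OF QFG_D(4)[OF assms]] NCF_iso_eqI[OF _ assms] by blast

lemma NCF_iso_bij: "bij_betw (NCF_iso q s) (NCF q s) (QFG q s)"
proof (rule bij_betwI')
  fix \<phi> \<phi>' assume "\<phi> \<in> NCF q s" "\<phi>' \<in> NCF q s"
  then show "(NCF_iso q s \<phi> = NCF_iso q s \<phi>') = (\<phi> = \<phi>')"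
    using NCF_unique NCF_iso(2) by metis
next
  fix \<phi> assume "\<phi> \<in> NCF q s"
  then show "NCF_iso q s \<phi> \<in> QFG q s" by (rule NCF_iso)
next
  fix \<psi> assume "\<psi> \<in> QFG q s"
  then show "\<exists>\<phi>\<in>NCF q s. \<psi> = NCF_iso q s \<phi>" using NCF_of_QFG by metis
qed

text \<open>
  The elements that commute with the image of one point form a subring. If it contains the value of the
  other point at \<open>u\<close>, then it contains the inverse of this value, and the value \<open>0\<close> at \<open>v\<close>.
\<close>

lemma H_images_commute:
  assumes \<psi>: "\<psi> \<in> QFG q s" and \<psi>': "\<psi>' \<in> QFG q s"
    and uu: "u_val q \<psi> * u_val q \<psi>' = u_val q \<psi>' * u_val q \<psi>"
    and x: "x \<in> carrier (H_ring q)" and y: "y \<in> carrier (H_ring q)"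
  shows "\<psi> (HL_elem q x 1) * \<psi>' (HL_elem q y 1) = \<psi>' (HL_elem q y 1) * \<psi> (HL_elem q x 1)"
proof -
  have inv: "b * c = c * b" if "a * b = 1" "b * a = 1" "a * c = c * a" for a b c :: 'a
  proof -
    have "b * c = b * (c * a) * b" by (simp add: that mult.assoc)
    also have "\<dots> = b * a * (c * b)" by (simp only: that(3)[symmetric] mult.assoc)
    finally show ?thesis by (simp add: that)
  qed
  have gen: "\<chi> (HL_elem q x 1) * c = c * \<chi> (HL_elem q x 1)"
    if \<chi>: "\<chi> \<in> QFG q s" and c: "u_val q \<chi> * c = c * u_val q \<chi>" and x: "x \<in> carrier (H_ring q)" for \<chi> c x
  proof -
    note h = QFG_H_hom[OF \<chi>]
    have 1: "u_val q \<chi> * \<chi> (HL_elem q (H_gen q GenUinv) 1) = 1" "\<chi> (HL_elem q (H_gen q GenUinv) 1) * u_val q \<chi> = 1"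
      using arg_cong[OF H_relations(1), of "\<lambda>x. \<chi> (HL_elem q x 1)"]
        arg_cong[OF H_relations(2), of "\<lambda>x. \<chi> (HL_elem q x 1)"] ring_hom_mult[OF h] ring_hom_one[OF h]
      by simp_all
    have g: "\<chi> (HL_elem q (H_gen q a) 1) * c = c * \<chi> (HL_elem q (H_gen q a) 1)" for a
      by (cases a) (simp_all add: c QFG_v_0[OF \<chi>] inv[OF 1 c])
    show ?thesis using x
    proof (induction rule: H_induct)
      case (const d)
      show ?case by (simp only: QFG_const[OF \<chi>] s_comm)
    next
      case (gen a)
      show ?case by (rule g)
    next
      case (add x y)
      then show ?case using ring_hom_add[OF h] by (simp add: distrib_left distrib_right)
    next
      case (mult x y)
      then show ?case using ring_hom_mult[OF h] by (simp add: mult.assoc) (metis mult.assoc)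
    qed
  qed
  have "\<psi>' (HL_elem q y 1) * u_val q \<psi> = u_val q \<psi> * \<psi>' (HL_elem q y 1)"
    by (rule gen[OF \<psi>' _ y]) (simp add: uu)
  then show ?thesis by (intro gen[OF \<psi> _ x]) simp
qed

text \<open>
  Since the two images commute, \<open>x \<otimes> y \<mapsto> \<psi>(x) \<psi>'(y)\<close> is multiplicative.
\<close>

lemma H_pairing:
  assumes \<psi>: "\<psi> \<in> QFG q s" and \<psi>': "\<psi>' \<in> QFG q s"
    and uu: "u_val q \<psi> * u_val q \<psi>' = u_val q \<psi>' * u_val q \<psi>"
  shows "H_pairing q \<psi> \<psi>' \<in> Ring.ring_hom (HH_ring q) type_ring"
    "\<And>x y. x \<in> carrier (H_ring q) \<Longrightarrow> y \<in> carrier (H_ring q) \<Longrightarrow>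
      H_pairing q \<psi> \<psi>' (HH_elem q x y) = \<psi> (HL_elem q x 1) * \<psi>' (HL_elem q y 1)"
proof -
  interpret A: ring "type_ring :: 'a ring" by (rule ring_type_ring)
  note h = QFG_H_hom[OF \<psi>] and h' = QFG_H_hom[OF \<psi>'] and comm = H_images_commute[OF \<psi> \<psi>' uu]
  define P where "P m \<longleftrightarrow> m \<in> extensional (carrier (HH_ring q)) \<and> m \<in> Ring.ring_hom (HH_ring q) (type_ring :: 'a ring) \<and>
     (\<forall>x\<in>carrier (H_ring q). \<forall>y\<in>carrier (H_ring q).
        m (HH_elem q x y) = \<psi> (HL_elem q x 1) * \<psi>' (HL_elem q y 1))" for m
  have "\<exists>g \<in> Ring.ring_hom (HH_ring q) (type_ring :: 'a ring).
      \<forall>x\<in>carrier (H_ring q). \<forall>y\<in>carrier (H_ring q). g (HH_elem q x y) = \<psi> (HL_elem q x 1) * \<psi>' (HL_elem q y 1)"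
  proof (rule HH.T_ring_map[OF ring_type_ring])
    fix x x' y y' assume c: "x \<in> carrier (H_ring q)" "x' \<in> carrier (H_ring q)" "y \<in> carrier (H_ring q)" "y' \<in> carrier (H_ring q)"
    have "\<psi> (HL_elem q x 1) * \<psi> (HL_elem q x' 1) * (\<psi>' (HL_elem q y 1) * \<psi>' (HL_elem q y' 1))
        = \<psi> (HL_elem q x 1) * (\<psi> (HL_elem q x' 1) * \<psi>' (HL_elem q y 1)) * \<psi>' (HL_elem q y' 1)"
      by (simp only: mult.assoc)
    also have "\<dots> = \<psi> (HL_elem q x 1) * \<psi>' (HL_elem q y 1) * (\<psi> (HL_elem q x' 1) * \<psi>' (HL_elem q y' 1))"
      unfolding comm[OF c(2,3)] by (simp only: mult.assoc)
    finally show "\<psi> (HL_elem q (x \<otimes>\<^bsub>H_ring q\<^esub> x') 1) * \<psi>' (HL_elem q (y \<otimes>\<^bsub>H_ring q\<^esub> y') 1)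
        = \<psi> (HL_elem q x 1) * \<psi>' (HL_elem q y 1) \<otimes>\<^bsub>type_ring\<^esub> (\<psi> (HL_elem q x' 1) * \<psi>' (HL_elem q y' 1))"
      using c by (simp add: ring_hom_mult[OF h] ring_hom_mult[OF h'])
  next
    fix c x y assume c: "x \<in> carrier (H_ring q)" "y \<in> carrier (H_ring q)"
    then show "\<psi> (HL_elem q (H_const q c \<otimes>\<^bsub>H_ring q\<^esub> x) 1) * \<psi>' (HL_elem q y 1)
        = \<psi> (HL_elem q x 1) * \<psi>' (HL_elem q (H_const q c \<otimes>\<^bsub>H_ring q\<^esub> y) 1)"
      by (simp add: ring_hom_mult[OF h] ring_hom_mult[OF h'] QFG_const[OF \<psi>] QFG_const[OF \<psi>'])
        (metis mult.assoc s_comm)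
  qed (simp_all add: ring_hom_add[OF h] ring_hom_add[OF h'] distrib_left distrib_right
      ring_hom_one[OF h, simplified] ring_hom_one[OF h', simplified])
  then obtain g where g: "g \<in> Ring.ring_hom (HH_ring q) (type_ring :: 'a ring)"
    "\<And>x y. x \<in> carrier (H_ring q) \<Longrightarrow> y \<in> carrier (H_ring q) \<Longrightarrow>
      g (HH_elem q x y) = \<psi> (HL_elem q x 1) * \<psi>' (HL_elem q y 1)" by blast
  have ex: "P (restrict g (carrier (HH_ring q)))"
    using g ring_hom_restrict[OF HH.T.ring_axioms g(1)] by (simp add: P_def)
  have "P (H_pairing q \<psi> \<psi>')"
    unfolding H_pairing_def P_def[symmetric]
  proof (rule theI[of P, OF ex])
    fix m assume m: "P m"
    note d = m[unfolded P_def] and e = ex[unfolded P_def]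
    have m1: "m \<in> Ring.ring_hom (HH_ring q) type_ring" and m2: "restrict g (carrier (HH_ring q)) \<in> Ring.ring_hom (HH_ring q) type_ring"
      using d e by blast+
    show "m = restrict g (carrier (HH_ring q))"
    proof (rule extensionalityI)
      fix z assume "z \<in> carrier (HH_ring q)"
      then show "m z = restrict g (carrier (HH_ring q)) z"
      proof (rule HH.T_additive_unique[OF A.abelian_group_axioms, rotated -1])
        fix x y assume "x \<in> carrier (H_ring q)" "y \<in> carrier (H_ring q)"
        then show "m (HH_elem q x y) = restrict g (carrier (HH_ring q)) (HH_elem q x y)"
          by (simp only: d e)
      qed (use ring_hom_add[OF m1] ring_hom_add[OF m2] in auto)
    qed (use d in auto)
  qed
  then show "H_pairing q \<psi> \<psi>' \<in> Ring.ring_hom (HH_ring q) type_ring"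
    "\<And>x y. x \<in> carrier (H_ring q) \<Longrightarrow> y \<in> carrier (H_ring q) \<Longrightarrow>
      H_pairing q \<psi> \<psi>' (HH_elem q x y) = \<psi> (HL_elem q x 1) * \<psi>' (HL_elem q y 1)"
    unfolding P_def by blast+
qed

lemma HL_point_unique:
  assumes "\<omega> \<in> QFG q s" "\<And>x. x \<in> carrier (H_ring q) \<Longrightarrow> \<omega> (HL_elem q x 1) = f x"
  shows "(THE \<omega>. \<omega> \<in> QFG q s \<and> (\<forall>x\<in>carrier (H_ring q). \<omega> (HL_elem q x 1) = f x)) = \<omega>"
proof (rule the_equality)
  show "\<omega> \<in> QFG q s \<and> (\<forall>x\<in>carrier (H_ring q). \<omega> (HL_elem q x 1) = f x)" using assms by blast
  fix \<omega>' assume "\<omega>' \<in> QFG q s \<and> (\<forall>x\<in>carrier (H_ring q). \<omega>' (HL_elem q x 1) = f x)"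
  then show "\<omega>' = \<omega>" using assms by (intro QFG_eqI) auto
qed

text \<open>
  The element \<open>u\<close> is group-like, so its values multiply; at \<open>v\<close> all values vanish. The point with these
  values satisfies the condition that defines the product.
\<close>

lemma QFG_prod:
  assumes \<psi>: "\<psi> \<in> QFG q s" and \<psi>': "\<psi>' \<in> QFG q s"
    and uu: "u_val q \<psi> * u_val q \<psi>' = u_val q \<psi>' * u_val q \<psi>"
  shows "QFG_prod q s \<psi> \<psi>' \<in> QFG q s" "u_val q (QFG_prod q s \<psi> \<psi>') = u_val q \<psi> * u_val q \<psi>'"
proof -
  note p = H_pairing[OF assms]
  obtain \<omega> where \<omega>: "\<omega> \<in> QFG q s" "u_val q \<omega> = u_val q \<psi> * u_val q \<psi>'"
    using QFG_exists[OF unipotent_mult[OF QFG_D(4)[OF \<psi>] QFG_D(4)[OF \<psi>'] uu]] by blast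
  have hom: "(\<lambda>x. H_pairing q \<psi> \<psi>' (H_coproduct q x)) \<in> Ring.ring_hom (H_ring q) type_ring"
    using ring_hom_trans[OF H_coproduct(1) p(1)] by (simp add: comp_def)
  have "\<omega> (HL_elem q x 1) = H_pairing q \<psi> \<psi>' (H_coproduct q x)" if "x \<in> carrier (H_ring q)" for x
  proof (rule H_hom_unique[OF ring_type_ring QFG_H_hom[OF \<omega>(1)] hom _ _ _ that])
    show "\<omega> (HL_elem q (H_const q c) 1) = H_pairing q \<psi> \<psi>' (H_coproduct q (H_const q c))" for c
      by (simp add: H_coproduct(2) p(2) QFG_const[OF \<omega>(1)] QFG_const[OF \<psi>] QFG_const[OF \<psi>'])
    show "u_val q \<omega> = H_pairing q \<psi> \<psi>' (H_coproduct q (H_gen q GenU))"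
      by (simp add: H_coproduct(3) p(2) \<omega>(2))
    show "v_val q \<omega> = H_pairing q \<psi> \<psi>' (H_coproduct q (H_gen q GenV))"
      using ring_hom_add[OF p(1)]
      by (simp add: H_coproduct(4) p(2) QFG_v_0[OF \<omega>(1)] QFG_v_0[OF \<psi>] QFG_v_0[OF \<psi>'])
  qed
  then have "QFG_prod q s \<psi> \<psi>' = \<omega>"
    unfolding QFG_prod_def by (intro HL_point_unique[OF \<omega>(1)])
  then show "QFG_prod q s \<psi> \<psi>' \<in> QFG q s" "u_val q (QFG_prod q s \<psi> \<psi>') = u_val q \<psi> * u_val q \<psi>'"
    using \<omega> by simp_all
qed

lemma QFG_unit: "QFG_unit q s \<in> QFG q s" "u_val q (QFG_unit q s) = 1"
proof -
  obtain \<omega> where \<omega>: "\<omega> \<in> QFG q s" "u_val q \<omega> = 1"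
    using QFG_exists[of 1] nilpotent_0 by auto
  have hom: "(\<lambda>x. s (rconst (H_counit q x))) \<in> Ring.ring_hom (H_ring q) type_ring"
    using ring_hom_trans[OF H_counit(1) s_rconst_hom] by (simp add: comp_def)
  have "\<omega> (HL_elem q x 1) = s (rconst (H_counit q x))" if "x \<in> carrier (H_ring q)" for x
    by (rule H_hom_unique[OF ring_type_ring QFG_H_hom[OF \<omega>(1)] hom _ _ _ that])
      (simp_all add: H_counit QFG_const[OF \<omega>(1)] \<omega>(2) QFG_v_0[OF \<omega>(1)])
  then have "QFG_unit q s = \<omega>"
    unfolding QFG_unit_def by (intro HL_point_unique[OF \<omega>(1)])
  then show "QFG_unit q s \<in> QFG q s" "u_val q (QFG_unit q s) = 1" using \<omega> by simp_all
qed

lemma QFG_act: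
  assumes \<psi>: "\<psi> \<in> QFG q s" and \<phi>: "\<phi> \<in> NCF q s" "\<phi> (iota0 q rt) = deformed q s e 0"
    and comm: "u_val q \<psi> * e = e * u_val q \<psi>"
  shows "QFG_act q s \<psi> \<phi> \<in> NCF q s"
    "QFG_act q s \<psi> \<phi> (iota0 q rt) = deformed q s (u_val q \<psi> * e) 0"
proof -
  obtain e' where "\<phi> (iota0 q rt) = deformed q s e' 0" "nilpotent (e' - 1)" using NCF_form[OF \<phi>(1)] by blast
  then have "nilpotent (e - 1)" using \<phi>(2) deformed_inject by simp
  then have "nilpotent (u_val q \<psi> * e - 1)" using QFG_D(4)[OF \<psi>] comm by (intro unipotent_mult)
  then obtain \<omega> where \<omega>: "\<omega> \<in> NCF q s" "\<omega> (iota0 q rt) = deformed q s (u_val q \<psi> * e) 0"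
    using NCF_exists by blast
  have "QFG_act q s \<psi> \<phi> = \<omega>"
    unfolding QFG_act_def
  proof (rule the_equality)
    show "\<omega> \<in> NCF q s \<and> (\<exists>e f. \<phi> (iota0 q rt) = deformed q s e f \<and>
        \<omega> (iota0 q rt) = deformed q s (u_val q \<psi> * e) (u_val q \<psi> * f + v_val q \<psi>))"
      using \<omega> \<phi>(2) QFG_v_0[OF \<psi>] by (intro conjI exI[of _ e] exI[of _ 0]) simp_all
    fix \<omega>' assume "\<omega>' \<in> NCF q s \<and> (\<exists>e f. \<phi> (iota0 q rt) = deformed q s e f \<and>
        \<omega>' (iota0 q rt) = deformed q s (u_val q \<psi> * e) (u_val q \<psi> * f + v_val q \<psi>))"
    then show "\<omega>' = \<omega>"
      using \<omega> \<phi>(2) QFG_v_0[OF \<psi>] by (intro NCF_unique) (auto simp: deformed_inject)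
  qed
  then show "QFG_act q s \<psi> \<phi> \<in> NCF q s"
    "QFG_act q s \<psi> \<phi> (iota0 q rt) = deformed q s (u_val q \<psi> * e) 0" using \<omega> by simp_all
qed

lemma NCF_deformed_0: "\<phi> \<in> NCF q s \<Longrightarrow> \<phi> (iota0 q rt) = deformed q s e f \<Longrightarrow> f = 0 \<and> u_val q (NCF_iso q s \<phi>) = e"
  using NCF_iso(2) deformed_inject by metis

end

lemma wsubst_affine:
  fixes a b :: "'a::{ring,monoid_mult}"
  shows "wsubst (fps_const a + fps_const b * fps_X) w = fps_const a + fps_const b * w"
proof -
  define p where "p = fps_const a + fps_const b * fps_X"
  have p: "fps_nth p 0 = a" "fps_nth p 1 = b" "fps_nth p (Suc (Suc n)) = 0" for n
    by (simp_all add: p_def fps_X_def)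
  have z: "fps_nth p n = 0" if "n \<notin> {0, 1}" for n
  proof -
    obtain m where "n = Suc (Suc m)" using \<open>n \<notin> {0, 1}\<close> by (metis One_nat_def insertI1 insertI2 not0_implies_Suc)
    then show ?thesis using p(3) by simp
  qed
  have "wsubst p w = (\<Sum>n\<in>{0, 1}. fps_const (fps_nth p n) * ((\<lambda>z. w * z) ^^ n) 1)"
    unfolding wsubst_def by (rule sum.mono_neutral_left) (use z in auto)
  then show ?thesis using p by (simp add: p_def[symmetric])
qed

context L_alg
begin

lemma coord_trans_deformed:
  assumes "\<phi> (iota0 q rt) = deformed q s e f"
  shows "initial_condition (\<phi> (iota0 q rt)) = fps_const e * (fps_const (s rt) + fps_X) + fps_const f"
    "coord_trans q s \<phi> = (\<lambda>w. fps_const ((e - 1) * s rt + f) + fps_const e * w)"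
proof -
  have i: "initial_condition (\<phi> (iota0 q rt)) = fps_const e * taylor s rt + fps_const f"
    by (simp add: assms initial_condition_def tcoeff_deformed wconst_def)
  then show "initial_condition (\<phi> (iota0 q rt)) = fps_const e * (fps_const (s rt) + fps_X) + fps_const f"
    by (simp add: taylor_rt)
  have "initial_condition (\<phi> (iota0 q rt)) - fps_const (s rt)
      = fps_const ((e - 1) * s rt + f) + fps_const e * fps_X"
    unfolding i taylor_rt by (rule fps_ext) (simp add: algebra_simps fps_X_def)
  then show "coord_trans q s \<phi> = (\<lambda>w. fps_const ((e - 1) * s rt + f) + fps_const e * w)"
    unfolding coord_trans_def fun_eq_iff by (simp only: wsubst_affine) simp
qed

end

section \<open>Change of the algebra\<close>

locale L_alg_hom = A: L_alg q s + B: L_alg q s'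
  for q and s :: "ratfun \<Rightarrow> 'a::{ring,monoid_mult}" and s' :: "ratfun \<Rightarrow> 'b::{ring,monoid_mult}" +
  fixes h :: "'a \<Rightarrow> 'b"
  assumes h: "L_algebra_hom s s' h"
begin

lemma h_1 [simp]: "h 1 = 1" and h_add: "h (x + y) = h x + h y" and h_mult: "h (x * y) = h x * h y"
  and h_s [simp]: "h (s a) = s' a"
  using h unfolding L_algebra_hom_def by blast+
lemma h_0 [simp]: "h 0 = 0" using h_add[of 0 0] by simp
lemma h_diff: "h (x - y) = h x - h y" using h_add[of "x - y" y] by (simp add: eq_diff_eq)
lemma h_power: "h (x ^ n) = h x ^ n" by (induction n) (simp_all add: h_mult)

lemma h_nilpotent: "nilpotent x \<Longrightarrow> nilpotent (h x)"
  unfolding nilpotent_def using h_power h_0 by metis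

lemma nth_wmap [simp]: "fps_nth (wmap h f) n = h (fps_nth f n)" by (simp add: wmap_def)
lemma wmap_add: "wmap h (f + g) = wmap h f + wmap h g" by (rule fps_ext) (simp add: h_add)
lemma wmap_mult: "wmap h (f * g) = wmap h f * wmap h g"
  by (rule fps_ext) (simp add: fps_mult_nth additive_sum[of h, OF h_add] h_mult)
lemma wmap_const [simp]: "wmap h (fps_const a) = fps_const (h a)" by (rule fps_ext) simp
lemma wmap_0 [simp]: "wmap h 0 = 0" by (rule fps_ext) simp
lemma wmap_1 [simp]: "wmap h 1 = 1" by (rule fps_ext) simp
lemma wmap_taylor [simp]: "wmap h (taylor s a) = taylor s' a" by (rule fps_ext) (simp add: A.nth_taylor B.nth_taylor)
lemma wmap_wconst [simp]: "wmap h (wconst s c) = wconst s' c" by (simp add: wconst_def)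
lemma wmap_wderiv: "wmap h (wderiv s f) = wderiv s' (wmap h f)"
  by (rule fps_ext) (simp add: A.nth_wderiv B.nth_wderiv h_mult del: of_nat_Suc)
lemma tmap_wmap_can_iota: "tmap (wmap h) (can_iota s x) = can_iota s' x"
  by (rule tser_eqI) simp
lemma tmap_wmap_add: "tmap (wmap h) (f + g) = tmap (wmap h) f + tmap (wmap h) g"
  by (rule tmap_add) (rule wmap_add)
lemma tmap_wmap_mult: "tmap (wmap h) (f * g) = tmap (wmap h) f * tmap (wmap h) g"
  by (rule tmap_hom) (rule wmap_add wmap_mult)+
lemma tmap_wmap_tconst: "tmap (wmap h) (tconst f) = tconst (wmap h f)"
  by (rule tser_eqI) (simp add: tcoeff_tconst)

lemma tmap_wmap_deformed: "tmap (wmap h) (deformed q s e f) = deformed q s' (h e) (h f)"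
  by (rule tser_eqI) (simp add: A.tcoeff_deformed B.tcoeff_deformed wmap_add wmap_mult)

lemma NCF_map_NCF: "\<phi> \<in> NCF q s \<Longrightarrow> NCF_map q h \<phi> \<in> NCF q s'"
proof -
  assume \<phi>: "\<phi> \<in> NCF q s"
  have sg: "tmap (wmap h) (tsigma (wconst s) q f) = tsigma (wconst s') q (tmap (wmap h) f)" for f
    by (rule tser_eqI) (simp add: wmap_mult)
  have th: "tmap (wmap h) (ttheta (wconst s) q l f) = ttheta (wconst s') q l (tmap (wmap h) f)" for f l
    by (rule tser_eqI) (simp add: wmap_mult)
  have dr: "tmap (wmap h) (tmap (wderiv s) f) = tmap (wderiv s') (tmap (wmap h) f)" for f
    by (rule tser_eqI) (simp add: wmap_wderiv)
  have one: "tmap (wmap h) 1 = 1" by (rule tser_eqI) (simp add: tcoeff_1)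
  have nil: "nilpotent (fps_nth (tcoeff (tmap (wmap h) (\<phi> x) - can_iota s' x) i n) m)" if "x \<in> galois_hull q" for x i n m
  proof -
    have "nilpotent (fps_nth (tcoeff (\<phi> x - can_iota s x) i n) m)" using \<phi> that unfolding NCF_def by blast
    then show ?thesis using h_nilpotent by (fastforce simp: h_diff A.nth_taylor B.nth_taylor)
  qed
  show ?thesis
    unfolding NCF_def NCF_map_def
  proof (intro CollectI conjI ballI allI)
    fix x y assume xy: "x \<in> galois_hull q" "y \<in> galois_hull q"
    have "\<phi> (x + y) = \<phi> x + \<phi> y" "\<phi> (x * y) = \<phi> x * \<phi> y" using \<phi> xy unfolding NCF_def by blast+
    then show "restrict (\<lambda>x. tmap (wmap h) (\<phi> x)) (galois_hull q) (x + y)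
        = restrict (\<lambda>x. tmap (wmap h) (\<phi> x)) (galois_hull q) x + restrict (\<lambda>x. tmap (wmap h) (\<phi> x)) (galois_hull q) y"
      "restrict (\<lambda>x. tmap (wmap h) (\<phi> x)) (galois_hull q) (x * y)
        = restrict (\<lambda>x. tmap (wmap h) (\<phi> x)) (galois_hull q) x * restrict (\<lambda>x. tmap (wmap h) (\<phi> x)) (galois_hull q) y"
      using xy by (simp_all add: galois_hull.hull_add galois_hull.hull_mult tmap_wmap_add tmap_wmap_mult)
  next
    have "\<phi> 1 = 1" using \<phi> unfolding NCF_def by blast
    then show "restrict (\<lambda>x. tmap (wmap h) (\<phi> x)) (galois_hull q) 1 = 1" by (simp add: one)
  qed (simp_all add: galois_hull.intros A.NCF_D[OF \<phi>] sg th dr nil tmap_wmap_can_iota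
      nil[unfolded tcoeff_diff fps_sub_nth B.tcoeff_can_iota tcoeff_tmap nth_wmap])
qed

lemma NCF_map_iota0: "NCF_map q h \<phi> (iota0 q rt) = tmap (wmap h) (\<phi> (iota0 q rt))"
  by (simp add: NCF_map_def galois_hull.hull_iota0)

lemma QFG_map_QFG:
  assumes "\<psi> \<in> QFG q s"
  shows "QFG_map q h \<psi> \<in> QFG q s'" "u_val q (QFG_map q h \<psi>) = h (u_val q \<psi>)"
proof -
  have hh: "h \<in> Ring.ring_hom (type_ring :: 'a ring) (type_ring :: 'b ring)"
    by (rule ring_hom_memI) (simp_all add: h_add h_mult)
  have r: "ring (HL_ring q)" unfolding A.HL_def by (rule A.HL.T.ring_axioms)
  have "(\<lambda>z. h (\<psi> z)) \<in> Ring.ring_hom (HL_ring q) (type_ring :: 'b ring)"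
    using ring_hom_trans[OF A.QFG_D(1)[OF assms] hh] by (simp add: comp_def)
  then have "QFG_map q h \<psi> \<in> Ring.ring_hom (HL_ring q) (type_ring :: 'b ring)"
    unfolding QFG_map_def by (rule ring_hom_restrict[OF r])
  moreover have e: "QFG_map q h \<psi> (HL_elem q x a) = h (\<psi> (HL_elem q x a))" if "x \<in> carrier (H_ring q)" for x a
    using that by (simp add: QFG_map_def)
  ultimately show "QFG_map q h \<psi> \<in> QFG q s'" "u_val q (QFG_map q h \<psi>) = h (u_val q \<psi>)"
    using h_nilpotent[OF A.QFG_D(4)[OF assms]]
    by (simp_all add: QFG_def A.QFG_D(3)[OF assms] A.QFG_v_0[OF assms] nilpotent_0 h_diff)
      (simp add: QFG_map_def)
qed

lemma NCF_iso_natural: "\<phi> \<in> NCF q s \<Longrightarrow> NCF_iso q s' (NCF_map q h \<phi>) = QFG_map q h (NCF_iso q s \<phi>)"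
  by (rule B.NCF_iso_eqI)
    (simp_all add: NCF_map_NCF QFG_map_QFG A.NCF_iso(1) NCF_map_iota0 A.NCF_iso(2)[of \<phi>] tmap_wmap_deformed
      del: B.tcoeff_can_iota)

end

section \<open>The completed hull as a ring of twisted power series\<close>

lemma fps_X_pow_nth:
  fixes f :: "'c::{comm_ring,comm_monoid_mult} fps"
  shows "fps_nth (fps_X ^ n * f) k = (if k < n then 0 else fps_nth f (k - n))"
proof (induction n arbitrary: k)
  case (Suc n)
  have "fps_X ^ Suc n * f = fps_X * (fps_X ^ n * f)" by (simp add: mult.assoc)
  then show ?case by (cases k) (simp_all add: Suc)
qed simp

lemma (in ring) genideal_central:
  assumes a: "a \<in> carrier R" and cen: "\<And>x. x \<in> carrier R \<Longrightarrow> a \<otimes> x = x \<otimes> a"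
  shows "Idl {a} = (\<lambda>y. a \<otimes> y) ` carrier R"
proof
  have "ideal ((\<lambda>y. a \<otimes> y) ` carrier R) R"
  proof (rule idealI[OF ring_axioms])
    show "subgroup ((\<lambda>y. a \<otimes> y) ` carrier R) (add_monoid R)"
    proof (rule add.subgroupI)
      show "\<ominus> x \<in> (\<lambda>y. a \<otimes> y) ` carrier R" if "x \<in> (\<lambda>y. a \<otimes> y) ` carrier R" for x
        using that a by (auto simp: image_iff intro!: bexI[of _ "\<ominus> _"] r_minus[symmetric])
      show "x \<oplus> z \<in> (\<lambda>y. a \<otimes> y) ` carrier R"
        if "x \<in> (\<lambda>y. a \<otimes> y) ` carrier R" "z \<in> (\<lambda>y. a \<otimes> y) ` carrier R" for x z
        using that a by (auto simp: image_iff r_distr[symmetric])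
    qed (use a in auto)
    fix x y assume "x \<in> (\<lambda>y. a \<otimes> y) ` carrier R" and y: "y \<in> carrier R"
    then obtain z where z: "z \<in> carrier R" "x = a \<otimes> z" by blast
    have "y \<otimes> x = a \<otimes> (y \<otimes> z)" using z y a cen[OF y] by (metis m_assoc)
    then show "y \<otimes> x \<in> (\<lambda>y. a \<otimes> y) ` carrier R" using z y by blast
    have "x \<otimes> y = a \<otimes> (z \<otimes> y)" using z y a by (metis m_assoc)
    then show "x \<otimes> y \<in> (\<lambda>y. a \<otimes> y) ` carrier R" using z y by blast
  qed
  moreover have "a \<in> (\<lambda>y. a \<otimes> y) ` carrier R" using a by (intro image_eqI[of _ _ \<one>]) simp_all
  ultimately show "Idl {a} \<subseteq> (\<lambda>y. a \<otimes> y) ` carrier R" by (intro genideal_minimal) auto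
  interpret I: ideal "Idl {a}" R by (rule genideal_ideal) (use a in simp)
  show "(\<lambda>y. a \<otimes> y) ` carrier R \<subseteq> Idl {a}"
    using genideal_self[of "{a}"] a I.I_r_closed by auto
qed

text \<open>
  The \<open>W\<close>-adic topology of \<open>F(\<int>, A[[W]])[[X]]\<close> enters only through congruences modulo \<open>W\<^sup>n\<close>, which
  separate the elements.
\<close>

definition wcong :: "nat \<Rightarrow> 'c::ring fps tser \<Rightarrow> 'c fps tser \<Rightarrow> bool" where
  "wcong n f g \<longleftrightarrow> (\<forall>i m k. k < n \<longrightarrow> fps_nth (tcoeff f i m) k = fps_nth (tcoeff g i m) k)"

lemma wcong_refl [simp]: "wcong n f f" by (simp add: wcong_def)
lemma wcong_sym: "wcong n f g \<Longrightarrow> wcong n g f" by (simp add: wcong_def)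
lemma wcong_trans: "wcong n f g \<Longrightarrow> wcong n g h \<Longrightarrow> wcong n f h" by (simp add: wcong_def)
lemma wcong_mono: "wcong n f g \<Longrightarrow> m \<le> n \<Longrightarrow> wcong m f g" by (simp add: wcong_def)
lemma wcong_add: "wcong n f f' \<Longrightarrow> wcong n g g' \<Longrightarrow> wcong n (f + g) (f' + g')" by (simp add: wcong_def)
lemma wcong_diff: "wcong n f f' \<Longrightarrow> wcong n g g' \<Longrightarrow> wcong n (f - g) (f' - g')" by (simp add: wcong_def)
lemma wcong_diff_0: "wcong n (f - g) 0 \<longleftrightarrow> wcong n f g" by (simp add: wcong_def)
lemma wcong_mult: "wcong n f f' \<Longrightarrow> wcong n g g' \<Longrightarrow> wcong n (f * g) (f' * g')"
  by (simp add: wcong_def tcoeff_mult fps_sum_nth fps_mult_nth)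
lemma wcong_all: "(\<And>n. wcong n f g) \<Longrightarrow> f = g"
  unfolding wcong_def by (intro tser_eqI fps_ext) blast

locale comm_alg = L_alg q s for q and s :: "ratfun \<Rightarrow> 'c::{comm_ring,comm_monoid_mult}"
begin

lemma tconst_comm: "tconst (b :: 'c fps) * f = f * tconst b"
  by (rule tconst_central) (rule mult.commute)
lemma tconst_left_comm: "f * (tconst (b :: 'c fps) * g) = tconst b * (f * g)"
  by (metis mult.assoc tconst_comm)

sublocale T: tensor "hull_ring q" "type_ring :: 'c fps ring" tconst "taylor s"
proof -
  interpret HG: ring "hull_ring q" by (rule ring_hull_ring)
  interpret B: ring "type_ring :: 'c fps ring" by (rule ring_type_ring)
  show "tensor (hull_ring q) (type_ring :: 'c fps ring) tconst (taylor s)"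
  proof unfold_locales
    fix c and x assume "x \<in> carrier (hull_ring q)"
    show "tconst c \<otimes>\<^bsub>hull_ring q\<^esub> x = x \<otimes>\<^bsub>hull_ring q\<^esub> tconst c"
      by (simp add: hull_ring_def tconst_commute)
  next
    fix c show "tconst c \<in> carrier (hull_ring q)" by (simp add: hull_ring_def galois_hull.hull_const)
  qed (simp_all add: taylor_central)
qed

lemma hull_ring_simps [simp]: "carrier (hull_ring q) = galois_hull q" "x \<otimes>\<^bsub>hull_ring q\<^esub> y = x * y"
  "x \<oplus>\<^bsub>hull_ring q\<^esub> y = x + y" "\<one>\<^bsub>hull_ring q\<^esub> = 1" "\<zero>\<^bsub>hull_ring q\<^esub> = 0"
  by (simp_all add: hull_ring_def)

lemma T_ring_eq: "T_ring q s = T.TR" and T_elem_eq: "T_elem q s = T.pure"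
  by (simp_all add: T_ring_def T_elem_def)

text \<open>
  The ring morphism \<open>x \<otimes> b \<mapsto> \<iota>(x) b\<close>. It exists by the universal property and is unique because the
  elements \<open>x \<otimes> b\<close> span.
\<close>

definition to_series :: "'c hullW \<Rightarrow> 'c fps tser" where
  "to_series = (SOME h. h \<in> Ring.ring_hom T.TR type_ring \<and>
     (\<forall>x\<in>galois_hull q. \<forall>b. h (T.pure x b) = can_iota s x * tconst b))"

lemma to_series: "to_series \<in> Ring.ring_hom T.TR type_ring"
  "x \<in> galois_hull q \<Longrightarrow> to_series (T.pure x b) = can_iota s x * tconst b"
proof -
  have "\<exists>h \<in> Ring.ring_hom T.TR (type_ring :: 'c fps tser ring).
      \<forall>x\<in>carrier (hull_ring q). \<forall>b\<in>carrier (type_ring :: 'c fps ring). h (T.pure x b) = can_iota s x * tconst b"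
  proof (rule T.T_ring_map[OF ring_type_ring])
    fix x x' and b b' :: "'c fps"
    show "can_iota s (x \<otimes>\<^bsub>hull_ring q\<^esub> x') * tconst (b \<otimes>\<^bsub>type_ring\<^esub> b')
        = can_iota s x * tconst b \<otimes>\<^bsub>type_ring\<^esub> (can_iota s x' * tconst b')"
      by (simp add: can_iota_mult tconst_mult mult.assoc tconst_left_comm)
  next
    fix c x and b :: "'c fps"
    show "can_iota s (tconst c \<otimes>\<^bsub>hull_ring q\<^esub> x) * tconst b = can_iota s x * tconst (taylor s c \<otimes>\<^bsub>type_ring\<^esub> b)"
      by (simp add: can_iota_mult can_iota_tconst tconst_mult mult.assoc tconst_left_comm)
  qed (simp_all add: can_iota_add tconst_add distrib_left distrib_right)
  then have "\<exists>h. h \<in> Ring.ring_hom T.TR type_ring \<and>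
     (\<forall>x\<in>galois_hull q. \<forall>b. h (T.pure x b) = can_iota s x * tconst b)" by auto
  from someI_ex[OF this] show "to_series \<in> Ring.ring_hom T.TR type_ring"
    "x \<in> galois_hull q \<Longrightarrow> to_series (T.pure x b) = can_iota s x * tconst b"
    unfolding to_series_def[symmetric] by blast+
qed

lemma to_series_simps:
  "z \<in> carrier T.TR \<Longrightarrow> w \<in> carrier T.TR \<Longrightarrow> to_series (z \<oplus>\<^bsub>T.TR\<^esub> w) = to_series z + to_series w"
  "z \<in> carrier T.TR \<Longrightarrow> w \<in> carrier T.TR \<Longrightarrow> to_series (z \<otimes>\<^bsub>T.TR\<^esub> w) = to_series z * to_series w"
  "to_series \<one>\<^bsub>T.TR\<^esub> = 1" "to_series \<zero>\<^bsub>T.TR\<^esub> = 0"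
  using ring_hom_add[OF to_series(1)] ring_hom_mult[OF to_series(1)] ring_hom_one[OF to_series(1)]
    ring_hom_add[OF to_series(1), of "\<zero>\<^bsub>T.TR\<^esub>" "\<zero>\<^bsub>T.TR\<^esub>"] by simp_all

lemma to_series_uminus: "z \<in> carrier T.TR \<Longrightarrow> to_series (\<ominus>\<^bsub>T.TR\<^esub> z) = - to_series z"
  using to_series_simps(1)[of "\<ominus>\<^bsub>T.TR\<^esub> z" z] by (simp add: T.T.l_neg to_series_simps eq_neg_iff_add_eq_0)

lemma to_series_diff: "z \<in> carrier T.TR \<Longrightarrow> w \<in> carrier T.TR \<Longrightarrow> to_series (z \<ominus>\<^bsub>T.TR\<^esub> w) = to_series z - to_series w"
  by (simp add: a_minus_def to_series_simps to_series_uminus)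

definition Wpow :: "nat \<Rightarrow> 'c hullW" where "Wpow n = T.pure 1 (fps_X ^ n)"

lemma Wpow_closed [simp]: "Wpow n \<in> carrier T.TR"
  by (simp add: Wpow_def)

lemma Wpow_pow: "T_elem q s 1 fps_X [^]\<^bsub>T_ring q s\<^esub> n = Wpow n"
  unfolding T_ring_eq T_elem_eq Wpow_def
  by (induction n) (simp_all add: T.pure_one T.pure_mult mult.commute)

lemma Wpow_central: "z \<in> carrier T.TR \<Longrightarrow> Wpow n \<otimes>\<^bsub>T.TR\<^esub> z = z \<otimes>\<^bsub>T.TR\<^esub> Wpow n"
  by (induction rule: T.T_induct)
    (simp_all add: Wpow_def T.pure_mult T.T.r_distr T.T.l_distr mult.commute)

abbreviation "Wideal \<equiv> T_filtration q s"

lemma Wideal_eq: "Wideal n = (\<lambda>y. Wpow n \<otimes>\<^bsub>T.TR\<^esub> y) ` carrier T.TR"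
  unfolding T_filtration_def Wpow_pow unfolding T_ring_eq
  by (rule T.T.genideal_central) (simp_all add: Wpow_central)

lemma Wideal_ideal: "ideal (Wideal n) T.TR"
  unfolding T_filtration_def Wpow_pow unfolding T_ring_eq
  by (rule T.T.genideal_ideal) simp

lemma to_series_Wpow: "z \<in> carrier T.TR \<Longrightarrow> to_series (Wpow n \<otimes>\<^bsub>T.TR\<^esub> z) = tconst (fps_X ^ n) * to_series z"
  using to_series(2)[OF hull_1, of "fps_X ^ n"] by (simp add: to_series_simps(2)) (simp add: Wpow_def)

lemma wcong_X_pow: "wcong n (tconst (fps_X ^ n) * f) (0 :: 'c fps tser)"
  by (simp add: wcong_def fps_X_pow_nth)

definition tsum :: "(ratfun tser \<times> 'c fps) list \<Rightarrow> 'c hullW" where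
  "tsum xs = foldr (\<lambda>(x, b) z. T.pure x b \<oplus>\<^bsub>T.TR\<^esub> z) xs \<zero>\<^bsub>T.TR\<^esub>"

lemma tsum_simps [simp]: "tsum [] = \<zero>\<^bsub>T.TR\<^esub>" "tsum ((x, b) # xs) = T.pure x b \<oplus>\<^bsub>T.TR\<^esub> tsum xs"
  by (simp_all add: tsum_def)

lemma tsum_closed: "fst ` set xs \<subseteq> galois_hull q \<Longrightarrow> tsum xs \<in> carrier T.TR"
  by (induction xs) auto

lemma tsum_append:
  "fst ` set xs \<subseteq> galois_hull q \<Longrightarrow> fst ` set ys \<subseteq> galois_hull q \<Longrightarrow> tsum (xs @ ys) = tsum xs \<oplus>\<^bsub>T.TR\<^esub> tsum ys"
  by (induction xs) (auto simp: T.T.a_assoc tsum_closed)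

lemma T_tsum: "z \<in> carrier T.TR \<Longrightarrow> \<exists>xs. fst ` set xs \<subseteq> galois_hull q \<and> z = tsum xs"
proof (induction rule: T.T_induct)
  case zero
  show ?case by (rule exI[of _ "[]"]) simp
next
  case (pure x b)
  then show ?case by (intro exI[of _ "[(x, b)]"]) simp
next
  case (add z w)
  then obtain xs ys where "fst ` set xs \<subseteq> galois_hull q" "z = tsum xs" "fst ` set ys \<subseteq> galois_hull q" "w = tsum ys"
    by blast
  then show ?case by (intro exI[of _ "xs @ ys"]) (auto simp: tsum_append)
qed

text \<open>
  One step of Gaussian elimination: if the coefficient of \<open>x\<^sub>0\<close> at a place \<open>(i, m)\<close> is \<open>1\<close>, then the
  coefficients of the other first components at \<open>(i, m)\<close> can be moved into the term with \<open>x\<^sub>0\<close>.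
\<close>

lemma eliminate:
  assumes x0: "x0 \<in> galois_hull q" "tcoeff x0 i m = 1" and xs: "fst ` set xs \<subseteq> galois_hull q"
  shows "\<exists>b ys. length ys = length xs \<and> fst ` set ys \<subseteq> {y \<in> galois_hull q. tcoeff y i m = 0} \<and>
    tsum xs = T.pure x0 b \<oplus>\<^bsub>T.TR\<^esub> tsum ys"
  using xs
proof (induction xs)
  case Nil
  show ?case
    using T.pure_zero_right[of x0] x0(1) by (intro exI[of _ 0] exI[of _ "[]"]) simp
next
  case (Cons xb xs)
  obtain x c where xb: "xb = (x, c)" by (cases xb)
  have xh: "x \<in> galois_hull q" and xsh: "fst ` set xs \<subseteq> galois_hull q" using Cons.prems xb by auto
  obtain b ys where ys: "length ys = length xs" "fst ` set ys \<subseteq> {y \<in> galois_hull q. tcoeff y i m = 0}"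
    "tsum xs = T.pure x0 b \<oplus>\<^bsub>T.TR\<^esub> tsum ys" using Cons.IH[OF xsh] by blast
  define d where "d = tcoeff x i m"
  define y where "y = x - tconst d * x0"
  have y: "y \<in> galois_hull q" "tcoeff y i m = 0"
    using xh x0 by (simp_all add: y_def d_def hull_diff galois_hull.intros)
  have dx0: "tconst d * x0 \<in> galois_hull q" by (simp add: galois_hull.intros x0)
  have "T.pure x c = T.pure (y \<oplus>\<^bsub>hull_ring q\<^esub> (tconst d \<otimes>\<^bsub>hull_ring q\<^esub> x0)) c" by (simp add: y_def)
  also have "\<dots> = T.pure y c \<oplus>\<^bsub>T.TR\<^esub> T.pure (tconst d \<otimes>\<^bsub>hull_ring q\<^esub> x0) c"
    using y dx0 by (subst T.pure_add_left) simp_all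
  also have "T.pure (tconst d \<otimes>\<^bsub>hull_ring q\<^esub> x0) c = T.pure x0 (taylor s d * c)"
    using x0 by (subst T.pure_balanced) simp_all
  finally have 1: "T.pure x c = T.pure y c \<oplus>\<^bsub>T.TR\<^esub> T.pure x0 (taylor s d * c)" .
  have 2: "T.pure x0 (taylor s d * c + b) = T.pure x0 (taylor s d * c) \<oplus>\<^bsub>T.TR\<^esub> T.pure x0 b"
    using T.pure_add_right[of x0 "taylor s d * c" b] x0 by simp
  have cl: "T.pure y c \<in> carrier T.TR" "T.pure x0 (taylor s d * c) \<in> carrier T.TR" "T.pure x0 b \<in> carrier T.TR"
    "tsum ys \<in> carrier T.TR"
    using y x0 ys(2) by (auto intro: tsum_closed)
  have "tsum (xb # xs) = T.pure x0 (taylor s d * c + b) \<oplus>\<^bsub>T.TR\<^esub> tsum ((y, c) # ys)"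
    unfolding xb tsum_simps 1 2 ys(3) using cl by (simp add: T.T.a_ac)
  then show ?case
    using ys y by (intro exI[of _ "taylor s d * c + b"] exI[of _ "(y, c) # ys"]) auto
qed

lemma tcoeff_to_series_tsum_0:
  "fst ` set ys \<subseteq> {y \<in> galois_hull q. tcoeff y i m = 0} \<Longrightarrow> tcoeff (to_series (tsum ys)) i m = 0"
proof (induction ys)
  case (Cons y ys)
  obtain x c where y: "y = (x, c)" by (cases y)
  then have "tsum ys \<in> carrier T.TR" "T.pure x c \<in> carrier T.TR" using Cons.prems by (auto intro!: tsum_closed)
  then show ?case using Cons y by (simp add: to_series_simps to_series(2))
qed (simp add: to_series_simps)

text \<open>
  Since \<open>L\<close> is a field, Gaussian elimination reduces the number of terms of a formal sum, whatever the
  algebra is. Hence the map to twisted power series is injective modulo \<open>W\<^sup>n\<close>.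
\<close>

lemma tsum_faithful:
  "length xs = N \<Longrightarrow> fst ` set xs \<subseteq> galois_hull q \<Longrightarrow> wcong n (to_series (tsum xs)) 0 \<Longrightarrow> tsum xs \<in> Wideal n"
proof (induction N arbitrary: xs)
  case 0
  interpret I: ideal "Wideal n" T.TR by (rule Wideal_ideal)
  show ?case using 0 I.zero_closed by simp
next
  case (Suc N)
  interpret I: ideal "Wideal n" T.TR by (rule Wideal_ideal)
  obtain x0 b0 xs' where xs: "xs = (x0, b0) # xs'" "length xs' = N" using Suc.prems(1) by (cases xs) auto
  have h: "x0 \<in> galois_hull q" "fst ` set xs' \<subseteq> galois_hull q" using Suc.prems(2) xs by auto
  show ?case
  proof (cases "x0 = 0")
    case True
    then have "tsum xs = tsum xs'"
      using T.pure_zero_left[of b0] tsum_closed[OF h(2)] by (simp add: xs)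
    then show ?thesis using Suc.IH[OF xs(2) h(2)] Suc.prems(3) by simp
  next
    case False
    then obtain i m where c: "tcoeff x0 i m \<noteq> 0" by (metis tser_eqI tcoeff_0)
    \<comment> \<open>normalize the pivot to \<open>1\<close>, which is possible since its value lies in the field \<open>L\<close>\<close>
    define d x1 where "d = tcoeff x0 i m" and "x1 = tconst (1 / d) * x0"
    have x1: "x1 \<in> galois_hull q" "tcoeff x1 i m = 1" using h c by (simp_all add: x1_def d_def galois_hull.intros)
    have "tconst d * x1 = x0" using c by (simp add: x1_def d_def mult.assoc[symmetric] flip: tconst_mult)
    then have t0: "T.pure x0 b0 = T.pure x1 (taylor s d * b0)"
      using T.pure_balanced[of x1 b0 d] x1 by simp
    obtain b ys where ys: "length ys = length xs'" "fst ` set ys \<subseteq> {y \<in> galois_hull q. tcoeff y i m = 0}"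
      "tsum xs' = T.pure x1 b \<oplus>\<^bsub>T.TR\<^esub> tsum ys" using eliminate[OF x1 h(2)] by blast
    define B where "B = taylor s d * b0 + b"
    have ysh: "fst ` set ys \<subseteq> galois_hull q" using ys(2) by auto
    have cl: "T.pure x1 B \<in> carrier T.TR" "tsum ys \<in> carrier T.TR" using x1 tsum_closed[OF ysh] by simp_all
    have z: "tsum xs = T.pure x1 B \<oplus>\<^bsub>T.TR\<^esub> tsum ys"
      unfolding xs tsum_simps t0 ys(3) B_def using T.pure_add_right[of x1 "taylor s d * b0" b] x1 cl
      by (simp add: T.T.a_assoc)
    \<comment> \<open>at the pivot place only the first term contributes, so its second factor is divisible by \<open>W\<^sup>n\<close>\<close>
    have B: "tcoeff (to_series (tsum xs)) i m = B"
      unfolding z using cl x1 by (simp add: to_series_simps to_series(2) tcoeff_to_series_tsum_0[OF ys(2)])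
    then have B0: "fps_nth B k = 0" if "k < n" for k
      using Suc.prems(3) that unfolding wcong_def by (metis tcoeff_0 fps_zero_nth)
    define B' where "B' = Abs_fps (\<lambda>k. fps_nth B (k + n))"
    have "B = fps_X ^ n * B'" by (rule fps_ext) (simp add: fps_X_pow_nth B0 B'_def)
    then have "T.pure x1 B = Wpow n \<otimes>\<^bsub>T.TR\<^esub> T.pure x1 B'"
      using x1 by (simp add: Wpow_def T.pure_mult)
    then have 1: "T.pure x1 B \<in> Wideal n" using x1 by (auto simp: Wideal_eq)
    have "wcong n (to_series (T.pure x1 B)) 0"
      using 1 by (auto simp: Wideal_eq to_series_Wpow wcong_X_pow)
    then have "wcong n (to_series (tsum ys)) 0"
      using Suc.prems(3) wcong_diff[of n "to_series (tsum xs)" 0 "to_series (T.pure x1 B)" 0] cl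
      by (simp add: z to_series_simps)
    then have "tsum ys \<in> Wideal n" using Suc.IH[of ys] ys(1) xs(2) ysh by simp
    then show ?thesis unfolding z using 1 I.a_closed by blast
  qed
qed

lemma Wideal_iff: "z \<in> Wideal n \<longleftrightarrow> z \<in> carrier T.TR \<and> wcong n (to_series z) 0"
proof
  assume "z \<in> Wideal n"
  then show "z \<in> carrier T.TR \<and> wcong n (to_series z) 0" by (auto simp: Wideal_eq to_series_Wpow wcong_X_pow)
next
  assume "z \<in> carrier T.TR \<and> wcong n (to_series z) 0"
  then show "z \<in> Wideal n" using T_tsum tsum_faithful by blast
qed

abbreviation "Wcoset n z \<equiv> Wideal n +>\<^bsub>T.TR\<^esub> z"

lemma Wcoset_eq: "z \<in> carrier T.TR \<Longrightarrow> Wcoset n z = {w \<in> carrier T.TR. wcong n (to_series w) (to_series z)}"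
proof -
  assume z: "z \<in> carrier T.TR"
  interpret I: ideal "Wideal n" T.TR by (rule Wideal_ideal)
  show ?thesis
    using I.quot_mem[OF z] I.quot_eq[OF _ z] by (auto simp: Wideal_iff to_series_diff z wcong_diff_0)
qed

abbreviation "CT \<equiv> CT_ring q s"

lemma CT_carrier: "x \<in> carrier CT \<longleftrightarrow> (\<forall>n. (\<exists>z\<in>carrier T.TR. x n = Wcoset n z) \<and> x (Suc n) \<subseteq> x n)"
  using ideal.quot_carrier[OF Wideal_ideal] by (simp add: CT_ring_def completion_ring_def T_ring_eq)

lemma CT_antimono: "x \<in> carrier CT \<Longrightarrow> m \<le> n \<Longrightarrow> x n \<subseteq> x m"
  by (rule lift_Suc_antimono_le) (simp_all add: CT_carrier)

text \<open>
  The coefficient of \<open>W\<^sup>k\<close> is determined modulo \<open>W\<^sup>k\<^sup>+\<^sup>1\<close>, so it can be read off from the component with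
  index \<open>k+1\<close> of an element of the inverse limit.
\<close>

definition CT_series :: "(nat \<Rightarrow> 'c hullW set) \<Rightarrow> 'c fps tser" where
  "CT_series x = Tser (\<lambda>i m. Abs_fps (\<lambda>k. fps_nth (tcoeff (to_series (SOME z. z \<in> x (Suc k))) i m) k))"

lemma CT_nonempty:
  assumes "x \<in> carrier CT"
  obtains z where "z \<in> carrier T.TR" "z \<in> x n" "x n = {w \<in> carrier T.TR. wcong n (to_series w) (to_series z)}"
proof -
  obtain z where z: "z \<in> carrier T.TR" "x n = Wcoset n z" using assms unfolding CT_carrier by blast
  then show thesis using that Wcoset_eq by auto
qed

lemma CT_series_cong:
  assumes x: "x \<in> carrier CT" and z: "z \<in> x n"
  shows "wcong n (to_series z) (CT_series x)"
proof -
  have "fps_nth (tcoeff (to_series z) i m) k = fps_nth (tcoeff (to_series (SOME z. z \<in> x (Suc k))) i m) k" if "k < n" for i m k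
  proof -
    obtain w where w: "w \<in> x (Suc k)" "x (Suc k) = {v \<in> carrier T.TR. wcong (Suc k) (to_series v) (to_series w)}"
      by (rule CT_nonempty[OF x, of "Suc k"])
    have "(SOME z. z \<in> x (Suc k)) \<in> x (Suc k)" by (rule someI[of _ w]) (rule w)
    moreover have "z \<in> x (Suc k)" using CT_antimono[OF x, of "Suc k" n] that z by auto
    ultimately show ?thesis using w(2) by (simp add: wcong_def)
  qed
  then show ?thesis by (simp add: wcong_def CT_series_def)
qed

text \<open>
  Through this description identities in the completion are checked on series.
\<close>

lemma CT_mem: "x \<in> carrier CT \<Longrightarrow> x n = {z \<in> carrier T.TR. wcong n (to_series z) (CT_series x)}"
proof -
  assume x: "x \<in> carrier CT"
  obtain z where z: "z \<in> x n" "x n = {w \<in> carrier T.TR. wcong n (to_series w) (to_series z)}"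
    by (rule CT_nonempty[OF x, of n])
  show ?thesis using CT_series_cong[OF x z(1)] by (subst z(2)) (auto intro: wcong_trans wcong_sym)
qed

lemma CT_series_inj: "x \<in> carrier CT \<Longrightarrow> y \<in> carrier CT \<Longrightarrow> CT_series x = CT_series y \<Longrightarrow> x = y"
  by (rule ext) (simp only: CT_mem)

text \<open>The image of the completion: the closure of the image of the tensor product.\<close>

definition approx :: "'c fps tser \<Rightarrow> bool" where
  "approx f \<longleftrightarrow> (\<forall>n. \<exists>z\<in>carrier T.TR. wcong n (to_series z) f)"

definition CT_of_series :: "'c fps tser \<Rightarrow> nat \<Rightarrow> 'c hullW set" where
  "CT_of_series f = (\<lambda>n. {z \<in> carrier T.TR. wcong n (to_series z) f})"

lemma CT_of_series_closed: "approx f \<Longrightarrow> CT_of_series f \<in> carrier CT"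
  unfolding CT_carrier
proof (intro allI conjI)
  fix n assume "approx f"
  then obtain z where z: "z \<in> carrier T.TR" "wcong n (to_series z) f" unfolding approx_def by blast
  show "\<exists>z\<in>carrier T.TR. CT_of_series f n = Wcoset n z"
    by (rule bexI[OF _ z(1)]) (use z in \<open>auto simp: CT_of_series_def Wcoset_eq intro: wcong_trans wcong_sym\<close>)
  show "CT_of_series f (Suc n) \<subseteq> CT_of_series f n" by (auto simp: CT_of_series_def intro: wcong_mono)
qed

lemma CT_series_CT_of_series [simp]: "approx f \<Longrightarrow> CT_series (CT_of_series f) = f"
proof (rule wcong_all)
  fix n assume f: "approx f"
  then obtain z where z: "z \<in> carrier T.TR" "wcong n (to_series z) f" unfolding approx_def by blast
  then have "z \<in> CT_of_series f n" by (simp add: CT_of_series_def)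
  from CT_series_cong[OF CT_of_series_closed[OF f] this] z show "wcong n (CT_series (CT_of_series f)) f"
    by (blast intro: wcong_trans wcong_sym)
qed

lemma approx_CT_series: "x \<in> carrier CT \<Longrightarrow> approx (CT_series x)"
  unfolding approx_def
proof
  fix n assume x: "x \<in> carrier CT"
  obtain z where "z \<in> carrier T.TR" "z \<in> x n" by (rule CT_nonempty[OF x, of n])
  then show "\<exists>z\<in>carrier T.TR. wcong n (to_series z) (CT_series x)" using CT_series_cong[OF x] by blast
qed

lemma CT_ops:
  "x \<in> carrier CT \<Longrightarrow> y \<in> carrier CT \<Longrightarrow> x \<oplus>\<^bsub>CT\<^esub> y = CT_of_series (CT_series x + CT_series y)"
  "x \<in> carrier CT \<Longrightarrow> y \<in> carrier CT \<Longrightarrow> x \<otimes>\<^bsub>CT\<^esub> y = CT_of_series (CT_series x * CT_series y)"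
  "\<zero>\<^bsub>CT\<^esub> = CT_of_series 0" "\<one>\<^bsub>CT\<^esub> = CT_of_series 1"
proof -
  have q: "(Wcoset n z) \<oplus>\<^bsub>T.TR Quot Wideal n\<^esub> (Wcoset n w) = Wcoset n (z \<oplus>\<^bsub>T.TR\<^esub> w)"
    "(Wcoset n z) \<otimes>\<^bsub>T.TR Quot Wideal n\<^esub> (Wcoset n w) = Wcoset n (z \<otimes>\<^bsub>T.TR\<^esub> w)"
    if "z \<in> carrier T.TR" "w \<in> carrier T.TR" for z w n
    using ideal.quot_add[OF Wideal_ideal that] ideal.quot_mult[OF Wideal_ideal that] by simp_all
  have c: "Wcoset n z = CT_of_series f n" if "z \<in> carrier T.TR" "wcong n (to_series z) f" for n z f
    using that by (auto simp: Wcoset_eq CT_of_series_def intro: wcong_trans wcong_sym)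
  {
    fix x y assume xy: "x \<in> carrier CT" "y \<in> carrier CT"
    have *: "x n \<oplus>\<^bsub>T.TR Quot Wideal n\<^esub> y n = CT_of_series (CT_series x + CT_series y) n \<and> x n \<otimes>\<^bsub>T.TR Quot Wideal n\<^esub> y n = CT_of_series (CT_series x * CT_series y) n" for n
    proof -
      obtain z where z: "z \<in> carrier T.TR" "x n = Wcoset n z" using xy(1) unfolding CT_carrier by blast
      obtain w where w: "w \<in> carrier T.TR" "y n = Wcoset n w" using xy(2) unfolding CT_carrier by blast
      have "wcong n (to_series z) (CT_series x)" "wcong n (to_series w) (CT_series y)"
        using CT_series_cong[OF xy(1), of z n] CT_series_cong[OF xy(2), of w n] z w by (simp_all add: Wcoset_eq)
      then show ?thesis
        unfolding z(2) w(2) q[OF z(1) w(1)] using z w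
        by (auto intro!: c simp: to_series_simps wcong_add wcong_mult)
    qed
    then show "x \<oplus>\<^bsub>CT\<^esub> y = CT_of_series (CT_series x + CT_series y)" "x \<otimes>\<^bsub>CT\<^esub> y = CT_of_series (CT_series x * CT_series y)"
      by (simp_all add: CT_ring_def completion_ring_def T_ring_eq fun_eq_iff)
  }
  have "\<zero>\<^bsub>T.TR Quot Wideal n\<^esub> = CT_of_series 0 n" "\<one>\<^bsub>T.TR Quot Wideal n\<^esub> = CT_of_series 1 n" for n
    using c[of "\<zero>\<^bsub>T.TR\<^esub>" n 0] c[of "\<one>\<^bsub>T.TR\<^esub>" n 1]
    by (simp_all add: ideal.quot_zero[OF Wideal_ideal] ideal.quot_one[OF Wideal_ideal] to_series_simps)
  then show "\<zero>\<^bsub>CT\<^esub> = CT_of_series 0" "\<one>\<^bsub>CT\<^esub> = CT_of_series 1"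
    by (simp_all add: CT_ring_def completion_ring_def T_ring_eq fun_eq_iff)
qed

lemma approx_add: "approx f \<Longrightarrow> approx g \<Longrightarrow> approx (f + g)"
  unfolding approx_def using to_series_simps(1) T.T.a_closed wcong_add by metis
lemma approx_mult: "approx f \<Longrightarrow> approx g \<Longrightarrow> approx (f * g)"
  unfolding approx_def using to_series_simps(2) T.T.m_closed wcong_mult by metis
lemma approx_to_series: "z \<in> carrier T.TR \<Longrightarrow> approx (to_series z)"
  unfolding approx_def using wcong_refl by blast
lemma approx_0: "approx 0" and approx_1: "approx 1"
  using approx_to_series[of "\<zero>\<^bsub>T.TR\<^esub>"] approx_to_series[of "\<one>\<^bsub>T.TR\<^esub>"] by (simp_all add: to_series_simps)
lemma approx_uminus: "approx f \<Longrightarrow> approx (- f)"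
proof -
  assume f: "approx f"
  have "- f = to_series (\<ominus>\<^bsub>T.TR\<^esub> \<one>\<^bsub>T.TR\<^esub>) * f" by (simp add: to_series_uminus to_series_simps)
  then show ?thesis using approx_mult[OF approx_to_series f] by simp
qed

lemma CT_closed [simp]:
  "x \<in> carrier CT \<Longrightarrow> y \<in> carrier CT \<Longrightarrow> x \<oplus>\<^bsub>CT\<^esub> y \<in> carrier CT"
  "x \<in> carrier CT \<Longrightarrow> y \<in> carrier CT \<Longrightarrow> x \<otimes>\<^bsub>CT\<^esub> y \<in> carrier CT"
  "\<zero>\<^bsub>CT\<^esub> \<in> carrier CT" "\<one>\<^bsub>CT\<^esub> \<in> carrier CT"
  by (simp_all add: CT_ops CT_of_series_closed approx_add approx_mult approx_CT_series approx_0 approx_1)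

lemma CT_series_ops [simp]:
  "x \<in> carrier CT \<Longrightarrow> y \<in> carrier CT \<Longrightarrow> CT_series (x \<oplus>\<^bsub>CT\<^esub> y) = CT_series x + CT_series y"
  "x \<in> carrier CT \<Longrightarrow> y \<in> carrier CT \<Longrightarrow> CT_series (x \<otimes>\<^bsub>CT\<^esub> y) = CT_series x * CT_series y"
  "CT_series \<zero>\<^bsub>CT\<^esub> = 0" "CT_series \<one>\<^bsub>CT\<^esub> = 1"
  by (simp_all add: CT_ops approx_add approx_mult approx_CT_series approx_0 approx_1)

sublocale CT: ring CT
proof (rule ringI)
  show "abelian_group CT"
  proof (rule abelian_groupI)
    fix x assume x: "x \<in> carrier CT"
    show "\<exists>y\<in>carrier CT. y \<oplus>\<^bsub>CT\<^esub> x = \<zero>\<^bsub>CT\<^esub>"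
      by (rule bexI[of _ "CT_of_series (- CT_series x)"], rule CT_series_inj)
        (use x in \<open>simp_all add: CT_of_series_closed approx_uminus approx_CT_series\<close>)
  qed (auto intro!: CT_series_inj simp: algebra_simps)
  show "Group.monoid CT"
    by (rule monoidI) (auto intro!: CT_series_inj simp: mult.assoc)
qed (auto intro!: CT_series_inj simp: algebra_simps)

lemma CT_series_uminus [simp]: "x \<in> carrier CT \<Longrightarrow> CT_series (\<ominus>\<^bsub>CT\<^esub> x) = - CT_series x"
  using CT_series_ops(1)[of "\<ominus>\<^bsub>CT\<^esub> x" x] by (simp add: CT.l_neg eq_neg_iff_add_eq_0 del: CT_series_ops(1))

lemma CT_series_diff [simp]: "x \<in> carrier CT \<Longrightarrow> y \<in> carrier CT \<Longrightarrow> CT_series (x \<ominus>\<^bsub>CT\<^esub> y) = CT_series x - CT_series y"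
  by (simp add: a_minus_def)

definition CT_embed :: "'c hullW \<Rightarrow> nat \<Rightarrow> 'c hullW set" where "CT_embed z = CT_of_series (to_series z)"

lemma CT_embed_closed [simp]: "z \<in> carrier T.TR \<Longrightarrow> CT_embed z \<in> carrier CT"
  and CT_series_embed [simp]: "z \<in> carrier T.TR \<Longrightarrow> CT_series (CT_embed z) = to_series z"
  by (simp_all add: CT_embed_def CT_of_series_closed approx_to_series)

lemma completion_map_embed: "z \<in> carrier T.TR \<Longrightarrow> completion_map (T_ring q s) Wideal z = CT_embed z"
  by (simp add: completion_map_def CT_embed_def CT_of_series_def Wcoset_eq T_ring_eq)

lemma CT_elem_embed: "x \<in> galois_hull q \<Longrightarrow> CT_elem q s x b = CT_embed (T.pure x b)"
  by (simp add: CT_elem_def completion_map_embed T_elem_eq)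

lemma CT_elem_closed [simp]: "x \<in> galois_hull q \<Longrightarrow> CT_elem q s x b \<in> carrier CT"
  by (simp add: CT_elem_embed)
lemma CT_series_CT_elem [simp]: "x \<in> galois_hull q \<Longrightarrow> CT_series (CT_elem q s x b) = can_iota s x * tconst b"
  by (simp add: CT_elem_embed to_series(2))

lemma CT_Wpow: "CT_elem q s 1 fps_X [^]\<^bsub>CT\<^esub> n = CT_embed (Wpow n)"
proof (induction n)
  case 0
  show ?case by (rule CT_series_inj) (simp_all add: Wpow_def to_series(2))
next
  case (Suc n)
  show ?case
    by (rule CT_series_inj) (simp_all add: Suc Wpow_def to_series(2) mult.commute flip: tconst_mult)
qed

lemma CT_nbhd_eq: "CT_nbhd q s n = (\<lambda>y. CT_embed (Wpow n) \<otimes>\<^bsub>CT\<^esub> y) ` carrier CT"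
  unfolding CT_nbhd_def CT_Wpow
  by (rule CT.genideal_central)
    (auto intro!: CT_series_inj simp: Wpow_def to_series(2) tconst_comm)

text \<open>
  A series divisible by \<open>W\<^sup>n\<close> that is a limit of tensors has a quotient by \<open>W\<^sup>n\<close> that is such a limit as
  well: the approximating tensors are divisible by \<open>W\<^sup>n\<close>, by the injectivity modulo \<open>W\<^sup>n\<close>.
\<close>

lemma CT_nbhd_iff: "x \<in> CT_nbhd q s n \<longleftrightarrow> x \<in> carrier CT \<and> wcong n (CT_series x) 0"
proof
  assume "x \<in> CT_nbhd q s n"
  then show "x \<in> carrier CT \<and> wcong n (CT_series x) 0"
    by (auto simp: CT_nbhd_eq) (simp add: Wpow_def to_series(2) wcong_X_pow)
next
  assume x: "x \<in> carrier CT \<and> wcong n (CT_series x) 0"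
  define g where "g = Tser (\<lambda>i m. Abs_fps (\<lambda>k. fps_nth (tcoeff (CT_series x) i m) (k + n)))"
  have g: "CT_series x = tconst (fps_X ^ n) * g"
    using x by (intro tser_eqI fps_ext) (simp add: g_def fps_X_pow_nth wcong_def)
  have "approx g"
    unfolding approx_def
  proof
    fix m
    obtain y where y: "y \<in> carrier T.TR" "wcong (m + n) (to_series y) (CT_series x)"
      using approx_CT_series x unfolding approx_def by blast
    then have "wcong n (to_series y) 0" using x by (meson le_add2 wcong_mono wcong_trans)
    then have "y \<in> Wideal n" using y Wideal_iff by blast
    then obtain z where z: "z \<in> carrier T.TR" "y = Wpow n \<otimes>\<^bsub>T.TR\<^esub> z" unfolding Wideal_eq by blast
    have "wcong m (to_series z) g"
      unfolding wcong_def
    proof (intro allI impI)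
      fix i l k assume "k < m"
      then show "fps_nth (tcoeff (to_series z) i l) k = fps_nth (tcoeff g i l) k"
      proof -
        have "fps_nth (tcoeff (tconst (fps_X ^ n) * to_series z) i l) (k + n)
            = fps_nth (tcoeff (tconst (fps_X ^ n) * g) i l) (k + n)"
          using y(2) \<open>k < m\<close> unfolding wcong_def g z(2) to_series_Wpow[OF z(1)] by (meson add_less_mono1)
        then show ?thesis by (simp add: fps_X_pow_nth)
      qed
    qed
    then show "\<exists>z\<in>carrier T.TR. wcong m (to_series z) g" using z(1) by blast
  qed
  then have "x = CT_embed (Wpow n) \<otimes>\<^bsub>CT\<^esub> CT_of_series g"
    using x by (intro CT_series_inj) (simp_all add: CT_of_series_closed g Wpow_def to_series(2))
  then show "x \<in> CT_nbhd q s n"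
    unfolding CT_nbhd_eq using CT_of_series_closed[OF \<open>approx g\<close>] by blast
qed

end

section \<open>Operators on the completion\<close>

text \<open>
  Operators on one completed tensor product and base change between two of them are constructed in the
  same way; the former is the case of equal structure maps.
\<close>

locale comm_alg_pair = A: comm_alg q s + B: comm_alg q s'
  for q and s :: "ratfun \<Rightarrow> 'c::{comm_ring,comm_monoid_mult}" and s' :: "ratfun \<Rightarrow> 'd::{comm_ring,comm_monoid_mult}"
begin

text \<open>
  Biadditive and \<open>L\<close>-balanced, up to the relations of the target.
\<close>

definition balanced :: "(ratfun tser \<times> 'c fps \<Rightarrow> (ratfun tser \<times> 'd fps \<Rightarrow>\<^sub>0 int)) \<Rightarrow> bool" where
  "balanced G \<longleftrightarrow>
    (\<forall>x\<in>galois_hull q. \<forall>b. G (x, b) \<in> carrier B.T.MR) \<and>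
    (\<forall>x\<in>galois_hull q. \<forall>x'\<in>galois_hull q. \<forall>b.
      B.T.tclass (G (x + x', b)) = B.T.tclass (G (x, b)) \<oplus>\<^bsub>B.T.TR\<^esub> B.T.tclass (G (x', b))) \<and>
    (\<forall>x\<in>galois_hull q. \<forall>b b'.
      B.T.tclass (G (x, b + b')) = B.T.tclass (G (x, b)) \<oplus>\<^bsub>B.T.TR\<^esub> B.T.tclass (G (x, b'))) \<and>
    (\<forall>x\<in>galois_hull q. \<forall>c b. B.T.tclass (G (tconst c * x, b)) = B.T.tclass (G (x, taylor s c * b)))"

lemma balanced_D:
  assumes "balanced G" "x \<in> galois_hull q"
  shows "G (x, b) \<in> carrier B.T.MR"
    "x' \<in> galois_hull q \<Longrightarrow> B.T.tclass (G (x + x', b)) = B.T.tclass (G (x, b)) \<oplus>\<^bsub>B.T.TR\<^esub> B.T.tclass (G (x', b))"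
    "B.T.tclass (G (x, b + b')) = B.T.tclass (G (x, b)) \<oplus>\<^bsub>B.T.TR\<^esub> B.T.tclass (G (x, b'))"
    "B.T.tclass (G (tconst c * x, b)) = B.T.tclass (G (x, taylor s c * b))"
  using assms unfolding balanced_def by blast+

lemma induced:
  assumes "balanced G"
  shows "z \<in> carrier A.T.TR \<Longrightarrow> T_extend q s' G z \<in> carrier B.T.TR"
    and "z \<in> carrier A.T.TR \<Longrightarrow> w \<in> carrier A.T.TR \<Longrightarrow>
      T_extend q s' G (z \<oplus>\<^bsub>A.T.TR\<^esub> w) = T_extend q s' G z \<oplus>\<^bsub>B.T.TR\<^esub> T_extend q s' G w"
    and "x \<in> galois_hull q \<Longrightarrow> T_extend q s' G (A.T.pure x b) = B.T.tclass (G (x, b))"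
proof -
  interpret TT: two_tensors "hull_ring q" "type_ring :: 'c fps ring" tconst "taylor s"
    "hull_ring q" "type_ring :: 'd fps ring" tconst "taylor s'" ..
  have G: "\<And>x y. x \<in> carrier (hull_ring q) \<Longrightarrow> y \<in> carrier (type_ring :: 'c fps ring) \<Longrightarrow> G (x, y) \<in> carrier B.T.MR"
    and l: "\<And>x x' y. x \<in> carrier (hull_ring q) \<Longrightarrow> x' \<in> carrier (hull_ring q) \<Longrightarrow> y \<in> carrier (type_ring :: 'c fps ring) \<Longrightarrow>
      B.T.tclass (G (x \<oplus>\<^bsub>hull_ring q\<^esub> x', y)) = B.T.tclass (G (x, y)) \<oplus>\<^bsub>B.T.TR\<^esub> B.T.tclass (G (x', y))"
    and r: "\<And>x y y'. x \<in> carrier (hull_ring q) \<Longrightarrow> y \<in> carrier (type_ring :: 'c fps ring) \<Longrightarrow> y' \<in> carrier (type_ring :: 'c fps ring) \<Longrightarrow>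
      B.T.tclass (G (x, y \<oplus>\<^bsub>type_ring\<^esub> y')) = B.T.tclass (G (x, y)) \<oplus>\<^bsub>B.T.TR\<^esub> B.T.tclass (G (x, y'))"
    and b: "\<And>c x y. x \<in> carrier (hull_ring q) \<Longrightarrow> y \<in> carrier (type_ring :: 'c fps ring) \<Longrightarrow>
      B.T.tclass (G (tconst c \<otimes>\<^bsub>hull_ring q\<^esub> x, y)) = B.T.tclass (G (x, taylor s c \<otimes>\<^bsub>type_ring\<^esub> y))"
    using assms unfolding balanced_def A.hull_ring_simps by simp_all
  note i = TT.induced_map[of G, OF G l r b]
  have e: "T_extend q s' G z = (\<Union>p\<in>z. B.T.tclass (frag_extend G p))" for z
    by (simp add: T_extend_def)
  show "z \<in> carrier A.T.TR \<Longrightarrow> T_extend q s' G z \<in> carrier B.T.TR"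
    unfolding e by (rule i(1))
  show "z \<in> carrier A.T.TR \<Longrightarrow> w \<in> carrier A.T.TR \<Longrightarrow>
      T_extend q s' G (z \<oplus>\<^bsub>A.T.TR\<^esub> w) = T_extend q s' G z \<oplus>\<^bsub>B.T.TR\<^esub> T_extend q s' G w"
    unfolding e by (rule i(2))
  show "x \<in> galois_hull q \<Longrightarrow> T_extend q s' G (A.T.pure x b) = B.T.tclass (G (x, b))"
    unfolding e by (rule i(3)) simp_all
qed

text \<open>
  The derivation lowers the \<open>W\<close>-adic order by one, so the value of an extension modulo \<open>W\<^sup>n\<close> is
  determined by the component of index \<open>n+1\<close>. The extension is described by congruences because it
  need not come from an operator on all series.
\<close>

lemma completion:
  assumes cl: "\<And>z. z \<in> carrier A.T.TR \<Longrightarrow> F z \<in> carrier B.T.TR"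
    and add: "\<And>z w. z \<in> carrier A.T.TR \<Longrightarrow> w \<in> carrier A.T.TR \<Longrightarrow> F (z \<oplus>\<^bsub>A.T.TR\<^esub> w) = F z \<oplus>\<^bsub>B.T.TR\<^esub> F w"
    and filt: "\<And>n z. z \<in> carrier A.T.TR \<Longrightarrow> wcong (Suc n) (A.to_series z) 0 \<Longrightarrow> wcong n (B.to_series (F z)) 0"
    and x: "x \<in> carrier A.CT"
  defines "E \<equiv> completion_extend (T_ring q s') (T_filtration q s') F"
  shows "E x \<in> carrier B.CT"
    and "y \<in> x (Suc n) \<Longrightarrow> wcong n (B.CT_series (E x)) (B.to_series (F y))"
proof -
  have F0: "F \<zero>\<^bsub>A.T.TR\<^esub> = \<zero>\<^bsub>B.T.TR\<^esub>"
    by (rule A.T.T_additive_0[OF B.T.T.abelian_group_axioms cl add])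
  have jF: "B.to_series (F (z \<ominus>\<^bsub>A.T.TR\<^esub> w)) = B.to_series (F z) - B.to_series (F w)"
    if "z \<in> carrier A.T.TR" "w \<in> carrier A.T.TR" for z w
  proof -
    have "F (z \<ominus>\<^bsub>A.T.TR\<^esub> w) \<oplus>\<^bsub>B.T.TR\<^esub> F w = F z"
      using that add[of "z \<ominus>\<^bsub>A.T.TR\<^esub> w" w] by (simp add: a_minus_def A.T.T.a_assoc A.T.T.l_neg)
    then have "B.to_series (F (z \<ominus>\<^bsub>A.T.TR\<^esub> w)) + B.to_series (F w) = B.to_series (F z)"
      using B.to_series_simps(1)[of "F (z \<ominus>\<^bsub>A.T.TR\<^esub> w)" "F w"] cl that by simp
    then show ?thesis by (simp add: eq_diff_eq)
  qed
  have yT: "y \<in> carrier A.T.TR" if "y \<in> x m" for y m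
    using that A.CT_mem[OF x, of m] by simp
  have cong: "wcong n (B.to_series (F y)) (B.to_series (F y'))" if "y \<in> x (Suc n)" "y' \<in> x (Suc n)" for y y' n
  proof -
    have "wcong (Suc n) (A.to_series y) (A.to_series y')"
      using A.CT_series_cong[OF x that(1)] A.CT_series_cong[OF x that(2)] by (blast intro: wcong_trans wcong_sym)
    then have "wcong (Suc n) (A.to_series (y \<ominus>\<^bsub>A.T.TR\<^esub> y')) 0"
      using yT that by (simp add: A.to_series_diff wcong_diff_0)
    then have "wcong n (B.to_series (F (y \<ominus>\<^bsub>A.T.TR\<^esub> y'))) 0" using yT that by (intro filt) auto
    then show ?thesis using yT that by (simp add: jF wcong_diff_0)
  qed
  have En: "E x n = {w \<in> carrier B.T.TR. wcong n (B.to_series w) (B.to_series (F y))}" if "y \<in> x (Suc n)" for y n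
  proof -
    have "B.Wcoset n (F y') = {w \<in> carrier B.T.TR. wcong n (B.to_series w) (B.to_series (F y))}" if "y' \<in> x (Suc n)" for y'
      using B.Wcoset_eq[OF cl[OF yT[OF that]]] cong[OF \<open>y \<in> x (Suc n)\<close> that]
      by (auto intro: wcong_trans wcong_sym)
    then show ?thesis using that unfolding E_def completion_extend_def B.T_ring_eq by auto
  qed
  show Ex: "E x \<in> carrier B.CT"
    unfolding B.CT_carrier
  proof (intro allI conjI)
    fix n
    obtain y where y: "y \<in> carrier A.T.TR" "y \<in> x (Suc (Suc n))" by (rule A.CT_nonempty[OF x, of "Suc (Suc n)"])
    then have y': "y \<in> x (Suc n)" using A.CT_antimono[OF x, of "Suc n" "Suc (Suc n)"] by auto
    show "\<exists>z\<in>carrier B.T.TR. E x n = B.Wcoset n z"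
      by (rule bexI[of _ "F y"]) (simp_all add: En[OF y'] B.Wcoset_eq cl y)
    show "E x (Suc n) \<subseteq> E x n" unfolding En[OF y'] En[OF y(2)] by (auto intro: wcong_mono)
  qed
  show "wcong n (B.CT_series (E x)) (B.to_series (F y))" if "y \<in> x (Suc n)"
  proof -
    have "F y \<in> E x n" using En[OF that] cl[OF yT[OF that]] by simp
    from B.CT_series_cong[OF Ex this] show ?thesis by (rule wcong_sym)
  qed
qed

text \<open>
  The operator \<open>Op\<close> on series is the one induced by \<open>G\<close>. It may lose one power of \<open>W\<close>, as the derivation
  does.
\<close>

definition lifts ::
    "(ratfun tser \<times> 'c fps \<Rightarrow> (ratfun tser \<times> 'd fps \<Rightarrow>\<^sub>0 int)) \<Rightarrow> ('c fps tser \<Rightarrow> 'd fps tser) \<Rightarrow> bool" where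
  "lifts G Op \<longleftrightarrow> balanced G \<and>
    (\<forall>x\<in>galois_hull q. \<forall>b. B.to_series (B.T.tclass (G (x, b))) = Op (can_iota s x * tconst b)) \<and>
    (\<forall>f g. Op (f + g) = Op f + Op g) \<and>
    (\<forall>n f g. wcong (Suc n) f g \<longrightarrow> wcong n (Op f) (Op g))"

lemma lifts_D:
  assumes "lifts G Op"
  shows "balanced G" "x \<in> galois_hull q \<Longrightarrow> B.to_series (B.T.tclass (G (x, b))) = Op (can_iota s x * tconst b)"
    "Op (f + g) = Op f + Op g" "wcong (Suc n) f g \<Longrightarrow> wcong n (Op f) (Op g)"
  using assms unfolding lifts_def by blast+

lemma operator:
  assumes L: "lifts G Op"
  shows "z \<in> carrier A.T.TR \<Longrightarrow> B.to_series (T_extend q s' G z) = Op (A.to_series z)"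
    and "x \<in> carrier A.CT \<Longrightarrow> CT_extend q s' G x \<in> carrier B.CT"
    and "x \<in> carrier A.CT \<Longrightarrow> B.CT_series (CT_extend q s' G x) = Op (A.CT_series x)"
proof -
  note G = lifts_D(1)[OF L] and val = lifts_D(2)[OF L] and Op_add = lifts_D(3)[OF L] and Op_cong = lifts_D(4)[OF L]
  have Op_0: "Op 0 = 0" using Op_add[of 0 0] by simp
  note i = induced[OF G]
  have j: "B.to_series (T_extend q s' G z) = Op (A.to_series z)" if "z \<in> carrier A.T.TR" for z
    using that
  proof (induction rule: A.T.T_induct)
    case zero
    have "T_extend q s' G \<zero>\<^bsub>A.T.TR\<^esub> = \<zero>\<^bsub>B.T.TR\<^esub>"
      by (rule A.T.T_additive_0[OF B.T.T.abelian_group_axioms i(1) i(2)])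
    then show ?case by (simp add: A.to_series_simps B.to_series_simps Op_0)
  next
    case (pure x b)
    then show ?case by (simp add: i val A.to_series(2))
  next
    case (add z w)
    then show ?case by (simp add: i B.to_series_simps A.to_series_simps Op_add)
  qed
  then show "z \<in> carrier A.T.TR \<Longrightarrow> B.to_series (T_extend q s' G z) = Op (A.to_series z)" .
  have filt: "wcong n (B.to_series (T_extend q s' G z)) 0" if "z \<in> carrier A.T.TR" "wcong (Suc n) (A.to_series z) 0" for n z
    using Op_cong[OF that(2)] by (simp add: j that(1) Op_0)
  note c = completion[of "T_extend q s' G", folded CT_extend_def]
  show "CT_extend q s' G x \<in> carrier B.CT" if x: "x \<in> carrier A.CT"
    by (rule c(1)) (fact i(1) i(2) filt x)+
  assume x: "x \<in> carrier A.CT"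
  show "B.CT_series (CT_extend q s' G x) = Op (A.CT_series x)"
  proof (rule wcong_all)
    fix n
    obtain y where y: "y \<in> carrier A.T.TR" "y \<in> x (Suc n)" by (rule A.CT_nonempty[OF x, of "Suc n"])
    have "wcong n (B.to_series (T_extend q s' G y)) (Op (A.CT_series x))"
      unfolding j[OF y(1)] by (rule Op_cong) (rule A.CT_series_cong[OF x y(2)])
    moreover have "wcong n (B.CT_series (CT_extend q s' G x)) (B.to_series (T_extend q s' G y))"
      by (rule c(2)) (fact i(1) i(2) filt x y(2))+
    ultimately show "wcong n (B.CT_series (CT_extend q s' G x)) (Op (A.CT_series x))" by (blast intro: wcong_trans)
  qed
qed

lemma balanced_frag:
  assumes "\<And>x. x \<in> galois_hull q \<Longrightarrow> P x \<in> galois_hull q"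
    and "\<And>x x'. x \<in> galois_hull q \<Longrightarrow> x' \<in> galois_hull q \<Longrightarrow> P (x + x') = P x + P x'"
    and "\<And>x c. x \<in> galois_hull q \<Longrightarrow> P (tconst c * x) = tconst c * P x"
    and "\<And>b b'. R (b + b') = R b + R b'" and "\<And>b c. R (taylor s c * b) = taylor s' c * R b"
  shows "balanced (\<lambda>(x, b). frag_of (P x, R b))"
  unfolding balanced_def using assms B.T.pure_add_left B.T.pure_add_right B.T.pure_balanced
  by (simp add: keys_frag_of flip: B.T.pure_tclass)

lemma balanced_add:
  assumes "balanced G" "balanced G'"
  shows "balanced (\<lambda>p. G p + G' p)"
proof -
  have c: "B.T.tclass (G (x, b) + G' (x, b)) = B.T.tclass (G (x, b)) \<oplus>\<^bsub>B.T.TR\<^esub> B.T.tclass (G' (x, b))"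
    "B.T.tclass (G (x, b)) \<in> carrier B.T.TR" "B.T.tclass (G' (x, b)) \<in> carrier B.T.TR"
    "G (x, b) + G' (x, b) \<in> carrier B.T.MR"
    if "x \<in> galois_hull q" for x b
  proof -
    have g1: "G (x, b) \<in> carrier B.T.MR" by (rule balanced_D(1)[OF assms(1) that])
    have g2: "G' (x, b) \<in> carrier B.T.MR" by (rule balanced_D(1)[OF assms(2) that])
    note g = g1 g2
    show "B.T.tclass (G (x, b) + G' (x, b)) = B.T.tclass (G (x, b)) \<oplus>\<^bsub>B.T.TR\<^esub> B.T.tclass (G' (x, b))"
      by (rule B.T.tclass_add[OF g, symmetric])
    show "B.T.tclass (G (x, b)) \<in> carrier B.T.TR" "B.T.tclass (G' (x, b)) \<in> carrier B.T.TR"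
      using g by (simp_all only: B.T.tclass_in)
    show "G (x, b) + G' (x, b) \<in> carrier B.T.MR"
      using B.T.MR.a_closed[OF g] by (simp only: B.T.MR_simps)
  qed
  show ?thesis
    unfolding balanced_def
  proof (intro conjI ballI allI)
    fix x b assume "x \<in> galois_hull q"
    then show "G (x, b) + G' (x, b) \<in> carrier B.T.MR" by (rule c)
  next
    fix x x' b assume x: "x \<in> galois_hull q" "x' \<in> galois_hull q"
    then have "x + x' \<in> galois_hull q" by (rule galois_hull.hull_add)
    moreover have "B.T.tclass (G (x + x', b)) = B.T.tclass (G (x, b)) \<oplus>\<^bsub>B.T.TR\<^esub> B.T.tclass (G (x', b))"
      "B.T.tclass (G' (x + x', b)) = B.T.tclass (G' (x, b)) \<oplus>\<^bsub>B.T.TR\<^esub> B.T.tclass (G' (x', b))"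
      by (rule balanced_D(2)[OF assms(1) x], rule balanced_D(2)[OF assms(2) x])
    ultimately show "B.T.tclass (G (x + x', b) + G' (x + x', b)) =
        B.T.tclass (G (x, b) + G' (x, b)) \<oplus>\<^bsub>B.T.TR\<^esub> B.T.tclass (G (x', b) + G' (x', b))"
      using c x by (simp add: B.T.T.a_ac)
  next
    fix x b b' assume x: "x \<in> galois_hull q"
    moreover have "B.T.tclass (G (x, b + b')) = B.T.tclass (G (x, b)) \<oplus>\<^bsub>B.T.TR\<^esub> B.T.tclass (G (x, b'))"
      "B.T.tclass (G' (x, b + b')) = B.T.tclass (G' (x, b)) \<oplus>\<^bsub>B.T.TR\<^esub> B.T.tclass (G' (x, b'))"
      by (rule balanced_D(3)[OF assms(1) x], rule balanced_D(3)[OF assms(2) x])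
    ultimately show "B.T.tclass (G (x, b + b') + G' (x, b + b')) =
        B.T.tclass (G (x, b) + G' (x, b)) \<oplus>\<^bsub>B.T.TR\<^esub> B.T.tclass (G (x, b') + G' (x, b'))"
      using c x by (simp add: B.T.T.a_ac)
  next
    fix x c' b assume x: "x \<in> galois_hull q"
    then have "tconst c' * x \<in> galois_hull q" by (simp add: galois_hull.intros)
    moreover have "B.T.tclass (G (tconst c' * x, b)) = B.T.tclass (G (x, taylor s c' * b))"
      "B.T.tclass (G' (tconst c' * x, b)) = B.T.tclass (G' (x, taylor s c' * b))"
      by (rule balanced_D(4)[OF assms(1) x], rule balanced_D(4)[OF assms(2) x])
    ultimately show "B.T.tclass (G (tconst c' * x, b) + G' (tconst c' * x, b)) =
        B.T.tclass (G (x, taylor s c' * b) + G' (x, taylor s c' * b))"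
      using c x by simp
  qed
qed

lemma balanced_sum:
  fixes N :: nat
  assumes "\<And>k. balanced (G k)"
  shows "balanced (\<lambda>p. \<Sum>k<N. G k p)"
proof (induction N)
  case 0
  show ?case by (simp add: balanced_def B.T.tclass_0)
next
  case (Suc N)
  from balanced_add[OF Suc assms] show ?case by simp
qed

end

context comm_alg
begin

lemma pair: "comm_alg_pair q s s" ..

lemma wconst_nth [simp]: "fps_nth (wconst s c * f) k = s (rconst c) * fps_nth f k"
  by (simp add: wconst_def)

lemma lifts_sigma: "comm_alg_pair.lifts q s s (\<lambda>(x, b). frag_of (tsigma rconst q x, b)) (tsigma (wconst s) q)"
proof -
  interpret P: comm_alg_pair q s s by (rule pair)
  have b: "P.balanced (\<lambda>(x, b). frag_of (tsigma rconst q x, b))"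
    by (rule P.balanced_frag) (auto intro!: galois_hull.intros tser_eqI simp: algebra_simps)
  have 1: "to_series (T.tclass (case (x, b) of (x, b) \<Rightarrow> frag_of (tsigma rconst q x, b)))
      = tsigma (wconst s) q (can_iota s x * tconst b)" if "x \<in> galois_hull q" for x b
    using that by (simp add: T.pure_tclass[symmetric] to_series(2) galois_hull.intros can_iota_sigma)
      (rule tser_eqI, simp add: mult.assoc)
  have 2: "tsigma (wconst s) q (f + g) = tsigma (wconst s) q f + tsigma (wconst s) q g" for f g :: "'c fps tser"
    by (rule tser_eqI) (simp add: distrib_left)
  have 3: "wcong n (tsigma (wconst s) q f) (tsigma (wconst s) q g)" if "wcong (Suc n) f g" for n f g
    using that by (simp add: wcong_def)
  show ?thesis
    unfolding P.lifts_def using b 1 2 3 by blast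
qed

lemma CT_sigma:
  assumes "x \<in> carrier CT"
  shows "CT_sigma q s x \<in> carrier CT" "CT_series (CT_sigma q s x) = tsigma (wconst s) q (CT_series x)"
proof -
  interpret P: comm_alg_pair q s s by (rule pair)
  note o = P.operator[OF lifts_sigma]
  show "CT_sigma q s x \<in> carrier CT" unfolding CT_sigma_def by (rule o(2)[OF assms])
  show "CT_series (CT_sigma q s x) = tsigma (wconst s) q (CT_series x)" unfolding CT_sigma_def by (rule o(3)[OF assms])
qed

lemma lifts_theta: "comm_alg_pair.lifts q s s (\<lambda>(x, b). frag_of (ttheta rconst q l x, b)) (ttheta (wconst s) q l)"
proof -
  interpret P: comm_alg_pair q s s by (rule pair)
  have b: "P.balanced (\<lambda>(x, b). frag_of (ttheta rconst q l x, b))"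
    by (rule P.balanced_frag) (auto intro!: galois_hull.intros tser_eqI simp: algebra_simps)
  have 1: "to_series (T.tclass (case (x, b) of (x, b) \<Rightarrow> frag_of (ttheta rconst q l x, b)))
      = ttheta (wconst s) q l (can_iota s x * tconst b)" if "x \<in> galois_hull q" for x b
    using that by (simp add: T.pure_tclass[symmetric] to_series(2) galois_hull.intros can_iota_theta)
      (rule tser_eqI, simp add: mult.assoc)
  have 2: "ttheta (wconst s) q l (f + g) = ttheta (wconst s) q l f + ttheta (wconst s) q l g" for f g :: "'c fps tser"
    by (rule tser_eqI) (simp add: distrib_left)
  have 3: "wcong n (ttheta (wconst s) q l f) (ttheta (wconst s) q l g)" if "wcong (Suc n) f g" for n f g
    using that by (simp add: wcong_def)
  show ?thesis
    unfolding P.lifts_def using b 1 2 3 by blast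
qed

lemma CT_theta:
  assumes "x \<in> carrier CT"
  shows "CT_theta q s l x \<in> carrier CT" "CT_series (CT_theta q s l x) = ttheta (wconst s) q l (CT_series x)"
proof -
  interpret P: comm_alg_pair q s s by (rule pair)
  note o = P.operator[OF lifts_theta]
  show "CT_theta q s l x \<in> carrier CT" unfolding CT_theta_def by (rule o(2)[OF assms])
  show "CT_series (CT_theta q s l x) = ttheta (wconst s) q l (CT_series x)" unfolding CT_theta_def by (rule o(3)[OF assms])
qed

lemma tclass_deriv:
  assumes "x \<in> galois_hull q"
  shows "T.tclass ((\<lambda>(x, b :: 'c fps). frag_of (tmap rderiv x, b) + frag_of (x, wderiv s b)) (x, b))
    = T.pure (tmap rderiv x) b \<oplus>\<^bsub>T.TR\<^esub> T.pure x (wderiv s b)"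
  using T.tclass_add[of "frag_of (tmap rderiv x, b)" "frag_of (x, wderiv s b)"] assms galois_hull.hull_deriv[OF assms]
  by (simp add: T.pure_tclass keys_frag_of)

text \<open>
  The two summands are not balanced by themselves. In the Leibniz rule for \<open>cx\<close> and for \<open>\<tau>(c)b\<close>, with
  \<open>\<tau>\<close> the Taylor morphism, the additional terms agree because \<open>\<partial>\<tau>(c)/\<partial>W = \<tau>(c')\<close>.
\<close>

lemma lifts_deriv: "comm_alg_pair.lifts q s s (\<lambda>(x, b). frag_of (tmap rderiv x, b) + frag_of (x, wderiv s b)) (tmap (wderiv s))"
proof -
  interpret P: comm_alg_pair q s s by (rule pair)
  let ?G = "\<lambda>(x, b :: 'c fps). frag_of (tmap rderiv x, b) + frag_of (x, wderiv s b)"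
  have dh: "tmap rderiv x \<in> galois_hull q" if "x \<in> galois_hull q" for x
    using that by (rule galois_hull.hull_deriv)
  note cl = tclass_deriv
  have tl: "T.pure (x + x') b = T.pure x b \<oplus>\<^bsub>T.TR\<^esub> T.pure x' b" if "x \<in> galois_hull q" "x' \<in> galois_hull q" for x x' b
    using T.pure_add_left[of x x' b] that by simp
  have tr: "T.pure x (b + b') = T.pure x b \<oplus>\<^bsub>T.TR\<^esub> T.pure x b'" if "x \<in> galois_hull q" for x b b'
    using T.pure_add_right[of x b b'] that by simp
  have tb: "T.pure (tconst c * x) b = T.pure x (taylor s c * b)" if "x \<in> galois_hull q" for c x b
    using T.pure_balanced[of x b c] that by simp
  have d_add: "tmap rderiv (x + x') = tmap rderiv x + tmap rderiv x'" for x x'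
    by (rule tmap_add) (rule rderiv_add)
  have d_mult: "tmap rderiv (tconst c * x) = tconst (rderiv c) * x + tconst c * tmap rderiv x" for c x
    by (rule tser_eqI) (simp add: rderiv_mult)
  have b: "P.balanced ?G"
    unfolding P.balanced_def
  proof (intro conjI ballI allI)
    fix x and b :: "'c fps" assume "x \<in> galois_hull q"
    then show "?G (x, b) \<in> carrier T.MR"
      using T.MR.a_closed[of "frag_of (tmap rderiv x, b)" "frag_of (x, wderiv s b)"] dh
      by (simp add: keys_frag_of)
  next
    fix x x' and b :: "'c fps" assume x: "x \<in> galois_hull q" "x' \<in> galois_hull q"
    then show "T.tclass (?G (x + x', b)) = T.tclass (?G (x, b)) \<oplus>\<^bsub>T.TR\<^esub> T.tclass (?G (x', b))"
      unfolding cl[OF x(1)] cl[OF x(2)] cl[OF galois_hull.hull_add[OF x]]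
      by (simp add: d_add tl dh T.T.a_ac)
  next
    fix x and b b' :: "'c fps" assume x: "x \<in> galois_hull q"
    then show "T.tclass (?G (x, b + b')) = T.tclass (?G (x, b)) \<oplus>\<^bsub>T.TR\<^esub> T.tclass (?G (x, b'))"
      unfolding cl[OF x] by (simp add: wderiv_add tr dh T.T.a_ac)
  next
    fix x c and b :: "'c fps" assume x: "x \<in> galois_hull q"
    then have cx: "tconst c * x \<in> galois_hull q" "tconst (rderiv c) * x \<in> galois_hull q" "tconst c * tmap rderiv x \<in> galois_hull q"
      by (simp_all add: galois_hull.intros)
    show "T.tclass (?G (tconst c * x, b)) = T.tclass (?G (x, taylor s c * b))"
      unfolding cl[OF x] cl[OF cx(1)]
      using x cx dh[OF x] by (simp add: d_mult tl tr tb wderiv_mult wderiv_taylor T.T.a_ac)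
  qed
  have 1: "to_series (T.tclass (?G (x, b))) = tmap (wderiv s) (can_iota s x * tconst b)" if "x \<in> galois_hull q" for x b
  proof -
    have "tmap (wderiv s) (tconst b) = tconst (wderiv s b)"
      using wderiv_const[of 0] by (intro tser_eqI) (simp add: tcoeff_tconst)
    then show ?thesis
      unfolding cl[OF that] tmap_derivation[of "wderiv s", OF wderiv_add wderiv_mult]
      using that dh[OF that] by (simp add: to_series_simps to_series(2) can_iota_deriv)
  qed
  have 2: "tmap (wderiv s) (f + g) = tmap (wderiv s) f + tmap (wderiv s) g" for f g :: "'c fps tser"
    by (rule tmap_add) (rule wderiv_add)
  have 3: "wcong n (tmap (wderiv s) f) (tmap (wderiv s) g)" if "wcong (Suc n) f g" for n f g
    using that by (simp add: wcong_def nth_wderiv del: of_nat_Suc)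
  show ?thesis
    unfolding P.lifts_def using b 1 2 3 by blast
qed

lemma CT_deriv:
  assumes "x \<in> carrier CT"
  shows "CT_deriv q s x \<in> carrier CT" "CT_series (CT_deriv q s x) = tmap (wderiv s) (CT_series x)"
proof -
  interpret P: comm_alg_pair q s s by (rule pair)
  note o = P.operator[OF lifts_deriv]
  show "CT_deriv q s x \<in> carrier CT" unfolding CT_deriv_def by (rule o(2)[OF assms])
  show "CT_series (CT_deriv q s x) = tmap (wderiv s) (CT_series x)" unfolding CT_deriv_def by (rule o(3)[OF assms])
qed

section \<open>Endomorphisms of the completed hull\<close>

text \<open>
  The automorphisms of the Galois group, without the requirements of bijectivity and continuity, which
  turn out to be consequences of the others.
\<close>

definition CT_endos :: "((nat \<Rightarrow> 'c hullW set) \<Rightarrow> (nat \<Rightarrow> 'c hullW set)) set" where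
  "CT_endos = {\<alpha> \<in> extensional (carrier CT). \<alpha> \<in> Ring.ring_hom CT CT \<and>
        (\<forall>x\<in>CT_base q s. \<alpha> x = x) \<and>
        (\<forall>x\<in>carrier CT. \<alpha> (CT_sigma q s x) = CT_sigma q s (\<alpha> x)) \<and>
        (\<forall>x\<in>carrier CT. \<forall>l. \<alpha> (CT_theta q s l x) = CT_theta q s l (\<alpha> x)) \<and>
        (\<forall>x\<in>carrier CT. \<alpha> (CT_deriv q s x) = CT_deriv q s (\<alpha> x)) \<and>
        (\<forall>x\<in>carrier CT. \<alpha> x \<ominus>\<^bsub>CT\<^esub> x \<in> CT_nil q s)}"

lemma CT_endos_D:
  assumes "\<alpha> \<in> CT_endos"
  shows "\<alpha> \<in> Ring.ring_hom CT CT" "\<alpha> \<in> extensional (carrier CT)" "x \<in> CT_base q s \<Longrightarrow> \<alpha> x = x"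
    "x \<in> carrier CT \<Longrightarrow> \<alpha> (CT_sigma q s x) = CT_sigma q s (\<alpha> x)"
    "x \<in> carrier CT \<Longrightarrow> \<alpha> (CT_theta q s l x) = CT_theta q s l (\<alpha> x)"
    "x \<in> carrier CT \<Longrightarrow> \<alpha> (CT_deriv q s x) = CT_deriv q s (\<alpha> x)"
    "x \<in> carrier CT \<Longrightarrow> \<alpha> x \<ominus>\<^bsub>CT\<^esub> x \<in> CT_nil q s"
  using assms unfolding CT_endos_def by blast+

lemma CT_base_elem: "CT_elem q s (tconst a) b \<in> CT_base q s"
proof -
  have "T.pure (tconst a) b \<in> generate_ring T.TR {T.pure (tconst a) b | a b. True}"
    by (rule generate_ring.incl) blast
  moreover have "CT_elem q s (tconst a) b n = Wcoset n (T.pure (tconst a) b)" for n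
    by (simp add: CT_elem_def completion_map_def T_ring_eq T_elem_eq)
  ultimately show ?thesis
    using CT_elem_closed[OF galois_hull.hull_const]
    unfolding CT_base_def T_ring_eq T_elem_eq by blast
qed

lemma CT_elem_1_base: "CT_elem q s 1 b \<in> CT_base q s"
  using CT_base_elem[of 1 b] by simp

lemma CT_elem_mult:
  "x \<in> galois_hull q \<Longrightarrow> y \<in> galois_hull q \<Longrightarrow> CT_elem q s x b \<otimes>\<^bsub>CT\<^esub> CT_elem q s y c = CT_elem q s (x * y) (b * c)"
  by (rule CT_series_inj)
    (simp_all add: galois_hull.intros can_iota_mult tconst_mult mult.assoc tconst_left_comm)
lemma CT_elem_add:
  "x \<in> galois_hull q \<Longrightarrow> y \<in> galois_hull q \<Longrightarrow> CT_elem q s x b \<oplus>\<^bsub>CT\<^esub> CT_elem q s y b = CT_elem q s (x + y) b"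
  by (rule CT_series_inj) (simp_all add: galois_hull.intros can_iota_add distrib_right)
lemma CT_elem_one: "\<one>\<^bsub>CT\<^esub> = CT_elem q s 1 1"
  by (rule CT_series_inj) simp_all

lemma CT_elem_ops:
  assumes "x \<in> galois_hull q"
  shows "CT_sigma q s (CT_elem q s x 1) = CT_elem q s (tsigma rconst q x) 1"
    "CT_theta q s l (CT_elem q s x 1) = CT_elem q s (ttheta rconst q l x) 1"
    "CT_deriv q s (CT_elem q s x 1) = CT_elem q s (tmap rderiv x) 1"
  using assms
  by (auto intro!: CT_series_inj CT_sigma CT_theta CT_deriv CT_elem_closed galois_hull.intros
      simp: CT_sigma CT_theta CT_deriv galois_hull.intros can_iota_sigma can_iota_theta can_iota_deriv)

text \<open>
  Read as twisted power series, the restriction of an endomorphism to the hull satisfies the hypotheses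
  of \<open>deformation_form\<close>.
\<close>

definition hull_part :: "((nat \<Rightarrow> 'c hullW set) \<Rightarrow> (nat \<Rightarrow> 'c hullW set)) \<Rightarrow> ratfun tser \<Rightarrow> 'c fps tser" where
  "hull_part \<alpha> x = CT_series (\<alpha> (CT_elem q s x 1))"

lemma hull_part:
  assumes \<alpha>: "\<alpha> \<in> CT_endos"
  shows "hull_part \<alpha> \<in> Ring.ring_hom (hull_ring q) type_ring"
    "hull_part \<alpha> (tconst a) = can_iota s (tconst a)"
    "x \<in> galois_hull q \<Longrightarrow> hull_part \<alpha> (tsigma rconst q x) = tsigma (wconst s) q (hull_part \<alpha> x)"
    "x \<in> galois_hull q \<Longrightarrow> hull_part \<alpha> (ttheta rconst q l x) = ttheta (wconst s) q l (hull_part \<alpha> x)"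
    "x \<in> galois_hull q \<Longrightarrow> hull_part \<alpha> (tmap rderiv x) = tmap (wderiv s) (hull_part \<alpha> x)"
proof -
  note a = ring_hom_closed[OF CT_endos_D(1)[OF \<alpha>]] ring_hom_mult[OF CT_endos_D(1)[OF \<alpha>]]
    ring_hom_add[OF CT_endos_D(1)[OF \<alpha>]] ring_hom_one[OF CT_endos_D(1)[OF \<alpha>]]
  show "hull_part \<alpha> \<in> Ring.ring_hom (hull_ring q) type_ring"
  proof (rule ring_hom_memI)
    fix x y assume "x \<in> carrier (hull_ring q)" "y \<in> carrier (hull_ring q)"
    then have xy: "x \<in> galois_hull q" "y \<in> galois_hull q" by simp_all
    show "hull_part \<alpha> (x \<otimes>\<^bsub>hull_ring q\<^esub> y) = hull_part \<alpha> x \<otimes>\<^bsub>type_ring\<^esub> hull_part \<alpha> y"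
      using CT_elem_mult[OF xy, of 1 1] a(2)[of "CT_elem q s x 1" "CT_elem q s y 1"] xy
      by (simp add: hull_part_def a(1))
    show "hull_part \<alpha> (x \<oplus>\<^bsub>hull_ring q\<^esub> y) = hull_part \<alpha> x \<oplus>\<^bsub>type_ring\<^esub> hull_part \<alpha> y"
      using CT_elem_add[OF xy, of 1] a(3)[of "CT_elem q s x 1" "CT_elem q s y 1"] xy
      by (simp add: hull_part_def a(1))
  next
    show "hull_part \<alpha> \<one>\<^bsub>hull_ring q\<^esub> = \<one>\<^bsub>type_ring\<^esub>"
      using a(4) by (simp add: hull_part_def flip: CT_elem_one)
  qed simp
  show "hull_part \<alpha> (tconst a) = can_iota s (tconst a)"
    using CT_endos_D(3)[OF \<alpha> CT_base_elem[of a 1]] by (simp add: hull_part_def galois_hull.intros)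
  note d = CT_endos_D(4-6)[OF \<alpha> CT_elem_closed]
  show "hull_part \<alpha> (tsigma rconst q x) = tsigma (wconst s) q (hull_part \<alpha> x)" if "x \<in> galois_hull q"
    using d(1)[OF that, of 1] CT_sigma(2)[OF a(1)] that by (simp add: CT_elem_ops hull_part_def)
  show "hull_part \<alpha> (ttheta rconst q l x) = ttheta (wconst s) q l (hull_part \<alpha> x)" if "x \<in> galois_hull q"
    using d(2)[OF that, of l 1] CT_theta(2)[OF a(1)] that by (simp add: CT_elem_ops hull_part_def)
  show "hull_part \<alpha> (tmap rderiv x) = tmap (wderiv s) (hull_part \<alpha> x)" if "x \<in> galois_hull q"
    using d(3)[OF that, of 1] CT_deriv(2)[OF a(1)] that by (simp add: CT_elem_ops hull_part_def)
qed

text \<open>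
  An endomorphism is determined on the hull by its value at \<open>\<iota>\<^sub>0(t)\<close>, and on \<open>A[[W]]\<close> it is the identity.
  As it fixes \<open>W\<close>, it preserves congruences modulo \<open>W\<^sup>n\<close>, so its values on tensors determine it.
\<close>

lemma CT_endo_unique:
  assumes \<alpha>: "\<alpha> \<in> CT_endos" and \<beta>: "\<beta> \<in> CT_endos"
    and Y: "\<alpha> (CT_elem q s (iota0 q rt) 1) = \<beta> (CT_elem q s (iota0 q rt) 1)"
  shows "\<alpha> = \<beta>"
proof (rule extensionalityI[OF CT_endos_D(2)[OF \<alpha>] CT_endos_D(2)[OF \<beta>]])
  note a = ring_hom_closed[OF CT_endos_D(1)[OF \<alpha>]] ring_hom_mult[OF CT_endos_D(1)[OF \<alpha>]]
    ring_hom_add[OF CT_endos_D(1)[OF \<alpha>]]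
  note b = ring_hom_closed[OF CT_endos_D(1)[OF \<beta>]] ring_hom_mult[OF CT_endos_D(1)[OF \<beta>]]
    ring_hom_add[OF CT_endos_D(1)[OF \<beta>]]
  have hull: "\<alpha> (CT_elem q s x 1) = \<beta> (CT_elem q s x 1)" if x: "x \<in> galois_hull q" for x
  proof -
    have "hull_part \<alpha> x = hull_part \<beta> x"
    proof (rule hull_hom_unique[OF ring_type_ring hull_part(1)[OF \<alpha>] hull_part(1)[OF \<beta>]])
      show "hull_part \<alpha> (tconst a) = hull_part \<beta> (tconst a)" for a
        by (simp only: hull_part(2)[OF \<alpha>] hull_part(2)[OF \<beta>])
      show "hull_part \<alpha> (iota0 q rt) = hull_part \<beta> (iota0 q rt)" by (simp only: hull_part_def Y)
    qed (fact hull_part(3-5)[OF \<alpha>] hull_part(3-5)[OF \<beta>] x)+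
    then show ?thesis using x by (intro CT_series_inj) (simp_all add: hull_part_def a b)
  qed
  have CT_embed: "\<alpha> (CT_embed z) = \<beta> (CT_embed z)" if "z \<in> carrier T.TR" for z
    using that
  proof (induction rule: T.T_induct)
    case zero
    have "CT_embed \<zero>\<^bsub>T.TR\<^esub> = CT_elem q s 0 1" by (rule CT_series_inj) (simp_all add: to_series_simps)
    then show ?case using hull[of 0] by simp
  next
    case (pure x c)
    then have x: "x \<in> galois_hull q" by simp
    have "CT_embed (T.pure x c) = CT_elem q s x 1 \<otimes>\<^bsub>CT\<^esub> CT_elem q s 1 c"
      using CT_elem_mult[of x 1 1 c] x by (simp add: CT_elem_embed)
    then show ?case
      using hull[OF x] CT_endos_D(3)[OF \<alpha> CT_elem_1_base[of c]] CT_endos_D(3)[OF \<beta> CT_elem_1_base[of c]] x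
      by (simp add: a b)
  next
    case (add z w)
    then have "CT_embed (z \<oplus>\<^bsub>T.TR\<^esub> w) = CT_embed z \<oplus>\<^bsub>CT\<^esub> CT_embed w" by (intro CT_series_inj) (simp_all add: to_series_simps)
    then show ?case using add by (simp add: a b)
  qed
  have app: "wcong n (CT_series (\<gamma> x)) (CT_series (\<gamma> (CT_embed y)))"
    if \<gamma>: "\<gamma> \<in> CT_endos" and x: "x \<in> carrier CT" and y: "y \<in> x n" for \<gamma> x y n
  proof -
    note c = ring_hom_closed[OF CT_endos_D(1)[OF \<gamma>]] ring_hom_mult[OF CT_endos_D(1)[OF \<gamma>]]
      ring_hom_add[OF CT_endos_D(1)[OF \<gamma>]]
    have yT: "y \<in> carrier T.TR" using y CT_mem[OF x] by simp
    have "x \<ominus>\<^bsub>CT\<^esub> CT_embed y \<in> CT_nbhd q s n"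
      using x yT wcong_sym[OF CT_series_cong[OF x y]] by (simp add: CT_nbhd_iff wcong_diff_0)
    then obtain w where w: "w \<in> carrier CT" "x \<ominus>\<^bsub>CT\<^esub> CT_embed y = CT_embed (Wpow n) \<otimes>\<^bsub>CT\<^esub> w"
      unfolding CT_nbhd_eq by blast
    have "x = CT_embed y \<oplus>\<^bsub>CT\<^esub> CT_embed (Wpow n) \<otimes>\<^bsub>CT\<^esub> w"
      unfolding w(2)[symmetric] using x yT by (intro CT_series_inj) simp_all
    moreover have "\<gamma> (CT_embed (Wpow n)) = CT_embed (Wpow n)"
      using CT_endos_D(3)[OF \<gamma> CT_elem_1_base[of "fps_X ^ n"]] by (simp add: CT_elem_embed Wpow_def)
    ultimately have "\<gamma> x = \<gamma> (CT_embed y) \<oplus>\<^bsub>CT\<^esub> CT_embed (Wpow n) \<otimes>\<^bsub>CT\<^esub> \<gamma> w"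
      using w(1) yT by (simp add: c)
    then have "CT_series (\<gamma> x) = CT_series (\<gamma> (CT_embed y)) + tconst (fps_X ^ n) * CT_series (\<gamma> w)"
      using w(1) yT by (simp add: c) (simp add: Wpow_def to_series(2))
    then show ?thesis
      using wcong_add[OF wcong_refl wcong_X_pow, of n "CT_series (\<gamma> (CT_embed y))" "CT_series (\<gamma> w)"] by simp
  qed
  fix x assume x: "x \<in> carrier CT"
  show "\<alpha> x = \<beta> x"
  proof (rule CT_series_inj)
    show "CT_series (\<alpha> x) = CT_series (\<beta> x)"
    proof (rule wcong_all)
      fix n
      obtain y where y: "y \<in> carrier T.TR" "y \<in> x n" by (rule CT_nonempty[OF x, of n])
      show "wcong n (CT_series (\<alpha> x)) (CT_series (\<beta> x))"
        using app[OF \<alpha> x y(2)] app[OF \<beta> x y(2)] CT_embed[OF y(1)] by (metis wcong_sym wcong_trans)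
    qed
  qed (use x a(1) b(1) in auto)
qed

text \<open>
  The series with nilpotent coefficients form an ideal that contains the generators. An element of the
  closure differs from an element of this ideal by a multiple of \<open>W\<close>, which does not change the constant
  coefficient.
\<close>

lemma CT_nil_coeff:
  assumes "x \<in> CT_nil q s"
  shows "nilpotent (fps_nth (tcoeff (CT_series x) i m) 0)"
proof -
  define S where "S = {CT_elem q s 1 (fps_const a) | a. nilpotent (a :: 'c)}"
  define K where "K = {y \<in> carrier CT. \<forall>i m k. nilpotent (fps_nth (tcoeff (CT_series y) i m) k)}"
  have nsum: "nilpotent (sum f A)" if "\<And>a. a \<in> A \<Longrightarrow> nilpotent (f a)" for f :: "nat \<Rightarrow> 'c" and A :: "nat set"
    using that
  proof (induction A rule: infinite_finite_induct)
    case (insert a A)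
    then show ?case using nilpotent_add[of "f a" "sum f A"] by (simp add: mult.commute)
  qed (simp_all add: nilpotent_0)
  have nmult: "nilpotent (a * b)" "nilpotent (b * a)" if "nilpotent a" for a b :: 'c
    using nilpotent_mult[OF that mult.commute, of b] by (simp_all add: mult.commute)
  have "ideal K CT"
  proof (rule idealI[OF CT.ring_axioms])
    show "subgroup K (add_monoid CT)"
    proof (rule CT.add.subgroupI)
      show "K \<noteq> {}" using CT_closed(3) by (force simp: K_def nilpotent_0)
      show "x \<oplus>\<^bsub>CT\<^esub> y \<in> K" if "x \<in> K" "y \<in> K" for x y
        using that nilpotent_add[where 'a='c, OF _ _ mult.commute] by (simp add: K_def)
    qed (auto simp: K_def nilpotent_minus)
  qed (auto simp: K_def tcoeff_mult fps_sum_nth fps_mult_nth intro!: nsum intro: nmult)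
  moreover have "S \<subseteq> K"
  proof
    fix y assume "y \<in> S"
    then obtain a where a: "nilpotent a" "y = CT_elem q s 1 (fps_const a)" unfolding S_def by blast
    then show "y \<in> K" by (simp add: K_def tcoeff_tconst nilpotent_0)
  qed
  ultimately have sub: "Idl\<^bsub>CT\<^esub> S \<subseteq> K" by (rule CT.genideal_minimal)
  obtain y where y: "y \<in> Idl\<^bsub>CT\<^esub> S" "x \<ominus>\<^bsub>CT\<^esub> y \<in> CT_nbhd q s 1" and x: "x \<in> carrier CT"
    using assms unfolding CT_nil_def S_def by blast
  have yK: "y \<in> K" using y(1) sub by blast
  then have "wcong 1 (CT_series x) (CT_series y)"
    using y(2) x by (simp add: CT_nbhd_iff K_def wcong_diff_0)
  then show ?thesis using yK by (simp add: wcong_def K_def)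
qed

lemma CT_endo_form:
  assumes \<alpha>: "\<alpha> \<in> CT_endos"
  obtains c where "nilpotent (c - 1)" "hull_part \<alpha> (iota0 q rt) = deformed q s c 0"
proof (rule deformation_form[OF hull_part(1,2)[OF \<alpha>]])
  show "hull_part \<alpha> (tsigma rconst q x) = tsigma (wconst s) q (hull_part \<alpha> x)"
    "hull_part \<alpha> (ttheta rconst q l x) = ttheta (wconst s) q l (hull_part \<alpha> x)"
    "hull_part \<alpha> (tmap rderiv x) = tmap (wderiv s) (hull_part \<alpha> x)" if "x \<in> galois_hull q" for x l
    using hull_part(3-5)[OF \<alpha> that] by blast+
  have "\<alpha> (CT_elem q s (tQ rconst q) 1) \<ominus>\<^bsub>CT\<^esub> CT_elem q s (tQ rconst q) 1 \<in> CT_nil q s"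
    by (rule CT_endos_D(7)[OF \<alpha>]) simp
  from CT_nil_coeff[OF this, of 0 0]
  show "nilpotent (fps_nth (tcoeff (hull_part \<alpha> (tQ rconst q) - can_iota s (tQ rconst q)) 0 0) 0)"
    using ring_hom_closed[OF CT_endos_D(1)[OF \<alpha>]] by (simp add: hull_part_def)
  fix c assume "hull_part \<alpha> (iota0 q rt) = deformed q s c 0" "nilpotent (c - 1)"
  then show thesis by (intro that)
qed

text \<open>
  The element of the completion whose series is \<open>c(t+W)Q + X\<close>.
\<close>

definition CT_deformed :: "'c \<Rightarrow> nat \<Rightarrow> 'c hullW set" where
  "CT_deformed c = CT_elem q s (tQ rconst q) (fps_const c * (fps_const (s rt) + fps_X))
       \<oplus>\<^bsub>CT\<^esub> CT_elem q s tX 1"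

lemma CT_deformed: "CT_deformed c \<in> carrier CT" "CT_series (CT_deformed c) = deformed q s c 0"
  by (simp_all add: CT_deformed_def deformed_def can_iota_Q can_iota_X tconst_comm)

lemma CT_endo_deformed:
  assumes \<alpha>: "\<alpha> \<in> CT_endos"
  shows "\<exists>!c. \<alpha> (CT_elem q s (iota0 q rt) 1) = CT_deformed c"
    and "\<alpha> (CT_elem q s (iota0 q rt) 1) = CT_deformed c \<Longrightarrow> nilpotent (c - 1)"
    and "\<alpha> (CT_elem q s (iota0 q rt) 1) = CT_deformed c \<longleftrightarrow> hull_part \<alpha> (iota0 q rt) = deformed q s c 0"
proof -
  have iff: "\<alpha> (CT_elem q s (iota0 q rt) 1) = CT_deformed c \<longleftrightarrow> hull_part \<alpha> (iota0 q rt) = deformed q s c 0" for c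
    using CT_series_inj[of "\<alpha> (CT_elem q s (iota0 q rt) 1)" "CT_deformed c"]
      ring_hom_closed[OF CT_endos_D(1)[OF \<alpha>], of "CT_elem q s (iota0 q rt) 1"]
    by (auto simp: CT_deformed hull_part_def galois_hull.intros)
  obtain d where d: "nilpotent (d - 1)" "hull_part \<alpha> (iota0 q rt) = deformed q s d 0"
    using CT_endo_form[OF \<alpha>] by blast
  show "\<exists>!c. \<alpha> (CT_elem q s (iota0 q rt) 1) = CT_deformed c"
    unfolding iff d(2) deformed_inject by simp
  show "\<alpha> (CT_elem q s (iota0 q rt) 1) = CT_deformed c \<Longrightarrow> nilpotent (c - 1)"
    unfolding iff d(2) deformed_inject using d(1) by simp
  show "\<alpha> (CT_elem q s (iota0 q rt) 1) = CT_deformed c \<longleftrightarrow> hull_part \<alpha> (iota0 q rt) = deformed q s c 0"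
    by (rule iff)
qed

text \<open>
  If \<open>\<alpha>\<close> maps \<open>\<iota>\<^sub>0(t) = tQ + X\<close> to \<open>c(t+W)Q + X\<close>, then it maps \<open>Q\<close> to \<open>cQ\<close>, by differentiation, and fixes
  \<open>X\<close>. This is why composition of automorphisms becomes multiplication.
\<close>

lemma CT_endo_CT_deformed:
  assumes \<alpha>: "\<alpha> \<in> CT_endos" and c: "\<alpha> (CT_elem q s (iota0 q rt) 1) = CT_deformed c"
  shows "\<alpha> (CT_deformed d) = CT_deformed (c * d)"
proof (rule CT_series_inj)
  note a = ring_hom_closed[OF CT_endos_D(1)[OF \<alpha>]] ring_hom_mult[OF CT_endos_D(1)[OF \<alpha>]]
    ring_hom_add[OF CT_endos_D(1)[OF \<alpha>]]
  have Y: "hull_part \<alpha> (iota0 q rt) = deformed q s c 0" using c CT_endo_deformed(3)[OF \<alpha>] by blast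
  have hY: "iota0 q rt \<in> galois_hull q" by (rule galois_hull.hull_iota0)
  have Q: "hull_part \<alpha> (tQ rconst q) = tconst (fps_const c) * tQ (wconst s) q"
    unfolding tmap_rderiv_iota0_rt[symmetric] hull_part(5)[OF \<alpha> hY] Y
  proof (rule tser_eqI)
    fix i n
    have "wderiv s (wconst s e) = 0" for e by (simp add: wconst_def)
    moreover have "wderiv s (taylor s rt) = 1" by (simp add: wderiv_taylor)
    ultimately show "tcoeff (tmap (wderiv s) (deformed q s c 0)) i n = tcoeff (tconst (fps_const c) * tQ (wconst s) q) i n"
      using wderiv_const[of 0] wderiv_const[of 1] by (simp add: tcoeff_deformed tcoeff_tQ wderiv_mult)
  qed
  have hp: "hull_part \<alpha> (x + y) = hull_part \<alpha> x + hull_part \<alpha> y" "hull_part \<alpha> (x * y) = hull_part \<alpha> x * hull_part \<alpha> y"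
    if "x \<in> galois_hull q" "y \<in> galois_hull q" for x y
    using ring_hom_add[OF hull_part(1)[OF \<alpha>]] ring_hom_mult[OF hull_part(1)[OF \<alpha>]] that by simp_all
  have "hull_part \<alpha> (iota0 q rt) = can_iota s (tconst rt) * hull_part \<alpha> (tQ rconst q) + hull_part \<alpha> tX"
    unfolding iota0_rt by (simp add: hp galois_hull.intros hull_part(2)[OF \<alpha>])
  moreover have "tconst (fps_const c * taylor s rt) * tQ (wconst s) q
      = tconst (taylor s rt) * (tconst (fps_const c) * tQ (wconst s) q)"
    by (simp only: mult.assoc[symmetric] tconst_mult[symmetric] mult.commute[of "taylor s rt"])
  ultimately have X: "hull_part \<alpha> tX = tX"
    unfolding Y Q deformed_def can_iota_tconst taylor_rt[symmetric] by simp
  have Qb: "CT_series (\<alpha> (CT_elem q s (tQ rconst q) b)) = hull_part \<alpha> (tQ rconst q) * tconst b" for b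
  proof -
    have "CT_elem q s (tQ rconst q) b = CT_elem q s (tQ rconst q) 1 \<otimes>\<^bsub>CT\<^esub> CT_elem q s 1 b"
      using CT_elem_mult[of "tQ rconst q" 1 1 b] by simp
    then have "\<alpha> (CT_elem q s (tQ rconst q) b) = \<alpha> (CT_elem q s (tQ rconst q) 1) \<otimes>\<^bsub>CT\<^esub> CT_elem q s 1 b"
      using CT_endos_D(3)[OF \<alpha> CT_elem_1_base[of b]] a(2)[of "CT_elem q s (tQ rconst q) 1" "CT_elem q s 1 b"]
      by (simp only: CT_elem_closed hull_Q hull_1)
    then show ?thesis by (simp add: a hull_part_def)
  qed
  have "CT_series (\<alpha> (CT_deformed d)) = hull_part \<alpha> (tQ rconst q) * tconst (fps_const d * (fps_const (s rt) + fps_X)) + hull_part \<alpha> tX"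
    unfolding CT_deformed_def by (simp add: a Qb) (simp add: hull_part_def)
  also have "\<dots> = deformed q s (c * d) 0"
  proof -
    define t where "t = fps_const (s rt) + fps_X"
    have "fps_const d * t * fps_const c = fps_const (c * d) * t"
      by (simp only: fps_const_mult[symmetric] mult.commute mult.left_commute mult.assoc)
    then have "tconst (fps_const c) * tQ (wconst s) q * tconst (fps_const d * t) = tconst (fps_const (c * d) * t) * tQ (wconst s) q"
      by (simp only: tconst_comm[of "fps_const d * t", symmetric] mult.assoc[symmetric] tconst_mult[symmetric])
    then show ?thesis unfolding Q X deformed_def t_def[symmetric] by simp
  qed
  finally show "CT_series (\<alpha> (CT_deformed d)) = CT_series (CT_deformed (c * d))" by (simp add: CT_deformed)
  show "\<alpha> (CT_deformed d) \<in> carrier CT" by (simp add: a CT_deformed)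
qed (rule CT_deformed)

section \<open>The substitution \<open>Q \<mapsto> (1+\<epsilon>)Q\<close> on the completion\<close>

text \<open>
  The formal sum for \<open>\<Sum>\<^sub>k D\<^sub>k(x) \<otimes> \<epsilon>\<^sup>k b\<close>, where \<open>D\<^sub>k\<close> are the divided powers of \<open>Q d/dQ\<close>.
\<close>

definition Gsubst :: "nat \<Rightarrow> 'c \<Rightarrow> ratfun tser \<times> 'c fps \<Rightarrow> (ratfun tser \<times> 'c fps \<Rightarrow>\<^sub>0 int)" where
  "Gsubst N \<epsilon> p = (\<Sum>k<N. (\<lambda>(x, b). frag_of (Qdiv k x, fps_const (\<epsilon> ^ k) * b)) p)"

lemma balanced_Gsubst: "comm_alg_pair.balanced q s s (Gsubst N \<epsilon>)"
proof -
  interpret P: comm_alg_pair q s s by (rule pair)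
  have "P.balanced (\<lambda>(x, b). frag_of (Qdiv k x, fps_const (\<epsilon> ^ k) * b))" for k
    by (rule P.balanced_frag) (simp_all add: Qdiv_add Qdiv_scale distrib_left mult.left_commute)
  from P.balanced_sum[OF this] show ?thesis unfolding Gsubst_def .
qed

abbreviation "Tsubst N \<epsilon> \<equiv> T_extend q s (Gsubst N \<epsilon>)"

lemma Tsubst_closed: "z \<in> carrier T.TR \<Longrightarrow> Tsubst N \<epsilon> z \<in> carrier T.TR"
  and Tsubst_add: "z \<in> carrier T.TR \<Longrightarrow> w \<in> carrier T.TR \<Longrightarrow>
    Tsubst N \<epsilon> (z \<oplus>\<^bsub>T.TR\<^esub> w) = Tsubst N \<epsilon> z \<oplus>\<^bsub>T.TR\<^esub> Tsubst N \<epsilon> w"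
  using comm_alg_pair.induced(1,2)[OF pair balanced_Gsubst] by blast+

lemma Tsubst_0: "Tsubst N \<epsilon> \<zero>\<^bsub>T.TR\<^esub> = \<zero>\<^bsub>T.TR\<^esub>"
  by (rule T.T_additive_0[OF T.T.abelian_group_axioms Tsubst_closed Tsubst_add])

lemma to_series_Tsubst_pure:
  assumes x: "x \<in> galois_hull q"
  shows "to_series (Tsubst N \<epsilon> (T.pure x b)) = deform N \<epsilon> x * tconst b"
proof -
  have "to_series (T.tclass (Gsubst N \<epsilon> (x, b))) = deform N \<epsilon> x * tconst b"
  proof (induction N)
    case 0
    show ?case by (simp add: Gsubst_def T.tclass_0 to_series_simps deform_def)
  next
    case (Suc N)
    define p where "p = frag_of (Qdiv N x, fps_const (\<epsilon> ^ N) * b)"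
    have g: "Gsubst N \<epsilon> (x, b) \<in> carrier T.MR"
      by (rule comm_alg_pair.balanced_D(1)[OF pair balanced_Gsubst x])
    have p: "p \<in> carrier T.MR" using x by (simp add: p_def keys_frag_of)
    have "T.tclass (Gsubst (Suc N) \<epsilon> (x, b)) = T.tclass (Gsubst N \<epsilon> (x, b)) \<oplus>\<^bsub>T.TR\<^esub> T.tclass p"
      unfolding T.tclass_add[OF g p] by (simp add: Gsubst_def p_def)
    moreover have "to_series (T.tclass p) = can_iota s (Qdiv N x) * tconst (fps_const (\<epsilon> ^ N)) * tconst b"
      using x by (simp add: p_def to_series(2) tconst_mult mult.assoc flip: T.pure_tclass)
    ultimately show ?case
      using T.tclass_in[OF g] T.tclass_in[OF p] by (simp add: to_series_simps Suc deform_def distrib_right)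
  qed
  then show ?thesis
    using comm_alg_pair.induced(3)[OF pair balanced_Gsubst[of N \<epsilon>] x, of b] by simp
qed

text \<open>
  The substitution is \<open>W\<close>-linear, so it preserves the filtration.
\<close>

lemma to_series_Tsubst_Wpow:
  "z \<in> carrier T.TR \<Longrightarrow> to_series (Tsubst N \<epsilon> (Wpow n \<otimes>\<^bsub>T.TR\<^esub> z)) = tconst (fps_X ^ n) * to_series (Tsubst N \<epsilon> z)"
proof (induction rule: T.T_induct)
  case zero
  show ?case by (simp add: Tsubst_0 to_series_simps)
next
  case (pure x b)
  then show ?case
    by (simp add: Wpow_def T.pure_mult to_series_Tsubst_pure tconst_mult tconst_left_comm)
next
  case (add z w)
  then show ?case by (simp add: T.T.r_distr Tsubst_add Tsubst_closed to_series_simps distrib_left)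
qed

lemma Tsubst_filtered:
  assumes "z \<in> carrier T.TR" "wcong (Suc n) (to_series z) 0"
  shows "wcong n (to_series (Tsubst N \<epsilon> z)) 0"
proof -
  have "z \<in> Wideal (Suc n)" using assms Wideal_iff by blast
  then obtain y where "y \<in> carrier T.TR" "z = Wpow (Suc n) \<otimes>\<^bsub>T.TR\<^esub> y" unfolding Wideal_eq by blast
  then show ?thesis using wcong_mono[OF wcong_X_pow, of n "Suc n"] by (simp only: to_series_Tsubst_Wpow)
qed

definition CTsubst :: "nat \<Rightarrow> 'c \<Rightarrow> (nat \<Rightarrow> 'c hullW set) \<Rightarrow> (nat \<Rightarrow> 'c hullW set)" where
  "CTsubst N \<epsilon> = restrict (CT_extend q s (Gsubst N \<epsilon>)) (carrier CT)"

lemma CTsubst: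
  assumes x: "x \<in> carrier CT"
  shows "CTsubst N \<epsilon> x \<in> carrier CT"
    and "y \<in> x (Suc n) \<Longrightarrow> wcong n (CT_series (CTsubst N \<epsilon> x)) (to_series (Tsubst N \<epsilon> y))"
proof -
  note c = comm_alg_pair.completion[OF pair, of "Tsubst N \<epsilon>", folded CT_extend_def]
  have "CT_extend q s (Gsubst N \<epsilon>) x \<in> carrier CT"
    by (rule c(1)) (fact Tsubst_closed Tsubst_add Tsubst_filtered x)+
  then show "CTsubst N \<epsilon> x \<in> carrier CT" using x by (simp add: CTsubst_def)
  assume y: "y \<in> x (Suc n)"
  have "wcong n (CT_series (CT_extend q s (Gsubst N \<epsilon>) x)) (to_series (Tsubst N \<epsilon> y))"
    by (rule c(2)) (fact Tsubst_closed Tsubst_add Tsubst_filtered x y)+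
  then show "wcong n (CT_series (CTsubst N \<epsilon> x)) (to_series (Tsubst N \<epsilon> y))" using x by (simp add: CTsubst_def)
qed

end

text \<open>
  Both sides are additive and compatible with the filtrations, so it suffices to compare them on the
  elements \<open>x \<otimes> b\<close>.
\<close>

lemma (in comm_alg_pair) CTsubst_commute:
  assumes L: "lifts G Op"
    and base: "\<And>x b. x \<in> galois_hull q \<Longrightarrow>
      B.to_series (B.Tsubst N \<epsilon>' (B.T.tclass (G (x, b)))) = Op (A.deform N \<epsilon> x * tconst b)"
    and x: "x \<in> carrier A.CT"
  shows "B.CTsubst N \<epsilon>' (CT_extend q s' G x) = CT_extend q s' G (A.CTsubst N \<epsilon> x)"
proof -
  note i = induced[OF lifts_D(1)[OF L]] and o = operator[OF L]
  note Op_add = lifts_D(3)[OF L] and Op_cong = lifts_D(4)[OF L]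
  have Op_0: "Op 0 = 0" using Op_add[of 0 0] by simp
  have T: "B.to_series (B.Tsubst N \<epsilon>' (T_extend q s' G z)) = Op (A.to_series (A.Tsubst N \<epsilon> z))"
    if "z \<in> carrier A.T.TR" for z
    using that
  proof (induction rule: A.T.T_induct)
    case zero
    have "T_extend q s' G \<zero>\<^bsub>A.T.TR\<^esub> = \<zero>\<^bsub>B.T.TR\<^esub>"
      by (rule A.T.T_additive_0[OF B.T.T.abelian_group_axioms i(1) i(2)])
    then show ?case by (simp add: A.Tsubst_0 B.Tsubst_0 A.to_series_simps B.to_series_simps Op_0)
  next
    case (pure x b)
    then show ?case by (simp add: i(3) base A.to_series_Tsubst_pure)
  next
    case (add z w)
    then show ?case
      by (simp add: i A.Tsubst_add B.Tsubst_add A.Tsubst_closed B.Tsubst_closed A.to_series_simps B.to_series_simps Op_add)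
  qed
  show ?thesis
  proof (rule B.CT_series_inj)
    show "B.CT_series (B.CTsubst N \<epsilon>' (CT_extend q s' G x)) = B.CT_series (CT_extend q s' G (A.CTsubst N \<epsilon> x))"
    proof (rule wcong_all)
      fix n
      obtain y where y: "y \<in> carrier A.T.TR" "y \<in> x (Suc (Suc n))"
        by (rule A.CT_nonempty[OF x, of "Suc (Suc n)"])
      have "wcong (Suc n) (B.to_series (T_extend q s' G y)) (B.CT_series (CT_extend q s' G x))"
        unfolding o(1)[OF y(1)] o(3)[OF x] by (rule Op_cong) (rule A.CT_series_cong[OF x y(2)])
      then have "T_extend q s' G y \<in> CT_extend q s' G x (Suc n)"
        using B.CT_mem[OF o(2)[OF x], of "Suc n"] i(1)[OF y(1)] by simp
      then have "wcong n (B.CT_series (B.CTsubst N \<epsilon>' (CT_extend q s' G x))) (B.to_series (B.Tsubst N \<epsilon>' (T_extend q s' G y)))"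
        by (rule B.CTsubst(2)[OF o(2)[OF x]])
      moreover have "wcong n (B.to_series (B.Tsubst N \<epsilon>' (T_extend q s' G y))) (B.CT_series (CT_extend q s' G (A.CTsubst N \<epsilon> x)))"
        unfolding T[OF y(1)] o(3)[OF A.CTsubst(1)[OF x]]
        by (rule Op_cong) (rule wcong_sym, rule A.CTsubst(2)[OF x y(2)])
      ultimately show "wcong n (B.CT_series (B.CTsubst N \<epsilon>' (CT_extend q s' G x))) (B.CT_series (CT_extend q s' G (A.CTsubst N \<epsilon> x)))"
        by (rule wcong_trans)
    qed
  qed (rule B.CTsubst(1) o(2) A.CTsubst(1) x)+
qed

context comm_alg
begin

lemma CTsubst_ops:
  assumes x: "x \<in> carrier CT"
  shows "CTsubst N \<epsilon> (CT_sigma q s x) = CT_sigma q s (CTsubst N \<epsilon> x)"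
    "CTsubst N \<epsilon> (CT_theta q s l x) = CT_theta q s l (CTsubst N \<epsilon> x)"
    "CTsubst N \<epsilon> (CT_deriv q s x) = CT_deriv q s (CTsubst N \<epsilon> x)"
proof -
  note c = comm_alg_pair.CTsubst_commute[OF pair]
  show "CTsubst N \<epsilon> (CT_sigma q s x) = CT_sigma q s (CTsubst N \<epsilon> x)"
    unfolding CT_sigma_def
  proof (rule c[OF lifts_sigma _ x])
    fix x and b :: "'c fps" assume "x \<in> galois_hull q"
    then show "to_series (Tsubst N \<epsilon> (T.tclass (case (x, b) of (x, b) \<Rightarrow> frag_of (tsigma rconst q x, b)))) =
        tsigma (wconst s) q (deform N \<epsilon> x * tconst b)"
      by (simp add: T.pure_tclass[symmetric] to_series_Tsubst_pure galois_hull.intros deform_sigma)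
        (rule tser_eqI, simp add: mult.assoc)
  qed
  show "CTsubst N \<epsilon> (CT_theta q s l x) = CT_theta q s l (CTsubst N \<epsilon> x)"
    unfolding CT_theta_def
  proof (rule c[OF lifts_theta _ x])
    fix x and b :: "'c fps" assume "x \<in> galois_hull q"
    then show "to_series (Tsubst N \<epsilon> (T.tclass (case (x, b) of (x, b) \<Rightarrow> frag_of (ttheta rconst q l x, b)))) =
        ttheta (wconst s) q l (deform N \<epsilon> x * tconst b)"
      by (simp add: T.pure_tclass[symmetric] to_series_Tsubst_pure galois_hull.intros deform_theta)
        (rule tser_eqI, simp add: mult.assoc)
  qed
  show "CTsubst N \<epsilon> (CT_deriv q s x) = CT_deriv q s (CTsubst N \<epsilon> x)"
    unfolding CT_deriv_def
  proof (rule c[OF lifts_deriv _ x])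
    fix x and b :: "'c fps" assume h: "x \<in> galois_hull q"
    have "tmap (wderiv s) (tconst b) = tconst (wderiv s b)"
      using wderiv_const[of 0] by (intro tser_eqI) (simp add: tcoeff_tconst)
    then show "to_series (Tsubst N \<epsilon> (T.tclass (case (x, b) of (x, b) \<Rightarrow> frag_of (tmap rderiv x, b) + frag_of (x, wderiv s b)))) =
        tmap (wderiv s) (deform N \<epsilon> x * tconst b)"
      unfolding tclass_deriv[OF h] tmap_derivation[of "wderiv s", OF wderiv_add wderiv_mult]
      using h galois_hull.hull_deriv[OF h]
      by (simp add: Tsubst_add Tsubst_closed to_series_simps to_series_Tsubst_pure deform_deriv)
  qed
qed

lemma to_series_Tsubst_mult:
  assumes "\<epsilon> ^ N = 0" "z \<in> carrier T.TR" "w \<in> carrier T.TR"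
  shows "to_series (Tsubst N \<epsilon> (z \<otimes>\<^bsub>T.TR\<^esub> w)) = to_series (Tsubst N \<epsilon> z) * to_series (Tsubst N \<epsilon> w)"
  using assms(2)
proof (induction rule: T.T_induct)
  case zero
  show ?case using assms(3) by (simp add: Tsubst_0 to_series_simps)
next
  case (pure x b)
  then have x: "x \<in> galois_hull q" by simp
  show ?case using assms(3)
  proof (induction rule: T.T_induct)
    case zero
    show ?case using x by (simp add: Tsubst_0 to_series_simps)
  next
    case (pure y c)
    then have y: "y \<in> galois_hull q" by simp
    show ?case
      using x y by (simp add: T.pure_mult to_series_Tsubst_pure galois_hull.intros deform_mult[OF assms(1)] tconst_mult
          mult.assoc tconst_left_comm)
  next
    case (add z w)
    then show ?case using x by (simp add: T.T.r_distr Tsubst_add Tsubst_closed to_series_simps distrib_left)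
  qed
next
  case (add z w)
  then show ?case using assms(3) by (simp add: T.T.l_distr Tsubst_add Tsubst_closed to_series_simps distrib_right)
qed

lemma to_series_can_sum:
  fixes M :: nat
  assumes "\<And>k. u k \<in> galois_hull q"
  shows "\<exists>w\<in>carrier T.TR. to_series w = (\<Sum>k<M. can_iota s (u k) * tconst (v k))"
proof (induction M)
  case 0
  show ?case by (rule bexI[of _ "\<zero>\<^bsub>T.TR\<^esub>"]) (simp_all add: to_series_simps)
next
  case (Suc M)
  then obtain w where "w \<in> carrier T.TR" "to_series w = (\<Sum>k<M. can_iota s (u k) * tconst (v k))" by blast
  then show ?case using assms
    by (intro bexI[of _ "w \<oplus>\<^bsub>T.TR\<^esub> T.pure (u M) (v M)"]) (simp_all add: to_series_simps to_series(2))
qed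

text \<open>
  All terms with \<open>k > 0\<close> are divisible by \<open>\<epsilon>\<close>. This yields the congruence modulo nilpotent elements.
\<close>

lemma Tsubst_diff:
  assumes "0 < N" "z \<in> carrier T.TR"
  shows "\<exists>w\<in>carrier T.TR. to_series (Tsubst N \<epsilon> z) - to_series z = tconst (fps_const \<epsilon>) * to_series w"
  using assms(2)
proof (induction rule: T.T_induct)
  case zero
  show ?case by (rule bexI[of _ "\<zero>\<^bsub>T.TR\<^esub>"]) (simp_all add: to_series_simps Tsubst_0)
next
  case (pure x b)
  then have x: "x \<in> galois_hull q" by simp
  obtain M where N: "N = Suc M" using assms(1) gr0_conv_Suc by blast
  obtain w where w: "w \<in> carrier T.TR"
    "to_series w = (\<Sum>k<M. can_iota s (Qdiv (Suc k) x) * tconst (fps_const (\<epsilon> ^ k) * b))"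
    using to_series_can_sum[where u="\<lambda>k. Qdiv (Suc k) x" and v="\<lambda>k. fps_const (\<epsilon> ^ k) * b" and M=M,
        OF Qdiv_hull[OF x]] by blast
  have "tconst (fps_const (\<epsilon> ^ Suc k)) * tconst b = tconst (fps_const \<epsilon>) * tconst (fps_const (\<epsilon> ^ k) * b)" for k
    by (simp add: mult.assoc[symmetric] flip: tconst_mult)
  then have "can_iota s (Qdiv (Suc k) x) * tconst (fps_const (\<epsilon> ^ Suc k)) * tconst b
      = tconst (fps_const \<epsilon>) * (can_iota s (Qdiv (Suc k) x) * tconst (fps_const (\<epsilon> ^ k) * b))" for k
    by (simp only: mult.assoc tconst_left_comm)
  then have "to_series (Tsubst N \<epsilon> (T.pure x b)) - to_series (T.pure x b) = tconst (fps_const \<epsilon>) * to_series w"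
    unfolding w(2) to_series_Tsubst_pure[OF x] to_series(2)[OF x] deform_def N sum.lessThan_Suc_shift
    by (simp only: distrib_right sum_distrib_right sum_distrib_left) simp
  then show ?case using w(1) by blast
next
  case (add z w)
  then obtain z' w' where "z' \<in> carrier T.TR" "to_series (Tsubst N \<epsilon> z) - to_series z = tconst (fps_const \<epsilon>) * to_series z'"
    "w' \<in> carrier T.TR" "to_series (Tsubst N \<epsilon> w) - to_series w = tconst (fps_const \<epsilon>) * to_series w'" by blast
  then show ?case using add
    by (intro bexI[of _ "z' \<oplus>\<^bsub>T.TR\<^esub> w'"]) (simp_all add: Tsubst_add Tsubst_closed to_series_simps distrib_left add_diff_add)
qed

text \<open>
  Every identity is checked on series modulo \<open>W\<^sup>n\<close>, where an element may be replaced by a tensor that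
  approximates it; on tensors the properties are those of \<open>deform\<close>. The bound \<open>2 \<le> N\<close> keeps the term
  with \<open>k = 1\<close>, which moves \<open>\<iota>\<^sub>0(t)\<close>.
\<close>

lemma CTsubst_endo:
  assumes \<epsilon>: "\<epsilon> ^ N = 0" "2 \<le> N"
  shows "CTsubst N \<epsilon> \<in> CT_endos" "CTsubst N \<epsilon> (CT_elem q s (iota0 q rt) 1) = CT_deformed (1 + \<epsilon>)"
proof -
  let ?\<alpha> = "CTsubst N \<epsilon>"
  have cong: "wcong n (to_series (Tsubst N \<epsilon> y)) (CT_series (?\<alpha> x))" if "x \<in> carrier CT" "y \<in> x (Suc n)" for x y n
    by (rule wcong_sym) (rule CTsubst(2)[OF that])
  have rep: "\<exists>y. y \<in> carrier T.TR \<and> y \<in> x (Suc n)" if "x \<in> carrier CT" for x n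
    by (rule CT_nonempty[OF that, of "Suc n"]) blast
  have val: "CT_series (?\<alpha> x) = f" if "x \<in> carrier CT" "\<And>n. \<exists>y\<in>x (Suc n). wcong n (to_series (Tsubst N \<epsilon> y)) f" for x f
    using cong[OF that(1)] that(2) by (intro wcong_all) (blast intro: wcong_trans wcong_sym)
  have hom: "?\<alpha> \<in> Ring.ring_hom CT CT"
  proof (rule ring_hom_memI)
    fix x y assume x: "x \<in> carrier CT" and y: "y \<in> carrier CT"
    show "?\<alpha> x \<in> carrier CT" by (rule CTsubst(1)[OF x])
    show "?\<alpha> (x \<otimes>\<^bsub>CT\<^esub> y) = ?\<alpha> x \<otimes>\<^bsub>CT\<^esub> ?\<alpha> y"
    proof (rule CT_series_inj)
      show "CT_series (?\<alpha> (x \<otimes>\<^bsub>CT\<^esub> y)) = CT_series (?\<alpha> x \<otimes>\<^bsub>CT\<^esub> ?\<alpha> y)"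
      proof (rule val)
        fix n
        obtain z w where z: "z \<in> carrier T.TR" "z \<in> x (Suc n)" and w: "w \<in> carrier T.TR" "w \<in> y (Suc n)"
          using rep[OF x] rep[OF y] by blast
        have "z \<otimes>\<^bsub>T.TR\<^esub> w \<in> (x \<otimes>\<^bsub>CT\<^esub> y) (Suc n)"
          using CT_mem[of "x \<otimes>\<^bsub>CT\<^esub> y" "Suc n"] x y z w CT_series_cong[OF x z(2)] CT_series_cong[OF y w(2)]
          by (simp add: to_series_simps wcong_mult)
        moreover have "wcong n (to_series (Tsubst N \<epsilon> (z \<otimes>\<^bsub>T.TR\<^esub> w))) (CT_series (?\<alpha> x \<otimes>\<^bsub>CT\<^esub> ?\<alpha> y))"
          using wcong_mult[OF cong[OF x z(2)] cong[OF y w(2)]] x y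
          by (simp add: to_series_Tsubst_mult[OF \<epsilon>(1) z(1) w(1)] CTsubst(1))
        ultimately show "\<exists>z\<in>(x \<otimes>\<^bsub>CT\<^esub> y) (Suc n). wcong n (to_series (Tsubst N \<epsilon> z)) (CT_series (?\<alpha> x \<otimes>\<^bsub>CT\<^esub> ?\<alpha> y))" by blast
      qed (simp add: x y)
    qed (simp_all add: x y CTsubst(1))
    show "?\<alpha> (x \<oplus>\<^bsub>CT\<^esub> y) = ?\<alpha> x \<oplus>\<^bsub>CT\<^esub> ?\<alpha> y"
    proof (rule CT_series_inj)
      show "CT_series (?\<alpha> (x \<oplus>\<^bsub>CT\<^esub> y)) = CT_series (?\<alpha> x \<oplus>\<^bsub>CT\<^esub> ?\<alpha> y)"
      proof (rule val)
        fix n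
        obtain z w where z: "z \<in> carrier T.TR" "z \<in> x (Suc n)" and w: "w \<in> carrier T.TR" "w \<in> y (Suc n)"
          using rep[OF x] rep[OF y] by blast
        have "z \<oplus>\<^bsub>T.TR\<^esub> w \<in> (x \<oplus>\<^bsub>CT\<^esub> y) (Suc n)"
          using CT_mem[of "x \<oplus>\<^bsub>CT\<^esub> y" "Suc n"] x y z w CT_series_cong[OF x z(2)] CT_series_cong[OF y w(2)]
          by (simp add: to_series_simps wcong_add)
        moreover have "wcong n (to_series (Tsubst N \<epsilon> (z \<oplus>\<^bsub>T.TR\<^esub> w))) (CT_series (?\<alpha> x \<oplus>\<^bsub>CT\<^esub> ?\<alpha> y))"
          using wcong_add[OF cong[OF x z(2)] cong[OF y w(2)]] x y z w
          by (simp add: Tsubst_add Tsubst_closed to_series_simps CTsubst(1))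
        ultimately show "\<exists>z\<in>(x \<oplus>\<^bsub>CT\<^esub> y) (Suc n). wcong n (to_series (Tsubst N \<epsilon> z)) (CT_series (?\<alpha> x \<oplus>\<^bsub>CT\<^esub> ?\<alpha> y))" by blast
      qed (simp add: x y)
    qed (simp_all add: x y CTsubst(1))
  next
    show "?\<alpha> \<one>\<^bsub>CT\<^esub> = \<one>\<^bsub>CT\<^esub>"
    proof (rule CT_series_inj)
      show "CT_series (?\<alpha> \<one>\<^bsub>CT\<^esub>) = CT_series \<one>\<^bsub>CT\<^esub>"
      proof (rule val)
        fix n
        have "T.pure 1 1 \<in> \<one>\<^bsub>CT\<^esub> (Suc n)" using CT_mem[OF CT_closed(4), of "Suc n"] by (simp add: to_series(2))
        moreover have "to_series (Tsubst N \<epsilon> (T.pure 1 1)) = 1"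
          using deform_tconst[of N \<epsilon> 1] \<epsilon>(2) by (simp add: to_series_Tsubst_pure)
        ultimately show "\<exists>y\<in>\<one>\<^bsub>CT\<^esub> (Suc n). wcong n (to_series (Tsubst N \<epsilon> y)) (CT_series \<one>\<^bsub>CT\<^esub>)"
          by (intro bexI[of _ "T.pure 1 1"]) simp_all
      qed simp
    qed (simp_all add: CTsubst(1))
  qed
  have base: "?\<alpha> x = x" if x: "x \<in> CT_base q s" for x
  proof -
    have xc: "x \<in> carrier CT" using x unfolding CT_base_def by blast
    have gen: "z \<in> carrier T.TR \<and> to_series (Tsubst N \<epsilon> z) = to_series z"
      if "z \<in> generate_ring T.TR {T.pure (tconst a) b | a b. True}" for z
      using that
    proof (induction rule: generate_ring.induct)
      case one
      show ?case using deform_tconst[of N \<epsilon> 1] \<epsilon>(2) by (simp add: T.pure_one to_series_Tsubst_pure to_series(2))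
    next
      case (incl z)
      then obtain a b where "z = T.pure (tconst a) b" by blast
      then show ?case using \<epsilon>(2) by (simp add: to_series_Tsubst_pure to_series(2) galois_hull.intros deform_tconst)
    next
      case (a_inv z)
      then have z: "z \<in> carrier T.TR" "to_series (Tsubst N \<epsilon> z) = to_series z" by blast+
      have "to_series (Tsubst N \<epsilon> (\<ominus>\<^bsub>T.TR\<^esub> z)) + to_series (Tsubst N \<epsilon> z) = to_series (Tsubst N \<epsilon> (\<ominus>\<^bsub>T.TR\<^esub> z \<oplus>\<^bsub>T.TR\<^esub> z))"
        using z(1) by (simp only: Tsubst_add Tsubst_closed to_series_simps T.T.a_inv_closed)
      then have "to_series (Tsubst N \<epsilon> (\<ominus>\<^bsub>T.TR\<^esub> z)) + to_series (Tsubst N \<epsilon> z) = 0"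
        using z(1) by (simp add: T.T.l_neg Tsubst_0 to_series_simps)
      then have "to_series (Tsubst N \<epsilon> (\<ominus>\<^bsub>T.TR\<^esub> z)) = - to_series z" unfolding z(2) by (rule minus_unique[symmetric, OF trans[OF add.commute]])
      then show ?case using z(1) by (simp add: to_series_uminus)
    next
      case (eng_add z w)
      then show ?case by (simp add: Tsubst_add Tsubst_closed to_series_simps)
    next
      case (eng_mult z w)
      then show ?case by (simp add: to_series_Tsubst_mult[OF \<epsilon>(1)] to_series_simps)
    qed
    have "CT_series (?\<alpha> x) = CT_series x"
    proof (rule val[OF xc])
      fix n
      obtain z where z: "z \<in> generate_ring T.TR {T.pure (tconst a) b | a b. True}" "x (Suc n) = Wcoset (Suc n) z"
        using x unfolding CT_base_def T_ring_eq T_elem_eq by blast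
      have zx: "z \<in> x (Suc n)" using gen[OF z(1)] by (simp add: z(2) Wcoset_eq)
      show "\<exists>y\<in>x (Suc n). wcong n (to_series (Tsubst N \<epsilon> y)) (CT_series x)"
        using gen[OF z(1)] wcong_mono[OF CT_series_cong[OF xc zx], of n] by (intro bexI[OF _ zx]) simp
    qed
    then show ?thesis by (intro CT_series_inj) (simp_all add: xc CTsubst(1))
  qed
  have nil: "?\<alpha> x \<ominus>\<^bsub>CT\<^esub> x \<in> CT_nil q s" if x: "x \<in> carrier CT" for x
  proof -
    define S where "S = {CT_elem q s 1 (fps_const a) | a. nilpotent (a :: 'c)}"
    have S: "S \<subseteq> carrier CT" unfolding S_def by auto
    interpret I: ideal "Idl\<^bsub>CT\<^esub> S" CT by (rule CT.genideal_ideal[OF S])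
    have "\<exists>y\<in>Idl\<^bsub>CT\<^esub> S. ?\<alpha> x \<ominus>\<^bsub>CT\<^esub> x \<ominus>\<^bsub>CT\<^esub> y \<in> CT_nbhd q s n" for n
    proof -
      obtain y where y: "y \<in> carrier T.TR" "y \<in> x (Suc n)" using rep[OF x] by blast
      obtain w where w: "w \<in> carrier T.TR" "to_series (Tsubst N \<epsilon> y) - to_series y = tconst (fps_const \<epsilon>) * to_series w"
        using Tsubst_diff[OF less_le_trans[OF pos2 \<epsilon>(2)] y(1)] by blast
      define u where "u = CT_elem q s 1 (fps_const \<epsilon>) \<otimes>\<^bsub>CT\<^esub> CT_embed w"
      have "CT_elem q s 1 (fps_const \<epsilon>) \<in> S" unfolding S_def using \<epsilon>(1) by (auto simp: nilpotent_def)
      then have u: "u \<in> Idl\<^bsub>CT\<^esub> S" unfolding u_def using CT.genideal_self[OF S] w(1) by (intro I.I_r_closed) auto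
      have ju: "CT_series u = to_series (Tsubst N \<epsilon> y) - to_series y" using w by (simp add: u_def)
      have uc: "u \<in> carrier CT" using u by (rule I.a_Hcarr)
      have "wcong n (CT_series (?\<alpha> x) - CT_series x) (CT_series u)"
        unfolding ju using wcong_sym[OF cong[OF x y(2)]] wcong_mono[OF wcong_sym[OF CT_series_cong[OF x y(2)]], of n]
        by (intro wcong_diff) simp_all
      then have "?\<alpha> x \<ominus>\<^bsub>CT\<^esub> x \<ominus>\<^bsub>CT\<^esub> u \<in> CT_nbhd q s n"
        using x uc by (simp add: CT_nbhd_iff CTsubst(1) wcong_diff_0)
      then show ?thesis using u by blast
    qed
    then show ?thesis unfolding CT_nil_def S_def using x by (simp add: CTsubst(1))
  qed
  show "?\<alpha> \<in> CT_endos"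
    unfolding CT_endos_def using hom base nil CTsubst_ops by (simp add: CTsubst_def)
  have hY: "iota0 q rt \<in> galois_hull q" by (rule galois_hull.hull_iota0)
  show "?\<alpha> (CT_elem q s (iota0 q rt) 1) = CT_deformed (1 + \<epsilon>)"
  proof (rule CT_series_inj)
    show "CT_series (?\<alpha> (CT_elem q s (iota0 q rt) 1)) = CT_series (CT_deformed (1 + \<epsilon>))"
    proof (rule val)
      fix n
      have "T.pure (iota0 q rt) 1 \<in> CT_elem q s (iota0 q rt) 1 (Suc n)"
        using CT_mem[OF CT_elem_closed[OF hY, of 1], of "Suc n"] hY by (simp add: to_series(2))
      then show "\<exists>y\<in>CT_elem q s (iota0 q rt) 1 (Suc n). wcong n (to_series (Tsubst N \<epsilon> y)) (CT_series (CT_deformed (1 + \<epsilon>)))"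
        by (rule bexI[rotated]) (simp add: to_series_Tsubst_pure hY CT_deformed deform_iota0_rt \<epsilon>(2))
    qed (simp add: hY)
  qed (simp_all add: hY CTsubst(1) CT_deformed)
qed

lemma CT_endo_exists:
  assumes "nilpotent (c - 1)"
  obtains \<alpha> where "\<alpha> \<in> CT_endos" "\<alpha> (CT_elem q s (iota0 q rt) 1) = CT_deformed c"
proof -
  obtain N where "(c - 1) ^ N = 0" "2 \<le> N" using nilpotent_bound[OF assms] by blast
  from CTsubst_endo[OF this] that show thesis by simp
qed

section \<open>The commutative Galois group\<close>

lemma CInf_gal_iso_eq: "CInf_gal_iso q s \<alpha> = (THE c. \<alpha> (CT_elem q s (iota0 q rt) 1) = CT_deformed c)"
  by (simp add: CInf_gal_iso_def CT_deformed_def)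

lemma CInf_gal_iso:
  assumes "\<alpha> \<in> CT_endos"
  shows "\<alpha> (CT_elem q s (iota0 q rt) 1) = CT_deformed (CInf_gal_iso q s \<alpha>)"
    and "nilpotent (CInf_gal_iso q s \<alpha> - 1)"
    and "\<alpha> (CT_elem q s (iota0 q rt) 1) = CT_deformed c \<Longrightarrow> CInf_gal_iso q s \<alpha> = c"
proof -
  show 1: "\<alpha> (CT_elem q s (iota0 q rt) 1) = CT_deformed (CInf_gal_iso q s \<alpha>)"
    unfolding CInf_gal_iso_eq by (rule theI'[OF CT_endo_deformed(1)[OF assms]])
  show "nilpotent (CInf_gal_iso q s \<alpha> - 1)" by (rule CT_endo_deformed(2)[OF assms 1])
  show "\<alpha> (CT_elem q s (iota0 q rt) 1) = CT_deformed c \<Longrightarrow> CInf_gal_iso q s \<alpha> = c"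
    using CT_endo_deformed(1)[OF assms] 1 by blast
qed

lemma CT_nil_add: "x \<in> CT_nil q s \<Longrightarrow> y \<in> CT_nil q s \<Longrightarrow> x \<oplus>\<^bsub>CT\<^esub> y \<in> CT_nil q s"
proof -
  assume x: "x \<in> CT_nil q s" and y: "y \<in> CT_nil q s"
  define S where "S = {CT_elem q s 1 (fps_const a) | a. nilpotent (a :: 'c)}"
  have S: "S \<subseteq> carrier CT" unfolding S_def by auto
  interpret I: ideal "Idl\<^bsub>CT\<^esub> S" CT by (rule CT.genideal_ideal[OF S])
  have xy: "x \<in> carrier CT" "y \<in> carrier CT" using x y unfolding CT_nil_def by blast+
  have "\<exists>w\<in>Idl\<^bsub>CT\<^esub> S. x \<oplus>\<^bsub>CT\<^esub> y \<ominus>\<^bsub>CT\<^esub> w \<in> CT_nbhd q s n" for n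
  proof -
    obtain v where v: "v \<in> Idl\<^bsub>CT\<^esub> S" "x \<ominus>\<^bsub>CT\<^esub> v \<in> CT_nbhd q s n" using x unfolding CT_nil_def S_def by blast
    obtain w where w: "w \<in> Idl\<^bsub>CT\<^esub> S" "y \<ominus>\<^bsub>CT\<^esub> w \<in> CT_nbhd q s n" using y unfolding CT_nil_def S_def by blast
    have vw: "v \<in> carrier CT" "w \<in> carrier CT" by (rule I.a_Hcarr, fact v(1) w(1))+
    have "x \<oplus>\<^bsub>CT\<^esub> y \<ominus>\<^bsub>CT\<^esub> (v \<oplus>\<^bsub>CT\<^esub> w) \<in> CT_nbhd q s n"
      using v(2) w(2) xy vw wcong_add[of n "CT_series x" "CT_series v" "CT_series y" "CT_series w"]
      by (simp add: CT_nbhd_iff wcong_diff_0)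
    moreover have "v \<oplus>\<^bsub>CT\<^esub> w \<in> Idl\<^bsub>CT\<^esub> S" using v(1) w(1) by (rule I.a_closed)
    ultimately show ?thesis by blast
  qed
  then show ?thesis unfolding CT_nil_def S_def using xy by simp
qed

lemma CT_endos_compose:
  assumes \<alpha>: "\<alpha> \<in> CT_endos" and \<beta>: "\<beta> \<in> CT_endos"
  shows "compose (carrier CT) \<alpha> \<beta> \<in> CT_endos"
proof -
  note a = ring_hom_closed[OF CT_endos_D(1)[OF \<alpha>]] ring_hom_mult[OF CT_endos_D(1)[OF \<alpha>]]
    ring_hom_add[OF CT_endos_D(1)[OF \<alpha>]] ring_hom_one[OF CT_endos_D(1)[OF \<alpha>]]
  note b = ring_hom_closed[OF CT_endos_D(1)[OF \<beta>]] ring_hom_mult[OF CT_endos_D(1)[OF \<beta>]]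
    ring_hom_add[OF CT_endos_D(1)[OF \<beta>]] ring_hom_one[OF CT_endos_D(1)[OF \<beta>]]
  have hom: "compose (carrier CT) \<alpha> \<beta> \<in> Ring.ring_hom CT CT"
    by (rule ring_hom_memI) (simp_all add: compose_eq a b)
  have base: "compose (carrier CT) \<alpha> \<beta> x = x" if "x \<in> CT_base q s" for x
  proof -
    have "x \<in> carrier CT" using that unfolding CT_base_def by blast
    then show ?thesis by (simp add: compose_eq CT_endos_D(3)[OF \<alpha> that] CT_endos_D(3)[OF \<beta> that])
  qed
  have nil: "compose (carrier CT) \<alpha> \<beta> x \<ominus>\<^bsub>CT\<^esub> x \<in> CT_nil q s" if x: "x \<in> carrier CT" for x
  proof -
    have "\<alpha> (\<beta> x) \<ominus>\<^bsub>CT\<^esub> x = (\<alpha> (\<beta> x) \<ominus>\<^bsub>CT\<^esub> \<beta> x) \<oplus>\<^bsub>CT\<^esub> (\<beta> x \<ominus>\<^bsub>CT\<^esub> x)"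
      using x by (intro CT_series_inj) (simp_all add: a b)
    then show ?thesis
      using CT_nil_add[OF CT_endos_D(7)[OF \<alpha> b(1)[OF x]] CT_endos_D(7)[OF \<beta> x]] x by (simp add: compose_eq)
  qed
  show ?thesis
    unfolding CT_endos_def
    using hom base nil
    by (simp add: compose_extensional compose_eq CT_sigma CT_theta CT_deriv a b
        CT_endos_D(4-6)[OF \<alpha>] CT_endos_D(4-6)[OF \<beta>])
qed

lemma CT_endos_id: "restrict (\<lambda>x. x) (carrier CT) \<in> CT_endos"
proof -
  have hom: "restrict (\<lambda>x. x) (carrier CT) \<in> Ring.ring_hom CT CT"
    by (rule ring_hom_memI) simp_all
  have "x \<ominus>\<^bsub>CT\<^esub> x \<in> CT_nil q s" if x: "x \<in> carrier CT" for x
  proof -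
    define S where "S = {CT_elem q s 1 (fps_const a) | a. nilpotent (a :: 'c)}"
    have S: "S \<subseteq> carrier CT" unfolding S_def by auto
    interpret I: ideal "Idl\<^bsub>CT\<^esub> S" CT by (rule CT.genideal_ideal[OF S])
    have "x \<ominus>\<^bsub>CT\<^esub> x \<ominus>\<^bsub>CT\<^esub> \<zero>\<^bsub>CT\<^esub> \<in> CT_nbhd q s n" for n using x by (simp add: CT_nbhd_iff)
    then show ?thesis using I.zero_closed x unfolding CT_nil_def S_def by blast
  qed
  moreover have "x \<in> carrier CT" if "x \<in> CT_base q s" for x using that unfolding CT_base_def by blast
  ultimately show ?thesis
    unfolding CT_endos_def using hom by (simp add: CT_sigma CT_theta CT_deriv)
qed

lemma CInf_gal_iso_id: "CInf_gal_iso q s (restrict (\<lambda>x. x) (carrier CT)) = 1"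
proof (rule CInf_gal_iso(3)[OF CT_endos_id])
  have "iota0 q rt \<in> galois_hull q" by (rule galois_hull.hull_iota0)
  then show "restrict (\<lambda>x. x) (carrier CT) (CT_elem q s (iota0 q rt) 1) = CT_deformed 1"
    by (intro CT_series_inj) (simp_all add: CT_deformed can_iota_iota0_rt)
qed

lemma CInf_gal_iso_compose:
  assumes \<alpha>: "\<alpha> \<in> CT_endos" and \<beta>: "\<beta> \<in> CT_endos"
  shows "CInf_gal_iso q s (compose (carrier CT) \<alpha> \<beta>) = CInf_gal_iso q s \<alpha> * CInf_gal_iso q s \<beta>"
  by (rule CInf_gal_iso(3)[OF CT_endos_compose[OF assms]])
    (simp add: compose_eq galois_hull.hull_iota0 CInf_gal_iso(1)[OF \<beta>] CT_endo_CT_deformed[OF \<alpha> CInf_gal_iso(1)[OF \<alpha>]])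

lemma CT_endos_eqI:
  "\<alpha> \<in> CT_endos \<Longrightarrow> \<beta> \<in> CT_endos \<Longrightarrow> CInf_gal_iso q s \<alpha> = CInf_gal_iso q s \<beta> \<Longrightarrow> \<alpha> = \<beta>"
  using CT_endo_unique CInf_gal_iso(1) by metis

text \<open>
  The inverse belongs to the inverse of the unipotent element.
\<close>

lemma CT_endos_inverse:
  assumes \<alpha>: "\<alpha> \<in> CT_endos"
  obtains \<beta> where "\<beta> \<in> CT_endos" "compose (carrier CT) \<alpha> \<beta> = restrict (\<lambda>x. x) (carrier CT)"
    "compose (carrier CT) \<beta> \<alpha> = restrict (\<lambda>x. x) (carrier CT)"
proof -
  obtain c' where c': "CInf_gal_iso q s \<alpha> * c' = 1" "c' * CInf_gal_iso q s \<alpha> = 1" "nilpotent (c' - 1)"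
    using unipotent_inverse[OF CInf_gal_iso(2)[OF \<alpha>]] by blast
  obtain \<beta> where \<beta>: "\<beta> \<in> CT_endos" "\<beta> (CT_elem q s (iota0 q rt) 1) = CT_deformed c'"
    using CT_endo_exists[OF c'(3)] by blast
  have b: "CInf_gal_iso q s \<beta> = c'" by (rule CInf_gal_iso(3)[OF \<beta>])
  show thesis
    by (rule that[OF \<beta>(1)]; rule CT_endos_eqI)
      (simp_all add: CT_endos_compose CT_endos_id \<alpha> \<beta>(1) CInf_gal_iso_compose CInf_gal_iso_id b c')
qed

text \<open>
  Bijectivity follows from the existence of inverse endomorphisms. Continuity holds since the
  neighbourhoods of \<open>0\<close> are the multiples of powers of \<open>W\<close>, which an endomorphism fixes.
\<close>

lemma CInf_gal_carrier: "carrier (CInf_gal q s) = CT_endos"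
proof
  show "carrier (CInf_gal q s) \<subseteq> CT_endos"
    unfolding CInf_gal_def CT_endos_def ring_iso_def by auto
  show "CT_endos \<subseteq> carrier (CInf_gal q s)"
  proof
    fix \<alpha> assume \<alpha>: "\<alpha> \<in> CT_endos"
    note a = ring_hom_closed[OF CT_endos_D(1)[OF \<alpha>]] ring_hom_mult[OF CT_endos_D(1)[OF \<alpha>]]
      ring_hom_add[OF CT_endos_D(1)[OF \<alpha>]]
    obtain \<beta> where \<beta>: "\<beta> \<in> CT_endos" "compose (carrier CT) \<alpha> \<beta> = restrict (\<lambda>x. x) (carrier CT)"
      "compose (carrier CT) \<beta> \<alpha> = restrict (\<lambda>x. x) (carrier CT)" by (rule CT_endos_inverse[OF \<alpha>])
    note b = ring_hom_closed[OF CT_endos_D(1)[OF \<beta>(1)]]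
    have ab: "\<alpha> (\<beta> x) = x" "\<beta> (\<alpha> x) = x" if "x \<in> carrier CT" for x
      using fun_cong[OF \<beta>(2), of x] fun_cong[OF \<beta>(3), of x] that by (simp_all add: compose_eq)
    have "bij_betw \<alpha> (carrier CT) (carrier CT)"
      by (rule bij_betw_byWitness[where f'=\<beta>]) (use a b ab in auto)
    then have iso: "\<alpha> \<in> ring_iso CT CT" using CT_endos_D(1)[OF \<alpha>] by (simp add: ring_iso_def)
    have sub: "\<alpha> (x \<ominus>\<^bsub>CT\<^esub> y) = \<alpha> x \<ominus>\<^bsub>CT\<^esub> \<alpha> y" if "x \<in> carrier CT" "y \<in> carrier CT" for x y
    proof -
      have "\<alpha> (x \<ominus>\<^bsub>CT\<^esub> y) \<oplus>\<^bsub>CT\<^esub> \<alpha> y = \<alpha> x"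
      proof -
        have "x \<ominus>\<^bsub>CT\<^esub> y \<oplus>\<^bsub>CT\<^esub> y = x" using that by (intro CT_series_inj) simp_all
        then show ?thesis using a(3)[of "x \<ominus>\<^bsub>CT\<^esub> y" y] that by simp
      qed
      then have "CT_series (\<alpha> (x \<ominus>\<^bsub>CT\<^esub> y)) + CT_series (\<alpha> y) = CT_series (\<alpha> x)"
        using CT_series_ops(1)[of "\<alpha> (x \<ominus>\<^bsub>CT\<^esub> y)" "\<alpha> y"] that a(1) by simp
      then show ?thesis using that by (intro CT_series_inj) (simp_all add: a eq_diff_eq)
    qed
    have W: "\<alpha> (CT_embed (Wpow n)) = CT_embed (Wpow n)" for n
      using CT_endos_D(3)[OF \<alpha> CT_elem_1_base[of "fps_X ^ n"]] by (simp add: CT_elem_embed Wpow_def)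
    have nb: "\<alpha> x \<in> CT_nbhd q s n" if x: "x \<in> CT_nbhd q s n" for x n
    proof -
      obtain w where "w \<in> carrier CT" "x = CT_embed (Wpow n) \<otimes>\<^bsub>CT\<^esub> w" using x unfolding CT_nbhd_eq by blast
      then have "\<alpha> x = CT_embed (Wpow n) \<otimes>\<^bsub>CT\<^esub> \<alpha> w" "\<alpha> w \<in> carrier CT" by (simp_all add: a W)
      then show ?thesis unfolding CT_nbhd_eq by blast
    qed
    have cont: "\<forall>x\<in>carrier CT. \<forall>n. \<exists>m. \<forall>y\<in>carrier CT.
           y \<ominus>\<^bsub>CT\<^esub> x \<in> CT_nbhd q s m \<longrightarrow> \<alpha> y \<ominus>\<^bsub>CT\<^esub> \<alpha> x \<in> CT_nbhd q s n"
    proof (intro ballI allI)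
      fix x n assume x: "x \<in> carrier CT"
      show "\<exists>m. \<forall>y\<in>carrier CT. y \<ominus>\<^bsub>CT\<^esub> x \<in> CT_nbhd q s m \<longrightarrow> \<alpha> y \<ominus>\<^bsub>CT\<^esub> \<alpha> x \<in> CT_nbhd q s n"
        by (rule exI[of _ n]) (use nb sub x in \<open>simp flip: sub\<close>)
    qed
    show "\<alpha> \<in> carrier (CInf_gal q s)"
      using \<alpha> iso cont unfolding CInf_gal_def CT_endos_def by simp
  qed
qed

lemma CInf_gal_ops:
  "\<alpha> \<otimes>\<^bsub>CInf_gal q s\<^esub> \<beta> = compose (carrier CT) \<alpha> \<beta>" "\<one>\<^bsub>CInf_gal q s\<^esub> = restrict (\<lambda>x. x) (carrier CT)"
  by (simp_all add: CInf_gal_def)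

lemma group_CInf_gal: "group (CInf_gal q s)"
proof (rule groupI)
  fix \<alpha> \<beta> \<gamma>
  assume a: "\<alpha> \<in> carrier (CInf_gal q s)" and b: "\<beta> \<in> carrier (CInf_gal q s)"
  then show "\<alpha> \<otimes>\<^bsub>CInf_gal q s\<^esub> \<beta> \<in> carrier (CInf_gal q s)"
    by (simp add: CInf_gal_carrier CInf_gal_ops CT_endos_compose)
  assume c: "\<gamma> \<in> carrier (CInf_gal q s)"
  show "\<alpha> \<otimes>\<^bsub>CInf_gal q s\<^esub> \<beta> \<otimes>\<^bsub>CInf_gal q s\<^esub> \<gamma> = \<alpha> \<otimes>\<^bsub>CInf_gal q s\<^esub> (\<beta> \<otimes>\<^bsub>CInf_gal q s\<^esub> \<gamma>)"
    using a b c unfolding CInf_gal_carrier CInf_gal_ops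
    by (intro CT_endos_eqI) (simp_all add: CT_endos_compose CInf_gal_iso_compose mult.assoc)
next
  show "\<one>\<^bsub>CInf_gal q s\<^esub> \<in> carrier (CInf_gal q s)" by (simp add: CInf_gal_carrier CInf_gal_ops CT_endos_id)
next
  fix \<alpha> assume a: "\<alpha> \<in> carrier (CInf_gal q s)"
  then show "\<one>\<^bsub>CInf_gal q s\<^esub> \<otimes>\<^bsub>CInf_gal q s\<^esub> \<alpha> = \<alpha>"
    unfolding CInf_gal_carrier CInf_gal_ops
    by (intro CT_endos_eqI) (simp_all add: CT_endos_compose CInf_gal_iso_compose CT_endos_id CInf_gal_iso_id)
  have "\<alpha> \<in> CT_endos" using a by (simp add: CInf_gal_carrier)
  from CT_endos_inverse[OF this]
  show "\<exists>\<beta>\<in>carrier (CInf_gal q s). \<beta> \<otimes>\<^bsub>CInf_gal q s\<^esub> \<alpha> = \<one>\<^bsub>CInf_gal q s\<^esub>"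
    unfolding CInf_gal_carrier CInf_gal_ops by blast
qed

lemma Gm_simps: "carrier (Gm :: 'c monoid) = {c. nilpotent (c - 1)}" "c \<otimes>\<^bsub>Gm\<^esub> d = c * (d :: 'c)" "\<one>\<^bsub>Gm\<^esub> = (1 :: 'c)"
  by (simp_all add: Gm_def)

lemma group_Gm: "group (Gm :: 'c monoid)"
proof (rule groupI)
  fix c :: 'c assume "c \<in> carrier Gm"
  then obtain c' where "c' * c = 1" "nilpotent (c' - 1)" using unipotent_inverse[of c] unfolding Gm_simps by blast
  then show "\<exists>d\<in>carrier Gm. d \<otimes>\<^bsub>Gm\<^esub> c = \<one>\<^bsub>Gm\<^esub>" unfolding Gm_simps by blast
qed (auto simp: Gm_simps nilpotent_0 mult.assoc intro: unipotent_mult mult.commute)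

lemma CInf_gal_iso_iso: "CInf_gal_iso q s \<in> iso (CInf_gal q s) Gm"
  unfolding iso_def
proof (intro CollectI conjI)
  show "CInf_gal_iso q s \<in> hom (CInf_gal q s) Gm"
    by (rule homI) (simp_all add: CInf_gal_carrier CInf_gal_ops Gm_simps CInf_gal_iso(2) CInf_gal_iso_compose)
  show "bij_betw (CInf_gal_iso q s) (carrier (CInf_gal q s)) (carrier Gm)"
    unfolding CInf_gal_carrier Gm_simps
  proof (rule bij_betwI')
    fix \<alpha> \<beta> assume "\<alpha> \<in> CT_endos" "\<beta> \<in> CT_endos"
    then show "(CInf_gal_iso q s \<alpha> = CInf_gal_iso q s \<beta>) = (\<alpha> = \<beta>)" using CT_endos_eqI by blast
  next
    fix \<alpha> assume "\<alpha> \<in> CT_endos"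
    then show "CInf_gal_iso q s \<alpha> \<in> {c. nilpotent (c - 1)}" using CInf_gal_iso(2) by blast
  next
    fix c :: 'c assume "c \<in> {c. nilpotent (c - 1)}"
    then obtain \<alpha> where "\<alpha> \<in> CT_endos" "\<alpha> (CT_elem q s (iota0 q rt) 1) = CT_deformed c"
      using CT_endo_exists by blast
    then show "\<exists>\<alpha>\<in>CT_endos. c = CInf_gal_iso q s \<alpha>" using CInf_gal_iso(3) by blast
  qed
qed

end

section \<open>Base change of automorphisms\<close>

locale comm_alg_hom = comm_alg_pair q s s' + L_alg_hom q s s' h
  for q and s :: "ratfun \<Rightarrow> 'c::{comm_ring,comm_monoid_mult}" and s' :: "ratfun \<Rightarrow> 'd::{comm_ring,comm_monoid_mult}"
    and h
begin

lemma lifts_map: "lifts (\<lambda>(x, b). frag_of (x, wmap h b)) (tmap (wmap h))"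
proof -
  have b: "balanced (\<lambda>(x, b). frag_of (x, wmap h b))"
    by (rule balanced_frag) (simp_all add: wmap_add wmap_mult)
  have 1: "B.to_series (B.T.tclass (case (x, b) of (x, b) \<Rightarrow> frag_of (x, wmap h b))) = tmap (wmap h) (can_iota s x * tconst b)"
    if "x \<in> galois_hull q" for x b
    using that by (simp add: B.T.pure_tclass[symmetric] B.to_series(2) tmap_wmap_mult tmap_wmap_can_iota tmap_wmap_tconst)
  have 3: "wcong n (tmap (wmap h) f) (tmap (wmap h) g)" if "wcong (Suc n) f g" for n f g
    using that by (simp add: wcong_def)
  show ?thesis unfolding lifts_def using b 1 3 tmap_wmap_add by blast
qed

lemma CT_map:
  assumes "x \<in> carrier A.CT"
  shows "CT_map q s' h x \<in> carrier B.CT" "B.CT_series (CT_map q s' h x) = tmap (wmap h) (A.CT_series x)"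
  using operator(2,3)[OF lifts_map assms] unfolding CT_map_def by blast+

lemma tmap_wmap_deform: "tmap (wmap h) (A.deform N \<epsilon> x) = B.deform N (h \<epsilon>) x"
  by (rule tser_eqI)
    (simp add: A.tcoeff_deform B.tcoeff_deform additive_sum[of "wmap h", OF wmap_add] wmap_mult h_power)

lemma CTsubst_map:
  assumes "x \<in> carrier A.CT"
  shows "B.CTsubst N (h \<epsilon>) (CT_map q s' h x) = CT_map q s' h (A.CTsubst N \<epsilon> x)"
  unfolding CT_map_def
proof (rule CTsubst_commute[OF lifts_map _ assms])
  fix x and b :: "'c fps" assume "x \<in> galois_hull q"
  then show "B.to_series (B.Tsubst N (h \<epsilon>) (B.T.tclass (case (x, b) of (x, b) \<Rightarrow> frag_of (x, wmap h b))))
      = tmap (wmap h) (A.deform N \<epsilon> x * tconst b)"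
    by (simp add: B.T.pure_tclass[symmetric] B.to_series_Tsubst_pure tmap_wmap_mult tmap_wmap_deform tmap_wmap_tconst)
qed

text \<open>
  Over the new algebra, the substitution with \<open>h(\<epsilon>)\<close> extends the one with \<open>\<epsilon>\<close>. It is the only
  extension because the completed hull over the new algebra has the same generator \<open>\<iota>\<^sub>0(t)\<close>.
\<close>

lemma base_change:
  assumes \<alpha>: "\<alpha> \<in> A.CT_endos"
  shows "\<exists>!\<beta>. \<beta> \<in> B.CT_endos \<and> (\<forall>x\<in>carrier A.CT. \<beta> (CT_map q s' h x) = CT_map q s' h (\<alpha> x))"
    and "\<beta> \<in> B.CT_endos \<Longrightarrow> (\<And>x. x \<in> carrier A.CT \<Longrightarrow> \<beta> (CT_map q s' h x) = CT_map q s' h (\<alpha> x)) \<Longrightarrow>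
      CInf_gal_iso q s' \<beta> = h (CInf_gal_iso q s \<alpha>)"
proof -
  have hY: "iota0 q rt \<in> galois_hull q" by (rule galois_hull.hull_iota0)
  have Y: "CT_map q s' h (CT_elem q s (iota0 q rt) 1) = CT_elem q s' (iota0 q rt) 1"
    using hY by (intro B.CT_series_inj) (simp_all add: CT_map tmap_wmap_mult tmap_wmap_can_iota tmap_wmap_tconst del: tconst_1)
  have def: "CT_map q s' h (A.CT_deformed c) = B.CT_deformed (h c)" for c
    by (intro B.CT_series_inj) (simp_all add: CT_map A.CT_deformed B.CT_deformed tmap_wmap_deformed)
  have val: "\<beta> (CT_elem q s' (iota0 q rt) 1) = B.CT_deformed (h (CInf_gal_iso q s \<alpha>))"
    if "\<And>x. x \<in> carrier A.CT \<Longrightarrow> \<beta> (CT_map q s' h x) = CT_map q s' h (\<alpha> x)" for \<beta>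
    using that[OF A.CT_elem_closed[OF hY, of 1]] by (simp add: Y A.CInf_gal_iso(1)[OF \<alpha>] def)
  show "CInf_gal_iso q s' \<beta> = h (CInf_gal_iso q s \<alpha>)" if "\<beta> \<in> B.CT_endos"
    "\<And>x. x \<in> carrier A.CT \<Longrightarrow> \<beta> (CT_map q s' h x) = CT_map q s' h (\<alpha> x)"
    by (rule B.CInf_gal_iso(3)[OF that(1) val[OF that(2)]])
  define c where "c = CInf_gal_iso q s \<alpha>"
  obtain N where N: "(c - 1) ^ N = 0" "2 \<le> N" using nilpotent_bound A.CInf_gal_iso(2)[OF \<alpha>] c_def by blast
  have "\<alpha> (CT_elem q s (iota0 q rt) 1) = A.CTsubst N (c - 1) (CT_elem q s (iota0 q rt) 1)"
    using A.CInf_gal_iso(1)[OF \<alpha>] A.CTsubst_endo(2)[OF N] by (simp add: c_def)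
  then have "\<alpha> = A.CTsubst N (c - 1)"
    by (rule A.CT_endo_unique[OF \<alpha> A.CTsubst_endo(1)[OF N]])
  moreover have hN: "h (c - 1) ^ N = 0" using N(1) by (simp flip: h_power)
  ultimately have ex: "B.CTsubst N (h (c - 1)) \<in> B.CT_endos"
    "\<And>x. x \<in> carrier A.CT \<Longrightarrow> B.CTsubst N (h (c - 1)) (CT_map q s' h x) = CT_map q s' h (\<alpha> x)"
    using B.CTsubst_endo(1)[OF hN N(2)] CTsubst_map by simp_all
  show "\<exists>!\<beta>. \<beta> \<in> B.CT_endos \<and> (\<forall>x\<in>carrier A.CT. \<beta> (CT_map q s' h x) = CT_map q s' h (\<alpha> x))"
  proof (rule ex1I)
    show "B.CTsubst N (h (c - 1)) \<in> B.CT_endos \<and>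
        (\<forall>x\<in>carrier A.CT. B.CTsubst N (h (c - 1)) (CT_map q s' h x) = CT_map q s' h (\<alpha> x))" using ex by blast
    fix \<beta> assume "\<beta> \<in> B.CT_endos \<and> (\<forall>x\<in>carrier A.CT. \<beta> (CT_map q s' h x) = CT_map q s' h (\<alpha> x))"
    then show "\<beta> = B.CTsubst N (h (c - 1))"
      using val[of \<beta>] val[OF ex(2)] ex(1) by (intro B.CT_endo_unique) auto
  qed
qed

lemma CInf_gal_natural:
  assumes \<alpha>: "\<alpha> \<in> carrier (CInf_gal q s)"
  shows "\<exists>!\<beta>. \<beta> \<in> carrier (CInf_gal q s') \<and> (\<forall>x\<in>carrier A.CT. \<beta> (CT_map q s' h x) = CT_map q s' h (\<alpha> x))"
    and "CInf_gal_iso q s' (CInf_gal_map q s s' h \<alpha>) = h (CInf_gal_iso q s \<alpha>)"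
proof -
  have a: "\<alpha> \<in> A.CT_endos" using \<alpha> A.CInf_gal_carrier by blast
  show 1: "\<exists>!\<beta>. \<beta> \<in> carrier (CInf_gal q s') \<and> (\<forall>x\<in>carrier A.CT. \<beta> (CT_map q s' h x) = CT_map q s' h (\<alpha> x))"
    unfolding B.CInf_gal_carrier by (rule base_change(1)[OF a])
  have "CInf_gal_map q s s' h \<alpha> \<in> carrier (CInf_gal q s') \<and>
      (\<forall>x\<in>carrier A.CT. CInf_gal_map q s s' h \<alpha> (CT_map q s' h x) = CT_map q s' h (\<alpha> x))"
    unfolding CInf_gal_map_def by (rule theI'[OF 1])
  then show "CInf_gal_iso q s' (CInf_gal_map q s s' h \<alpha>) = h (CInf_gal_iso q s \<alpha>)"
    unfolding B.CInf_gal_carrier by (intro base_change(2)[OF a]) auto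
qed

end

section \<open>The operation and the composition of coordinate transformations\<close>

lemma upper_mat_mult: "upper_mat e f * upper_mat g h = upper_mat (e * g) (e * h + f)"
proof (rule eq_matI)
  show "dim_row (upper_mat e f * upper_mat g h) = dim_row (upper_mat (e * g) (e * h + f))"
    "dim_col (upper_mat e f * upper_mat g h) = dim_col (upper_mat (e * g) (e * h + f))"
    by (simp_all add: upper_mat_def mat_of_rows_list_def)
  fix i j assume "i < dim_row (upper_mat (e * g) (e * h + f))" "j < dim_col (upper_mat (e * g) (e * h + f))"
  then have "i < 2" "j < 2" by (simp_all add: upper_mat_def mat_of_rows_list_def)
  then have "i = 0 \<or> i = 1" "j = 0 \<or> j = 1" by linarith+
  then show "(upper_mat e f * upper_mat g h) $$ (i, j) = upper_mat (e * g) (e * h + f) $$ (i, j)"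
    by (auto simp: upper_mat_def mat_of_rows_list_def times_mat_def scalar_prod_def sum.atLeast0_lessThan_Suc numeral_2_eq_2)
qed

context L_alg
begin

lemma NCF_eqI:
  "\<phi> \<in> NCF q s \<Longrightarrow> \<phi>' \<in> NCF q s \<Longrightarrow> \<phi> (iota0 q rt) = deformed q s e 0 \<Longrightarrow> \<phi>' (iota0 q rt) = deformed q s e 0 \<Longrightarrow> \<phi> = \<phi>'"
  by (rule NCF_unique) simp_all

lemma QFG_act_unit: "\<phi> \<in> NCF q s \<Longrightarrow> QFG_act q s (QFG_unit q s) \<phi> = \<phi>"
  using QFG_act[OF QFG_unit(1), of \<phi> "u_val q (NCF_iso q s \<phi>)"] NCF_iso(2)[of \<phi>]
  by (intro NCF_eqI) (simp_all add: QFG_unit(2))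

lemma NCF_iso_act:
  assumes \<psi>: "\<psi> \<in> QFG q s" and \<phi>: "\<phi> \<in> NCF q s" "\<phi> (iota0 q rt) = deformed q s e 0"
    and comm: "u_val q \<psi> * e = e * u_val q \<psi>"
  shows "NCF_iso q s (QFG_act q s \<psi> \<phi>) = QFG_prod q s \<psi> (NCF_iso q s \<phi>)"
proof -
  have u: "u_val q (NCF_iso q s \<phi>) = e" using NCF_deformed_0[OF \<phi>] by simp
  note p = QFG_prod[OF \<psi> NCF_iso(1)[OF \<phi>(1)], unfolded u, OF comm]
  show ?thesis
    using QFG_act[OF \<psi> \<phi> comm] by (intro NCF_iso_eqI p(1)) (simp_all add: p(2))
qed

text \<open>
  Both sides have the value with \<open>e\<close> replaced by \<open>u(\<psi>')u(\<psi>)e\<close>, and a deformation is determined by this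
  value.
\<close>

lemma QFG_act_prod:
  assumes \<psi>': "\<psi>' \<in> QFG q s" and \<psi>: "\<psi> \<in> QFG q s"
    and \<phi>: "\<phi> \<in> NCF q s" "\<phi> (iota0 q rt) = deformed q s e 0"
    and comm: "u_val q \<psi> * e = e * u_val q \<psi>" "u_val q \<psi>' * e = e * u_val q \<psi>'"
      "u_val q \<psi>' * u_val q \<psi> = u_val q \<psi> * u_val q \<psi>'"
  shows "QFG_act q s (QFG_prod q s \<psi>' \<psi>) \<phi> = QFG_act q s \<psi>' (QFG_act q s \<psi> \<phi>)"
proof -
  note p = QFG_prod[OF \<psi>' \<psi> comm(3)]
  have 1: "u_val q (QFG_prod q s \<psi>' \<psi>) * e = e * u_val q (QFG_prod q s \<psi>' \<psi>)"
    unfolding p(2) by (simp only: mult.assoc comm(1)) (simp only: mult.assoc[symmetric] comm(2))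
  have 2: "u_val q \<psi>' * (u_val q \<psi> * e) = u_val q \<psi> * e * u_val q \<psi>'"
    by (simp only: mult.assoc[symmetric] comm(3)) (simp only: mult.assoc comm(2))
  note a = QFG_act[OF \<psi> \<phi> comm(1)]
  show ?thesis
    using QFG_act[OF p(1) \<phi> 1] QFG_act[OF \<psi>' a 2]
    by (intro NCF_eqI[of _ _ "u_val q \<psi>' * (u_val q \<psi> * e)"]) (simp_all add: p(2) mult.assoc)
qed

lemma NCF_iso_act_iota:
  assumes "\<psi> \<in> QFG q s"
  shows "NCF_iso q s (QFG_act q s \<psi> (restrict (can_iota s) (galois_hull q))) = \<psi>"
proof -
  have "restrict (can_iota s) (galois_hull q) (iota0 q rt) = deformed q s 1 0"
    by (simp add: galois_hull.hull_iota0 can_iota_iota0_rt)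
  then show ?thesis
    using QFG_act[OF assms can_iota_NCF, of 1] assms by (intro NCF_iso_eqI) simp_all
qed

lemma NCF_ex1_deformed:
  assumes "\<phi> \<in> NCF q s"
  shows "\<exists>!ef. \<phi> (iota0 q rt) = deformed q s (fst ef) (snd ef)"
  by (rule ex1I[of _ "(u_val q (NCF_iso q s \<phi>), 0)"])
    (use NCF_iso(2)[OF assms] deformed_inject in \<open>auto simp: prod_eq_iff\<close>)

lemma QFG_mat_NCF_iso:
  "\<phi> \<in> NCF q s \<Longrightarrow> \<phi> (iota0 q rt) = deformed q s e f \<Longrightarrow> QFG_mat q (NCF_iso q s \<phi>) = upper_mat e f"
  using NCF_deformed_0[of \<phi> e f] QFG_v_0[OF NCF_iso(1)] by (simp add: QFG_mat_def)

lemma QFG_mat_prod: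
  assumes "\<psi> \<in> QFG q s" "\<psi>' \<in> QFG q s" "u_val q \<psi> * u_val q \<psi>' = u_val q \<psi>' * u_val q \<psi>"
  shows "QFG_mat q (QFG_prod q s \<psi> \<psi>') = QFG_mat q \<psi> * QFG_mat q \<psi>'"
  using QFG_prod[OF assms] assms by (simp add: QFG_mat_def upper_mat_mult QFG_v_0)

text \<open>
  The affine maps \<open>w \<mapsto> (e-1)t + f + ew\<close> are the conjugates by the translation with \<open>t\<close> of
  \<open>w \<mapsto> ew + f\<close>, so they compose as the matrices do. The element \<open>t\<close> is central.
\<close>

lemma coord_trans_compose:
  assumes "\<phi> (iota0 q rt) = deformed q s e f" "\<phi>' (iota0 q rt) = deformed q s g h"
    "\<omega> (iota0 q rt) = deformed q s (e * g) (e * h + f)"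
  shows "coord_trans q s \<omega> = coord_trans q s \<phi> \<circ> coord_trans q s \<phi>'"
proof
  fix w :: "'a fps"
  have c: "(e * g - 1) * s rt + (e * h + f) = (e - 1) * s rt + f + e * ((g - 1) * s rt + h)"
    by (simp add: algebra_simps)
  show "coord_trans q s \<omega> w = (coord_trans q s \<phi> \<circ> coord_trans q s \<phi>') w"
    unfolding comp_def coord_trans_deformed(2)[of \<phi>, OF assms(1)] coord_trans_deformed(2)[of \<phi>', OF assms(2)]
      coord_trans_deformed(2)[of \<omega>, OF assms(3)] c
    by (simp add: distrib_left mult.assoc add.assoc flip: fps_const_mult fps_const_add)
qed

lemma NCF_prod:
  assumes \<phi>: "\<phi> \<in> NCF q s" "\<phi> (iota0 q rt) = deformed q s e f"
    and \<phi>': "\<phi>' \<in> NCF q s" "\<phi>' (iota0 q rt) = deformed q s g h"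
    and comm: "e * g = g * e"
  shows "QFG_prod q s (NCF_iso q s \<phi>) (NCF_iso q s \<phi>') \<in> QFG q s"
    and "QFG_mat q (QFG_prod q s (NCF_iso q s \<phi>) (NCF_iso q s \<phi>')) = upper_mat e f * upper_mat g h"
    and "\<exists>!\<omega>. \<omega> \<in> NCF q s \<and> NCF_iso q s \<omega> = QFG_prod q s (NCF_iso q s \<phi>) (NCF_iso q s \<phi>')"
    and "\<omega> \<in> NCF q s \<Longrightarrow> NCF_iso q s \<omega> = QFG_prod q s (NCF_iso q s \<phi>) (NCF_iso q s \<phi>') \<Longrightarrow>
      coord_trans q s \<omega> = coord_trans q s \<phi> \<circ> coord_trans q s \<phi>'"
proof -
  have u: "f = 0" "u_val q (NCF_iso q s \<phi>) = e" "h = 0" "u_val q (NCF_iso q s \<phi>') = g"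
    using NCF_deformed_0[OF \<phi>] NCF_deformed_0[OF \<phi>'] by simp_all
  have "u_val q (NCF_iso q s \<phi>) * u_val q (NCF_iso q s \<phi>') = u_val q (NCF_iso q s \<phi>') * u_val q (NCF_iso q s \<phi>)"
    by (simp add: u comm)
  note p = QFG_prod[OF NCF_iso(1)[OF \<phi>(1)] NCF_iso(1)[OF \<phi>'(1)] this]
    QFG_mat_prod[OF NCF_iso(1)[OF \<phi>(1)] NCF_iso(1)[OF \<phi>'(1)] this]
  show 1: "QFG_prod q s (NCF_iso q s \<phi>) (NCF_iso q s \<phi>') \<in> QFG q s" by (rule p(1))
  show "QFG_mat q (QFG_prod q s (NCF_iso q s \<phi>) (NCF_iso q s \<phi>')) = upper_mat e f * upper_mat g h"
    unfolding p(3) by (simp only: QFG_mat_NCF_iso[OF \<phi>] QFG_mat_NCF_iso[OF \<phi>'])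
  show "\<exists>!\<omega>. \<omega> \<in> NCF q s \<and> NCF_iso q s \<omega> = QFG_prod q s (NCF_iso q s \<phi>) (NCF_iso q s \<phi>')"
    using NCF_iso_bij 1 unfolding bij_betw_iff_bijections by metis
  assume \<omega>: "\<omega> \<in> NCF q s" "NCF_iso q s \<omega> = QFG_prod q s (NCF_iso q s \<phi>) (NCF_iso q s \<phi>')"
  have "\<omega> (iota0 q rt) = deformed q s (e * g) (e * h + f)"
    using NCF_iso(2)[OF \<omega>(1)] by (simp add: \<omega>(2) p(2) u)
  with \<phi>(2) \<phi>'(2) show "coord_trans q s \<omega> = coord_trans q s \<phi> \<circ> coord_trans q s \<phi>'"
    by (rule coord_trans_compose)
qed

end

lemma (in L_alg_hom) NCF_map_act:
  assumes \<psi>: "\<psi> \<in> QFG q s" and \<phi>: "\<phi> \<in> NCF q s" "\<phi> (iota0 q rt) = deformed q s e 0"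
    and comm: "u_val q \<psi> * e = e * u_val q \<psi>"
  shows "NCF_map q h (QFG_act q s \<psi> \<phi>) = QFG_act q s' (QFG_map q h \<psi>) (NCF_map q h \<phi>)"
proof -
  note a = A.QFG_act[OF \<psi> \<phi> comm]
  have "NCF_map q h \<phi> (iota0 q rt) = deformed q s' (h e) 0"
    by (simp add: NCF_map_iota0 \<phi>(2) tmap_wmap_deformed)
  note b = B.QFG_act[OF QFG_map_QFG(1)[OF \<psi>] NCF_map_NCF[OF \<phi>(1)] this]
  have c: "u_val q (QFG_map q h \<psi>) * h e = h e * u_val q (QFG_map q h \<psi>)"
    unfolding QFG_map_QFG(2)[OF \<psi>] by (simp add: comm flip: h_mult)
  show ?thesis
    using b[OF c] NCF_map_NCF[OF a(1)]
    by (intro B.NCF_eqI[of _ _ "h (u_val q \<psi> * e)"])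
      (simp_all add: NCF_map_iota0 a(2) tmap_wmap_deformed QFG_map_QFG(2)[OF \<psi>] h_mult)
qed

theorem theorem4p14:
  fixes q :: complex
    and sA :: "ratfun \<Rightarrow> 'a::{ring,monoid_mult}"
    and sB :: "ratfun \<Rightarrow> 'b::{ring,monoid_mult}"
    and sC :: "ratfun \<Rightarrow> 'c::{comm_ring,comm_monoid_mult}"
    and sD :: "ratfun \<Rightarrow> 'd::{comm_ring,comm_monoid_mult}"
  assumes "q \<noteq> 0" and "\<forall>n\<ge>1. q ^ n \<noteq> 1"
    and "L_algebra sA" and "L_algebra sB" and "L_algebra sC" and "L_algebra sD"
  shows
    \<comment> \<open>the isomorphism of functors on \<open>(NCAlg/L)\<close>\<close>
    "bij_betw (NCF_iso q sA) (NCF q sA) (QFG q sA) \<and>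
     (\<forall>h. L_algebra_hom sA sB h \<longrightarrow>
        (\<forall>\<psi>\<in>QFG q sA. QFG_map q h \<psi> \<in> QFG q sB) \<and>
        (\<forall>\<phi>\<in>NCF q sA. NCF_map q h \<phi> \<in> NCF q sB \<and>
           NCF_iso q sB (NCF_map q h \<phi>) = QFG_map q h (NCF_iso q sA \<phi>))) \<and>
     \<comment> \<open>the operation of the quantum formal group\<close>
     QFG_unit q sA \<in> QFG q sA \<and>
     (\<forall>\<phi>\<in>NCF q sA. QFG_act q sA (QFG_unit q sA) \<phi> = \<phi>) \<and>
     (\<forall>\<psi>\<in>QFG q sA. \<forall>\<phi>\<in>NCF q sA. \<forall>e f.
        \<phi> (iota0 q rt) = deformed q sA e f \<and>
        mutually_commutative {u_val q \<psi>, v_val q \<psi>} {e, f} \<longrightarrow>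
          (\<exists>!\<omega>. \<omega> \<in> NCF q sA \<and>
             \<omega> (iota0 q rt) = deformed q sA (u_val q \<psi> * e) (u_val q \<psi> * f + v_val q \<psi>)) \<and>
          QFG_act q sA \<psi> \<phi> \<in> NCF q sA \<and>
          QFG_act q sA \<psi> \<phi> (iota0 q rt)
            = deformed q sA (u_val q \<psi> * e) (u_val q \<psi> * f + v_val q \<psi>) \<and>
          NCF_iso q sA (QFG_act q sA \<psi> \<phi>) = QFG_prod q sA \<psi> (NCF_iso q sA \<phi>) \<and>
          (\<forall>\<psi>'\<in>QFG q sA.
             mutually_commutative {u_val q \<psi>', v_val q \<psi>'} {e, f} \<and>
             mutually_commutative {u_val q \<psi>', v_val q \<psi>'} {u_val q \<psi>, v_val q \<psi>} \<longrightarrow>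
               QFG_act q sA (QFG_prod q sA \<psi>' \<psi>) \<phi> = QFG_act q sA \<psi>' (QFG_act q sA \<psi> \<phi>)) \<and>
          (\<forall>h. L_algebra_hom sA sB h \<longrightarrow>
             NCF_map q h (QFG_act q sA \<psi> \<phi>) = QFG_act q sB (QFG_map q h \<psi>) (NCF_map q h \<phi>))) \<and>
     (\<forall>\<psi>\<in>QFG q sA.
        NCF_iso q sA (QFG_act q sA \<psi> (restrict (can_iota sA) (galois_hull q))) = \<psi>) \<and>
     \<comment> \<open>the restriction to \<open>(CAlg/L)\<close>\<close>
     bij_betw (\<lambda>\<phi>. u_val q (NCF_iso q sC \<phi>)) (NCF q sC) (carrier Gm) \<and>
     (\<forall>h. L_algebra_hom sC sD h \<longrightarrow>
        (\<forall>\<phi>\<in>NCF q sC. NCF_map q h \<phi> \<in> NCF q sD \<and>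
           u_val q (NCF_iso q sD (NCF_map q h \<phi>)) = h (u_val q (NCF_iso q sC \<phi>)))) \<and>
     \<comment> \<open>matrices, initial conditions and coordinate transformations\<close>
     (\<forall>\<phi>\<in>NCF q sA. \<exists>!ef. \<phi> (iota0 q rt) = deformed q sA (fst ef) (snd ef)) \<and>
     (\<forall>\<phi>\<in>NCF q sA. \<forall>e f. \<phi> (iota0 q rt) = deformed q sA e f \<longrightarrow>
        QFG_mat q (NCF_iso q sA \<phi>) = upper_mat e f \<and>
        initial_condition (\<phi> (iota0 q rt))
          = fps_const e * (fps_const (sA rt) + fps_X) + fps_const f \<and>
        coord_trans q sA \<phi> = (\<lambda>w. fps_const ((e - 1) * sA rt + f) + fps_const e * w)) \<and>
     (\<forall>\<phi>\<in>NCF q sA. \<forall>\<phi>'\<in>NCF q sA. \<forall>e f g h.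
        \<phi> (iota0 q rt) = deformed q sA e f \<and> \<phi>' (iota0 q rt) = deformed q sA g h \<and>
        mutually_commutative {e, f} {g, h} \<longrightarrow>
          QFG_prod q sA (NCF_iso q sA \<phi>) (NCF_iso q sA \<phi>') \<in> QFG q sA \<and>
          QFG_mat q (QFG_prod q sA (NCF_iso q sA \<phi>) (NCF_iso q sA \<phi>'))
            = upper_mat e f * upper_mat g h \<and>
          (\<exists>!\<omega>. \<omega> \<in> NCF q sA \<and>
             NCF_iso q sA \<omega> = QFG_prod q sA (NCF_iso q sA \<phi>) (NCF_iso q sA \<phi>')) \<and>
          (\<forall>\<omega>\<in>NCF q sA.
             NCF_iso q sA \<omega> = QFG_prod q sA (NCF_iso q sA \<phi>) (NCF_iso q sA \<phi>') \<longrightarrow>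
             coord_trans q sA \<omega> = coord_trans q sA \<phi> \<circ> coord_trans q sA \<phi>')) \<and>
     \<comment> \<open>the commutative Galois group\<close>
     group (CInf_gal q sC) \<and> group (Gm :: 'c monoid) \<and>
     CInf_gal_iso q sC \<in> iso (CInf_gal q sC) Gm \<and>
     (\<forall>h. L_algebra_hom sC sD h \<longrightarrow>
        (\<forall>\<alpha>\<in>carrier (CInf_gal q sC).
           (\<exists>!\<beta>. \<beta> \<in> carrier (CInf_gal q sD) \<and>
              (\<forall>x\<in>carrier (CT_ring q sC). \<beta> (CT_map q sD h x) = CT_map q sD h (\<alpha> x))) \<and>
           CInf_gal_iso q sD (CInf_gal_map q sC sD h \<alpha>) = h (CInf_gal_iso q sC \<alpha>)))"
proof -
  have q: "nonroot q" using assms(1,2) by unfold_locales auto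
  interpret A: L_alg q sA by (intro L_alg.intro L_alg_axioms.intro q assms)
  interpret B: L_alg q sB by (intro L_alg.intro L_alg_axioms.intro q assms)
  interpret C: comm_alg q sC by (intro comm_alg.intro L_alg.intro L_alg_axioms.intro q assms)
  interpret D: comm_alg q sD by (intro comm_alg.intro L_alg.intro L_alg_axioms.intro q assms)
  have AB: "L_alg_hom q sA sB h" if "L_algebra_hom sA sB h" for h
    by (intro L_alg_hom.intro L_alg_hom_axioms.intro A.L_alg_axioms B.L_alg_axioms that)
  have CD: "L_alg_hom q sC sD h" if "L_algebra_hom sC sD h" for h
    by (intro L_alg_hom.intro L_alg_hom_axioms.intro C.L_alg_axioms D.L_alg_axioms that)
  have CD': "comm_alg_hom q sC sD h" if "L_algebra_hom sC sD h" for h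
    by (intro comm_alg_hom.intro comm_alg_pair.intro CD[OF that] C.comm_alg_axioms D.comm_alg_axioms)
  have act: "f = 0" "u_val q \<psi> * e = e * u_val q \<psi>" "v_val q \<psi> = 0"
    if "\<psi> \<in> QFG q sA" "\<phi> \<in> NCF q sA" "\<phi> (iota0 q rt) = deformed q sA e f"
      "mutually_commutative {u_val q \<psi>, v_val q \<psi>} {e, f}" for \<psi> \<phi> e f
    using A.NCF_deformed_0[OF that(2,3)] A.QFG_v_0[OF that(1)] that(4) by (simp_all add: mutually_commutative_def)
  have C_bij: "bij_betw (\<lambda>\<phi>. u_val q (NCF_iso q sC \<phi>)) (NCF q sC) (carrier Gm)"
    using bij_betw_trans[OF C.NCF_iso_bij C.u_val_bij] by (simp add: Gm_def comp_def)
  show ?thesis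
  proof (intro conjI ballI allI impI; (elim conjE)?)
    show "bij_betw (NCF_iso q sA) (NCF q sA) (QFG q sA)" by (rule A.NCF_iso_bij)
  next
    fix h \<psi> assume "L_algebra_hom sA sB h" "\<psi> \<in> QFG q sA"
    then show "QFG_map q h \<psi> \<in> QFG q sB" by (rule L_alg_hom.QFG_map_QFG(1)[OF AB])
  next
    fix h \<phi> assume "L_algebra_hom sA sB h" "\<phi> \<in> NCF q sA"
    then show "NCF_map q h \<phi> \<in> NCF q sB"
      "NCF_iso q sB (NCF_map q h \<phi>) = QFG_map q h (NCF_iso q sA \<phi>)"
      by (rule L_alg_hom.NCF_map_NCF[OF AB] L_alg_hom.NCF_iso_natural[OF AB])+
  next
    show "QFG_unit q sA \<in> QFG q sA" by (rule A.QFG_unit)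
  next
    fix \<phi> assume "\<phi> \<in> NCF q sA"
    then show "QFG_act q sA (QFG_unit q sA) \<phi> = \<phi>" by (rule A.QFG_act_unit)
  next
    fix \<psi> \<phi> e f
    assume \<psi>: "\<psi> \<in> QFG q sA" and \<phi>: "\<phi> \<in> NCF q sA" "\<phi> (iota0 q rt) = deformed q sA e f"
      and "mutually_commutative {u_val q \<psi>, v_val q \<psi>} {e, f}"
    note c = act[OF this]
    have \<phi>0: "\<phi> (iota0 q rt) = deformed q sA e 0" using \<phi>(2) c(1) by simp
    have d: "deformed q sA (u_val q \<psi> * e) (u_val q \<psi> * f + v_val q \<psi>) = deformed q sA (u_val q \<psi> * e) 0"
      by (simp add: c(1,3))
    note a = A.QFG_act[OF \<psi> \<phi>(1) \<phi>0 c(2)]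
    show "\<exists>!\<omega>. \<omega> \<in> NCF q sA \<and> \<omega> (iota0 q rt) = deformed q sA (u_val q \<psi> * e) (u_val q \<psi> * f + v_val q \<psi>)"
      unfolding d using a A.NCF_eqI by blast
    show "QFG_act q sA \<psi> \<phi> \<in> NCF q sA" by (rule a)
    show "QFG_act q sA \<psi> \<phi> (iota0 q rt) = deformed q sA (u_val q \<psi> * e) (u_val q \<psi> * f + v_val q \<psi>)"
      unfolding d by (rule a)
    show "NCF_iso q sA (QFG_act q sA \<psi> \<phi>) = QFG_prod q sA \<psi> (NCF_iso q sA \<phi>)"
      by (rule A.NCF_iso_act[OF \<psi> \<phi>(1) \<phi>0 c(2)])
    show "QFG_act q sA (QFG_prod q sA \<psi>' \<psi>) \<phi> = QFG_act q sA \<psi>' (QFG_act q sA \<psi> \<phi>)"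
      if "\<psi>' \<in> QFG q sA" "mutually_commutative {u_val q \<psi>', v_val q \<psi>'} {e, f}"
        "mutually_commutative {u_val q \<psi>', v_val q \<psi>'} {u_val q \<psi>, v_val q \<psi>}" for \<psi>'
      using that(2,3) by (intro A.QFG_act_prod[OF that(1) \<psi> \<phi>(1) \<phi>0 c(2)]) (simp_all add: mutually_commutative_def)
    show "NCF_map q h (QFG_act q sA \<psi> \<phi>) = QFG_act q sB (QFG_map q h \<psi>) (NCF_map q h \<phi>)"
      if "L_algebra_hom sA sB h" for h
      by (rule L_alg_hom.NCF_map_act[OF AB[OF that] \<psi> \<phi>(1) \<phi>0 c(2)])
  next
    fix \<psi> assume "\<psi> \<in> QFG q sA"
    then show "NCF_iso q sA (QFG_act q sA \<psi> (restrict (can_iota sA) (galois_hull q))) = \<psi>"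
      by (rule A.NCF_iso_act_iota)
  next
    show "bij_betw (\<lambda>\<phi>. u_val q (NCF_iso q sC \<phi>)) (NCF q sC) (carrier Gm)" by (rule C_bij)
  next
    fix h \<phi> assume h: "L_algebra_hom sC sD h" and \<phi>: "\<phi> \<in> NCF q sC"
    show "NCF_map q h \<phi> \<in> NCF q sD" by (rule L_alg_hom.NCF_map_NCF[OF CD[OF h] \<phi>])
    show "u_val q (NCF_iso q sD (NCF_map q h \<phi>)) = h (u_val q (NCF_iso q sC \<phi>))"
      unfolding L_alg_hom.NCF_iso_natural[OF CD[OF h] \<phi>]
      by (rule L_alg_hom.QFG_map_QFG(2)[OF CD[OF h] C.NCF_iso(1)[OF \<phi>]])
  next
    fix \<phi> assume "\<phi> \<in> NCF q sA"
    then show "\<exists>!ef. \<phi> (iota0 q rt) = deformed q sA (fst ef) (snd ef)" by (rule A.NCF_ex1_deformed)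
  next
    fix \<phi> e f assume \<phi>: "\<phi> \<in> NCF q sA" "\<phi> (iota0 q rt) = deformed q sA e f"
    show "QFG_mat q (NCF_iso q sA \<phi>) = upper_mat e f" by (rule A.QFG_mat_NCF_iso[OF \<phi>])
    show "initial_condition (\<phi> (iota0 q rt)) = fps_const e * (fps_const (sA rt) + fps_X) + fps_const f"
      "coord_trans q sA \<phi> = (\<lambda>w. fps_const ((e - 1) * sA rt + f) + fps_const e * w)"
      by (rule A.coord_trans_deformed[of \<phi>, OF \<phi>(2)])+
  next
    fix \<phi> \<phi>' e f g h
    assume \<phi>: "\<phi> \<in> NCF q sA" and \<phi>': "\<phi>' \<in> NCF q sA"
      and d: "\<phi> (iota0 q rt) = deformed q sA e f" "\<phi>' (iota0 q rt) = deformed q sA g h"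
      and "mutually_commutative {e, f} {g, h}"
    then have "e * g = g * e" by (simp add: mutually_commutative_def)
    note p = A.NCF_prod[OF \<phi> d(1) \<phi>' d(2) this]
    show "QFG_prod q sA (NCF_iso q sA \<phi>) (NCF_iso q sA \<phi>') \<in> QFG q sA"
      "QFG_mat q (QFG_prod q sA (NCF_iso q sA \<phi>) (NCF_iso q sA \<phi>')) = upper_mat e f * upper_mat g h"
      "\<exists>!\<omega>. \<omega> \<in> NCF q sA \<and> NCF_iso q sA \<omega> = QFG_prod q sA (NCF_iso q sA \<phi>) (NCF_iso q sA \<phi>')"
      by (rule p)+
    show "coord_trans q sA \<omega> = coord_trans q sA \<phi> \<circ> coord_trans q sA \<phi>'"
      if "\<omega> \<in> NCF q sA" "NCF_iso q sA \<omega> = QFG_prod q sA (NCF_iso q sA \<phi>) (NCF_iso q sA \<phi>')" for \<omega>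
      by (rule p(4)[OF that])
  next
    show "group (CInf_gal q sC)" by (rule C.group_CInf_gal)
    show "group (Gm :: 'c monoid)" by (rule C.group_Gm)
    show "CInf_gal_iso q sC \<in> iso (CInf_gal q sC) Gm" by (rule C.CInf_gal_iso_iso)
  next
    fix h \<alpha> assume h: "L_algebra_hom sC sD h" and \<alpha>: "\<alpha> \<in> carrier (CInf_gal q sC)"
    note n = comm_alg_hom.CInf_gal_natural[OF CD'[OF h] \<alpha>]
    show "\<exists>!\<beta>. \<beta> \<in> carrier (CInf_gal q sD) \<and>
        (\<forall>x\<in>carrier (CT_ring q sC). \<beta> (CT_map q sD h x) = CT_map q sD h (\<alpha> x))" by (rule n)
    show "CInf_gal_iso q sD (CInf_gal_map q sC sD h \<alpha>) = h (CInf_gal_iso q sC \<alpha>)" by (rule n)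
  qed
qed

end
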